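(* (i) If $\lim_{z\to\infty}a(-z)/a(z)=0$, then as $R\to\infty$ $$P\big[\sigma^x_{(-\infty,-R]}<\sigma^x_0\big]\sim P\big[\sigma^x_{-R}<\sigma^x_0\big]\qquad\text{uniformly for }x\in\mathbb Z .$$ (ii) Suppose $m_+(x)/m(x)\to0$ as $x\to\infty$. Then $\lim_{z\to\infty}a(-z)/a(z)=0$ and, as $R\to\infty$, $$P\big[\sigma^x_{[R,\infty)}<\sigma^x_0\big]\sim P\big[\sigma^x_R<\sigma^x_0\big]\sim\frac{a^\dagger(x)}{a(R)}$$ uniformly for integers $x\le R$ subject to the condition $$\frac{a(-R)-a(-R+x)}{a^\dagger(x)}\longrightarrow0 .$$
   Context: Let $X,X_1,X_2,\dots$ be i.i.d. integer-valued random variables, $S_n=X_1+\dots+X_n$, $S_0=0$, and $S^x_n=x+S_n$ for $x\in\mathbb Z$. Standing assumptions: the random walk is irreducible on $\mathbb Z$, $EX=0$, $EX^2=\infty$, and $P[X\ge2]>0$. The potential function is $a(x)=\sum_{n=0}^\infty\big(P[S_n=0]-P[S_n=-x]\big)$ (the series converges), and $a^\dagger(x)=\delta_{x,0}+a(x)$ with $\delta_{x,0}$ the Kronecker delta (note $a(0)=0$). For real $x\ge0$: $\mu_-(x)=P[X<-x]$, $\mu_+(x)=P[X>x]$; $\eta_\pm(x)=\int_x^\infty\mu_\pm(y)\,dy$; $m_\pm(x)=\int_0^x\eta_\pm(s)\,ds$, $m=m_++m_-$. $\sigma^x_B=\inf\{n\ge1:S^x_n\in B\}$ and $\sigma^x_y=\sigma^x_{\{y\}}$.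 $R$ denotes a positive integer. "$f\sim g$ uniformly for $x\le R$ subject to the condition $D(x,R)\to0$" means: for every $\varepsilon>0$ there are $\delta>0$ and $R_0$ such that $|f/g-1|<\varepsilon$ whenever $R\ge R_0$, $x\le R$ and $|D(x,R)|<\delta$. *)

theory Defs
  imports "HOL-Probability.Probability"
begin

text \<open>
  The family \<open>X\<close> models \<open>X, X\<^sub>1, X\<^sub>2, \<dots>\<close>: the entry \<open>X 0\<close> is the generic variable \<open>X\<close>,
  and only \<open>X 1, X 2, \<dots>\<close> are steps of the walk.
\<close>

definition iid :: "'a measure \<Rightarrow> (nat \<Rightarrow> 'a \<Rightarrow> int) \<Rightarrow> bool" where
  "iid M X \<longleftrightarrow>
     prob_space.indep_vars M (\<lambda>_. count_space UNIV) X UNIV \<and>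
     (\<forall>i. distr M (count_space UNIV) (X i) = distr M (count_space UNIV) (X 0))"

definition walk :: "(nat \<Rightarrow> 'a \<Rightarrow> int) \<Rightarrow> int \<Rightarrow> nat \<Rightarrow> 'a \<Rightarrow> int" where
  "walk X x n \<omega> = x + (\<Sum>i=1..n. X i \<omega>)"

definition irreducible_walk :: "'a measure \<Rightarrow> (nat \<Rightarrow> 'a \<Rightarrow> int) \<Rightarrow> bool" where
  "irreducible_walk M X \<longleftrightarrow> (\<forall>x y. \<exists>n. \<P>(\<omega> in M. walk X x n \<omega> = y) > 0)"

definition potential :: "'a measure \<Rightarrow> (nat \<Rightarrow> 'a \<Rightarrow> int) \<Rightarrow> int \<Rightarrow> real" where
  "potential M X x =
     (\<Sum>n. \<P>(\<omega> in M. walk X 0 n \<omega> = 0) - \<P>(\<omega> in M. walk X 0 n \<omega> = - x))"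

definition potential_dag :: "'a measure \<Rightarrow> (nat \<Rightarrow> 'a \<Rightarrow> int) \<Rightarrow> int \<Rightarrow> real" where
  "potential_dag M X x = (if x = 0 then 1 else 0) + potential M X x"

text \<open>Tails of a single integer-valued variable \<open>Y\<close> and their iterated integrals.\<close>

definition mu_minus :: "'a measure \<Rightarrow> ('a \<Rightarrow> int) \<Rightarrow> real \<Rightarrow> real" where
  "mu_minus M Y x = \<P>(\<omega> in M. real_of_int (Y \<omega>) < - x)"

definition mu_plus :: "'a measure \<Rightarrow> ('a \<Rightarrow> int) \<Rightarrow> real \<Rightarrow> real" where
  "mu_plus M Y x = \<P>(\<omega> in M. real_of_int (Y \<omega>) > x)"

definition eta_minus :: "'a measure \<Rightarrow> ('a \<Rightarrow> int) \<Rightarrow> real \<Rightarrow> real" where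
  "eta_minus M Y x = (LBINT y:{x..}. mu_minus M Y y)"

definition eta_plus :: "'a measure \<Rightarrow> ('a \<Rightarrow> int) \<Rightarrow> real \<Rightarrow> real" where
  "eta_plus M Y x = (LBINT y:{x..}. mu_plus M Y y)"

definition m_minus :: "'a measure \<Rightarrow> ('a \<Rightarrow> int) \<Rightarrow> real \<Rightarrow> real" where
  "m_minus M Y x = (LBINT s:{0..x}. eta_minus M Y s)"

definition m_plus :: "'a measure \<Rightarrow> ('a \<Rightarrow> int) \<Rightarrow> real \<Rightarrow> real" where
  "m_plus M Y x = (LBINT s:{0..x}. eta_plus M Y s)"

definition m_total :: "'a measure \<Rightarrow> ('a \<Rightarrow> int) \<Rightarrow> real \<Rightarrow> real" where
  "m_total M Y x = m_plus M Y x + m_minus M Y x"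

text \<open>The infimum is taken in \<^typ>\<open>enat\<close>, so it is \<open>\<infinity>\<close> if \<open>B\<close> is never hit.\<close>

definition hitting_time :: "(nat \<Rightarrow> 'a \<Rightarrow> int) \<Rightarrow> int \<Rightarrow> int set \<Rightarrow> 'a \<Rightarrow> enat" where
  "hitting_time X x B \<omega> = Inf {enat n |n. n \<ge> 1 \<and> walk X x n \<omega> \<in> B}"

definition prob_hit_before ::
    "'a measure \<Rightarrow> (nat \<Rightarrow> 'a \<Rightarrow> int) \<Rightarrow> int \<Rightarrow> int set \<Rightarrow> int set \<Rightarrow> real" where
  "prob_hit_before M X x A B = \<P>(\<omega> in M. hitting_time X x A \<omega> < hitting_time X x B \<omega>)"

text \<open>
  Division by zero yields zero in HOL, so a quotient whose denominator vanishes identically would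
  converge to \<open>0\<close>. This really happens for \<open>a(-z) / a(z)\<close>: if the walk is left-continuous
  (\<open>X \<ge> -1\<close>) with infinite variance, then \<open>a(z) = 0\<close> for all \<open>z > 0\<close>. The limit of a quotient is therefore
  understood to require that the quotient be eventually defined.
\<close>

definition quotient_tendsto ::
    "('b \<Rightarrow> real) \<Rightarrow> ('b \<Rightarrow> real) \<Rightarrow> real \<Rightarrow> 'b filter \<Rightarrow> bool" where
  "quotient_tendsto f g l F \<longleftrightarrow>
     (\<forall>\<^sub>F z in F. g z \<noteq> 0) \<and> ((\<lambda>z. f z / g z) \<longlongrightarrow> l) F"

text \<open>
  In the two relations below the first argument of \<open>f\<close>, \<open>g\<close> and \<open>D\<close> is the starting point
  \<open>x\<close>, the second is \<open>R\<close>. Since \<open>\<bar>f / 0 - 1\<bar> = 1\<close> in HOL, both force \<open>g\<close> to be nonzero on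
  the range in question once \<open>\<epsilon> \<le> 1\<close>.
\<close>

definition asymp_uniformly :: "(int \<Rightarrow> int \<Rightarrow> real) \<Rightarrow> (int \<Rightarrow> int \<Rightarrow> real) \<Rightarrow> bool" where
  "asymp_uniformly f g \<longleftrightarrow>
     (\<forall>\<epsilon>>0. \<exists>R\<^sub>0>0. \<forall>R\<ge>R\<^sub>0. \<forall>x. \<bar>f x R / g x R - 1\<bar> < \<epsilon>)"

definition asymp_subject_to ::
    "(int \<Rightarrow> int \<Rightarrow> real) \<Rightarrow> (int \<Rightarrow> int \<Rightarrow> real) \<Rightarrow> (int \<Rightarrow> int \<Rightarrow> real) \<Rightarrow> bool" where
  "asymp_subject_to f g D \<longleftrightarrow>
     (\<forall>\<epsilon>>0. \<exists>\<delta>>0. \<exists>R\<^sub>0>0. \<forall>R\<ge>R\<^sub>0. \<forall>x\<le>R.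
        \<bar>D x R\<bar> < \<delta> \<longrightarrow> \<bar>f x R / g x R - 1\<bar> < \<epsilon>)"

end

theory Submission
  imports Defs "HOL-Complex_Analysis.Great_Picard"
begin

text \<open>
  Let \<open>a\<^sub>N\<close> be the partial sums of the series defining \<open>a\<close>. The maximum principle bounds the increments
  of \<open>a\<^sub>N\<close> by its values, and infinite variance makes \<open>a\<^sub>N\<close> sublinear uniformly in \<open>N\<close>; by a
  Liouville theorem all subsequential limits coincide, so \<open>a\<close> exists, is subadditive, and satisfies
  \<open>E a(x + X) = a\<^sup>\<dagger>(x)\<close>. Recurrence then yields, for \<open>y \<noteq> 0\<close>,
  \<open>(a(y) + a(-y)) P[\<sigma>\<^sup>x\<^sub>y < \<sigma>\<^sup>x\<^sub>0] = a\<^sup>\<dagger>(x) + a(-y) - a\<^sup>\<dagger>(x - y)\<close>.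
  If \<open>a(-z)/a(z) \<rightarrow> 0\<close>, this formula shows that from any point of \<open>(-\<infinity>, -R]\<close> the walk hits \<open>-R\<close>
  before \<open>0\<close> with probability close to \<open>1\<close>, which is (i). It also gives
  \<open>P[\<sigma>\<^sup>x\<^sub>R < \<sigma>\<^sup>x\<^sub>0] \<sim> a\<^sup>\<dagger>(x)/a(R)\<close> in (ii), and the half-line \<open>[R, \<infinity>)\<close> adds nothing, since optional
  stopping bounds \<open>P[\<sigma>\<^sup>x\<^bsub>[R,\<infinity>)\<^esub> < \<sigma>\<^sup>x\<^sub>0]\<close> by \<open>a\<^sup>\<dagger>(x) / inf {a(y) | y \<ge> R}\<close> and \<open>a\<close> is almost increasing.

  That \<open>m\<^sub>+/m \<rightarrow> 0\<close> forces \<open>a(-z)/a(z) \<rightarrow> 0\<close> is proved by comparison with an upward skip-free walk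
  having the same negative jumps: its potential \<open>a'\<close> vanishes on the negative half-line. By Fourier
  analysis the Cesaro means of \<open>a - a'/\<theta>\<close> over \<open>\<plusminus>j\<close>, \<open>j < R\<close>, are \<open>o(a'(R))\<close>; averaging removes the
  oscillation of the kernel, and subadditivity turns the means back into pointwise bounds.
\<close>

text \<open>All probabilities are first expressed through the operator \<open>step p\<close> on
  functions on the integers. There \<open>hit\<close> is the least nonnegative supersolution of a
  one-step equation, so optional stopping becomes a comparison of functions.

  The obstacle in (ii) is that integral bounds on absolute values do not distinguish a(-R) from
  a(R). The comparison walk settles the leading order exactly: its potential vanishes on the
  negative side, and after scaling by \<theta> its 1 - phi differs from that of the given walk only
  through positive jumps, which are negligible. The factor 1/\<theta> is there because the
  comparison law must have mass one. Even so, pointwise the imaginary part of the difference is only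
  controlled by \<epsilon> times the integral of dt/t over t > 1/R, a logarithm too much; a Cesaro
  mean gains a factor 1/(Rt) there.

  Since the tails are arbitrary, m has no usable asymptotics. \<open>Lam\<close> at t = 1/x is
  differentiable, and the integrals to be bounded have majorants with explicit antiderivatives built
  from it.\<close>

section \<open>Taboo probabilities\<close>

text \<open>\<open>taboo p C n f x\<close> is the expectation of \<open>f (S\<^sup>x\<^sub>n)\<close> on the event that \<open>S\<^sup>x\<^sub>1, \<dots>, S\<^sup>x\<^sub>n\<close> avoid \<open>C\<close>;
  the starting point \<open>x\<close> may lie in \<open>C\<close>.\<close>

definition step :: "int pmf \<Rightarrow> (int \<Rightarrow> real) \<Rightarrow> int \<Rightarrow> real" where
  "step p f x = measure_pmf.expectation p (\<lambda>z. f (x + z))"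

definition kill :: "int set \<Rightarrow> (int \<Rightarrow> real) \<Rightarrow> int \<Rightarrow> real" where
  "kill C f x = (if x \<in> C then 0 else f x)"

definition taboo :: "int pmf \<Rightarrow> int set \<Rightarrow> nat \<Rightarrow> (int \<Rightarrow> real) \<Rightarrow> int \<Rightarrow> real" where
  "taboo p C n = (\<lambda>f. step p (kill C f)) ^^ n"

text \<open>The n-th term is the probability that the first visit to \<open>A \<union> B\<close> at
  a positive time occurs at time n + 1 and lies in \<open>A\<close>. For disjoint \<open>A\<close>
  and \<open>B\<close> the sum is P[sigma_A < sigma_B] for the walk from \<open>x\<close>.\<close>

definition hit :: "int pmf \<Rightarrow> int set \<Rightarrow> int set \<Rightarrow> int \<Rightarrow> real" where
  "hit p A B x = (\<Sum>n. taboo p (A \<union> B) n (step p (indicator A)) x)"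

lemma taboo_0 [simp]: "taboo p C 0 f = f"
  by (simp add: taboo_def)

lemma taboo_Suc: "taboo p C (Suc n) f = step p (kill C (taboo p C n f))"
  by (simp add: taboo_def)

text \<open>Splits off the last step, as needed when a path is extended; \<open>taboo_Suc\<close>
  splits off the first one.\<close>

lemma taboo_Suc': "taboo p C (Suc n) f = taboo p C n (step p (kill C f))"
  by (simp add: taboo_def funpow_Suc_right del: funpow.simps)

lemma kill_empty [simp]: "kill {} f = f"
  by (simp add: kill_def fun_eq_iff)

lemma abs_kill_le: "\<bar>kill C f x\<bar> \<le> \<bar>f x\<bar>"
  by (simp add: kill_def)

lemma integrable_bounded_pmf:
  fixes f :: "int \<Rightarrow> real"
  assumes "\<And>x. \<bar>f x\<bar> \<le> K"
  shows "integrable (measure_pmf p) f"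
  using assms by (intro measure_pmf.integrable_const_bound[where B=K]) auto

lemma step_mono:
  assumes "\<And>z. f (x + z) \<le> g (x + z)"
    and "integrable (measure_pmf p) (\<lambda>z. f (x + z))" "integrable (measure_pmf p) (\<lambda>z. g (x + z))"
  shows "step p f x \<le> step p g x"
  unfolding step_def using assms by (intro integral_mono) auto

lemma step_const [simp]: "step p (\<lambda>_. c) x = c"
  by (simp add: step_def)

lemma step_nonneg: "(\<And>z. 0 \<le> f (x + z)) \<Longrightarrow> 0 \<le> step p f x"
  unfolding step_def by (intro integral_nonneg_AE) auto

lemma abs_step_le:
  assumes "\<And>z. \<bar>f z\<bar> \<le> K"
  shows "\<bar>step p f x\<bar> \<le> K"
proof -
  have "\<bar>step p f x\<bar> \<le> measure_pmf.expectation p (\<lambda>z. \<bar>f (x + z)\<bar>)"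
    unfolding step_def by (rule integral_abs_bound)
  also have "\<dots> \<le> measure_pmf.expectation p (\<lambda>z. K)"
    using assms by (intro integral_mono integrable_bounded_pmf[where K=K]) (auto intro: order_trans[OF abs_ge_zero])
  finally show ?thesis by simp
qed

lemma abs_taboo_le:
  assumes "\<And>z. \<bar>f z\<bar> \<le> K"
  shows "\<bar>taboo p C n f x\<bar> \<le> K"
proof (induction n arbitrary: x)
  case (Suc n)
  have "\<bar>kill C (taboo p C n f) z\<bar> \<le> K" for z
    using abs_kill_le[of C "taboo p C n f" z] Suc by (meson order_trans)
  then show ?case unfolding taboo_Suc by (rule abs_step_le)
qed (use assms in simp)

lemma measurable_add_int:
  fixes f g :: "'b \<Rightarrow> int"
  assumes "f \<in> measurable N (count_space UNIV)" "g \<in> measurable N (count_space UNIV)"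
  shows "(\<lambda>h. f h + g h) \<in> measurable N (count_space UNIV)"
  using assms by measurable

section \<open>The walk on the probability space and its Markov property\<close>

locale iid_steps = prob_space M for M :: "'a measure" +
  fixes X :: "nat \<Rightarrow> 'a \<Rightarrow> int" and p :: "int pmf"
  assumes indep: "indep_vars (\<lambda>_. count_space UNIV) X UNIV"
    and law: "\<And>i. distr M (count_space UNIV) (X i) = measure_pmf p"
begin

lemma measurable_X [measurable]: "X i \<in> measurable M (count_space UNIV)"
  using indep by (auto simp: indep_vars_def)

lemma measurable_walk [measurable]: "walk X x n \<in> measurable M (count_space UNIV)"
proof (induction n)
  case 0
  then show ?case by (simp add: walk_def)
next
  case (Suc n)
  have eq: "walk X x (Suc n) = (\<lambda>\<omega>. walk X x n \<omega> + X (Suc n) \<omega>)"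
    by (simp add: walk_def fun_eq_iff)
  note Suc [measurable]
  show ?case unfolding eq by measurable
qed

definition alive :: "int set \<Rightarrow> int \<Rightarrow> nat \<Rightarrow> 'a \<Rightarrow> bool" where
  "alive C x n \<omega> \<longleftrightarrow> (\<forall>j\<in>{1..n}. walk X x j \<omega> \<notin> C)"

lemma measurable_alive [measurable]: "alive C x n \<in> measurable M (count_space UNIV)"
  unfolding alive_def by measurable

text \<open>Survival and position are packed into one discrete variable, \<open>None\<close>
  standing for a killed path, so that a single independence statement covers both. The next step is
  wrapped in \<open>Some\<close> below to give the two variables the same value type.\<close>

definition past :: "int set \<Rightarrow> int \<Rightarrow> nat \<Rightarrow> 'a \<Rightarrow> int option" where
  "past C x n \<omega> = (if alive C x n \<omega> then Some (walk X x n \<omega>) else None)"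

lemma indep_past:
  "indep_var (count_space UNIV) (past C x n) (count_space UNIV) (\<lambda>\<omega>. Some (X (Suc n) \<omega>))"
proof -
  let ?P = "\<lambda>A. PiM A (\<lambda>_. count_space (UNIV::int set))"
  define wk where "wk = (\<lambda>(k::nat) (h::nat\<Rightarrow>int). x + (\<Sum>i=1..k. h i))"
  have ind: "indep_var (?P {1..n}) (\<lambda>\<omega>. restrict (\<lambda>i. X i \<omega>) {1..n})
     (?P {Suc n}) (\<lambda>\<omega>. restrict (\<lambda>i. X i \<omega>) {Suc n})"
    by (rule indep_var_restrict[OF indep]) auto
  have wk_m: "k \<le> n \<Longrightarrow> wk k \<in> measurable (?P {1..n}) (count_space UNIV)" for k
  proof (induction k)
    case 0
    then show ?case by (simp add: wk_def)
  next
    case (Suc k)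
    have eq: "wk (Suc k) = (\<lambda>h. wk k h + h (Suc k))"
      by (simp add: wk_def fun_eq_iff)
    have [measurable]: "wk k \<in> measurable (?P {1..n}) (count_space UNIV)"
      using Suc by simp
    have [measurable]: "(\<lambda>h. h (Suc k)) \<in> measurable (?P {1..n}) (count_space UNIV)"
      by (rule measurable_component_singleton) (use Suc in auto)
    show ?case unfolding eq by (rule measurable_add_int) fact+
  qed
  have al_m: "(\<lambda>h. \<forall>j\<in>{1..n}. wk j h \<notin> C) \<in> measurable (?P {1..n}) (count_space UNIV)"
  proof -
    have "Measurable.pred (?P {1..n}) (\<lambda>h. wk j h \<notin> C)" if "j \<in> {1..n}" for j
      using measurable_compose[OF wk_m, of j "\<lambda>y. y \<notin> C" "count_space UNIV"] that by simp
    then show ?thesis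
      by (intro pred_intros_finite) auto
  qed
  define g where "g = (\<lambda>h. if \<forall>j\<in>{1..n}. wk j h \<notin> C then Some (wk n h) else None)"
  have g_m: "g \<in> measurable (?P {1..n}) (count_space UNIV)"
    unfolding g_def using al_m measurable_compose[OF wk_m[of n], of Some "count_space UNIV"]
    by (intro measurable_If) auto
  have comp_m: "(\<lambda>h. Some (h (Suc n))) \<in> measurable (?P {Suc n}) (count_space UNIV)"
    by (rule measurable_compose[OF measurable_component_singleton]) auto
  have wk_walk: "wk k (restrict (\<lambda>i. X i \<omega>) {1..n}) = walk X x k \<omega>" if "k \<le> n" for k \<omega>
    using that by (auto simp: wk_def walk_def intro!: sum.cong)
  have 1: "g \<circ> (\<lambda>\<omega>. restrict (\<lambda>i. X i \<omega>) {1..n}) = past C x n"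
    by (auto simp: g_def past_def alive_def wk_walk fun_eq_iff simp del: One_nat_def)
  have 2: "(\<lambda>h. Some (h (Suc n))) \<circ> (\<lambda>\<omega>. restrict (\<lambda>i. X i \<omega>) {Suc n}) = (\<lambda>\<omega>. Some (X (Suc n) \<omega>))"
    by (auto simp: fun_eq_iff)
  show ?thesis
    using indep_var_compose[OF ind g_m comp_m] unfolding 1 2 .
qed

lemma measurable_past [measurable]: "past C x n \<in> measurable M (count_space UNIV)"
  unfolding past_def by measurable

text \<open>Markov property at time n: the surviving position and step n + 1 are independent, so
  their joint law is a product and Fubini integrates the new step out.\<close>

lemma expectation_alive_Suc:
  assumes f: "\<And>z. \<bar>f z\<bar> \<le> K"
  shows "expectation (\<lambda>\<omega>. if alive C x n \<omega> then f (walk X x (Suc n) \<omega>) else 0) =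
         expectation (\<lambda>\<omega>. if alive C x n \<omega> then step p f (walk X x n \<omega>) else 0)"
proof -
  let ?Z = "\<lambda>\<omega>. Some (X (Suc n) \<omega>)"
  let ?c = "count_space (UNIV :: int option set)"
  define H where "H = (\<lambda>(u::int option, v::int option).
     case u of None \<Rightarrow> 0 | Some y \<Rightarrow> (case v of None \<Rightarrow> 0 | Some z \<Rightarrow> f (y + z)))"
  have K: "0 \<le> K" using f[of 0] by linarith
  have H_le: "\<bar>H w\<bar> \<le> K" for w
    using f K by (auto simp: H_def split: option.splits prod.splits)
  interpret N1: prob_space "distr M ?c (past C x n)"
    by (rule prob_space_distr) measurable
  interpret N2: prob_space "distr M ?c ?Z"
    by (rule prob_space_distr) measurable
  interpret N: pair_prob_space "distr M ?c (past C x n)" "distr M ?c ?Z" ..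
  have dist: "distr M ?c (past C x n) \<Otimes>\<^sub>M distr M ?c ?Z = distr M (?c \<Otimes>\<^sub>M ?c) (\<lambda>\<omega>. (past C x n \<omega>, ?Z \<omega>))"
    using indep_past[of C x n] unfolding indep_var_distribution_eq by auto
  have cc: "?c \<Otimes>\<^sub>M ?c = count_space UNIV"
    by (simp add: pair_measure_countable)
  have H_m [measurable]: "H \<in> borel_measurable (?c \<Otimes>\<^sub>M ?c)"
    unfolding cc by simp
  have "expectation (\<lambda>\<omega>. if alive C x n \<omega> then f (walk X x (Suc n) \<omega>) else 0) =
        expectation (\<lambda>\<omega>. H (past C x n \<omega>, ?Z \<omega>))"
    by (intro Bochner_Integration.integral_cong) (auto simp: H_def past_def walk_def add.assoc)
  also have "\<dots> = integral\<^sup>L (distr M (?c \<Otimes>\<^sub>M ?c) (\<lambda>\<omega>. (past C x n \<omega>, ?Z \<omega>))) H"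
    by (rule integral_distr[symmetric]) measurable
  also have "\<dots> = integral\<^sup>L (distr M ?c (past C x n) \<Otimes>\<^sub>M distr M ?c ?Z) H"
    unfolding dist ..
  also have "\<dots> = (\<integral>u. (\<integral>v. H (u, v) \<partial>distr M ?c ?Z) \<partial>distr M ?c (past C x n))"
  proof (rule N.integral_fst'[symmetric])
    show "integrable (distr M ?c (past C x n) \<Otimes>\<^sub>M distr M ?c ?Z) H"
      by (rule N.integrable_const_bound[where B=K]) (use H_le in auto)
  qed
  also have "\<dots> = expectation (\<lambda>\<omega>. \<integral>v. H (past C x n \<omega>, v) \<partial>distr M ?c ?Z)"
    by (rule integral_distr) measurable
  also have "\<dots> = expectation (\<lambda>\<omega>. if alive C x n \<omega> then step p f (walk X x n \<omega>) else 0)"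
  proof (intro Bochner_Integration.integral_cong refl)
    fix \<omega>
    have "(\<integral>v. H (past C x n \<omega>, v) \<partial>distr M ?c ?Z) = (\<integral>\<omega>'. H (past C x n \<omega>, Some (X (Suc n) \<omega>')) \<partial>M)"
      by (rule integral_distr) measurable
    also have "\<dots> = (\<integral>z. H (past C x n \<omega>, Some z) \<partial>distr M (count_space UNIV) (X (Suc n)))"
      by (rule integral_distr[symmetric]) measurable
    also have "\<dots> = (if alive C x n \<omega> then step p f (walk X x n \<omega>) else 0)"
      unfolding law by (simp add: H_def past_def step_def)
    finally show "(\<integral>v. H (past C x n \<omega>, v) \<partial>distr M ?c ?Z) = \<dots>" .
  qed
  finally show ?thesis .
qed

lemma expectation_alive:
  assumes f: "\<And>z. \<bar>f z\<bar> \<le> K"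
  shows "expectation (\<lambda>\<omega>. if alive C x n \<omega> then f (walk X x n \<omega>) else 0) = taboo p C n f x"
  using assms
proof (induction n arbitrary: f)
  case 0
  then show ?case by (simp add: alive_def walk_def prob_space)
next
  case (Suc n)
  have K: "\<bar>kill C f z\<bar> \<le> K" for z
    using abs_kill_le[of C f z] Suc.prems by (meson order_trans)
  have "expectation (\<lambda>\<omega>. if alive C x (Suc n) \<omega> then f (walk X x (Suc n) \<omega>) else 0) =
        expectation (\<lambda>\<omega>. if alive C x n \<omega> then kill C f (walk X x (Suc n) \<omega>) else 0)"
    by (intro Bochner_Integration.integral_cong)
       (auto simp: alive_def kill_def atLeastAtMostSuc_conv)
  also have "\<dots> = expectation (\<lambda>\<omega>. if alive C x n \<omega> then step p (kill C f) (walk X x n \<omega>) else 0)"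
    using K by (rule expectation_alive_Suc)
  also have "\<dots> = taboo p C n (step p (kill C f)) x"
    by (rule Suc.IH) (rule abs_step_le[OF K])
  finally show ?case by (simp add: taboo_Suc')
qed

lemma prob_walk_eq: "\<P>(\<omega> in M. walk X x n \<omega> = y) = taboo p {} n (indicator {y}) x"
proof -
  have "\<P>(\<omega> in M. walk X x n \<omega> = y) = expectation (indicator {\<omega> \<in> space M. walk X x n \<omega> = y})"
    by simp
  also have "\<dots> = expectation (\<lambda>\<omega>. if alive {} x n \<omega> then indicator {y} (walk X x n \<omega>) else 0)"
    by (intro Bochner_Integration.integral_cong) (auto simp: alive_def indicator_def)
  also have "\<dots> = taboo p {} n (indicator {y}) x"
    by (rule expectation_alive[where K=1]) (simp add: indicator_def)
  finally show ?thesis .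
qed

text \<open>Hitting times start at 1, so the witness n is one less than the entrance time into
  \<open>A\<close>. Disjointness ensures that this time is not also a visit to
  \<open>B\<close>.\<close>

lemma hitting_time_less_iff:
  assumes "A \<inter> B = {}"
  shows "hitting_time X x A \<omega> < hitting_time X x B \<omega> \<longleftrightarrow>
    (\<exists>n. alive (A \<union> B) x n \<omega> \<and> walk X x (Suc n) \<omega> \<in> A)"
proof
  let ?T = "\<lambda>C. {enat n |n. n \<ge> 1 \<and> walk X x n \<omega> \<in> C}"
  assume less: "hitting_time X x A \<omega> < hitting_time X x B \<omega>"
  then have "?T A \<noteq> {}"
    by (auto simp: hitting_time_def Inf_enat_def split: if_splits)
  then have "hitting_time X x A \<omega> \<in> ?T A"
    unfolding hitting_time_def by (simp only: Inf_enat_def if_False) (rule LeastI_ex, blast)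
  then obtain m where m: "hitting_time X x A \<omega> = enat m" "m \<ge> 1" "walk X x m \<omega> \<in> A"
    by auto
  have "walk X x j \<omega> \<notin> A \<union> B" if j: "1 \<le> j" "j < m" for j
  proof
    assume "walk X x j \<omega> \<in> A \<union> B"
    then have "hitting_time X x A \<omega> \<le> enat j \<or> hitting_time X x B \<omega> \<le> enat j"
      unfolding hitting_time_def using j by (auto intro!: Inf_lower)
    then show False using m less j by (auto simp: less_le_trans dest: leD order_less_le_trans)
  qed
  then show "\<exists>n. alive (A \<union> B) x n \<omega> \<and> walk X x (Suc n) \<omega> \<in> A"
    using m by (intro exI[of _ "m - 1"]) (auto simp: alive_def)
next
  let ?T = "\<lambda>C. {enat n |n. n \<ge> 1 \<and> walk X x n \<omega> \<in> C}"
  assume "\<exists>n. alive (A \<union> B) x n \<omega> \<and> walk X x (Suc n) \<omega> \<in> A"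
  then obtain n where n: "alive (A \<union> B) x n \<omega>" "walk X x (Suc n) \<omega> \<in> A" by auto
  have "hitting_time X x A \<omega> \<le> enat (Suc n)"
    unfolding hitting_time_def using n by (intro Inf_lower) auto
  also have "enat (Suc n) < enat (Suc (Suc n))" by simp
  also have "enat (Suc (Suc n)) \<le> hitting_time X x B \<omega>"
    unfolding hitting_time_def
  proof (rule Inf_greatest)
    fix t assume "t \<in> ?T B"
    then obtain k where k: "t = enat k" "k \<ge> 1" "walk X x k \<omega> \<in> B" by auto
    have "k \<noteq> Suc n" using n(2) k(3) assms by auto
    moreover have "\<not> k \<le> n" using n(1) k by (auto simp: alive_def)
    ultimately show "enat (Suc (Suc n)) \<le> t" using k by simp
  qed
  finally show "hitting_time X x A \<omega> < hitting_time X x B \<omega>" .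
qed

lemma prob_hit_before_eq:
  assumes "A \<inter> B = {}"
  shows "(\<lambda>n. taboo p (A \<union> B) n (step p (indicator A)) x) sums prob_hit_before M X x A B"
    and "prob_hit_before M X x A B = hit p A B x"
proof -
  define E where "E n = {\<omega> \<in> space M. alive (A \<union> B) x n \<omega> \<and> walk X x (Suc n) \<omega> \<in> A}" for n
  have E_m: "E n \<in> events" for n
    unfolding E_def by measurable
  have alive_mono: "alive C x n \<omega>" if "alive C x m \<omega>" "n \<le> m" for C n m \<omega>
    using that by (auto simp: alive_def)
  have disj: "disjoint_family E"
    unfolding disjoint_family_on_def
  proof (intro ballI impI)
    fix m n :: nat
    assume "m \<noteq> n"
    have *: "E m \<inter> E n = {}" if "m < n" for m n
      using that by (auto simp: E_def alive_def)
    show "E m \<inter> E n = {}"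
      using \<open>m \<noteq> n\<close> *[of m n] *[of n m] by (cases "m < n") auto
  qed
  have "(\<lambda>n. prob (E n)) sums prob (\<Union>n. E n)"
    by (rule finite_measure_UNION[OF _ disj]) (use E_m in auto)
  also have "(\<Union>n. E n) = {\<omega> \<in> space M. hitting_time X x A \<omega> < hitting_time X x B \<omega>}"
    using hitting_time_less_iff[OF assms] by (auto simp: E_def)
  also have "prob \<dots> = prob_hit_before M X x A B"
    by (simp add: prob_hit_before_def)
  also have "(\<lambda>n. prob (E n)) = (\<lambda>n. taboo p (A \<union> B) n (step p (indicator A)) x)"
  proof
    fix n
    have "prob (E n) = expectation (indicator (E n))" using E_m by simp
    also have "\<dots> = expectation (\<lambda>\<omega>. if alive (A \<union> B) x n \<omega> then indicator A (walk X x (Suc n) \<omega>) else 0)"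
      by (intro Bochner_Integration.integral_cong) (auto simp: E_def indicator_def)
    also have "\<dots> = expectation (\<lambda>\<omega>. if alive (A \<union> B) x n \<omega> then step p (indicator A) (walk X x n \<omega>) else 0)"
      by (rule expectation_alive_Suc[where K=1]) (simp add: indicator_def)
    also have "\<dots> = taboo p (A \<union> B) n (step p (indicator A)) x"
      by (rule expectation_alive[where K=1], rule abs_step_le) (simp add: indicator_def)
    finally show "prob (E n) = taboo p (A \<union> B) n (step p (indicator A)) x" .
  qed
  finally show "(\<lambda>n. taboo p (A \<union> B) n (step p (indicator A)) x) sums prob_hit_before M X x A B" .
  then show "prob_hit_before M X x A B = hit p A B x"
    unfolding hit_def by (rule sums_unique)
qed

end

lemma iid_imp_iid_steps:
  assumes "prob_space M" "iid M X"
  obtains p where "iid_steps M X p"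
proof -
  interpret prob_space M by fact
  define N where "N = distr M (count_space UNIV) (X 0)"
  have X: "X i \<in> measurable M (count_space UNIV)" for i
    using assms(2) by (auto simp: iid_def indep_vars_def)
  interpret N: prob_space N
    unfolding N_def by (rule prob_space_distr[OF X])
  have sets: "sets N = UNIV" and space: "space N = UNIV"
    by (auto simp: N_def)
  \<comment> \<open>The integers are countable, so a law on them is carried by its atoms and is a
    \<open>pmf\<close>.\<close>
  have "AE x in N. Sigma_Algebra.measure N {x} \<noteq> 0"
    by (subst N.AE_support_countable) (auto simp: sets intro!: exI[of _ UNIV] )
  then have "measure_pmf (Abs_pmf N) = N"
    using sets N.prob_space_axioms by (intro Abs_pmf_inverse) auto
  then have "iid_steps M X (Abs_pmf N)"
    using assms unfolding iid_def iid_steps_def iid_steps_axioms_def by (auto simp: N_def)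
  then show ?thesis by (rule that)
qed

section \<open>Convergence of the potential series\<close>

lemma step_add:
  assumes "integrable (measure_pmf p) (\<lambda>z. f (x + z))" "integrable (measure_pmf p) (\<lambda>z. g (x + z))"
  shows "step p (\<lambda>y. f y + g y) x = step p f x + step p g x"
  unfolding step_def using assms by (rule Bochner_Integration.integral_add)

lemma step_diff:
  assumes "integrable (measure_pmf p) (\<lambda>z. f (x + z))" "integrable (measure_pmf p) (\<lambda>z. g (x + z))"
  shows "step p (\<lambda>y. f y - g y) x = step p f x - step p g x"
  unfolding step_def using assms by (rule Bochner_Integration.integral_diff)

lemma step_cmult: "step p (\<lambda>y. c * f y) x = c * step p f x"
  unfolding step_def by simp

lemma step_shift: "step p (\<lambda>y. f (y + k)) x = step p f (x + k)"
  unfolding step_def by (simp add: algebra_simps)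

lemma step_pos_imp:
  assumes "step p f x > 0"
  obtains b where "b \<in> set_pmf p" "f (x + b) > 0"
proof -
  have "\<exists>b\<in>set_pmf p. f (x + b) > 0"
  proof (rule ccontr)
    assume "\<not> ?thesis"
    then have "0 \<le> measure_pmf.expectation p (\<lambda>z. - f (x + z))"
      by (intro integral_nonneg_AE) (auto simp: AE_measure_pmf_iff not_less)
    then have "step p f x \<le> 0"
      by (simp add: step_def)
    then show False using assms by simp
  qed
  then show ?thesis using that by auto
qed

lemma step_ge_atom:
  assumes "\<And>z. 0 \<le> f (x + z)" "integrable (measure_pmf p) (\<lambda>z. f (x + z))"
  shows "pmf p b * f (x + b) \<le> step p f x"
proof -
  have "pmf p b * f (x + b) = measure_pmf.expectation p (\<lambda>z. indicator {b} z * f (x + b))"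
    by (simp add: pmf.rep_eq)
  also have "\<dots> \<le> step p f x"
    unfolding step_def
    by (intro integral_mono assms integrable_bounded_pmf[where K="\<bar>f (x + b)\<bar>"])
       (use assms(1) in \<open>auto simp: indicator_def\<close>)
  finally show ?thesis .
qed

lemma taboo_empty_Suc: "taboo p {} (Suc n) f = step p (taboo p {} n f)"
  by (simp add: taboo_Suc)

text \<open>Irreducibility is used through this induction: with every point reachable, a property
  inherited along steps of the support spreads to all integers.\<close>

lemma reach_induct:
  assumes "taboo p {} n (indicator {y}) x > 0" "Q x"
    and "\<And>x b. Q x \<Longrightarrow> b \<in> set_pmf p \<Longrightarrow> Q (x + b)"
  shows "Q y"
  using assms(1,2)
proof (induction n arbitrary: x)
  case 0
  then show ?case by (auto simp: indicator_def split: if_splits)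
next
  case (Suc n)
  then obtain b where "b \<in> set_pmf p" "taboo p {} n (indicator {y}) (x + b) > 0"
    unfolding taboo_empty_Suc by (elim step_pos_imp)
  with Suc assms(3) show ?case by blast
qed

section \<open>Sublinear functions and bounded harmonic functions\<close>

definition sublinear :: "(int \<Rightarrow> real) \<Rightarrow> bool" where
  "sublinear f \<longleftrightarrow> (\<forall>\<epsilon>>0. \<exists>C. \<forall>x. \<bar>f x\<bar> \<le> \<epsilon> * \<bar>real_of_int x\<bar> + C)"

lemma sublinear_diff:
  assumes "sublinear f" "sublinear g"
  shows "sublinear (\<lambda>x. f x - g x)"
  unfolding sublinear_def
proof (intro allI impI)
  fix \<epsilon> :: real assume "\<epsilon> > 0"
  then have "\<epsilon> / 2 > 0" by simp
  from assms(1) this obtain C where C: "\<And>x. \<bar>f x\<bar> \<le> \<epsilon> / 2 * \<bar>real_of_int x\<bar> + C"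
    unfolding sublinear_def by blast
  from assms(2) \<open>\<epsilon> / 2 > 0\<close> obtain D where D: "\<And>x. \<bar>g x\<bar> \<le> \<epsilon> / 2 * \<bar>real_of_int x\<bar> + D"
    unfolding sublinear_def by blast
  show "\<exists>C. \<forall>x. \<bar>f x - g x\<bar> \<le> \<epsilon> * \<bar>real_of_int x\<bar> + C"
  proof (intro exI[of _ "C + D"] allI)
    fix x
    show "\<bar>f x - g x\<bar> \<le> \<epsilon> * \<bar>real_of_int x\<bar> + (C + D)"
      using C[of x] D[of x] by linarith
  qed
qed

lemma sublinear_cmult:
  assumes "sublinear f"
  shows "sublinear (\<lambda>x. c * f x)"
  unfolding sublinear_def
proof (intro allI impI)
  fix \<epsilon> :: real assume "\<epsilon> > 0"
  then have "\<epsilon> / (\<bar>c\<bar> + 1) > 0" by (simp add: add_nonneg_pos)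
  with assms obtain C where C: "\<And>x. \<bar>f x\<bar> \<le> \<epsilon> / (\<bar>c\<bar> + 1) * \<bar>real_of_int x\<bar> + C"
    unfolding sublinear_def by blast
  have "\<bar>c * f x\<bar> \<le> \<epsilon> * \<bar>real_of_int x\<bar> + \<bar>c\<bar> * C" for x
  proof -
    have "\<bar>c * f x\<bar> \<le> \<bar>c\<bar> * (\<epsilon> / (\<bar>c\<bar> + 1) * \<bar>real_of_int x\<bar> + C)"
      unfolding abs_mult by (intro mult_left_mono C) auto
    also have "\<dots> = (\<bar>c\<bar> / (\<bar>c\<bar> + 1)) * (\<epsilon> * \<bar>real_of_int x\<bar>) + \<bar>c\<bar> * C"
      by (simp add: algebra_simps)
    also have "(\<bar>c\<bar> / (\<bar>c\<bar> + 1)) * (\<epsilon> * \<bar>real_of_int x\<bar>) \<le> 1 * (\<epsilon> * \<bar>real_of_int x\<bar>)"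
      using \<open>\<epsilon> > 0\<close> by (intro mult_right_mono) (auto simp: divide_simps)
    finally show ?thesis by simp
  qed
  then show "\<exists>C. \<forall>x. \<bar>c * f x\<bar> \<le> \<epsilon> * \<bar>real_of_int x\<bar> + C" by blast
qed

lemma bounded_sublinear:
  assumes "\<And>x. \<bar>f x\<bar> \<le> K"
  shows "sublinear f"
  unfolding sublinear_def
proof (intro allI impI exI[of _ K])
  fix \<epsilon> :: real and x assume "\<epsilon> > 0"
  then have "0 \<le> \<epsilon> * \<bar>real_of_int x\<bar>" by simp
  with assms[of x] show "\<bar>f x\<bar> \<le> \<epsilon> * \<bar>real_of_int x\<bar> + K" by linarith
qed

lemma lipschitz_int_bound:
  fixes f :: "int \<Rightarrow> real"
  assumes "\<And>x. \<bar>f (x + 1) - f x\<bar> \<le> C"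
  shows "\<bar>f (x + k) - f x\<bar> \<le> C * \<bar>real_of_int k\<bar>"
proof -
  have nat: "\<bar>f (x + int n) - f x\<bar> \<le> C * real n" for n x
  proof (induction n)
    case (Suc n)
    have "\<bar>f (x + int n + 1) - f (x + int n)\<bar> \<le> C" by (rule assms)
    with Suc show ?case by (simp add: algebra_simps)
  qed simp
  show ?thesis
  proof (cases "k \<ge> 0")
    case True
    then show ?thesis using nat[of x "nat k"] by simp
  next
    case False
    then show ?thesis using nat[of "x + k" "nat (- k)"] by (simp add: abs_minus_commute)
  qed
qed

text \<open>Choquet-Deny argument. The difference \<open>v\<close> of \<open>g\<close> along
  \<open>b\<close> is again bounded and harmonic. Near a positive supremum it must stay near that
  supremum along b, 2b, ..., and adding these increments contradicts the bound on
  \<open>g\<close>.\<close>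

lemma periodic_of_bounded_harmonic:
  fixes g :: "int \<Rightarrow> real"
  assumes bdd: "\<And>x. \<bar>g x\<bar> \<le> K" and harm: "\<And>x. step p g x = g x" and b: "b \<in> set_pmf p"
  shows "g (x + b) \<le> g x"
proof (rule ccontr)
  assume neg: "\<not> g (x + b) \<le> g x"
  define v where "v y = g (y + b) - g y" for y
  have v_bdd: "\<bar>v y\<bar> \<le> 2 * K" for y
    using bdd[of "y + b"] bdd[of y] by (simp add: v_def)
  have v_harm: "step p v y = v y" for y
  proof -
    have "step p v y = step p (\<lambda>y. g (y + b)) y - step p g y"
      unfolding v_def by (rule step_diff) (auto intro!: integrable_bounded_pmf bdd)
    then show ?thesis by (simp add: step_shift harm v_def)
  qed
  define S where "S = Sup (range v)"
  have bdd_v: "bdd_above (range v)"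
    using v_bdd by (intro bdd_aboveI[of _ "2 * K"]) (auto dest: abs_le_D1)
  have le_S: "v y \<le> S" for y
    unfolding S_def using bdd_v by (rule cSup_upper[rotated]) simp
  have S_pos: "S > 0"
    using neg le_S[of x] by (simp add: v_def)
  define q where "q = pmf p b"
  have q: "0 < q" "q \<le> 1"
    using b by (auto simp: q_def pmf_positive pmf_le_1)
  \<comment> \<open>S - v is nonnegative and its mean over one step equals its value, so the atom at
    \<open>b\<close> alone bounds the new deficit by 1/q times the old one.\<close>
  have hop: "v (y + b) \<ge> S - \<eta> / q" if "v y \<ge> S - \<eta>" for y \<eta>
  proof -
    have "q * (S - v (y + b)) \<le> step p (\<lambda>y. S - v y) y"
      unfolding q_def
    proof (rule step_ge_atom)
      show "integrable (measure_pmf p) (\<lambda>z. S - v (y + z))"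
        by (intro Bochner_Integration.integrable_diff integrable_bounded_pmf[OF v_bdd]) simp
    qed (use le_S in simp)
    also have "\<dots> = S - v y"
      by (subst step_diff) (auto intro!: integrable_bounded_pmf[OF v_bdd] simp: v_harm)
    finally have "q * (S - v (y + b)) \<le> \<eta>" using that by simp
    then show ?thesis using q by (simp add: field_simps)
  qed
  \<comment> \<open>Here k increments of size S/2 exceed the oscillation 2K of \<open>g\<close>, and
    \<eta> is so small that the deficit, growing by 1/q per hop, stays below S/2 during all of
    them.\<close>
  obtain k :: nat where k: "real k * (S / 2) > 2 * K"
    using S_pos reals_Archimedean3[of "S / 2"] half_gt_zero by blast
  define \<eta> where "\<eta> = S / 2 * q ^ k"
  have \<eta>: "\<eta> > 0" using S_pos q by (simp add: \<eta>_def)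
  obtain y where y: "v y > S - \<eta>"
    using less_cSupD[of "range v" "S - \<eta>"] \<eta> by (auto simp: S_def)
  have iter: "v (y + int j * b) \<ge> S - \<eta> / q ^ j" for j
  proof (induction j)
    case (Suc j)
    from hop[OF Suc] show ?case by (simp add: algebra_simps)
  qed (use y in simp)
  have half: "v (y + int j * b) \<ge> S / 2" if "j < k" for j
  proof -
    have "q ^ k \<le> q ^ j" using that q by (intro power_decreasing) auto
    then have "\<eta> / q ^ j \<le> S / 2"
      using S_pos q by (simp add: \<eta>_def divide_simps)
    then show ?thesis using iter[of j] by linarith
  qed
  have tele: "g (y + int j * b) - g y = (\<Sum>i<j. v (y + int i * b))" for j
    by (induction j) (auto simp: v_def algebra_simps)
  have "real k * (S / 2) \<le> (\<Sum>i<k. v (y + int i * b))"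
    using sum_mono[of "{..<k}" "\<lambda>_. S / 2" "\<lambda>i. v (y + int i * b)"] half by simp
  also have "\<dots> \<le> 2 * K"
    using bdd[of "y + int k * b"] bdd[of y] unfolding tele[symmetric] by linarith
  finally show False using k by simp
qed

section \<open>Characteristic function and Fourier inversion\<close>

definition phi :: "int pmf \<Rightarrow> real \<Rightarrow> complex" where
  "phi p t = (\<integral>z. cis (t * real_of_int z) \<partial>measure_pmf p)"

lemma phi_eq_char: "phi p t = char (distr (measure_pmf p) borel real_of_int) t"
  unfolding phi_def char_def by (subst integral_distr) (auto simp: cis_conv_exp mult.commute)

lemma continuous_on_phi [continuous_intros]: "continuous_on S (phi p)"
proof -
  interpret real_distribution "distr (measure_pmf p) borel real_of_int"
    by (rule prob_space.real_distribution_distr[OF measure_pmf.prob_space_axioms]) simp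
  have "isCont (phi p) t" for t
    unfolding phi_eq_char[abs_def] by (rule isCont_char)
  then show ?thesis by (auto intro: continuous_at_imp_continuous_on)
qed

lemma borel_measurable_phi [measurable]: "phi p \<in> borel_measurable borel"
  by (intro borel_measurable_continuous_onI continuous_on_phi)

lemma integrable_cis: "integrable (measure_pmf p) (\<lambda>z. cis (t * real_of_int z))"
  by (rule measure_pmf.integrable_const_bound[where B=1]) auto

lemma norm_phi_le: "norm (phi p t) \<le> 1"
proof -
  have "norm (phi p t) \<le> measure_pmf.expectation p (\<lambda>z. norm (cis (t * real_of_int z)))"
    unfolding phi_def by (rule integral_norm_bound)
  then show ?thesis by simp
qed

lemma Re_phi: "Re (phi p t) = measure_pmf.expectation p (\<lambda>z. cos (t * real_of_int z))"
  unfolding phi_def using integral_Re[OF integrable_cis, of p t] by simp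

lemma Im_phi: "Im (phi p t) = measure_pmf.expectation p (\<lambda>z. sin (t * real_of_int z))"
  unfolding phi_def using integral_Im[OF integrable_cis, of p t] by simp

lemma pmf_LBINT_swap:
  fixes F :: "int \<Rightarrow> real \<Rightarrow> real"
  assumes [measurable]: "\<And>z. F z \<in> borel_measurable borel"
    and bdd: "\<And>z t. \<bar>F z t\<bar> \<le> K"
  shows "measure_pmf.expectation p (\<lambda>z. LBINT t:{0..pi}. F z t) =
         (LBINT t:{0..pi}. measure_pmf.expectation p (\<lambda>z. F z t))"
proof -
  let ?L = "restrict_space lborel {0..pi}"
  interpret L: finite_measure ?L
    by (rule finite_measureI) (simp add: emeasure_restrict_space)
  interpret N: pair_sigma_finite "measure_pmf p" ?L ..
  interpret NF: finite_measure "measure_pmf p \<Otimes>\<^sub>M ?L"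
    by (rule finite_measure_pair_measure) unfold_locales
  have K: "0 \<le> K" using bdd[of 0 0] by linarith
  have meas: "(\<lambda>(z, t). F z t) \<in> borel_measurable (measure_pmf p \<Otimes>\<^sub>M ?L)"
  proof -
    have "(\<lambda>w. F (fst w) (snd w)) \<in> borel_measurable (measure_pmf p \<Otimes>\<^sub>M ?L)"
    proof (rule measurable_compose_countable'[where I=UNIV and f="\<lambda>i w. F i (snd w)" and g=fst])
      show "(\<lambda>w. F i (snd w)) \<in> borel_measurable (measure_pmf p \<Otimes>\<^sub>M ?L)" for i
        by (rule measurable_compose[OF measurable_snd]) (simp add: measurable_restrict_space1)
      have "fst \<in> measurable (measure_pmf p \<Otimes>\<^sub>M ?L) (measure_pmf p)"
        by (rule measurable_fst)
      then show "fst \<in> measurable (measure_pmf p \<Otimes>\<^sub>M ?L) (count_space UNIV)"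
        by (simp cong: measurable_cong_sets)
    qed simp
    then show ?thesis by (simp add: case_prod_beta')
  qed
  have int: "integrable (measure_pmf p \<Otimes>\<^sub>M ?L) (\<lambda>(z, t). F z t)"
    by (rule NF.integrable_const_bound[where B=K]) (use meas bdd in auto)
  have "(\<integral>z. (\<integral>t. F z t \<partial>?L) \<partial>measure_pmf p) = (\<integral>t. (\<integral>z. F z t \<partial>measure_pmf p) \<partial>?L)"
    using N.Fubini_integral[OF int] by simp
  then show ?thesis
    by (simp add: integral_restrict_space set_lebesgue_integral_def)
qed

lemma LBINT_cos_int:
  "(LBINT t:{0..pi}. cos (real_of_int k * t)) = (if k = 0 then pi else 0)"
proof (cases "k = 0")
  case False
  have "(LBINT t:{0..pi}. cos (real_of_int k * t)) =
      sin (real_of_int k * pi) / real_of_int k - sin (real_of_int k * 0) / real_of_int k"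
    unfolding set_lebesgue_integral_def
    using False by (intro integral_FTC_Icc) (auto intro!: derivative_eq_intros continuous_intros
      simp: has_real_derivative_iff_has_vector_derivative[symmetric])
  then show ?thesis using False by (simp add: sin_integer_2pi sin_zero_iff_int2)
qed (simp add: set_lebesgue_integral_def)

text \<open>The walk from \<open>x\<close> is at 0 after n steps with probability P[S_n = -x]; this
  is the sign convention of the potential series.\<close>

definition pn :: "int pmf \<Rightarrow> nat \<Rightarrow> int \<Rightarrow> real" where
  "pn p n = taboo p {} n (indicator {0})"

lemma pn_0: "pn p 0 = indicator {0}" and pn_Suc: "pn p (Suc n) = step p (pn p n)"
  by (simp_all add: pn_def taboo_empty_Suc)

lemma abs_pn_le: "\<bar>pn p n x\<bar> \<le> 1"
  unfolding pn_def by (rule abs_taboo_le) (simp add: indicator_def)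

lemma pn_nonneg: "0 \<le> pn p n x"
  by (induction n arbitrary: x) (auto simp: pn_0 pn_Suc intro: step_nonneg)

lemma integrable_pn: "integrable (measure_pmf p) (\<lambda>z. pn p n (x + z))"
  by (rule integrable_bounded_pmf[OF abs_pn_le])

text \<open>Inversion by induction on n, since one more step multiplies by \<open>phi p t\<close>.
  The usual integral over (-pi, pi) is folded to (0, pi) because the real part is even in t.\<close>

lemma pn_fourier:
  "pn p n x = (LBINT t:{0..pi}. Re (cis (real_of_int x * t) * phi p t ^ n)) / pi"
proof (induction n arbitrary: x)
  case 0
  show ?case by (simp add: pn_0 LBINT_cos_int indicator_def)
next
  case (Suc n)
  have bd: "\<bar>Re (cis (real_of_int (x + z) * t) * phi p t ^ n)\<bar> \<le> 1" for z t
  proof -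
    have "\<bar>Re (cis (real_of_int (x + z) * t) * phi p t ^ n)\<bar> \<le> norm (cis (real_of_int (x + z) * t) * phi p t ^ n)"
      by (rule abs_Re_le_cmod)
    also have "\<dots> \<le> 1" using norm_phi_le[of p t] by (simp add: norm_mult norm_power power_le_one)
    finally show ?thesis .
  qed
  have "pn p (Suc n) x = measure_pmf.expectation p
     (\<lambda>z. LBINT t:{0..pi}. Re (cis (real_of_int (x + z) * t) * phi p t ^ n)) / pi"
    by (simp add: pn_Suc step_def Suc)
  also have "\<dots> = (LBINT t:{0..pi}. measure_pmf.expectation p
     (\<lambda>z. Re (cis (real_of_int (x + z) * t) * phi p t ^ n))) / pi"
    by (subst pmf_LBINT_swap[where K=1]) (use bd in auto)
  also have "(LBINT t:{0..pi}. measure_pmf.expectation p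
     (\<lambda>z. Re (cis (real_of_int (x + z) * t) * phi p t ^ n))) =
     (LBINT t:{0..pi}. Re (cis (real_of_int x * t) * phi p t ^ Suc n))"
  proof (intro set_lebesgue_integral_cong allI impI)
    fix t :: real
    have eq: "cis (real_of_int (x + z) * t) * phi p t ^ n =
        (cis (real_of_int x * t) * phi p t ^ n) * cis (t * real_of_int z)" for z
      by (simp add: distrib_left distrib_right cis_mult[symmetric] mult_ac)
    show "measure_pmf.expectation p (\<lambda>z. Re (cis (real_of_int (x + z) * t) * phi p t ^ n)) =
      Re (cis (real_of_int x * t) * phi p t ^ Suc n)"
      unfolding eq
      by (subst integral_Re) (auto simp: phi_def[symmetric] mult_ac intro!: integrable_cis)
  qed simp
  finally show ?case .
qed

section \<open>Truncated Green function and partial sums of the potential\<close>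

definition greenN :: "int pmf \<Rightarrow> nat \<Rightarrow> int \<Rightarrow> real" where
  "greenN p N x = (\<Sum>n\<le>N. pn p n x)"

lemma greenN_Suc: "greenN p (Suc N) x = indicator {0} x + step p (greenN p N) x"
proof -
  have "step p (greenN p N) x = (\<Sum>n\<le>N. step p (pn p n) x)"
    unfolding step_def greenN_def by (rule Bochner_Integration.integral_sum) (rule integrable_pn)
  then show ?thesis
    by (simp add: greenN_def sum.atMost_Suc_shift pn_Suc pn_0 del: sum.atMost_Suc)
qed

lemma integrable_greenN: "integrable (measure_pmf p) (\<lambda>z. greenN p N (x + z))"
  unfolding greenN_def by (intro Bochner_Integration.integrable_sum integrable_pn)

text \<open>Off 0 the recursion \<open>greenN_Suc\<close> has no source, so each value is a mean of
  values with smaller N, and the maximum sits at 0.\<close>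

lemma greenN_le: "greenN p N x \<le> greenN p N 0"
proof (induction N arbitrary: x)
  case 0
  then show ?case by (simp add: greenN_def pn_0 indicator_def)
next
  case (Suc N)
  show ?case
  proof (cases "x = 0")
    case False
    have "greenN p (Suc N) x = step p (greenN p N) x" using False by (simp add: greenN_Suc)
    also have "\<dots> \<le> step p (\<lambda>_. greenN p N 0) x"
      by (rule step_mono) (use Suc integrable_greenN in auto)
    also have "\<dots> \<le> greenN p (Suc N) 0"
      by (simp add: greenN_def pn_nonneg)
    finally show ?thesis .
  qed simp
qed

definition potN :: "int pmf \<Rightarrow> nat \<Rightarrow> int \<Rightarrow> real" where
  "potN p N x = greenN p N 0 - greenN p N x"

lemma potN_nonneg: "0 \<le> potN p N x"
  using greenN_le[of p N x] by (simp add: potN_def)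

lemma potN_zero [simp]: "potN p N 0 = 0"
  by (simp add: potN_def)

text \<open>Maximum principle: the increment \<open>G\<^sub>N(x) - G\<^sub>N(x + y)\<close> is subharmonic off \<open>0\<close>.\<close>

lemma potN_increment_le:
  assumes "\<And>N. potN p N y \<le> K"
  shows "potN p N (x + y) - potN p N x \<le> K"
proof -
  have "greenN p N x - greenN p N (x + y) \<le> K"
  proof (induction N arbitrary: x)
    case 0
    show ?case
      using assms[of 0] order_trans[OF potN_nonneg assms[of 0]]
      by (auto simp: greenN_def pn_0 indicator_def potN_def split: if_splits)
  next
    case (Suc N)
    show ?case
    proof (cases "x = 0")
      case True
      then show ?thesis using assms[of "Suc N"] by (simp add: potN_def)
    next
      case False
      have int2: "integrable (measure_pmf p) (\<lambda>z. greenN p N (x + z + y))"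
        using integrable_greenN[of p N "x + y"] by (simp add: ac_simps)
      have "greenN p (Suc N) x - greenN p (Suc N) (x + y) \<le>
          step p (greenN p N) x - step p (greenN p N) (x + y)"
        using False by (simp add: greenN_Suc)
      also have "\<dots> = step p (\<lambda>u. greenN p N u - greenN p N (u + y)) x"
        by (subst step_diff) (auto simp: step_shift integrable_greenN int2)
      also have "\<dots> \<le> step p (\<lambda>_. K) x"
        by (rule step_mono) (auto intro!: Bochner_Integration.integrable_diff Suc int2 integrable_greenN)
      finally show ?thesis by simp
    qed
  qed
  then show ?thesis by (simp add: potN_def)
qed

text \<open>The Poisson equation of the potential, up to the term \<open>pn p (Suc N) x\<close> that
  disappears in the limit.\<close>

lemma step_potN:
  "step p (potN p N) x = potN p N x + indicator {0} x - pn p (Suc N) x"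
proof -
  have "step p (potN p N) x = greenN p N 0 - step p (greenN p N) x"
    unfolding potN_def[abs_def] by (subst step_diff) (auto intro: integrable_greenN)
  also have "step p (greenN p N) x = greenN p N x + pn p (Suc N) x - indicator {0} x"
    using greenN_Suc[of p N x] by (simp add: greenN_def)
  finally show ?thesis by (simp add: potN_def[abs_def])
qed

lemma set_integral_finite_sum:
  fixes f :: "'i \<Rightarrow> real \<Rightarrow> real"
  assumes "\<And>i. i \<in> I \<Longrightarrow> set_integrable lborel S (f i)"
  shows "(LBINT t:S. (\<Sum>i\<in>I. f i t)) = (\<Sum>i\<in>I. LBINT t:S. f i t)"
  using assms unfolding set_lebesgue_integral_def set_integrable_def
  by (simp only: scaleR_sum_right Bochner_Integration.integral_sum)

lemma one_minus_cos_quadratic: "1 - cos y \<le> y\<^sup>2 / 2" for y :: real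
proof -
  have "1 - cos y = 2 * (sin (y / 2))\<^sup>2" using cos_double_sin[of "y / 2"] by simp
  also have "\<dots> \<le> 2 * (y / 2)\<^sup>2"
    using abs_sin_x_le_abs_x[of "y / 2"] by (simp only: abs_le_square_iff mult_le_cancel_left_pos zero_less_numeral)
  finally show ?thesis by (simp add: power_divide)
qed

text \<open>Jordan's inequality for sin(|y|/2), read off the chord of the concave sine from 0 to
  pi/2.\<close>

lemma one_minus_cos_ge_quadratic: "2 * y\<^sup>2 / pi\<^sup>2 \<le> 1 - cos y" if "\<bar>y\<bar> \<le> pi" for y :: real
proof -
  have "\<bar>y\<bar> / pi \<le> sin (\<bar>y\<bar> / 2)"
  proof -
    define u where "u = \<bar>y\<bar> / pi"
    have u: "0 \<le> u" "u \<le> 1" using that by (auto simp: u_def divide_simps)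
    have "concave_on {0..pi} sin"
      by (rule f''_le0_imp_concave[where f'=cos and f''="\<lambda>x. - sin x"])
         (auto intro!: derivative_eq_intros sin_ge_zero)
    then have "sin ((1 - u) *\<^sub>R 0 + u *\<^sub>R (pi / 2)) \<ge> (1 - u) * sin 0 + u * sin (pi / 2)"
      using u by (intro concave_onD) auto
    then show ?thesis by (simp add: u_def)
  qed
  then have "(\<bar>y\<bar> / pi)\<^sup>2 \<le> (sin (\<bar>y\<bar> / 2))\<^sup>2"
    by (intro power_mono) auto
  also have "\<dots> = (1 - cos y) / 2"
    using cos_double_sin[of "\<bar>y\<bar> / 2"] by (simp add: field_simps)
  finally show ?thesis by (simp add: power_divide field_simps)
qed

section \<open>Liouville theorem for the centred irreducible walk\<close>

locale zwalk =
  fixes p :: "int pmf"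
  assumes irr: "\<And>x y. \<exists>n. taboo p {} n (indicator {y}) x > 0"
    and int_p: "integrable (measure_pmf p) real_of_int"
    and mean_p: "measure_pmf.expectation p real_of_int = 0"
    and var_p: "(\<integral>\<^sup>+z. ennreal ((real_of_int z)\<^sup>2) \<partial>measure_pmf p) = \<infinity>"
begin

lemma integrable_linear:
  assumes "\<And>y. \<bar>f y\<bar> \<le> K * \<bar>real_of_int y\<bar> + C"
  shows "integrable (measure_pmf p) (\<lambda>z. f (x + z))"
proof (rule Bochner_Integration.integrable_bound)
  show "integrable (measure_pmf p) (\<lambda>z. \<bar>K\<bar> * (\<bar>real_of_int x\<bar> + \<bar>real_of_int z\<bar>) + \<bar>C\<bar>)"
    using int_p by auto
  have "\<bar>f (x + z)\<bar> \<le> \<bar>K\<bar> * (\<bar>real_of_int x\<bar> + \<bar>real_of_int z\<bar>) + \<bar>C\<bar>" for z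
  proof -
    have "\<bar>f (x + z)\<bar> \<le> K * \<bar>real_of_int (x + z)\<bar> + C" by (rule assms)
    also have "\<dots> \<le> \<bar>K\<bar> * (\<bar>real_of_int x\<bar> + \<bar>real_of_int z\<bar>) + \<bar>C\<bar>"
      by (intro add_mono mult_mono) auto
    finally show ?thesis .
  qed
  then show "AE z in measure_pmf p. norm (f (x + z)) \<le> norm (\<bar>K\<bar> * (\<bar>real_of_int x\<bar> + \<bar>real_of_int z\<bar>) + \<bar>C\<bar>)"
    by (auto intro!: AE_I2 order_trans[OF _ abs_ge_self])
qed simp

lemma integrable_sublinear:
  assumes "sublinear f"
  shows "integrable (measure_pmf p) (\<lambda>z. f (x + z))"
proof -
  obtain C where "\<And>x. \<bar>f x\<bar> \<le> 1 * \<bar>real_of_int x\<bar> + C"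
    using assms unfolding sublinear_def by (meson zero_less_one)
  then show ?thesis by (rule integrable_linear)
qed

text \<open>Applying the one-sided inequality to \<open>g\<close> and to its negative gives
  invariance along the support, which irreducibility spreads to all integers.\<close>

lemma bounded_harmonic_const:
  assumes bdd: "\<And>x. \<bar>g x\<bar> \<le> K" and harm: "\<And>x. step p g x = g x"
  shows "g x = g y"
proof -
  have eq: "g (u + b) = g u" if "b \<in> set_pmf p" for u b
  proof (rule antisym)
    show "g (u + b) \<le> g u"
      by (rule periodic_of_bounded_harmonic[OF bdd harm that])
    have "- g (u + b) \<le> - g u"
      by (rule periodic_of_bounded_harmonic[OF _ _ that, where K=K])
         (use bdd harm step_cmult[of p "-1" g] in auto)
    then show "g u \<le> g (u + b)" by simp
  qed
  obtain n where "taboo p {} n (indicator {y}) x > 0"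
    using irr by blast
  then show ?thesis
    by (rule reach_induct[where Q="\<lambda>u. g x = g u"]) (auto simp: eq)
qed

text \<open>The increments are bounded and harmonic, hence constant, so \<open>f\<close> is affine;
  sublinearity leaves only slope 0.\<close>

lemma liouville:
  assumes lip: "\<And>x. \<bar>f (x + 1) - f x\<bar> \<le> C" and harm: "\<And>x. step p f x = f x"
    and sub: "sublinear f"
  shows "f x = f 0"
proof -
  define g where "g x = f (x + 1) - f x" for x
  have g_harm: "step p g x = g x" for x
  proof -
    have "step p g x = step p (\<lambda>y. f (y + 1)) x - step p f x"
      unfolding g_def
      by (rule step_diff) (use integrable_sublinear[OF sub, of "x + 1"] integrable_sublinear[OF sub, of x] in \<open>auto simp: ac_simps\<close>)
    then show ?thesis by (simp add: step_shift harm g_def)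
  qed
  have g_const: "g x = g 0" for x
    by (rule bounded_harmonic_const[OF _ g_harm, where K=C]) (use lip in \<open>simp add: g_def\<close>)
  have lin0: "\<bar>f (0 + k) - g 0 * real_of_int (0 + k) - (f 0 - g 0 * real_of_int 0)\<bar> \<le> 0 * \<bar>real_of_int k\<bar>" for k
  proof (rule lipschitz_int_bound[of "\<lambda>x. f x - g 0 * real_of_int x"])
    fix x
    have "f (x + 1) - g 0 * real_of_int (x + 1) - (f x - g 0 * real_of_int x) = g x - g 0"
      by (simp add: g_def algebra_simps)
    then show "\<bar>f (x + 1) - g 0 * real_of_int (x + 1) - (f x - g 0 * real_of_int x)\<bar> \<le> 0"
      by (simp add: g_const[of x])
  qed
  have lin: "f k = f 0 + g 0 * real_of_int k" for k
    using lin0[of k] by simp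
  have "g 0 = 0"
  proof (rule ccontr)
    assume "g 0 \<noteq> 0"
    then have "\<bar>g 0\<bar> / 2 > 0" by simp
    then obtain D where D: "\<And>x. \<bar>f x\<bar> \<le> \<bar>g 0\<bar> / 2 * \<bar>real_of_int x\<bar> + D"
      using sub unfolding sublinear_def by blast
    obtain n :: nat where n: "real n * (\<bar>g 0\<bar> / 2) > D + \<bar>f 0\<bar>"
      using reals_Archimedean3[OF \<open>\<bar>g 0\<bar> / 2 > 0\<close>] by blast
    have "\<bar>g 0 * real n\<bar> \<le> \<bar>f (int n)\<bar> + \<bar>f 0\<bar>"
      using lin[of "int n"] by simp
    also have "\<bar>f (int n)\<bar> \<le> \<bar>g 0\<bar> / 2 * real n + D"
      using D[of "int n"] by simp
    finally show False using n by (simp add: abs_mult field_simps)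
  qed
  then show ?thesis using lin[of x] by simp
qed

section \<open>The characteristic function near zero and away from it\<close>

definition reA :: "real \<Rightarrow> real" where
  "reA t = 1 - Re (phi p t)"

lemma reA_eq: "reA t = measure_pmf.expectation p (\<lambda>z. 1 - cos (t * real_of_int z))"
  unfolding reA_def Re_phi
  by (subst Bochner_Integration.integral_diff) (auto intro!: integrable_bounded_pmf[where K=1])

lemma integrable_1_cos: "integrable (measure_pmf p) (\<lambda>z. 1 - cos (t * real_of_int z))"
proof (rule integrable_bounded_pmf[where K=2])
  show "\<bar>1 - cos (t * real_of_int x)\<bar> \<le> 2" for x
    using cos_ge_minus_one[of "t * real_of_int x"] cos_le_one[of "t * real_of_int x"] by linarith
qed

lemma reA_nonneg: "reA t \<ge> 0"
  unfolding reA_eq by (intro integral_nonneg_AE) auto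

text \<open>If it vanished, cos(t z) = 1 would hold on the support and be inherited by sums;
  irreducibility would then give cos t = 1.\<close>

lemma reA_pos:
  assumes "0 < t" "t \<le> pi"
  shows "reA t > 0"
proof (rule ccontr)
  assume "\<not> reA t > 0"
  then have "reA t = 0" using reA_nonneg[of t] by simp
  then have "AE z in measure_pmf p. 1 - cos (t * real_of_int z) = 0"
    unfolding reA_eq by (subst (asm) integral_nonneg_eq_0_iff_AE) (auto intro: integrable_1_cos)
  then have one: "cos (t * real_of_int z) = 1" if "z \<in> set_pmf p" for z
    using that by (auto simp: AE_measure_pmf_iff)
  obtain n where "taboo p {} n (indicator {1}) 0 > 0"
    using irr by blast
  then have "cos (t * real_of_int 1) = 1"
  proof (rule reach_induct[where Q="\<lambda>u. cos (t * real_of_int u) = 1"])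
    fix x b assume x: "cos (t * real_of_int x) = 1" and b: "b \<in> set_pmf p"
    have "sin (t * real_of_int x) = 0"
      using sin_cos_squared_add[of "t * real_of_int x"] x by simp
    then show "cos (t * real_of_int (x + b)) = 1"
      using x one[OF b] by (simp add: distrib_left cos_add)
  qed simp
  moreover have "cos t < cos 0"
    using assms by (intro cos_monotone_0_pi) auto
  ultimately show False by simp
qed

lemma continuous_on_reA: "continuous_on S reA"
  unfolding reA_def by (intro continuous_intros)

lemma reA_bounded_below:
  assumes "0 < \<delta>" "\<delta> \<le> pi"
  obtains c where "c > 0" "\<And>t. \<delta> \<le> t \<Longrightarrow> t \<le> pi \<Longrightarrow> reA t \<ge> c"
proof -
  obtain u where u: "u \<in> {\<delta>..pi}" "\<And>t. t \<in> {\<delta>..pi} \<Longrightarrow> reA u \<le> reA t"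
    using continuous_attains_inf[OF compact_Icc _ continuous_on_reA, of \<delta> pi] assms by auto
  show ?thesis
    by (rule that[of "reA u"]) (use u assms in \<open>auto intro!: reA_pos\<close>)
qed

lemma truncated_second_moment:
  obtains n :: nat where "n > 0"
    "measure_pmf.expectation p (\<lambda>z. (real_of_int z)\<^sup>2 * indicator {- int n..int n} z) \<ge> K"
proof -
  define F where "F n z = ennreal ((real_of_int z)\<^sup>2 * indicator {- int n..int n} z)" for n z
  have "incseq F"
    unfolding F_def by (auto simp: incseq_def le_fun_def indicator_def intro!: ennreal_leI)
  then have "(\<integral>\<^sup>+z. (SUP n. F n z) \<partial>measure_pmf p) = (SUP n. \<integral>\<^sup>+z. F n z \<partial>measure_pmf p)"
    by (intro nn_integral_monotone_convergence_SUP) auto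
  moreover have "(SUP n. F n z) = ennreal ((real_of_int z)\<^sup>2)" for z
  proof (rule antisym)
    show "(SUP n. F n z) \<le> ennreal ((real_of_int z)\<^sup>2)"
      unfolding F_def by (intro SUP_least ennreal_leI) (auto simp: indicator_def)
    have "ennreal ((real_of_int z)\<^sup>2) = F (nat \<bar>z\<bar>) z"
      by (simp add: F_def indicator_def abs_if)
    also have "\<dots> \<le> (SUP n. F n z)" by (intro SUP_upper) simp
    finally show "ennreal ((real_of_int z)\<^sup>2) \<le> (SUP n. F n z)" .
  qed
  ultimately have "(SUP n. \<integral>\<^sup>+z. F n z \<partial>measure_pmf p) = \<infinity>"
    using var_p by simp
  then have "ennreal \<bar>K\<bar> < (SUP n. \<integral>\<^sup>+z. F n z \<partial>measure_pmf p)"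
    by (metis ennreal_less_top infinity_ennreal_def)
  then obtain n where n: "ennreal \<bar>K\<bar> < (\<integral>\<^sup>+z. F n z \<partial>measure_pmf p)"
    by (auto simp: less_SUP_iff)
  also have "\<dots> \<le> (\<integral>\<^sup>+z. F (Suc n) z \<partial>measure_pmf p)"
    using \<open>incseq F\<close> by (intro nn_integral_mono) (auto simp: incseq_Suc_iff le_fun_def)
  also have "\<dots> = ennreal (measure_pmf.expectation p (\<lambda>z. (real_of_int z)\<^sup>2 * indicator {- int (Suc n)..int (Suc n)} z))"
  proof -
    have b: "\<bar>(real_of_int z)\<^sup>2 * indicator {- int (Suc n)..int (Suc n)} z\<bar> \<le> (real (Suc n))\<^sup>2" for z
    proof (cases "z \<in> {- int (Suc n)..int (Suc n)}")
      case True
      then have "\<bar>real_of_int z\<bar> \<le> real (Suc n)" by auto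
      from power_mono[OF this, of 2] show ?thesis using True by simp
    qed simp
    show ?thesis
      unfolding F_def by (rule nn_integral_eq_integral) (use integrable_bounded_pmf[OF b] in auto)
  qed
  finally have "\<bar>K\<bar> < measure_pmf.expectation p (\<lambda>z. (real_of_int z)\<^sup>2 * indicator {- int (Suc n)..int (Suc n)} z)"
    by (simp add: ennreal_less_iff)
  then show ?thesis by (intro that[of "Suc n"]) auto
qed

text \<open>Infinite variance enters here. Truncation at n leaves a second moment as large as
  desired, and for t <= pi/n every t z with |z| <= n lies where the quadratic lower bound for 1 -
  cos holds.\<close>

lemma reA_ge_quadratic:
  obtains \<delta> where "\<delta> > 0" "\<And>t. 0 \<le> t \<Longrightarrow> t \<le> \<delta> \<Longrightarrow> reA t \<ge> K * t\<^sup>2"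
proof -
  obtain n where n: "n > 0"
    "measure_pmf.expectation p (\<lambda>z. (real_of_int z)\<^sup>2 * indicator {- int n..int n} z) \<ge> K * pi\<^sup>2 / 2"
    by (rule truncated_second_moment)
  show ?thesis
  proof (rule that[of "pi / real n"])
    show "pi / real n > 0" using n by simp
    fix t :: real assume t: "0 \<le> t" "t \<le> pi / real n"
    have pt: "2 / pi\<^sup>2 * t\<^sup>2 * ((real_of_int z)\<^sup>2 * indicator {- int n..int n} z) \<le> 1 - cos (t * real_of_int z)" for z
    proof (cases "z \<in> {- int n..int n}")
      case True
      then have "\<bar>real_of_int z\<bar> \<le> real n" by auto
      then have "\<bar>t * real_of_int z\<bar> \<le> pi / real n * real n"
        unfolding abs_mult using t by (intro mult_mono) auto
      then have "\<bar>t * real_of_int z\<bar> \<le> pi" using n by simp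
      from one_minus_cos_ge_quadratic[OF this] show ?thesis using True by (simp add: power_mult_distrib field_simps)
    qed simp
    have "K * t\<^sup>2 = 2 / pi\<^sup>2 * t\<^sup>2 * (K * pi\<^sup>2 / 2)" by simp
    also have "\<dots> \<le> 2 / pi\<^sup>2 * t\<^sup>2 * measure_pmf.expectation p (\<lambda>z. (real_of_int z)\<^sup>2 * indicator {- int n..int n} z)"
      using n(2) by (intro mult_left_mono) auto
    also have "\<dots> = measure_pmf.expectation p (\<lambda>z. 2 / pi\<^sup>2 * t\<^sup>2 * ((real_of_int z)\<^sup>2 * indicator {- int n..int n} z))"
      by simp
    also have "\<dots> \<le> reA t"
      unfolding reA_eq
    proof (rule integral_mono)
      show "integrable (measure_pmf p) (\<lambda>z. 2 / pi\<^sup>2 * t\<^sup>2 * ((real_of_int z)\<^sup>2 * indicator {- int n..int n} z))"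
        by (rule Bochner_Integration.integrable_bound[OF integrable_1_cos[of t]])
           (use pt in \<open>auto intro!: AE_I2 simp: abs_mult indicator_def\<close>)
    qed (use pt integrable_1_cos in auto)
    finally show "reA t \<ge> K * t\<^sup>2" .
  qed
qed

text \<open>Modulus 1 forces t z to be constant modulo 2 pi on the support, and two distinct support
  points confine such t to a countable set. A periodic walk has nonzero ones, so the statement is
  only almost everywhere.\<close>

lemma norm_phi_less_AE: "AE t in lborel. norm (phi p t) < 1"
proof -
  obtain z1 z2 where z: "z1 \<in> set_pmf p" "z2 \<in> set_pmf p" "z1 \<noteq> z2"
  proof -
    obtain b where b: "b \<in> set_pmf p" using set_pmf_not_empty[of p] by blast
    have "\<exists>z\<in>set_pmf p. z \<noteq> b"
    proof (rule ccontr)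
      assume "\<not> ?thesis"
      then have AE: "AE z in measure_pmf p. z = b" by (auto simp: AE_measure_pmf_iff)
      then have "(\<integral>\<^sup>+z. ennreal ((real_of_int z)\<^sup>2) \<partial>measure_pmf p) = (\<integral>\<^sup>+z. ennreal ((real_of_int b)\<^sup>2) \<partial>measure_pmf p)"
        by (intro nn_integral_cong_AE) auto
      then show False using var_p by simp
    qed
    with b that show ?thesis by blast
  qed
  define S where "S = range (\<lambda>m::int. 2 * pi * real_of_int m / real_of_int (z1 - z2))"
  have "norm (phi p t) < 1" if "t \<notin> S" for t
  proof (rule ccontr)
    assume "\<not> norm (phi p t) < 1"
    then have n1: "norm (phi p t) = 1" using norm_phi_le[of p t] by simp
    have int: "integrable (measure_pmf p) (\<lambda>z. cnj (phi p t) * cis (t * real_of_int z))"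
      by (intro integrable_mult_right integrable_cis)
    have le1: "Re (cnj (phi p t) * cis (t * real_of_int z)) \<le> 1" for z
      using complex_Re_le_cmod[of "cnj (phi p t) * cis (t * real_of_int z)"] n1 by (simp add: norm_mult)
    have "measure_pmf.expectation p (\<lambda>z. Re (cnj (phi p t) * cis (t * real_of_int z))) = Re (cnj (phi p t) * phi p t)"
      using integral_Re[OF int] by (simp add: phi_def)
    also have "\<dots> = 1" using n1 by (simp add: mult.commute[of "cnj _"] complex_norm_square[symmetric] del: Re_complex_of_real flip: of_real_power)
    finally have E1: "measure_pmf.expectation p (\<lambda>z. Re (cnj (phi p t) * cis (t * real_of_int z))) = 1" .
    have int2: "integrable (measure_pmf p) (\<lambda>z. 1 - Re (cnj (phi p t) * cis (t * real_of_int z)))"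
      by (intro Bochner_Integration.integrable_diff integrable_Re int) simp
    have "measure_pmf.expectation p (\<lambda>z. 1 - Re (cnj (phi p t) * cis (t * real_of_int z))) = 0"
      by (subst Bochner_Integration.integral_diff) (use E1 in \<open>auto intro!: integrable_Re int simp del: times_complex.sel\<close>)
    then have "AE z in measure_pmf p. 1 - Re (cnj (phi p t) * cis (t * real_of_int z)) = 0"
      by (subst (asm) integral_nonneg_eq_0_iff_AE) (use int2 le1 in auto)
    then have eq: "Re (cnj (phi p t) * cis (t * real_of_int z)) = 1" if "z \<in> set_pmf p" for z
      using that by (auto simp: AE_measure_pmf_iff)
    have eq2: "cis (t * real_of_int z) = phi p t" if "z \<in> set_pmf p" for z
    proof -
      let ?w = "cnj (phi p t) * cis (t * real_of_int z)"
      have "(Re ?w)\<^sup>2 + (Im ?w)\<^sup>2 = (norm ?w)\<^sup>2" by (simp add: cmod_power2)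
      also have "\<dots> = 1" using n1 by (simp add: norm_mult)
      finally have "Im ?w = 0" using eq[OF that] by simp
      then have "?w = 1" using eq[OF that] by (simp add: complex_eq_iff del: times_complex.sel)
      then have "phi p t * ?w = phi p t" by simp
      moreover have "phi p t * cnj (phi p t) = 1"
        using n1 by (simp add: complex_norm_square[symmetric] flip: of_real_power)
      ultimately show ?thesis by (simp add: mult.assoc[symmetric])
    qed
    have "cis (t * real_of_int z1 - t * real_of_int z2) = 1"
      using eq2[OF z(1)] eq2[OF z(2)] n1 by (auto simp: cis_divide[symmetric])
    then have "cos (t * real_of_int (z1 - z2)) = 1"
      by (simp add: complex_eq_iff algebra_simps)
    then obtain m :: int where "t * real_of_int (z1 - z2) = real_of_int m * (2 * pi)"
      by (auto simp: cos_one_2pi_int)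
    then have "t = 2 * pi * real_of_int m / real_of_int (z1 - z2)"
      using z(3) by (simp add: field_simps)
    then show False using that by (auto simp: S_def)
  qed
  moreover have "AE t in lborel. t \<notin> S"
    by (rule AE_not_in) (auto simp: S_def intro!: countable_imp_null_set_lborel)
  ultimately show ?thesis by (auto elim: AE_mp)
qed

lemma pn_tendsto_0: "(\<lambda>n. pn p n x) \<longlonglongrightarrow> 0"
proof -
  have "(\<lambda>n. LBINT t:{0..pi}. Re (cis (real_of_int x * t) * phi p t ^ n)) \<longlonglongrightarrow> (LBINT t:{0..pi}. 0)"
    unfolding set_lebesgue_integral_def
  proof (rule integral_dominated_convergence[where w="indicator {0..pi}"])
    show "AE t in lborel. (\<lambda>n. indicat_real {0..pi} t *\<^sub>R Re (cis (real_of_int x * t) * phi p t ^ n))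
        \<longlonglongrightarrow> indicat_real {0..pi} t *\<^sub>R 0"
      using norm_phi_less_AE
    proof eventually_elim
      case (elim t)
      then have "(\<lambda>n. phi p t ^ n) \<longlonglongrightarrow> 0" by (rule LIMSEQ_power_zero)
      then have "(\<lambda>n. indicat_real {0..pi} t *\<^sub>R Re (cis (real_of_int x * t) * phi p t ^ n))
          \<longlonglongrightarrow> indicat_real {0..pi} t *\<^sub>R Re (cis (real_of_int x * t) * 0)"
        by (intro tendsto_scaleR tendsto_const tendsto_Re tendsto_mult)
      then show ?case by simp
    qed
    show "AE t in lborel. norm (indicat_real {0..pi} t *\<^sub>R Re (cis (real_of_int x * t) * phi p t ^ n)) \<le> indicator {0..pi} t" for n
    proof (rule AE_I2)
      fix t
      have "\<bar>Re (cis (real_of_int x * t) * phi p t ^ n)\<bar> \<le> norm (cis (real_of_int x * t) * phi p t ^ n)"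
        by (rule abs_Re_le_cmod)
      also have "\<dots> \<le> 1" using norm_phi_le[of p t] by (simp add: norm_mult norm_power power_le_one)
      finally show "norm (indicat_real {0..pi} t *\<^sub>R Re (cis (real_of_int x * t) * phi p t ^ n)) \<le> indicator {0..pi} t"
        by (auto simp: indicator_def simp del: times_complex.sel)
    qed
  qed (auto simp: integrable_real_indicator)
  from tendsto_divide[OF this tendsto_const[of pi]] show ?thesis
    by (simp add: pn_fourier[abs_def] set_lebesgue_integral_def)
qed

text \<open>The majorant has an arctan antiderivative whose increment is at most linear in |x|; this
  is where the |x| in the bound for the partial sums originates.\<close>

lemma one_minus_cos_over_square_le:
  fixes x t :: real
  assumes "t \<noteq> 0"
  shows "(1 - cos (x * t)) / t\<^sup>2 \<le> 4 * x\<^sup>2 / (1 + (x * t)\<^sup>2)"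
proof -
  define y where "y = x * t"
  have c1: "1 - cos y \<le> 2" using cos_ge_minus_one[of y] by linarith
  have c2: "1 - cos y \<le> y\<^sup>2 / 2" by (rule one_minus_cos_quadratic)
  have "(1 - cos y) * (1 + y\<^sup>2) \<le> 4 * y\<^sup>2"
  proof (cases "y\<^sup>2 \<le> 1")
    case True
    have "(1 - cos y) * (1 + y\<^sup>2) \<le> (y\<^sup>2 / 2) * 2"
      using True c2 by (intro mult_mono) auto
    then show ?thesis by (simp add: order_trans[of _ "y\<^sup>2"])
  next
    case False
    have "(1 - cos y) * (1 + y\<^sup>2) \<le> 2 * (y\<^sup>2 + y\<^sup>2)"
      using False c1 by (intro mult_mono) auto
    then show ?thesis by simp
  qed
  then have "(1 - cos y) \<le> 4 * y\<^sup>2 / (1 + y\<^sup>2)"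
    by (subst pos_le_divide_eq) (auto simp: add_pos_nonneg)
  then have "(1 - cos y) / t\<^sup>2 \<le> 4 * y\<^sup>2 / (1 + y\<^sup>2) / t\<^sup>2"
    by (rule divide_right_mono) simp
  also have "\<dots> = 4 * x\<^sup>2 / (1 + y\<^sup>2)"
    using assms by (simp add: y_def power_mult_distrib)
  finally show ?thesis by (simp add: y_def)
qed

lemma LBINT_poisson_le:
  fixes x :: real
  shows "set_integrable lborel {0..pi} (\<lambda>t. 4 * x\<^sup>2 / (1 + (x * t)\<^sup>2))"
    and "(LBINT t:{0..pi}. 4 * x\<^sup>2 / (1 + (x * t)\<^sup>2)) \<le> 2 * pi * \<bar>x\<bar>"
proof -
  have nz: "1 + (x * t)\<^sup>2 \<noteq> 0" for t
    by (metis add_pos_nonneg less_numeral_extra(1,3) zero_le_power2)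
  show "set_integrable lborel {0..pi} (\<lambda>t. 4 * x\<^sup>2 / (1 + (x * t)\<^sup>2))"
    using nz by (intro borel_integrable_atLeastAtMost') (auto intro!: continuous_intros)
  have "(LBINT t:{0..pi}. 4 * x\<^sup>2 / (1 + (x * t)\<^sup>2)) = 4 * x * arctan (x * pi) - 4 * x * arctan (x * 0)"
    unfolding set_lebesgue_integral_def
  proof (rule integral_FTC_Icc)
    fix t :: real
    show "((\<lambda>t. 4 * x * arctan (x * t)) has_vector_derivative 4 * x\<^sup>2 / (1 + (x * t)\<^sup>2)) (at t within {0..pi})"
      unfolding has_real_derivative_iff_has_vector_derivative[symmetric]
      by (auto intro!: derivative_eq_intros simp: power2_eq_square divide_simps)
  qed (use nz in \<open>auto intro!: continuous_intros\<close>)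
  also have "\<dots> \<le> 4 * \<bar>x\<bar> * (pi / 2)"
  proof -
    have "x * arctan (x * pi) \<le> \<bar>x\<bar> * \<bar>arctan (x * pi)\<bar>"
      by (metis abs_ge_self abs_mult)
    also have "\<dots> \<le> \<bar>x\<bar> * (pi / 2)"
      using arctan_bounded[of "x * pi"] by (intro mult_left_mono) auto
    finally show ?thesis by (simp add: mult_ac)
  qed
  finally show "(LBINT t:{0..pi}. 4 * x\<^sup>2 / (1 + (x * t)\<^sup>2)) \<le> 2 * pi * \<bar>x\<bar>" by simp
qed

text \<open>Adding the values at x and -x removes the sine, so only the real part of the geometric
  sum matters. Since \<open>potN\<close> is nonnegative, an upper bound for the sum bounds each
  value.\<close>

lemma potN_symmetric:
  "potN p N x + potN p N (- x) =
   (LBINT t:{0..pi}. 2 * (1 - cos (real_of_int x * t)) * Re (\<Sum>n\<le>N. phi p t ^ n)) / pi"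
proof -
  have int: "set_integrable lborel {0..pi} (\<lambda>t. Re (cis (real_of_int y * t) * phi p t ^ n))" for y n
    by (intro borel_integrable_atLeastAtMost' continuous_intros)
  have eq: "2 * (1 - cos (real_of_int x * t)) * Re (\<Sum>n\<le>N. phi p t ^ n) =
    (\<Sum>n\<le>N. 2 * Re (cis (real_of_int 0 * t) * phi p t ^ n) - Re (cis (real_of_int x * t) * phi p t ^ n)
        - Re (cis (real_of_int (- x) * t) * phi p t ^ n))" for t
    by (simp add: sum_distrib_left algebra_simps sum.distrib sum_subtractf)
  have "(LBINT t:{0..pi}. 2 * (1 - cos (real_of_int x * t)) * Re (\<Sum>n\<le>N. phi p t ^ n)) =
    (\<Sum>n\<le>N. 2 * (LBINT t:{0..pi}. Re (cis (real_of_int 0 * t) * phi p t ^ n))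
        - (LBINT t:{0..pi}. Re (cis (real_of_int x * t) * phi p t ^ n))
        - (LBINT t:{0..pi}. Re (cis (real_of_int (- x) * t) * phi p t ^ n)))"
    unfolding eq
    by (subst set_integral_finite_sum)
       (auto intro!: sum.cong set_integral_diff set_integrable_mult_right int simp del: times_complex.sel of_int_0 of_int_minus
         simp: set_integral_diff set_integrable_mult_right int)
  then have "(LBINT t:{0..pi}. 2 * (1 - cos (real_of_int x * t)) * Re (\<Sum>n\<le>N. phi p t ^ n)) / pi =
    (\<Sum>n\<le>N. 2 * pn p n 0 - pn p n x - pn p n (- x))"
    by (simp add: pn_fourier sum_divide_distrib diff_divide_distrib del: times_complex.sel)
  also have "\<dots> = potN p N x + potN p N (- x)"
    by (simp add: potN_def greenN_def sum_subtractf sum_distrib_left[symmetric])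
  finally show ?thesis ..
qed

lemma Re_geometric_le:
  assumes "0 < t" "t \<le> pi"
  shows "\<bar>Re (\<Sum>n\<le>N. phi p t ^ n)\<bar> \<le> 2 / reA t"
proof -
  have pos: "reA t > 0" using assms by (rule reA_pos)
  then have ne: "phi p t \<noteq> 1" by (auto simp: reA_def)
  have "(\<Sum>n\<le>N. phi p t ^ n) = (1 - phi p t ^ Suc N) / (1 - phi p t)"
    using sum_gp0[of "phi p t" N] ne by simp
  then have "norm (\<Sum>n\<le>N. phi p t ^ n) = norm (1 - phi p t ^ Suc N) / norm (1 - phi p t)"
    by (simp add: norm_divide)
  also have "\<dots> \<le> 2 / reA t"
  proof (rule frac_le)
    have "norm (1 - phi p t ^ Suc N) \<le> norm (1::complex) + norm (phi p t ^ Suc N)"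
      by (rule norm_triangle_ineq4)
    also have "\<dots> \<le> 1 + 1"
      using norm_phi_le[of p t] unfolding norm_power by (intro add_mono power_le_one) auto
    finally show "norm (1 - phi p t ^ Suc N) \<le> 2" by simp
    show "reA t \<le> norm (1 - phi p t)"
      using complex_Re_le_cmod[of "1 - phi p t"] by (simp add: reA_def)
  qed (use pos in auto)
  finally show ?thesis
    using abs_Re_le_cmod order_trans by blast
qed

text \<open>Near 0 infinite variance puts \<open>reA t\<close> above K t^2 for any K, and away from
  0 the integrand is bounded; neither bound depends on N.\<close>

lemma potN_sublinear:
  assumes "\<epsilon> > 0"
  obtains C where "\<And>N x. potN p N x \<le> \<epsilon> * \<bar>real_of_int x\<bar> + C"
proof -
  \<comment> \<open>The integral bound 2 pi |x| enters with factor 4/K and is divided by pi, so K =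
    8/\<epsilon> produces the slope \<epsilon>.\<close>
  define K where "K = 8 / \<epsilon>"
  have K: "K > 0" using assms by (simp add: K_def)
  obtain \<delta> where \<delta>: "\<delta> > 0" "\<And>t. 0 \<le> t \<Longrightarrow> t \<le> \<delta> \<Longrightarrow> reA t \<ge> K * t\<^sup>2"
    using reA_ge_quadratic[of K] by blast
  obtain c where c: "c > 0" "\<And>t. min \<delta> pi \<le> t \<Longrightarrow> t \<le> pi \<Longrightarrow> reA t \<ge> c"
    by (rule reA_bounded_below[of "min \<delta> pi"]) (use \<delta>(1) in auto)
  show ?thesis
  proof (rule that[of "8 / c"])
    fix N x
    let ?x = "real_of_int x"
    have bd: "2 * (1 - cos (?x * t)) * Re (\<Sum>n\<le>N. phi p t ^ n) \<le>
        (4 / K) * (4 * ?x\<^sup>2 / (1 + (?x * t)\<^sup>2)) + 8 / c" if t: "0 \<le> t" "t \<le> pi" for t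
    proof (cases "t = 0")
      case True
      then show ?thesis using K c by simp
    next
      case False
      then have t0: "0 < t" using t by simp
      have "2 * (1 - cos (?x * t)) * Re (\<Sum>n\<le>N. phi p t ^ n) \<le> 2 * (1 - cos (?x * t)) * (2 / reA t)"
        using Re_geometric_le[OF t0 t(2), of N] by (intro mult_left_mono) auto
      also have "\<dots> \<le> (4 / K) * (4 * ?x\<^sup>2 / (1 + (?x * t)\<^sup>2)) + 8 / c"
      proof (cases "t \<le> \<delta>")
        case True
        have "2 * (1 - cos (?x * t)) * (2 / reA t) \<le> 2 * (1 - cos (?x * t)) * (2 / (K * t\<^sup>2))"
          using \<delta>(2)[of t] t0 True K by (intro mult_left_mono divide_left_mono mult_pos_pos reA_pos t) auto
        also have "\<dots> = (4 / K) * ((1 - cos (?x * t)) / t\<^sup>2)" by simp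
        also have "\<dots> \<le> (4 / K) * (4 * ?x\<^sup>2 / (1 + (?x * t)\<^sup>2))"
          using K t0 by (intro mult_left_mono one_minus_cos_over_square_le) auto
        finally show ?thesis using c by (simp add: add_increasing2)
      next
        case False
        have "1 - cos (?x * t) \<le> 1 - (- 1)"
          by (intro diff_left_mono cos_ge_minus_one)
        from mult_left_mono[OF this, of 2] have "2 * (1 - cos (?x * t)) \<le> 4"
          unfolding diff_minus_eq_add by (rule order_trans) auto
        then have "2 * (1 - cos (?x * t)) * (2 / reA t) \<le> 4 * (2 / c)"
          using c(2)[of t] False t c(1) t0
          by (intro mult_mono divide_left_mono mult_pos_pos reA_pos) auto
        then show ?thesis using K by (simp add: add_increasing add_nonneg_nonneg)
      qed
      finally show ?thesis .
    qed
    have "potN p N x \<le> potN p N x + potN p N (- x)"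
      using potN_nonneg[of p N "- x"] by simp
    also have "\<dots> = (LBINT t:{0..pi}. 2 * (1 - cos (?x * t)) * Re (\<Sum>n\<le>N. phi p t ^ n)) / pi"
      by (rule potN_symmetric)
    also have "\<dots> \<le> (LBINT t:{0..pi}. (4 / K) * (4 * ?x\<^sup>2 / (1 + (?x * t)\<^sup>2)) + 8 / c) / pi"
    proof (intro divide_right_mono set_integral_mono)
      show "set_integrable lborel {0..pi} (\<lambda>t. 2 * (1 - cos (?x * t)) * Re (\<Sum>n\<le>N. phi p t ^ n))"
        by (intro borel_integrable_atLeastAtMost' continuous_intros)
      show "set_integrable lborel {0..pi} (\<lambda>t. (4 / K) * (4 * ?x\<^sup>2 / (1 + (?x * t)\<^sup>2)) + 8 / c)"
        by (intro set_integral_add set_integrable_mult_right LBINT_poisson_le) (simp add: set_integrable_def)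
    qed (use bd in auto)
    also have "(LBINT t:{0..pi}. (4 / K) * (4 * ?x\<^sup>2 / (1 + (?x * t)\<^sup>2)) + 8 / c) =
       (4 / K) * (LBINT t:{0..pi}. 4 * ?x\<^sup>2 / (1 + (?x * t)\<^sup>2)) + pi * (8 / c)"
    proof -
      have i1: "set_integrable lborel {0..pi} (\<lambda>t. (4 / K) * (4 * ?x\<^sup>2 / (1 + (?x * t)\<^sup>2)))"
        by (intro set_integrable_mult_right LBINT_poisson_le)
      have i2: "set_integrable lborel {0..pi} (\<lambda>t. 8 / c)"
        by (simp add: set_integrable_def)
      have "(LBINT t:{0..pi}. 8 / c) = pi * (8 / c)"
        by (simp add: set_lebesgue_integral_def)
      then show ?thesis
        unfolding set_integral_add(2)[OF i1 i2] set_integral_mult_right by simp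
    qed
    also have "(\<dots>) / pi \<le> ((4 / K) * (2 * pi * \<bar>?x\<bar>) + pi * (8 / c)) / pi"
      using K LBINT_poisson_le(2)[of ?x] by (intro divide_right_mono add_right_mono mult_left_mono) auto
    also have "\<dots> = \<epsilon> * \<bar>?x\<bar> + 8 / c"
      using assms by (simp add: K_def add_divide_distrib)
    finally show "potN p N x \<le> \<epsilon> * \<bar>?x\<bar> + 8 / c" .
  qed
qed

text \<open>The properties that survive every subsequential limit of the partial sums and together
  determine it; the last is the Poisson equation with source at 0.\<close>

definition potential_like :: "(int \<Rightarrow> real) \<Rightarrow> bool" where
  "potential_like h \<longleftrightarrow> (\<forall>x. 0 \<le> h x) \<and> h 0 = 0 \<and> (\<exists>C. \<forall>x. \<bar>h (x + 1) - h x\<bar> \<le> C) \<and> sublinear h \<and>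
     (\<forall>x. step p h x = h x + indicator {0} x)"

lemma potential_like_limit:
  assumes lim: "\<And>x. (\<lambda>n. potN p (k n) x) \<longlonglongrightarrow> h x" and k: "strict_mono (k :: nat \<Rightarrow> nat)"
  shows "potential_like h"
proof -
  obtain C where C: "\<And>N x. potN p N x \<le> 1 * \<bar>real_of_int x\<bar> + C"
    using potN_sublinear[of 1] by auto
  have nonneg: "0 \<le> h x" for x
    by (rule LIMSEQ_le_const[OF lim]) (use potN_nonneg in auto)
  moreover have "h 0 = 0"
    by (rule LIMSEQ_unique[OF lim]) simp
  moreover have "\<bar>h (x + 1) - h x\<bar> \<le> 1 + C" for x
  proof -
    have "\<bar>potN p N (x + 1) - potN p N x\<bar> \<le> 1 + C" for N
      using potN_increment_le[of p 1 "1 + C" N x] potN_increment_le[of p "-1" "1 + C" N "x + 1"]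
        C[of _ 1] C[of _ "-1"] by (simp add: abs_le_iff)
    then have "\<forall>n\<ge>0. \<bar>potN p (k n) (x + 1) - potN p (k n) x\<bar> \<le> 1 + C" by simp
    then show ?thesis
      by (intro LIMSEQ_le_const2[OF tendsto_rabs[OF tendsto_diff[OF lim lim]]]) blast
  qed
  moreover have "sublinear h"
    unfolding sublinear_def
  proof (intro allI impI)
    fix \<epsilon> :: real assume "\<epsilon> > 0"
    then obtain D where D: "\<And>N x. potN p N x \<le> \<epsilon> * \<bar>real_of_int x\<bar> + D"
      using potN_sublinear by blast
    have "h x \<le> \<epsilon> * \<bar>real_of_int x\<bar> + D" for x
      by (rule LIMSEQ_le_const2[OF lim]) (use D in auto)
    then show "\<exists>C. \<forall>x. \<bar>h x\<bar> \<le> \<epsilon> * \<bar>real_of_int x\<bar> + C"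
      using nonneg by (intro exI[of _ D]) auto
  qed
  moreover have "step p h x = h x + indicator {0} x" for x
  proof (rule LIMSEQ_unique)
    show "(\<lambda>n. step p (potN p (k n)) x) \<longlonglongrightarrow> step p h x"
      unfolding step_def
    proof (rule integral_dominated_convergence[where w="\<lambda>z. 1 * \<bar>real_of_int (x + z)\<bar> + C"])
      show "integrable (measure_pmf p) (\<lambda>z. 1 * \<bar>real_of_int (x + z)\<bar> + C)"
        by (rule integrable_linear[where K=1 and C="\<bar>C\<bar>"]) auto
      show "AE z in measure_pmf p. norm (potN p (k n) (x + z)) \<le> 1 * \<bar>real_of_int (x + z)\<bar> + C" for n
        using C potN_nonneg by (intro AE_I2) (simp del: of_int_add)
    qed (use lim in auto)
    have "(\<lambda>n. potN p (k n) x + indicator {0} x - pn p (Suc (k n)) x) \<longlonglongrightarrow> h x + indicator {0} x - 0"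
    proof (intro tendsto_diff tendsto_add tendsto_const lim)
      have "strict_mono (\<lambda>n. Suc (k n))" using k by (simp add: strict_mono_def)
      from LIMSEQ_subseq_LIMSEQ[OF pn_tendsto_0 this] show "(\<lambda>n. pn p (Suc (k n)) x) \<longlonglongrightarrow> 0"
        by (simp add: o_def)
    qed
    then show "(\<lambda>n. step p (potN p (k n)) x) \<longlonglongrightarrow> h x + indicator {0} x"
      by (simp add: step_potN)
  qed
  ultimately show ?thesis unfolding potential_like_def by blast
qed

lemma potential_like_unique:
  assumes "potential_like g" "potential_like h"
  shows "g x = h x"
proof -
  obtain C where C: "\<And>x. \<bar>g (x + 1) - g x\<bar> \<le> C" using assms(1) unfolding potential_like_def by blast
  obtain D where D: "\<And>x. \<bar>h (x + 1) - h x\<bar> \<le> D" using assms(2) unfolding potential_like_def by blast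
  have sg: "sublinear g" and sh: "sublinear h" using assms by (auto simp: potential_like_def)
  have "g x - h x = g 0 - h 0"
  proof (rule liouville[of "\<lambda>x. g x - h x"])
    show "\<bar>g (x + 1) - h (x + 1) - (g x - h x)\<bar> \<le> C + D" for x
      using C[of x] D[of x] by linarith
    show "step p (\<lambda>x. g x - h x) x = g x - h x" for x
      by (subst step_diff) (use assms in \<open>auto simp: potential_like_def intro!: integrable_sublinear\<close>)
    show "sublinear (\<lambda>x. g x - h x)" using sg sh by (rule sublinear_diff)
  qed
  then show ?thesis using assms by (simp add: potential_like_def)
qed

lemma potN_subsequence:
  fixes r :: "nat \<Rightarrow> nat"
  assumes "strict_mono r"
  obtains k h where "strict_mono (k :: nat \<Rightarrow> nat)" "\<And>x. (\<lambda>n. potN p (r (k n)) x) \<longlonglongrightarrow> h x"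
proof -
  obtain C where C: "\<And>N x. potN p N x \<le> 1 * \<bar>real_of_int x\<bar> + C"
    using potN_sublinear[of 1] by auto
  \<comment> \<open>Division by an affine weight bounds the family uniformly in \<open>x\<close>, so
    that a diagonal selection on the countable set of integers applies.\<close>
  define f where "f n x = potN p (r n) x / (\<bar>real_of_int x\<bar> + \<bar>C\<bar> + 1)" for n x
  have den: "\<bar>real_of_int x\<bar> + \<bar>C\<bar> + 1 > 0" for x by linarith
  have bd: "norm (f n x) \<le> 1" for n x
  proof -
    have "\<bar>potN p (r n) x\<bar> \<le> \<bar>real_of_int x\<bar> + \<bar>C\<bar> + 1"
      using C[of "r n" x] potN_nonneg[of p "r n" x] by linarith
    then show ?thesis using den[of x] by (simp add: f_def divide_simps)
  qed
  have "\<exists>k::nat \<Rightarrow> nat. strict_mono k \<and> (\<forall>x. \<exists>l. (\<lambda>n. f (k n) x) \<longlonglongrightarrow> l)"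
    by (rule function_convergent_subsequence[of "UNIV :: int set" f 1]) (use bd in \<open>simp, simp, blast\<close>)
  then obtain k where k: "strict_mono (k :: nat \<Rightarrow> nat)" "\<And>x. \<exists>l. (\<lambda>n. f (k n) x) \<longlonglongrightarrow> l"
    by blast
  then obtain g where g: "\<And>x. (\<lambda>n. f (k n) x) \<longlonglongrightarrow> g x" by metis
  show ?thesis
  proof (rule that[OF k(1)])
    fix x
    from tendsto_mult[OF g[of x] tendsto_const[of "\<bar>real_of_int x\<bar> + \<bar>C\<bar> + 1"]]
    show "(\<lambda>n. potN p (r (k n)) x) \<longlonglongrightarrow> g x * (\<bar>real_of_int x\<bar> + \<bar>C\<bar> + 1)"
      using den[of x] by (simp add: f_def)
  qed
qed

definition pot :: "int \<Rightarrow> real" where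
  "pot x = (\<Sum>n. pn p n 0 - pn p n x)"

text \<open>If the values at some \<open>x\<close> kept a distance from the first limit along a
  subsequence, a further subsequence would have a different potential-like limit, against
  uniqueness.\<close>

lemma potN_converges: "\<exists>h. \<forall>x. (\<lambda>N. potN p N x) \<longlonglongrightarrow> h x"
proof -
  obtain k h where k: "strict_mono (k :: nat \<Rightarrow> nat)" and h: "\<And>x. (\<lambda>n. potN p (k n) x) \<longlonglongrightarrow> h x"
    using potN_subsequence[of id] by (auto simp: strict_mono_def)
  have "(\<lambda>N. potN p N x) \<longlonglongrightarrow> h x" for x
  proof (rule ccontr)
    assume "\<not> (\<lambda>N. potN p N x) \<longlonglongrightarrow> h x"
    then obtain e where e: "e > 0" "\<And>N. \<exists>n\<ge>N. \<not> dist (potN p n x) (h x) < e"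
      unfolding lim_sequentially by blast
    then have inf: "infinite {n. \<not> dist (potN p n x) (h x) < e}"
      unfolding infinite_nat_iff_unbounded_le by auto
    define r where "r = enumerate {n. \<not> dist (potN p n x) (h x) < e}"
    have r: "strict_mono r" using inf by (simp add: r_def strict_mono_enumerate)
    have far: "e \<le> dist (potN p (r n) x) (h x)" for n
      using enumerate_in_set[OF inf, of n] by (simp add: r_def)
    obtain k' h' where k': "strict_mono (k' :: nat \<Rightarrow> nat)" and h': "\<And>x. (\<lambda>n. potN p (r (k' n)) x) \<longlonglongrightarrow> h' x"
      using potN_subsequence[OF r] by blast
    have "strict_mono (\<lambda>n. r (k' n))" using r k' by (simp add: strict_mono_def)
    from potential_like_limit[OF h' this] potential_like_limit[OF h k] have "h' x = h x" by (rule potential_like_unique)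
    moreover have "e \<le> dist (h' x) (h x)"
      by (rule LIMSEQ_le_const[OF tendsto_dist[OF h' tendsto_const]]) (use far in auto)
    ultimately show False using e(1) by simp
  qed
  then show ?thesis by blast
qed

lemma potN_tendsto_pot: "(\<lambda>N. potN p N x) \<longlonglongrightarrow> pot x"
  and pot_sums: "(\<lambda>n. pn p n 0 - pn p n x) sums pot x"
proof -
  obtain h where h: "(\<lambda>N. potN p N x) \<longlonglongrightarrow> h x" for x
    using potN_converges by blast
  have "potN p N x = (\<Sum>n\<le>N. pn p n 0 - pn p n x)" for N
    by (simp add: potN_def greenN_def sum_subtractf)
  then have s: "(\<lambda>n. pn p n 0 - pn p n x) sums h x"
    using h[of x] by (simp add: sums_def_le)
  have eq: "pot x = h x"
    unfolding pot_def by (rule sums_unique[OF s, symmetric])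
  show "(\<lambda>n. pn p n 0 - pn p n x) sums pot x"
    unfolding eq by (rule s)
  show "(\<lambda>N. potN p N x) \<longlonglongrightarrow> pot x"
    unfolding eq by (rule h)
qed

lemma potential_like_pot: "potential_like pot"
  by (rule potential_like_limit[where k=id]) (auto simp: potN_tendsto_pot strict_mono_def)

lemma pot_nonneg: "0 \<le> pot x"
  and pot_0 [simp]: "pot 0 = 0"
  and sublinear_pot: "sublinear pot"
  and step_pot: "step p pot x = pot x + indicator {0} x"
  using potential_like_pot by (auto simp: potential_like_def)

lemma integrable_pot: "integrable (measure_pmf p) (\<lambda>z. pot (x + z))"
  by (rule integrable_sublinear[OF sublinear_pot])

lemma nonneg_eq_zero_propagates:
  assumes "f x = step p g x" "f x = 0" "\<And>y. 0 \<le> g y" "integrable (measure_pmf p) (\<lambda>z. g (x + z))"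
    "b \<in> set_pmf p"
  shows "g (x + b) = 0"
proof -
  have "pmf p b * g (x + b) \<le> step p g x" by (rule step_ge_atom) (use assms in auto)
  then have "pmf p b * g (x + b) \<le> 0" using assms by simp
  moreover have "pmf p b > 0" using assms(5) by (rule pmf_positive)
  ultimately show ?thesis using assms(3)[of "x + b"] by (metis antisym mult_le_cancel_left_pos mult_zero_right)
qed

section \<open>Resolvent, and first-order behaviour of the characteristic function at zero\<close>

lemma summable_power_pn: "0 \<le> r \<Longrightarrow> r < 1 \<Longrightarrow> summable (\<lambda>n. r ^ n * pn p n x)"
  by (rule summable_comparison_test'[where g="\<lambda>n. r ^ n" and N=0])
     (auto simp: abs_mult abs_pn_le mult_left_le summable_geometric)

lemma norm_rphi: "0 \<le> r \<Longrightarrow> norm (complex_of_real r * phi p t) \<le> r"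
  using norm_phi_le[of p t] by (simp add: norm_mult mult_left_le)

lemma continuous_on_resolvent:
  assumes "0 \<le> r" "r < 1"
  shows "continuous_on S (\<lambda>t. 1 / (1 - complex_of_real r * phi p t))"
proof -
  have "complex_of_real r * phi p t \<noteq> 1" for t
    using norm_rphi[OF assms(1), of t] assms(2) by auto
  then show ?thesis by (intro continuous_intros) auto
qed

text \<open>The factors r^n make the sum of the inversion formulas absolutely convergent, so sum and
  integral may be exchanged.\<close>

lemma resolvent_fourier:
  assumes r: "0 \<le> r" "r < 1"
  shows "(\<Sum>n. r ^ n * pn p n x) =
    (LBINT t:{0..pi}. Re (cis (real_of_int x * t) / (1 - complex_of_real r * phi p t))) / pi"
proof -
  define F where "F n t = Re (cis (real_of_int x * t) * (complex_of_real r * phi p t) ^ n)" for n t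
  have F_int: "set_integrable lborel {0..pi} (F n)" for n
    unfolding F_def by (intro borel_integrable_atLeastAtMost' continuous_intros)
  have F_le: "\<bar>F n t\<bar> \<le> r ^ n" for n t
  proof -
    have "\<bar>F n t\<bar> \<le> norm (cis (real_of_int x * t) * (complex_of_real r * phi p t) ^ n)"
      unfolding F_def by (rule abs_Re_le_cmod)
    also have "\<dots> \<le> r ^ n"
      using norm_rphi[OF r(1), of t] by (simp add: norm_mult norm_power power_mono del: norm_of_real)
    finally show ?thesis .
  qed
  have F_sums: "(\<lambda>n. F n t) sums Re (cis (real_of_int x * t) / (1 - complex_of_real r * phi p t))" for t
  proof -
    have "norm (complex_of_real r * phi p t) < 1" using norm_rphi[OF r(1), of t] r(2) by simp
    from sums_mult[OF geometric_sums[OF this], of "cis (real_of_int x * t)"]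
    show ?thesis unfolding F_def by (intro sums_Re) simp
  qed
  have "(\<lambda>n. LBINT t:{0..pi}. F n t) sums (LBINT t:{0..pi}. (\<Sum>n. F n t))"
    unfolding set_lebesgue_integral_def
  proof -
    have sm: "summable (\<lambda>n. norm (F n t))" for t
      by (rule summable_comparison_test'[where g="\<lambda>n. r ^ n" and N=0]) (use F_le r in \<open>auto simp: summable_geometric\<close>)
    have "(\<lambda>n. \<integral>t. indicator {0..pi} t *\<^sub>R F n t \<partial>lborel) sums (\<integral>t. (\<Sum>n. indicator {0..pi} t *\<^sub>R F n t) \<partial>lborel)"
    proof (rule sums_integral)
      show "integrable lborel (\<lambda>t. indicator {0..pi} t *\<^sub>R F n t)" for n
        using F_int by (simp add: set_integrable_def)
      show "AE t in lborel. summable (\<lambda>n. norm (indicator {0..pi} t *\<^sub>R F n t))"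
        using sm by (intro AE_I2) (auto simp: indicator_def)
      show "summable (\<lambda>n. \<integral>t. norm (indicator {0..pi} t *\<^sub>R F n t) \<partial>lborel)"
      proof (rule summable_comparison_test'[where g="\<lambda>n. r ^ n * pi" and N=0])
        show "summable (\<lambda>n. r ^ n * pi)" using r by (intro summable_mult2) (auto simp: summable_geometric)
        fix n
        have "integrable lborel (\<lambda>t. indicat_real {0..pi} t *\<^sub>R r ^ n)"
          by (intro integrable_scaleR_left integrable_real_indicator) auto
        then have "(\<integral>t. norm (indicator {0..pi} t *\<^sub>R F n t) \<partial>lborel) \<le> (\<integral>t. indicator {0..pi} t *\<^sub>R r ^ n \<partial>lborel)"
          using F_int F_le by (intro integral_mono) (auto simp: set_integrable_def indicator_def)
        also have "\<dots> = r ^ n * pi" by simp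
        finally show "norm (\<integral>t. norm (indicator {0..pi} t *\<^sub>R F n t) \<partial>lborel) \<le> r ^ n * pi"
          by (simp add: integral_nonneg_AE)
      qed
    qed
    moreover have "(\<Sum>n. indicator {0..pi} t *\<^sub>R F n t) = indicator {0..pi} t *\<^sub>R (\<Sum>n. F n t)" for t
      using summable_rabs_cancel[of "\<lambda>n. F n t"] sm[of t] by (simp add: suminf_mult)
    ultimately show "(\<lambda>n. \<integral>t. indicator {0..pi} t *\<^sub>R F n t \<partial>lborel) sums (\<integral>t. indicator {0..pi} t *\<^sub>R (\<Sum>n. F n t) \<partial>lborel)"
      by simp
  qed
  then have "(\<lambda>n. (LBINT t:{0..pi}. F n t) / pi) sums ((LBINT t:{0..pi}. (\<Sum>n. F n t)) / pi)"
    by (rule sums_divide)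
  moreover have "(LBINT t:{0..pi}. F n t) / pi = r ^ n * pn p n x" for n
  proof -
    have "F n t = r ^ n * Re (cis (real_of_int x * t) * phi p t ^ n)" for t
      by (simp add: F_def power_mult_distrib algebra_simps flip: of_real_power)
    then show ?thesis by (simp add: pn_fourier del: times_complex.sel)
  qed
  moreover have "(\<Sum>n. F n t) = Re (cis (real_of_int x * t) / (1 - complex_of_real r * phi p t))" for t
    using F_sums sums_unique by metis
  ultimately show ?thesis by (simp add: sums_iff)
qed

text \<open>With only a first moment, the remainder of the first-order expansion is t/2 times the
  mean of min(4|z|, t z^2), and dominated convergence sends this mean to 0. The linear term is
  absent since the mean is zero.\<close>

lemma norm_1_minus_phi_small:
  assumes "\<eta> > 0"
  obtains \<delta> where "\<delta> > 0" "\<And>t. 0 \<le> t \<Longrightarrow> t \<le> \<delta> \<Longrightarrow> norm (1 - phi p t) \<le> \<eta> * t"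
proof -
  interpret rd: real_distribution "distr (measure_pmf p) borel real_of_int"
    by (rule prob_space.real_distribution_distr[OF measure_pmf.prob_space_axioms]) simp
  define G where "G t = measure_pmf.expectation p (\<lambda>z. min (4 * \<bar>real_of_int z\<bar>) (\<bar>t\<bar> * \<bar>real_of_int z\<bar>\<^sup>2))" for t :: real
  have bound: "norm (1 - phi p t) \<le> \<bar>t\<bar> / 2 * G t" for t
  proof -
    have "k \<le> 1 \<Longrightarrow> integrable (distr (measure_pmf p) borel real_of_int) (\<lambda>x. x ^ k)" for k
      by (cases k) (auto simp: integrable_distr_eq int_p)
    from rd.char_approx2[of 1 t, OF this]
    have "norm (phi p t - 1) \<le> \<bar>t\<bar> / 2 * G t"
      by (simp add: phi_eq_char integral_distr mean_p G_def power2_eq_square)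
    then show ?thesis by (simp add: norm_minus_commute)
  qed
  have G_int: "integrable (measure_pmf p) (\<lambda>z. min (4 * \<bar>real_of_int z\<bar>) (\<bar>t\<bar> * \<bar>real_of_int z\<bar>\<^sup>2))" for t
    by (rule Bochner_Integration.integrable_bound[where f="\<lambda>z. 4 * \<bar>real_of_int z\<bar>"]) (use int_p in auto)
  have "(\<lambda>n. G (1 / real (Suc n))) \<longlonglongrightarrow> measure_pmf.expectation p (\<lambda>z. 0)"
    unfolding G_def
  proof (rule integral_dominated_convergence[where w="\<lambda>z. 4 * \<bar>real_of_int z\<bar>"])
    show "AE z in measure_pmf p. (\<lambda>n. min (4 * \<bar>real_of_int z\<bar>) (\<bar>1 / real (Suc n)\<bar> * \<bar>real_of_int z\<bar>\<^sup>2)) \<longlonglongrightarrow> 0"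
    proof (rule AE_I2)
      fix z
      have "(\<lambda>n. min (4 * \<bar>real_of_int z\<bar>) (\<bar>1 / real (Suc n)\<bar> * \<bar>real_of_int z\<bar>\<^sup>2))
         \<longlonglongrightarrow> min (4 * \<bar>real_of_int z\<bar>) (\<bar>0\<bar> * \<bar>real_of_int z\<bar>\<^sup>2)"
        using LIMSEQ_inverse_real_of_nat unfolding inverse_eq_divide
        by (intro tendsto_min tendsto_mult tendsto_rabs tendsto_const)
      then show "(\<lambda>n. min (4 * \<bar>real_of_int z\<bar>) (\<bar>1 / real (Suc n)\<bar> * \<bar>real_of_int z\<bar>\<^sup>2)) \<longlonglongrightarrow> 0"
        by simp
    qed
  qed (use int_p in auto)
  then have "(\<lambda>n. G (1 / real (Suc n))) \<longlonglongrightarrow> 0" by simp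
  then have "eventually (\<lambda>n. G (1 / real (Suc n)) < 2 * \<eta>) sequentially"
    by (rule order_tendstoD) (use assms in simp)
  then obtain n where n: "G (1 / real (Suc n)) < 2 * \<eta>"
    by (auto simp: eventually_sequentially)
  show ?thesis
  proof (rule that[of "1 / real (Suc n)"])
    fix t :: real assume t: "0 \<le> t" "t \<le> 1 / real (Suc n)"
    have "G t \<le> G (1 / real (Suc n))"
      unfolding G_def using t
      by (intro integral_mono G_int min.mono order_refl mult_right_mono) auto
    then have "t / 2 * G t \<le> t / 2 * (2 * \<eta>)" using n t by (intro mult_left_mono) auto
    then show "norm (1 - phi p t) \<le> \<eta> * t" using bound[of t] t by (simp add: mult.commute)
  qed simp
qed

section \<open>Recurrence and subadditivity\<close>

text \<open>Each visit to 0 before time n feeds 1 into the mean of \<open>pot\<close>, by the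
  Poisson equation.\<close>

lemma taboo_empty_pot: "taboo p {} n pot x = pot x + (\<Sum>k<n. pn p k x)"
proof (induction n arbitrary: x)
  case (Suc n)
  have "taboo p {} (Suc n) pot x = step p (\<lambda>y. pot y + (\<Sum>k<n. pn p k y)) x"
    unfolding taboo_empty_Suc using Suc by presburger
  also have "\<dots> = step p pot x + step p (\<lambda>y. \<Sum>k<n. pn p k y) x"
    by (rule step_add) (auto intro: integrable_pot integrable_pn)
  also have "step p (\<lambda>y. \<Sum>k<n. pn p k y) x = (\<Sum>k<n. pn p (Suc k) x)"
    unfolding step_def pn_Suc by (rule Bochner_Integration.integral_sum) (rule integrable_pn)
  finally show ?case
    by (simp add: step_pot sum.lessThan_Suc_shift pn_0 del: sum.lessThan_Suc)
qed simp

text \<open>A bound on \<open>pot\<close> would bound the Green function at 0 through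
  \<open>taboo_empty_pot\<close>. The resolvent contradicts this as in the Chung-Fuchs criterion,
  since 1 - phi is small compared with t.\<close>

lemma pot_unbounded: "\<exists>x. pot x > K"
proof (rule ccontr)
  assume "\<not> (\<exists>x. pot x > K)"
  then have le: "pot x \<le> K" for x by (auto simp: not_less)
  have K: "0 \<le> K" using le[of 0] by simp
  have part: "(\<Sum>k<n. pn p k 0) \<le> K" for n
    using abs_taboo_le[of pot K p "{}" n 0] le pot_nonneg by (simp add: taboo_empty_pot)
  have res_le: "(\<Sum>n. r ^ n * pn p n 0) \<le> K" if r: "0 \<le> r" "r < 1" for r
  proof (rule suminf_le_const[OF summable_power_pn[OF r]])
    fix n
    have "(\<Sum>k<n. r ^ k * pn p k 0) \<le> (\<Sum>k<n. pn p k 0)"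
      using r pn_nonneg by (intro sum_mono) (simp add: mult_left_le_one_le power_le_one)
    then show "(\<Sum>k<n. r ^ k * pn p k 0) \<le> K" using part[of n] by linarith
  qed
  \<comment> \<open>Chosen so that 1/(4\<eta>) = 2 pi (K + 1), which exceeds the final upper bound
    pi K.\<close>
  define \<eta> where "\<eta> = 1 / (8 * pi * (K + 1))"
  have \<eta>: "\<eta> > 0" using K by (simp add: \<eta>_def)
  obtain \<delta> where \<delta>: "\<delta> > 0" "\<And>t. 0 \<le> t \<Longrightarrow> t \<le> \<delta> \<Longrightarrow> norm (1 - phi p t) \<le> \<eta> * t"
    using norm_1_minus_phi_small[OF \<eta>] by blast
  \<comment> \<open>With r = 1 - s, on [0, s/\<eta>] the denominator has modulus at most 2s and real
    part at least s, so its reciprocal has real part at least 1/(4s). The integral over this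
    interval is then at least 1/(4\<eta>).\<close>
  define s where "s = min (1/2) (\<eta> * min \<delta> pi)"
  have "s \<le> \<eta> * min \<delta> pi" by (simp add: s_def)
  then have "s / \<eta> \<le> min \<delta> pi" using \<eta> by (simp add: pos_divide_le_eq mult.commute del: min_less_iff_conj min.bounded_iff)
  then have s: "0 < s" "s < 1" "s / \<eta> \<le> \<delta>" "s / \<eta> \<le> pi"
    using \<eta> \<delta>(1) by (auto simp: s_def)
  let ?r = "1 - s"
  let ?w = "\<lambda>t. 1 - complex_of_real ?r * phi p t"
  have r: "0 \<le> ?r" "?r < 1" using s by auto
  have Re_w: "s \<le> Re (?w t)" for t
  proof -
    have "Re (complex_of_real ?r * phi p t) \<le> norm (complex_of_real ?r * phi p t)"
      by (rule complex_Re_le_cmod)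
    also have "\<dots> \<le> ?r" by (rule norm_rphi[OF r(1)])
    finally show ?thesis by simp
  qed
  have Re_inv: "Re (1 / ?w t) = Re (?w t) / (norm (?w t))\<^sup>2" for t
    by (simp add: Re_divide cmod_power2)
  have low: "indicator {0..s / \<eta>} t * (1 / (4 * s)) \<le> Re (1 / ?w t)" for t
  proof (cases "t \<in> {0..s / \<eta>}")
    case True
    have "?w t = complex_of_real s + complex_of_real ?r * (1 - phi p t)"
      by (simp add: algebra_simps)
    then have "norm (?w t) \<le> norm (complex_of_real s) + norm (complex_of_real ?r * (1 - phi p t))"
      by (metis norm_triangle_ineq)
    also have "norm (complex_of_real ?r * (1 - phi p t)) \<le> 1 * (\<eta> * t)"
      unfolding norm_mult norm_of_real using True s \<delta>(2)[of t] by (intro mult_mono) auto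
    also have "\<eta> * t \<le> s" using True \<eta> by (simp add: field_simps)
    finally have nw: "norm (?w t) \<le> 2 * s" using s by simp
    have "0 < norm (?w t)" using Re_w[of t] s complex_Re_le_cmod[of "?w t"] by linarith
    then have "s / (2 * s)\<^sup>2 \<le> Re (?w t) / (norm (?w t))\<^sup>2"
      using Re_w[of t] s nw by (intro frac_le power_mono) auto
    then show ?thesis using True s unfolding Re_inv by (simp add: power2_eq_square)
  next
    case False
    then show ?thesis using Re_w[of t] s unfolding Re_inv by simp
  qed
  have "1 / (4 * \<eta>) = (\<integral>t. indicator {0..s / \<eta>} t * (1 / (4 * s)) \<partial>lborel)"
    using s \<eta> by simp
  also have "\<dots> \<le> (LBINT t:{0..pi}. Re (1 / ?w t))"
    unfolding set_lebesgue_integral_def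
  proof (rule integral_mono)
    show "integrable lborel (\<lambda>t. indicat_real {0..pi} t *\<^sub>R Re (1 / ?w t))"
      using borel_integrable_atLeastAtMost'[OF continuous_on_Re[OF continuous_on_resolvent[OF r]]]
      by (simp add: set_integrable_def)
    show "indicator {0..s / \<eta>} t * (1 / (4 * s)) \<le> indicat_real {0..pi} t *\<^sub>R Re (1 / ?w t)" for t
      using low[of t] s(4) by (auto simp: indicator_def split: if_splits)
  qed (use s \<eta> in simp)
  also have "(LBINT t:{0..pi}. Re (1 / ?w t)) = pi * (\<Sum>n. ?r ^ n * pn p n 0)"
    using resolvent_fourier[OF r, of 0] by simp
  also have "\<dots> \<le> pi * K" using res_le[OF r] by (intro mult_left_mono) auto
  finally have "2 * pi * (K + 1) \<le> pi * K" by (simp add: \<eta>_def)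
  then have "K * pi + pi * 2 \<le> 0" by (simp add: algebra_simps)
  with mult_nonneg_nonneg[OF K pi_ge_zero] pi_gt_zero show False by linarith
qed

lemma taboo_mono:
  assumes "\<And>z. f z \<le> g z" "\<And>z. \<bar>f z\<bar> \<le> K" "\<And>z. \<bar>g z\<bar> \<le> K"
  shows "taboo p C n f x \<le> taboo p C n g x"
proof (induction n arbitrary: x)
  case (Suc n)
  have i: "integrable (measure_pmf p) (\<lambda>z. kill C (taboo p C n h) (x + z))" if "\<And>z. \<bar>h z\<bar> \<le> K" for h
    using abs_taboo_le[of h K p C n] that
    by (intro integrable_bounded_pmf[where K=K]) (meson abs_kill_le order_trans)
  show ?case
    unfolding taboo_Suc by (rule step_mono) (use Suc i assms in \<open>auto simp: kill_def\<close>)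
qed (use assms in simp)

text \<open>The non-return probability \<open>e\<close> gives a harmonic function \<open>e 1\<^bsub>x \<noteq> 0\<^esub> - e(0) a\<close>,
  which is constant; as \<open>a\<close> is unbounded, \<open>e\<close> vanishes.\<close>

lemma recurrence: "(\<lambda>n. taboo p {0} n (\<lambda>_. 1) x) \<longlonglongrightarrow> 0"
proof -
  define E where "E n x = taboo p {0} n (\<lambda>_. 1) x" for n x
  have E_abs: "\<bar>E n x\<bar> \<le> 1" for n x
    unfolding E_def by (rule abs_taboo_le) simp
  have E_nonneg: "0 \<le> E n x" for n x
    unfolding E_def by (induction n arbitrary: x) (auto simp: taboo_Suc kill_def intro: step_nonneg)
  have E_dec: "E (Suc n) x \<le> E n x" for n x
    unfolding E_def taboo_Suc'
  proof (rule taboo_mono[where K=1])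
    show "\<bar>step p (kill {0} (\<lambda>_. 1)) z\<bar> \<le> 1" for z
      by (rule abs_step_le) (simp add: kill_def)
    then show "step p (kill {0} (\<lambda>_. 1)) z \<le> 1" for z by (simp add: abs_le_iff)
  qed simp
  have "decseq (\<lambda>n. E n x)" for x using E_dec by (simp add: decseq_Suc_iff)
  then have "convergent (\<lambda>n. E n x)" for x
    using E_abs by (intro Bseq_monoseq_convergent) (auto intro!: BseqI'[where K=1] simp: monoseq_iff)
  then obtain e where e: "\<And>x. (\<lambda>n. E n x) \<longlonglongrightarrow> e x" unfolding convergent_def by metis
  have e_nonneg: "0 \<le> e x" for x by (rule LIMSEQ_le_const[OF e]) (use E_nonneg in auto)
  have e_le: "e x \<le> 1" for x
    by (rule LIMSEQ_le_const2[OF e]) (use E_abs in \<open>auto simp: abs_le_iff\<close>)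
  define f where "f = kill {0} e"
  have f_abs: "\<bar>f x\<bar> \<le> 1" for x using e_nonneg e_le by (simp add: f_def kill_def)
  have step_f: "step p f x = e x" for x
  proof (rule LIMSEQ_unique)
    show "(\<lambda>n. step p (kill {0} (E n)) x) \<longlonglongrightarrow> step p f x"
      unfolding step_def
      by (rule integral_dominated_convergence[where w="\<lambda>_. 1"])
         (use E_abs e in \<open>auto simp: f_def kill_def\<close>)
    have "(\<lambda>n. E (Suc n) x) \<longlonglongrightarrow> e x" using e by (rule LIMSEQ_Suc)
    then show "(\<lambda>n. step p (kill {0} (E n)) x) \<longlonglongrightarrow> e x"
      by (simp add: E_def[abs_def] taboo_Suc)
  qed
  obtain C where C: "\<And>x. \<bar>pot (x + 1) - pot x\<bar> \<le> C" using potential_like_pot unfolding potential_like_def by blast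
  have harm: "f x - e 0 * pot x = f 0 - e 0 * pot 0" for x
  proof (rule liouville[of "\<lambda>x. f x - e 0 * pot x"])
    show "\<bar>f (x + 1) - e 0 * pot (x + 1) - (f x - e 0 * pot x)\<bar> \<le> 2 + \<bar>e 0\<bar> * C" for x
    proof -
      have "\<bar>e 0 * (pot (x + 1) - pot x)\<bar> \<le> \<bar>e 0\<bar> * C"
        unfolding abs_mult by (intro mult_left_mono C) simp
      then show ?thesis using f_abs[of x] f_abs[of "x + 1"] by (simp add: right_diff_distrib)
    qed
    show "sublinear (\<lambda>x. f x - e 0 * pot x)"
      by (intro sublinear_diff sublinear_cmult sublinear_pot bounded_sublinear[OF f_abs])
    show "step p (\<lambda>x. f x - e 0 * pot x) x = f x - e 0 * pot x" for x
    proof -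
      have "step p (\<lambda>x. f x - e 0 * pot x) x = step p f x - step p (\<lambda>x. e 0 * pot x) x"
        by (rule step_diff) (intro integrable_bounded_pmf[OF f_abs] integrable_mult_right integrable_pot)+
      also have "\<dots> = e x - e 0 * (pot x + indicator {0} x)"
        unfolding step_cmult by (simp only: step_f step_pot)
      finally show ?thesis by (simp add: f_def kill_def)
    qed
  qed
  then have f_eq: "f x = e 0 * pot x" for x by (simp add: f_def kill_def algebra_simps)
  have "e 0 = 0"
  proof (rule ccontr)
    assume "e 0 \<noteq> 0"
    then have pos: "e 0 > 0" using e_nonneg[of 0] by simp
    obtain x where "pot x > 1 / e 0" using pot_unbounded by blast
    then have "e 0 * pot x > 1" using pos by (simp add: field_simps)
    then show False using f_abs[of x] f_eq[of x] by simp
  qed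
  then have "e x = 0" using step_f[of x] f_eq by (simp add: step_def)
  then show ?thesis using e[of x] by (simp add: E_def)
qed

text \<open>Iterating the inequality n times bounds \<open>e\<close> by K times the probability of
  avoiding 0 up to time n, which recurrence sends to 0. It is the uniqueness principle for bounded
  solutions.\<close>

lemma recurrent_zero:
  assumes bdd: "\<And>x. e x \<le> K" and sub: "\<And>x. e x \<le> step p (kill {0} e) x" and nonneg: "\<And>x. 0 \<le> e x"
  shows "e x = 0"
proof -
  have K: "0 \<le> K" using bdd[of 0] nonneg[of 0] by linarith
  have le: "e x \<le> K * taboo p {0} n (\<lambda>_. 1) x" for n x
  proof (induction n arbitrary: x)
    case (Suc n)
    have T: "\<bar>taboo p {0} n (\<lambda>_. 1) y\<bar> \<le> 1" for y by (rule abs_taboo_le) simp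
    have "e x \<le> step p (kill {0} e) x" by (rule sub)
    also have "\<dots> \<le> step p (\<lambda>y. K * kill {0} (taboo p {0} n (\<lambda>_. 1)) y) x"
    proof (rule step_mono)
      show "integrable (measure_pmf p) (\<lambda>z. kill {0} e (x + z))"
        by (rule integrable_bounded_pmf[where K=K]) (use bdd nonneg K in \<open>auto simp: kill_def\<close>)
      show "integrable (measure_pmf p) (\<lambda>z. K * kill {0} (taboo p {0} n (\<lambda>_. 1)) (x + z))"
        by (intro integrable_mult_right integrable_bounded_pmf[where K=1]) (use T in \<open>auto simp: kill_def\<close>)
    qed (use Suc in \<open>auto simp: kill_def\<close>)
    finally show ?case by (simp add: step_cmult taboo_Suc)
  qed (use bdd in simp)
  have "(\<lambda>n. K * taboo p {0} n (\<lambda>_. 1) x) \<longlonglongrightarrow> K * 0"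
    by (intro tendsto_mult tendsto_const recurrence)
  then have "e x \<le> K * 0"
    by (rule LIMSEQ_le_const) (use le in auto)
  then show ?thesis using nonneg[of x] by simp
qed

lemma pot_lipschitz: "\<exists>C. \<forall>x k. \<bar>pot (x + k) - pot x\<bar> \<le> C * \<bar>real_of_int k\<bar>"
  using potential_like_pot unfolding potential_like_def by (meson lipschitz_int_bound)

text \<open>The defect \<open>d\<close> is bounded because \<open>pot\<close> is Lipschitz, vanishes
  at 0, and is subharmonic elsewhere: the source of the shifted potential at -y only adds to it.
  Hence \<open>recurrent_zero\<close> removes its positive part.\<close>

lemma pot_subadditive: "pot (x + y) \<le> pot x + pot y"
proof -
  obtain C where C: "\<And>x k. \<bar>pot (x + k) - pot x\<bar> \<le> C * \<bar>real_of_int k\<bar>"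
    using pot_lipschitz by blast
  define d where "d x = pot (x + y) - pot x - pot y" for x
  define e where "e x = max (d x) 0" for x
  have d_le: "\<bar>d x\<bar> \<le> C * \<bar>real_of_int y\<bar> + pot y" for x
    using C[of x y] pot_nonneg[of y] unfolding d_def by linarith
  have e_abs: "\<bar>e x\<bar> \<le> C * \<bar>real_of_int y\<bar> + pot y" for x
    using d_le[of x] by (auto simp: e_def)
  have int_y: "integrable (measure_pmf p) (\<lambda>z. pot (u + z + y))" for u
    using integrable_pot[of "u + y"] by (simp add: ac_simps)
  have step_d: "step p d u = d u + indicator {0} (u + y) - indicator {0} u" for u
  proof -
    have "step p d u = step p (\<lambda>x. pot (x + y) - pot x) u - step p (\<lambda>_. pot y) u"
      unfolding d_def[abs_def] by (rule step_diff) (auto intro!: Bochner_Integration.integrable_diff integrable_pot int_y)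
    also have "step p (\<lambda>x. pot (x + y) - pot x) u = step p (\<lambda>x. pot (x + y)) u - step p pot u"
      by (rule step_diff) (auto intro: integrable_pot int_y)
    finally show ?thesis by (simp add: step_shift step_pot d_def[abs_def])
  qed
  have "e x = 0" for x
  proof (rule recurrent_zero[where K="C * \<bar>real_of_int y\<bar> + pot y"])
    show "e x \<le> C * \<bar>real_of_int y\<bar> + pot y" for x using e_abs[of x] by linarith
    show "0 \<le> e x" for x by (simp add: e_def)
    have k: "kill {0} e = e" by (simp add: kill_def e_def d_def fun_eq_iff)
    fix x
    show "e x \<le> step p (kill {0} e) x"
      unfolding k
    proof (cases "x = 0")
      case True
      then have "e x = 0" by (simp add: e_def d_def)
      then show "e x \<le> step p e x" using step_nonneg[of e x p] by (simp add: e_def)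
    next
      case False
      then have "d x \<le> step p d x" by (simp add: step_d)
      also have "\<dots> \<le> step p e x"
        by (rule step_mono) (auto simp: e_def[abs_def] intro!: integrable_bounded_pmf[OF d_le] integrable_bounded_pmf[OF e_abs[unfolded e_def]])
      finally have "d x \<le> step p e x" .
      moreover have "0 \<le> step p e x" by (rule step_nonneg) (simp add: e_def)
      ultimately show "e x \<le> step p e x" by (simp add: e_def)
    qed
  qed
  from this[of x] show ?thesis by (simp add: e_def d_def max_def split: if_splits)
qed

end

section \<open>Hitting probabilities\<close>

lemma step_sum:
  assumes "\<And>i. i \<in> I \<Longrightarrow> integrable (measure_pmf p) (\<lambda>z. f i (x + z))"
  shows "step p (\<lambda>y. \<Sum>i\<in>I. f i y) x = (\<Sum>i\<in>I. step p (f i) x)"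
  unfolding step_def using assms by (rule Bochner_Integration.integral_sum)

text \<open>Boundary values 1 on \<open>A\<close> and 0 on \<open>B\<close>, applied after a step.
  The starting point itself is never tested, as hitting times begin at 1.\<close>

definition one_step :: "int set \<Rightarrow> int set \<Rightarrow> (int \<Rightarrow> real) \<Rightarrow> int \<Rightarrow> real" where
  "one_step A B v y = (if y \<in> A then 1 else if y \<in> B then 0 else v y)"

definition hitN :: "int pmf \<Rightarrow> int set \<Rightarrow> int set \<Rightarrow> nat \<Rightarrow> int \<Rightarrow> real" where
  "hitN p A B N x = (\<Sum>n<N. taboo p (A \<union> B) n (step p (indicator A)) x)"

lemma taboo_hit_term_abs: "\<bar>taboo p C n (step p (indicator A)) x\<bar> \<le> 1"
  by (intro abs_taboo_le abs_step_le) (simp add: indicator_def)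

lemma taboo_nonneg:
  assumes "\<And>z. 0 \<le> f z"
  shows "0 \<le> taboo p C n f x"
  using assms by (induction n arbitrary: x) (auto simp: taboo_Suc kill_def intro: step_nonneg)

lemma hitN_Suc:
  assumes "A \<inter> B = {}"
  shows "hitN p A B (Suc N) x = step p (one_step A B (hitN p A B N)) x"
proof -
  let ?T = "\<lambda>n. taboo p (A \<union> B) n (step p (indicator A))"
  have i: "integrable (measure_pmf p) (\<lambda>z. kill (A \<union> B) (?T n) (x + z))" for n
    by (rule integrable_bounded_pmf[where K=1]) (meson abs_kill_le order_trans taboo_hit_term_abs)
  have eq: "one_step A B (hitN p A B N) y = indicator A y + (\<Sum>n<N. kill (A \<union> B) (?T n) y)" for y
    using assms by (auto simp: one_step_def hitN_def kill_def)
  have "hitN p A B (Suc N) x = step p (indicator A) x + (\<Sum>n<N. ?T (Suc n) x)"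
    by (simp add: hitN_def sum.lessThan_Suc_shift del: sum.lessThan_Suc)
  also have "(\<Sum>n<N. ?T (Suc n) x) = step p (\<lambda>y. \<Sum>n<N. kill (A \<union> B) (?T n) y) x"
    unfolding taboo_Suc by (rule step_sum[symmetric]) (rule i)
  also have "step p (indicator A) x + \<dots> = step p (\<lambda>y. indicator A y + (\<Sum>n<N. kill (A \<union> B) (?T n) y)) x"
  proof (rule step_add[symmetric])
    show "integrable (measure_pmf p) (\<lambda>z. indicator A (x + z) :: real)"
      by (rule integrable_bounded_pmf[where K=1]) (simp add: indicator_def)
  qed (intro Bochner_Integration.integrable_sum i)
  also have "\<dots> = step p (one_step A B (hitN p A B N)) x"
    unfolding eq ..
  finally show ?thesis .
qed

lemma hitN_bounds:
  assumes "A \<inter> B = {}"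
  shows "0 \<le> hitN p A B N x" "hitN p A B N x \<le> 1"
proof -
  have *: "0 \<le> hitN p A B N x \<and> hitN p A B N x \<le> 1"
  proof (induction N arbitrary: x)
    case (Suc N)
    have "\<bar>one_step A B (hitN p A B N) z\<bar> \<le> 1" for z
      using Suc[of z] by (auto simp: one_step_def)
    then have "\<bar>step p (one_step A B (hitN p A B N)) x\<bar> \<le> 1" by (rule abs_step_le)
    moreover have "0 \<le> step p (one_step A B (hitN p A B N)) x"
      by (rule step_nonneg) (use Suc in \<open>auto simp: one_step_def\<close>)
    ultimately show ?case using hitN_Suc[OF assms] by simp
  qed (simp add: hitN_def)
  then show "0 \<le> hitN p A B N x" "hitN p A B N x \<le> 1" by auto
qed

lemma hitN_tendsto:
  assumes "A \<inter> B = {}"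
  shows "(\<lambda>N. hitN p A B N x) \<longlonglongrightarrow> hit p A B x"
proof -
  have "summable (\<lambda>n. taboo p (A \<union> B) n (step p (indicator A)) x)"
  proof (rule summableI_nonneg_bounded[where x=1])
    show "0 \<le> taboo p (A \<union> B) n (step p (indicator A)) x" for n
      by (intro taboo_nonneg step_nonneg) simp
    show "(\<Sum>n<N. taboo p (A \<union> B) n (step p (indicator A)) x) \<le> 1" for N
      using hitN_bounds(2)[OF assms, of p N x] by (simp add: hitN_def)
  qed
  from summable_LIMSEQ[OF this] show ?thesis
    by (simp add: hit_def hitN_def)
qed

lemma hit_nonneg: "A \<inter> B = {} \<Longrightarrow> 0 \<le> hit p A B x"
  by (rule LIMSEQ_le_const[OF hitN_tendsto]) (auto intro: hitN_bounds)

lemma hit_le_1: "A \<inter> B = {} \<Longrightarrow> hit p A B x \<le> 1"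
  by (rule LIMSEQ_le_const2[OF hitN_tendsto]) (auto intro: hitN_bounds)

lemma abs_one_step_hit: "A \<inter> B = {} \<Longrightarrow> \<bar>one_step A B (hit p A B) y\<bar> \<le> 1"
  by (auto simp: one_step_def hit_nonneg hit_le_1)

lemma hit_eq:
  assumes "A \<inter> B = {}"
  shows "hit p A B x = step p (one_step A B (hit p A B)) x"
proof (rule LIMSEQ_unique)
  show "(\<lambda>N. hitN p A B (Suc N) x) \<longlonglongrightarrow> hit p A B x"
    using hitN_tendsto[OF assms] by (rule LIMSEQ_Suc)
  have "(\<lambda>N. step p (one_step A B (hitN p A B N)) x) \<longlonglongrightarrow> step p (one_step A B (hit p A B)) x"
    unfolding step_def
    by (rule integral_dominated_convergence[where w="\<lambda>_. 1"])
       (use hitN_bounds[OF assms] hitN_tendsto[OF assms] in \<open>auto simp: one_step_def\<close>)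
  then show "(\<lambda>N. hitN p A B (Suc N) x) \<longlonglongrightarrow> step p (one_step A B (hit p A B)) x"
    by (simp add: hitN_Suc[OF assms])
qed

text \<open>The substitute for optional stopping: by induction on N, a nonnegative supersolution
  dominates the probability of success within N steps.\<close>

lemma hit_least:
  assumes AB: "A \<inter> B = {}"
    and super: "\<And>x. step p (one_step A B v) x \<le> v x"
    and nonneg: "\<And>x. 0 \<le> v x"
    and int: "\<And>x. integrable (measure_pmf p) (\<lambda>z. one_step A B v (x + z))"
  shows "hit p A B x \<le> v x"
proof -
  have "hitN p A B N x \<le> v x" for N
  proof (induction N arbitrary: x)
    case (Suc N)
    have "step p (one_step A B (hitN p A B N)) x \<le> step p (one_step A B v) x"
    proof (rule step_mono[OF _ _ int])
      show "integrable (measure_pmf p) (\<lambda>z. one_step A B (hitN p A B N) (x + z))"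
        by (rule integrable_bounded_pmf[where K=1])
           (use hitN_bounds[OF AB] in \<open>auto simp: one_step_def\<close>)
    qed (use Suc in \<open>auto simp: one_step_def\<close>)
    also have "\<dots> \<le> v x" by (rule super)
    finally show ?case by (simp add: hitN_Suc[OF AB])
  qed (simp add: hitN_def nonneg)
  then show ?thesis by (intro LIMSEQ_le_const2[OF hitN_tendsto[OF AB]]) auto
qed

text \<open>The function of the larger target is at most 1, so it is a supersolution for the smaller
  target.\<close>

lemma hit_mono:
  assumes "A \<subseteq> A'" "A' \<inter> B = {}"
  shows "hit p A B x \<le> hit p A' B x"
proof (rule hit_least)
  have i: "integrable (measure_pmf p) (\<lambda>z. one_step S B (hit p A' B) (x + z))" for S x
    by (rule integrable_bounded_pmf[where K=1])
       (use hit_nonneg[OF assms(2)] hit_le_1[OF assms(2)] in \<open>auto simp: one_step_def\<close>)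
  then show "integrable (measure_pmf p) (\<lambda>z. one_step A B (hit p A' B) (x + z))" for x .
  fix x
  have "step p (one_step A B (hit p A' B)) x \<le> step p (one_step A' B (hit p A' B)) x"
    by (rule step_mono[OF _ i i]) (use assms hit_le_1[OF assms(2)] in \<open>auto simp: one_step_def\<close>)
  then show "step p (one_step A B (hit p A' B)) x \<le> hit p A' B x"
    using hit_eq[OF assms(2)] by simp
qed (use assms hit_nonneg in auto)

section \<open>Hitting a point before the origin in terms of the potential\<close>

context zwalk
begin

definition adag :: "int \<Rightarrow> real" where
  "adag x = (if x = 0 then 1 else 0) + pot x"

lemma step_pot_adag: "step p pot x = adag x"
  by (simp add: step_pot adag_def)

lemma adag_nonneg: "0 \<le> adag x"
  using pot_nonneg[of x] by (simp add: adag_def)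

text \<open>\<open>pot\<close> is at least \<kappa> on \<open>A\<close> and its step is
  \<open>adag\<close>, so \<open>adag\<close> divided by \<kappa> is a supersolution for the target
  \<open>A\<close>.\<close>

lemma adag_ge_hit:
  assumes "0 \<notin> A" "\<And>y. y \<in> A \<Longrightarrow> \<kappa> \<le> pot y" "0 \<le> \<kappa>"
  shows "\<kappa> * hit p A {0} x \<le> adag x"
proof (cases "\<kappa> = 0")
  case False
  then have \<kappa>: "\<kappa> > 0" using assms by simp
  have le: "one_step A {0} (\<lambda>x. adag x / \<kappa>) y \<le> 1 / \<kappa> * pot y" for y
    using assms(2)[of y] assms(1) \<kappa> pot_nonneg[of y] by (auto simp: one_step_def adag_def divide_simps)
  have "hit p A {0} x \<le> adag x / \<kappa>"
  proof (rule hit_least)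
    have pot_i: "integrable (measure_pmf p) (\<lambda>z. 1 / \<kappa> * pot (x + z))" for x
      by (intro integrable_mult_right integrable_pot)
    show i: "integrable (measure_pmf p) (\<lambda>z. one_step A {0} (\<lambda>x. adag x / \<kappa>) (x + z))" for x
      by (rule Bochner_Integration.integrable_bound[OF pot_i[of x]])
         (use le \<kappa> adag_nonneg pot_nonneg in \<open>auto intro!: AE_I2 simp: abs_of_nonneg one_step_def\<close>)
    fix x
    have "step p (one_step A {0} (\<lambda>x. adag x / \<kappa>)) x \<le> step p (\<lambda>y. 1 / \<kappa> * pot y) x"
      by (rule step_mono[OF le i pot_i])
    also have "\<dots> = adag x / \<kappa>" unfolding step_cmult by (simp add: step_pot_adag)
    finally show "step p (one_step A {0} (\<lambda>x. adag x / \<kappa>)) x \<le> adag x / \<kappa>" .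
  qed (use assms(1) \<kappa> adag_nonneg in auto)
  then show ?thesis using \<kappa> by (simp add: field_simps)
qed (simp add: adag_nonneg)

definition sym_pot :: "int \<Rightarrow> real" where
  "sym_pot y = pot y + pot (- y)"

text \<open>The function \<open>f\<close> is bounded, equals 0 at 0 and \<open>sym_pot y\<close> at
  \<open>y\<close>, and its step is \<open>F\<close>, the same expression with daggers. So
  \<open>F\<close> and the multiple of the hitting probability solve the same one-step equation with
  the same boundary values, and recurrence makes bounded solutions unique.\<close>

lemma hit_formula:
  assumes y: "y \<noteq> 0"
  shows "sym_pot y * hit p {y} {0} x = adag x + pot (- y) - adag (x - y)"
proof -
  define f where "f x = pot x + pot (- y) - pot (x - y)" for x
  define F where "F x = adag x + pot (- y) - adag (x - y)" for x
  obtain C where C: "\<And>x k. \<bar>pot (x + k) - pot x\<bar> \<le> C * \<bar>real_of_int k\<bar>"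
    using pot_lipschitz by blast
  have f_abs: "\<bar>f x\<bar> \<le> C * \<bar>real_of_int y\<bar> + pot (- y)" for x
    using C[of "x - y" y] pot_nonneg[of "- y"] by (simp add: f_def abs_le_iff)
  have F_abs: "\<bar>F x\<bar> \<le> C * \<bar>real_of_int y\<bar> + pot (- y) + 1" for x
    using f_abs[of x] y by (auto simp: f_def F_def adag_def)
  have int_sh: "integrable (measure_pmf p) (\<lambda>z. pot (u + z - y))" for u
    using integrable_pot[of "u - y"] by (simp add: algebra_simps)
  have step_f: "step p f x = F x" for x
  proof -
    have "step p f x = step p (\<lambda>x. pot x + pot (- y)) x - step p (\<lambda>x. pot (x - y)) x"
      unfolding f_def[abs_def] by (rule step_diff) (auto intro!: Bochner_Integration.integrable_add integrable_pot int_sh)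
    also have "step p (\<lambda>x. pot x + pot (- y)) x = step p pot x + step p (\<lambda>_. pot (- y)) x"
      by (rule step_add) (auto intro: integrable_pot)
    also have "step p (\<lambda>x. pot (x - y)) x = step p pot (x - y)"
      using step_shift[of p pot "- y" x] by simp
    finally show ?thesis by (simp add: step_pot_adag F_def)
  qed
  let ?h = "hit p {y} {0}"
  have disj: "{y} \<inter> {0} = {}" using y by simp
  define d where "d x = F x - sym_pot y * ?h x" for x
  define B where "B = C * \<bar>real_of_int y\<bar> + pot (- y) + 1 + \<bar>sym_pot y\<bar>"
  have d_abs: "\<bar>d x\<bar> \<le> B" for x
  proof -
    have "\<bar>sym_pot y * ?h x\<bar> \<le> \<bar>sym_pot y\<bar> * 1"
      unfolding abs_mult using hit_nonneg[OF disj] hit_le_1[OF disj] by (intro mult_left_mono) auto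
    then show ?thesis using F_abs[of x] unfolding d_def B_def by linarith
  qed
  have f_split: "f z - sym_pot y * one_step {y} {0} ?h z = kill {0, y} d z" for z
    by (auto simp: f_def one_step_def kill_def d_def F_def adag_def sym_pot_def)
  have d_eq: "d x = step p (kill {0, y} d) x" for x
  proof -
    have "d x = step p f x - step p (\<lambda>z. sym_pot y * one_step {y} {0} ?h z) x"
      unfolding d_def step_f step_cmult using hit_eq[OF disj, of p x] by simp
    also have "\<dots> = step p (\<lambda>z. f z - sym_pot y * one_step {y} {0} ?h z) x"
      by (rule step_diff[symmetric])
         (auto intro!: integrable_bounded_pmf[OF f_abs] integrable_mult_right integrable_bounded_pmf[OF abs_one_step_hit[OF disj]])
    finally show ?thesis unfolding f_split[abs_def] .
  qed
  have "\<bar>d x\<bar> = 0"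
  proof (rule recurrent_zero[of "\<lambda>x. \<bar>d x\<bar>", OF d_abs])
    fix x
    have "\<bar>d x\<bar> = \<bar>step p (kill {0, y} d) x\<bar>" by (subst d_eq) simp
    also have "\<dots> \<le> step p (\<lambda>z. \<bar>kill {0, y} d z\<bar>) x"
      unfolding step_def by (rule integral_abs_bound)
    also have "\<dots> \<le> step p (kill {0} (\<lambda>x. \<bar>d x\<bar>)) x"
    proof (rule step_mono)
      have B: "0 \<le> B" using d_abs[of 0] by linarith
      show "integrable (measure_pmf p) (\<lambda>z. \<bar>kill {0, y} d (x + z)\<bar>)"
        "integrable (measure_pmf p) (\<lambda>z. kill {0} (\<lambda>x. \<bar>d x\<bar>) (x + z))"
        by (rule integrable_bounded_pmf[where K=B], use d_abs B in \<open>simp add: kill_def\<close>)+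
    qed (simp add: kill_def)
    finally show "\<bar>d x\<bar> \<le> step p (kill {0} (\<lambda>x. \<bar>d x\<bar>)) x" .
  qed simp
  then show ?thesis by (simp add: d_def F_def)
qed

text \<open>At the starting point 0 the two potentials in \<open>hit_formula\<close> cancel and only
  the 1 of the dagger remains.\<close>

lemma sym_pot_times_return: "y \<noteq> 0 \<Longrightarrow> sym_pot y * hit p {y} {0} 0 = 1"
  using hit_formula[of y 0] by (simp add: adag_def)

lemma sym_pot_pos: "y \<noteq> 0 \<Longrightarrow> sym_pot y > 0"
  using sym_pot_times_return[of y] pot_nonneg[of y] pot_nonneg[of "- y"]
  by (metis add_nonneg_nonneg less_eq_real_def mult_zero_left sym_pot_def zero_neq_one)

lemma hit_point_eq:
  "y \<noteq> 0 \<Longrightarrow> hit p {y} {0} x = (adag x + pot (- y) - adag (x - y)) / sym_pot y"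
  using hit_formula[of y x] sym_pot_pos[of y] by (simp add: field_simps)

text \<open>Markov's inequality for the absolute value of the position, whose mean grows by at most
  E|X| per step.\<close>

lemma transition_markov_bound:
  assumes "y \<noteq> 0"
  shows "taboo p {} k (indicator {y}) x \<le>
    (\<bar>real_of_int x\<bar> + real k * measure_pmf.expectation p (\<lambda>z. \<bar>real_of_int z\<bar>)) / \<bar>real_of_int y\<bar>"
proof (induction k arbitrary: x)
  case 0
  then show ?case using assms by (simp add: indicator_def)
next
  case (Suc k)
  let ?m = "measure_pmf.expectation p (\<lambda>z. \<bar>real_of_int z\<bar>)"
  let ?g = "\<lambda>u. (\<bar>real_of_int u\<bar> + real k * ?m) / \<bar>real_of_int y\<bar>"
  have i: "integrable (measure_pmf p) (\<lambda>z. \<bar>real_of_int z\<bar>)" using int_p by simp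
  have "taboo p {} (Suc k) (indicator {y}) x \<le> step p ?g x"
    unfolding taboo_empty_Suc
  proof (rule step_mono)
    show "integrable (measure_pmf p) (\<lambda>z. taboo p {} k (indicator {y}) (x + z))"
      by (rule integrable_bounded_pmf[where K=1], rule abs_taboo_le) (simp add: indicator_def)
    show "integrable (measure_pmf p) (\<lambda>z. ?g (x + z))"
      by (intro integrable_divide_zero Bochner_Integration.integrable_add integrable_linear[where K=1 and C=0 and f="\<lambda>u. \<bar>real_of_int u\<bar>"]) auto
  qed (rule Suc)
  also have "\<dots> \<le> measure_pmf.expectation p (\<lambda>z. (\<bar>real_of_int x\<bar> + real k * ?m + \<bar>real_of_int z\<bar>) / \<bar>real_of_int y\<bar>)"
    unfolding step_def
  proof (rule integral_mono)
    show "integrable (measure_pmf p) (\<lambda>z. ?g (x + z))"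
      by (intro integrable_divide_zero Bochner_Integration.integrable_add integrable_linear[where K=1 and C=0 and f="\<lambda>u. \<bar>real_of_int u\<bar>"]) auto
  qed (use i in \<open>auto intro!: divide_right_mono\<close>)
  also have "\<dots> = (\<bar>real_of_int x\<bar> + real (Suc k) * ?m) / \<bar>real_of_int y\<bar>"
    using i by (simp add: algebra_simps)
  finally show ?case .
qed

text \<open>Either \<open>y\<close> is met within N steps, where the taboo is dropped and a union
  bound taken, or 0 is avoided for N steps.\<close>

lemma hit_point_le:
  assumes "y \<noteq> 0"
  shows "hit p {y} {0} x \<le> (\<Sum>k\<in>{1..N}. taboo p {} k (indicator {y}) x) + taboo p {0} N (\<lambda>_. 1) x"
proof (induction N arbitrary: x)
  case 0
  then show ?case using hit_le_1[of "{y}" "{0}"] assms by simp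
next
  case (Suc N)
  have disj: "{y} \<inter> {0} = {}" using assms by simp
  let ?P = "\<lambda>k. taboo p {} k (indicator {y})"
  let ?T = "taboo p {0} N (\<lambda>_. 1)"
  have P_abs: "\<bar>?P k z\<bar> \<le> 1" for k z by (rule abs_taboo_le) (simp add: indicator_def)
  have P_nonneg: "0 \<le> ?P k z" for k z by (rule taboo_nonneg) simp
  have T_abs: "\<bar>?T z\<bar> \<le> 1" for z by (rule abs_taboo_le) simp
  have kT_abs: "\<bar>kill {0} ?T z\<bar> \<le> 1" for z using T_abs[of z] by (simp add: kill_def)
  have T_nonneg: "0 \<le> ?T z" for z by (rule taboo_nonneg) simp
  have iP: "integrable (measure_pmf p) (\<lambda>z. ?P k (u + z))" for k u by (rule integrable_bounded_pmf[OF P_abs])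
  have iT: "integrable (measure_pmf p) (\<lambda>z. kill {0} ?T (u + z))" for u by (rule integrable_bounded_pmf[OF kT_abs])
  have "hit p {y} {0} x = step p (one_step {y} {0} (hit p {y} {0})) x"
    by (rule hit_eq[OF disj])
  also have "\<dots> \<le> step p (\<lambda>z. (\<Sum>k\<in>{0..N}. ?P k z) + kill {0} ?T z) x"
  proof (rule step_mono)
    show "integrable (measure_pmf p) (\<lambda>z. one_step {y} {0} (hit p {y} {0}) (x + z))"
      by (rule integrable_bounded_pmf[OF abs_one_step_hit[OF disj]])
    show "integrable (measure_pmf p) (\<lambda>z. (\<Sum>k\<in>{0..N}. ?P k (x + z)) + kill {0} ?T (x + z))"
      by (intro Bochner_Integration.integrable_add Bochner_Integration.integrable_sum iP iT)
    fix z
    have split: "(\<Sum>k\<in>{0..N}. ?P k u) = indicator {y} u + (\<Sum>k\<in>{1..N}. ?P k u)" for u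
      by (simp add: sum.atLeast_Suc_atMost)
    show "one_step {y} {0} (hit p {y} {0}) (x + z) \<le> (\<Sum>k\<in>{0..N}. ?P k (x + z)) + kill {0} ?T (x + z)"
      unfolding split using Suc[of "x + z"] P_nonneg T_nonneg assms
      by (auto simp: one_step_def kill_def intro!: sum_nonneg add_nonneg_nonneg)
  qed
  also have "\<dots> = (\<Sum>k\<in>{0..N}. step p (?P k) x) + step p (kill {0} ?T) x"
    by (subst step_add) (auto intro!: Bochner_Integration.integrable_sum iP iT simp: step_sum iP)
  also have "(\<Sum>k\<in>{0..N}. step p (?P k) x) = (\<Sum>k\<in>{1..Suc N}. ?P k x)"
    by (simp only: taboo_empty_Suc[symmetric] One_nat_def sum.atLeast_Suc_atMost_Suc_shift o_def)
  finally show ?case by (simp add: taboo_Suc)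
qed

text \<open>By \<open>sym_pot_times_return\<close> it suffices that P[sigma_y < sigma_0] from 0
  tends to 0. First N is fixed to make avoiding 0 for N steps rare, then \<open>y\<close> is taken
  too far away to be likely within N steps.\<close>

lemma sym_pot_at_infinity: "\<exists>R0. \<forall>y. \<bar>y\<bar> \<ge> R0 \<longrightarrow> sym_pot y > K"
proof -
  define \<epsilon> where "\<epsilon> = 1 / (2 * (\<bar>K\<bar> + 1))"
  have \<epsilon>: "\<epsilon> > 0" by (simp add: \<epsilon>_def add_nonneg_pos)
  let ?m = "measure_pmf.expectation p (\<lambda>z. \<bar>real_of_int z\<bar>)"
  have "eventually (\<lambda>n. taboo p {0} n (\<lambda>_. 1) 0 < \<epsilon>) sequentially"
    using recurrence \<epsilon> by (rule order_tendstoD)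
  then obtain N where N: "taboo p {0} N (\<lambda>_. 1) 0 < \<epsilon>" by (auto simp: eventually_sequentially)
  define S where "S = (\<Sum>k\<in>{1..N}. real k * ?m)"
  have "sym_pot y > K" if y: "\<bar>y\<bar> \<ge> \<lceil>S / \<epsilon>\<rceil> + 1" for y
  proof -
    have S0: "0 \<le> S" unfolding S_def by (intro sum_nonneg) auto
    have yS: "\<bar>real_of_int y\<bar> > S / \<epsilon>" using y by linarith
    then have y0: "y \<noteq> 0" using divide_nonneg_pos[OF S0 \<epsilon>] by auto
    have "hit p {y} {0} 0 \<le> (\<Sum>k\<in>{1..N}. taboo p {} k (indicator {y}) 0) + taboo p {0} N (\<lambda>_. 1) 0"
      by (rule hit_point_le[OF y0])
    also have "(\<Sum>k\<in>{1..N}. taboo p {} k (indicator {y}) 0) \<le> (\<Sum>k\<in>{1..N}. real k * ?m / \<bar>real_of_int y\<bar>)"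
      by (intro sum_mono order_trans[OF transition_markov_bound[OF y0]]) simp
    also have "\<dots> = S / \<bar>real_of_int y\<bar>" by (simp add: S_def sum_divide_distrib)
    also have "\<dots> \<le> \<epsilon>" using yS y0 \<epsilon> by (simp add: field_simps)
    finally have h: "hit p {y} {0} 0 < 2 * \<epsilon>" using N by linarith
    have "1 = sym_pot y * hit p {y} {0} 0" using sym_pot_times_return[OF y0] by simp
    also have "\<dots> < sym_pot y * (2 * \<epsilon>)" using h sym_pot_pos[OF y0] by (intro mult_strict_left_mono)
    finally have "\<bar>K\<bar> + 1 < sym_pot y" by (simp add: \<epsilon>_def field_simps)
    then show ?thesis by linarith
  qed
  then show ?thesis by blast
qed

text \<open>The pointwise bound \<open>a(x) \<ge> P\<^sup>x[\<sigma>\<^sub>y < \<sigma>\<^sub>0] a(y)\<close>, rewritten by \<open>hit_formula\<close> with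
  \<open>x = -w-R\<close> and \<open>y = -w\<close>; it makes the escape probability small uniformly in \<open>w\<close>.\<close>

lemma pot_negative_increment:
  assumes "w > 0" "R > 0" "pot w > 0"
  shows "pot (- w) + pot (- R) - pot (- w - R) \<le> pot (- R) * (1 + pot (- w) / pot w)"
proof -
  have w: "- w \<noteq> 0" using assms by simp
  have h: "sym_pot (- w) * hit p {- w} {0} (- w - R) = pot (- w - R) + pot w - pot (- R)"
    using hit_formula[OF w, of "- w - R"] assms by (simp add: adag_def)
  have "pot (- w) * hit p {- w} {0} (- w - R) \<le> adag (- w - R)"
    by (rule adag_ge_hit) (use assms pot_nonneg in auto)
  then have "pot (- w) * hit p {- w} {0} (- w - R) \<le> pot (- w - R)"
    using assms by (simp add: adag_def)
  then have "sym_pot (- w) * (pot (- w) * hit p {- w} {0} (- w - R)) \<le> sym_pot (- w) * pot (- w - R)"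
    using sym_pot_pos[OF w] by (intro mult_left_mono) auto
  then have "pot (- w) * (pot (- w - R) + pot w - pot (- R)) \<le> sym_pot (- w) * pot (- w - R)"
    unfolding h[symmetric] by (simp add: mult_ac)
  then have "pot (- w) * pot w \<le> pot w * pot (- w - R) + pot (- w) * pot (- R)"
    by (simp add: sym_pot_def algebra_simps)
  then have "(pot (- w) + pot (- R) - pot (- w - R)) * pot w \<le> (pot (- R) * (1 + pot (- w) / pot w)) * pot w"
    using assms(3) by (simp add: algebra_simps)
  then show ?thesis using assms(3) by (simp only: mult_le_cancel_right_pos)
qed

lemma exists_negative_step: "\<exists>c\<in>set_pmf p. c < 0"
proof (rule ccontr)
  assume "\<not> ?thesis"
  then have nn: "AE z in measure_pmf p. 0 \<le> real_of_int z"
    by (auto simp: AE_measure_pmf_iff not_less)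
  then have "AE z in measure_pmf p. real_of_int z = 0"
    using integral_nonneg_eq_0_iff_AE[OF int_p nn] mean_p by simp
  then have "(\<integral>\<^sup>+z. ennreal ((real_of_int z)\<^sup>2) \<partial>measure_pmf p) = (\<integral>\<^sup>+z. 0 \<partial>measure_pmf p)"
    by (intro nn_integral_cong_AE) auto
  then show False using var_p by simp
qed

lemma hit_ge_atom:
  assumes "A \<inter> B = {}"
  shows "pmf p b * one_step A B (hit p A B) (x + b) \<le> hit p A B x"
proof -
  have "pmf p b * one_step A B (hit p A B) (x + b) \<le> step p (one_step A B (hit p A B)) x"
    by (rule step_ge_atom)
       (use hit_nonneg[OF assms] in \<open>auto simp: one_step_def[abs_def] intro!: integrable_bounded_pmf[OF abs_one_step_hit[OF assms, unfolded one_step_def]]\<close>)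
  then show ?thesis using hit_eq[OF assms] by simp
qed

text \<open>Repeating one negative jump never lands on 0: the start is not counted, and all later
  points are negative.\<close>

lemma hit_left_halfline_pos:
  assumes "R > 0" "x \<le> 0"
  shows "hit p {..- R} {0} x > 0"
proof -
  obtain c where c: "c \<in> set_pmf p" "c < 0" using exists_negative_step by blast
  have pc: "pmf p c > 0" using c(1) by (rule pmf_positive)
  have disj: "{..- R} \<inter> {0} = {}" using assms by auto
  have "x \<le> 0 \<Longrightarrow> x + int (Suc n) * c \<le> - R \<Longrightarrow> hit p {..- R} {0} x > 0" for n x
  proof (induction n arbitrary: x)
    case 0
    then have "one_step {..- R} {0} (hit p {..- R} {0}) (x + c) = 1" by (simp add: one_step_def)
    then show ?case using hit_ge_atom[OF disj, of c x] pc by simp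
  next
    case (Suc n)
    have "one_step {..- R} {0} (hit p {..- R} {0}) (x + c) > 0"
    proof (cases "x + c \<le> - R")
      case False
      have "hit p {..- R} {0} (x + c) > 0"
        by (rule Suc.IH) (use Suc.prems c in \<open>auto simp: algebra_simps\<close>)
      then show ?thesis using Suc.prems(1) c(2) by (simp add: one_step_def)
    qed (simp add: one_step_def)
    then have "0 < pmf p c * one_step {..- R} {0} (hit p {..- R} {0}) (x + c)" using pc by simp
    then show ?case using hit_ge_atom[OF disj, of c x] by linarith
  qed
  moreover have "x + int (Suc (nat R)) * c \<le> - R"
  proof -
    have "int (Suc (nat R)) * c \<le> int (Suc (nat R)) * (- 1)" using c by (intro mult_left_mono) auto
    then show ?thesis using assms by simp
  qed
  ultimately show ?thesis using assms(2) by blast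
qed

lemma pot_multiple_le: "pot (int n * x) \<le> real n * pot x"
proof (induction n)
  case (Suc n)
  have "pot (int (Suc n) * x) \<le> pot (int n * x) + pot x"
    using pot_subadditive[of "int n * x" x] by (simp add: algebra_simps)
  then show ?case using Suc by (simp add: algebra_simps)
qed simp

end

section \<open>Negligible potential on the negative half-line\<close>

locale zwalk_left = zwalk +
  assumes ev_nonzero: "\<forall>\<^sub>F z in at_top. pot z \<noteq> 0"
    and ratio_limit: "((\<lambda>z. pot (- z) / pot z) \<longlongrightarrow> 0) at_top"
begin

lemma ratio_small:
  assumes "\<epsilon> > 0"
  obtains Z :: int where "Z > 0" "\<And>z. z \<ge> Z \<Longrightarrow> pot z > 0 \<and> pot (- z) \<le> \<epsilon> * pot z"
proof -
  have "\<forall>\<^sub>F z in at_top. pot (- z) / pot z < \<epsilon>"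
    using order_tendstoD(2)[OF ratio_limit assms] .
  then have "\<forall>\<^sub>F z in at_top. pot z > 0 \<and> pot (- z) \<le> \<epsilon> * pot z"
    using ev_nonzero
  proof eventually_elim
    case (elim z)
    then have "pot z > 0" using pot_nonneg[of z] by simp
    then show ?case using elim by (simp add: field_simps)
  qed
  then obtain Z where Z: "\<And>z. z \<ge> Z \<Longrightarrow> pot z > 0 \<and> pot (- z) \<le> \<epsilon> * pot z"
    by (auto simp: eventually_at_top_linorder)
  show ?thesis by (rule that[of "max 1 Z"]) (use Z in auto)
qed

lemma pot_at_top: obtains Z :: int where "Z > 0" "\<And>z. z \<ge> Z \<Longrightarrow> pot z > K"
proof -
  obtain Z where Z: "Z > 0" "\<And>z. z \<ge> Z \<Longrightarrow> pot z > 0 \<and> pot (- z) \<le> 1 * pot z"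
    using ratio_small[of 1] by auto
  obtain R0 where R0: "\<And>y. \<bar>y\<bar> \<ge> R0 \<Longrightarrow> sym_pot y > 2 * K" using sym_pot_at_infinity by blast
  show ?thesis
  proof (rule that[of "max Z R0"])
    fix z assume "z \<ge> max Z R0"
    then show "pot z > K" using R0[of z] Z(2)[of z] Z(1) by (auto simp: sym_pot_def)
  qed (use Z in auto)
qed

lemma pot_left_le:
  assumes "\<epsilon> > 0"
  obtains C where "C \<ge> 0" "\<And>z. z \<ge> 0 \<Longrightarrow> pot (- z) \<le> \<epsilon> * pot z + C"
proof -
  obtain Z where Z: "Z > 0" "\<And>z. z \<ge> Z \<Longrightarrow> pot z > 0 \<and> pot (- z) \<le> \<epsilon> * pot z"
    using ratio_small[OF assms] by blast
  define C where "C = (\<Sum>z\<in>{0..Z}. pot (- z))"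
  have C: "C \<ge> 0" unfolding C_def by (intro sum_nonneg pot_nonneg)
  show ?thesis
  proof (rule that[OF C])
    fix z :: int assume z: "z \<ge> 0"
    show "pot (- z) \<le> \<epsilon> * pot z + C"
    proof (cases "z \<ge> Z")
      case False
      have "pot (- z) \<le> C"
        unfolding C_def by (rule member_le_sum) (use False z pot_nonneg in auto)
      moreover have "0 \<le> \<epsilon> * pot z" using assms pot_nonneg[of z] by simp
      ultimately show ?thesis by linarith
    qed (use Z C in fastforce)
  qed
qed

text \<open>By subadditivity a zero at \<open>x\<close> would produce zeros at all positive
  multiples of \<open>x\<close>, against eventual positivity.\<close>

lemma pot_positive: "x > 0 \<Longrightarrow> pot x > 0"
proof (rule ccontr)
  assume x: "x > 0" "\<not> pot x > 0"
  then have p0: "pot x = 0" using pot_nonneg[of x] by simp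
  obtain Z where Z: "Z > 0" "\<And>z. z \<ge> Z \<Longrightarrow> pot z > 0 \<and> pot (- z) \<le> 1 * pot z"
    using ratio_small[of 1] by auto
  have "Z * 1 \<le> Z * x" using x Z by (intro mult_left_mono) auto
  then have "pot (int (nat Z) * x) > 0" using Z by auto
  then show False using pot_multiple_le[of "nat Z" x] p0 by simp
qed

text \<open>By \<open>hit_formula\<close> the left side is \<open>sym_pot R\<close> times the
  probability that the walk from -w-R fails to hit -R before 0. For w >= Z the increment bound
  leaves 2a(-R), for smaller w there is the additional constant D; both are small against
  a(R).\<close>

lemma escape_small:
  assumes "\<epsilon> > 0"
  obtains R0 :: int where "R0 > 0"
    "\<And>R w. R \<ge> R0 \<Longrightarrow> w > 0 \<Longrightarrow> pot (- w) + pot (- R) - pot (- w - R) \<le> \<epsilon> * sym_pot R"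
proof -
  obtain C where C: "C \<ge> 0" "\<And>z. z \<ge> 0 \<Longrightarrow> pot (- z) \<le> 1 * pot z + C"
    using pot_left_le[of 1] by auto
  obtain Z where Z: "Z > 0" "\<And>z. z \<ge> Z \<Longrightarrow> pot z > 0 \<and> pot (- z) \<le> 1 * pot z"
    using ratio_small[of 1] by auto
  define D where "D = (\<Sum>z\<in>{0..Z}. pot (- z))"
  obtain Z1 where Z1: "Z1 > 0" "\<And>z. z \<ge> Z1 \<Longrightarrow> pot z > 0 \<and> pot (- z) \<le> (\<epsilon> / 4) * pot z"
    using ratio_small[of "\<epsilon> / 4"] assms by auto
  obtain Z2 where Z2: "Z2 > 0" "\<And>z. z \<ge> Z2 \<Longrightarrow> pot z > 2 * D / \<epsilon>"
    using pot_at_top by blast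
  have D: "D \<ge> 0" unfolding D_def by (intro sum_nonneg pot_nonneg)
  show ?thesis
  proof (rule that[of "max Z1 Z2"])
    fix R w :: int assume R: "R \<ge> max Z1 Z2" and w: "w > 0"
    have R0: "R > 0" using R Z1(1) by simp
    have "pot (- w) + pot (- R) - pot (- w - R) \<le> 2 * pot (- R) + D"
    proof (cases "w \<ge> Z")
      case True
      have pw: "pot w > 0" "pot (- w) \<le> pot w" using Z(2)[OF True] by auto
      have "pot (- w) + pot (- R) - pot (- w - R) \<le> pot (- R) * (1 + pot (- w) / pot w)"
        by (rule pot_negative_increment) (use w R0 pw in auto)
      also have "\<dots> \<le> pot (- R) * 2"
        using pw pot_nonneg[of "- R"] by (intro mult_left_mono) auto
      finally show ?thesis using D by simp
    next
      case False
      have "pot (- w) \<le> D"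
        unfolding D_def by (rule member_le_sum) (use False w pot_nonneg in auto)
      then show ?thesis using pot_nonneg[of "- w - R"] pot_nonneg[of "- R"] by simp
    qed
    also have "2 * pot (- R) \<le> \<epsilon> / 2 * pot R" using Z1(2)[of R] R by simp
    also have "D \<le> \<epsilon> / 2 * pot R" using Z2(2)[of R] R assms by (simp add: field_simps)
    also have "\<epsilon> / 2 * pot R + \<epsilon> / 2 * pot R \<le> \<epsilon> * sym_pot R"
      using assms pot_nonneg[of "- R"] by (simp add: sym_pot_def distrib_left)
    finally show "pot (- w) + pot (- R) - pot (- w - R) \<le> \<epsilon> * sym_pot R" by simp
  qed (use Z1 in auto)
qed

text \<open>From a positive point an explicit path past 0 need not be at hand. If the probability
  vanished, \<open>hit_formula\<close> at all -R' with R' >= R would make \<open>pot\<close>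
  additive along \<open>x\<close>, hence of linear growth. Positivity matters because 0/0 is 0 and
  would spoil the asymptotic relation.\<close>

lemma hit_left_halfline_pos':
  assumes "R > 0"
  shows "hit p {..- R} {0} x > 0"
proof (cases "x \<le> 0")
  case True
  then show ?thesis by (rule hit_left_halfline_pos[OF assms])
next
  case False
  then have x: "x > 0" by simp
  show ?thesis
  proof (rule ccontr)
    have disj: "{..- R'} \<inter> {0} = {}" if "R' > 0" for R' :: int using that by auto
    assume "\<not> hit p {..- R} {0} x > 0"
    then have h0: "hit p {..- R} {0} x = 0" using hit_nonneg[OF disj[OF assms], of p x] by simp
    have add: "pot (x + R') = pot x + pot R'" if R': "R' \<ge> R" for R'
    proof -
      have "hit p {- R'} {0} x \<le> hit p {..- R} {0} x"
        by (rule hit_mono) (use R' assms in auto)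
      then have "hit p {- R'} {0} x = 0"
        using hit_nonneg[of "{- R'}" "{0}" p x] h0 assms R' by auto
      then show ?thesis using hit_formula[of "- R'" x] x assms R' by (simp add: adag_def)
    qed
    have iter: "pot (R + int n * x) = pot R + real n * pot x" for n
    proof (induction n)
      case (Suc n)
      have "pot (x + (R + int n * x)) = pot x + pot (R + int n * x)"
        by (rule add) (use x in simp)
      then show ?case using Suc by (simp add: algebra_simps)
    qed simp
    have px: "pot x > 0" using x by (rule pot_positive)
    define \<epsilon> where "\<epsilon> = pot x / (2 * real_of_int x)"
    have \<epsilon>: "\<epsilon> > 0" using px x by (simp add: \<epsilon>_def)
    then obtain C where C: "\<And>y. \<bar>pot y\<bar> \<le> \<epsilon> * \<bar>real_of_int y\<bar> + C"
      using sublinear_pot unfolding sublinear_def by blast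
    obtain n :: nat where n: "real n * (pot x / 2) > \<epsilon> * real_of_int R + C"
      using reals_Archimedean3[of "pot x / 2"] px by (metis half_gt_zero)
    have "real n * pot x \<le> pot (R + int n * x)" using iter[of n] pot_nonneg[of R] by simp
    also have "\<dots> \<le> \<epsilon> * \<bar>real_of_int (R + int n * x)\<bar> + C" using C[of "R + int n * x"] by linarith
    also have "\<bar>real_of_int (R + int n * x)\<bar> = real_of_int R + real n * real_of_int x"
      using assms x by simp
    also have "\<epsilon> * (real_of_int R + real n * real_of_int x) + C = \<epsilon> * real_of_int R + C + real n * (pot x / 2)"
      using x by (simp add: \<epsilon>_def field_simps)
    finally show False using n by simp
  qed
qed

text \<open>From any point below -R the point -R is hit before 0 with probability at least 1 - e. So
  the hitting probability of -R, divided by 1 - e, is a supersolution for the half-line.\<close>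

lemma hit_halfline_asymp_point:
  assumes "\<epsilon> > 0"
  shows "\<exists>R0>0. \<forall>R\<ge>R0. \<forall>x. \<bar>hit p {..- R} {0} x / hit p {- R} {0} x - 1\<bar> < \<epsilon>"
proof -
  \<comment> \<open>Then 1/(1 - e) - 1 = \<epsilon>/(2 + \<epsilon>), which is below
    \<epsilon>.\<close>
  define e where "e = \<epsilon> / (2 + 2 * \<epsilon>)"
  have e: "0 < e" "e < 1" using assms by (auto simp: e_def divide_simps)
  obtain R0 where R0: "R0 > 0"
    "\<And>R w. R \<ge> R0 \<Longrightarrow> w > 0 \<Longrightarrow> pot (- w) + pot (- R) - pot (- w - R) \<le> e * sym_pot R"
    using escape_small[OF e(1)] by blast
  have "\<bar>hit p {..- R} {0} x / hit p {- R} {0} x - 1\<bar> < \<epsilon>" if R: "R \<ge> R0" for R x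
  proof -
    have Rp: "R > 0" using R R0 by simp
    have d1: "{..- R} \<inter> {0} = {}" and d2: "{- R} \<inter> {0} = {}" using Rp by auto
    let ?f = "hit p {..- R} {0}" and ?g = "hit p {- R} {0}"
    have g_low: "?g y \<ge> 1 - e" if y: "y < - R" for y
    proof -
      define w where "w = - y - R"
      have w: "w > 0" "y = - w - R" using y by (auto simp: w_def)
      have s: "sym_pot (- R) = sym_pot R" by (simp add: sym_pot_def)
      have "sym_pot R * ?g y = pot (- w - R) + pot R - pot (- w)"
        using hit_formula[of "- R" y] w Rp by (simp add: adag_def s)
      also have "\<dots> \<ge> sym_pot R * (1 - e)"
        using R0(2)[OF R w(1)] by (simp add: sym_pot_def algebra_simps)
      finally show ?thesis using sym_pot_pos[of R] Rp by simp
    qed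
    have "?f x \<le> ?g x / (1 - e)"
    proof (rule hit_least[OF d1])
      have le: "one_step {..- R} {0} (\<lambda>x. ?g x / (1 - e)) y \<le> 1 / (1 - e) * one_step {- R} {0} ?g y" for y
        using g_low[of y] e Rp by (auto simp: one_step_def divide_simps)
      have ig: "integrable (measure_pmf p) (\<lambda>z. 1 / (1 - e) * one_step {- R} {0} ?g (x + z))" for x
        by (intro integrable_mult_right integrable_bounded_pmf[OF abs_one_step_hit[OF d2]])
      show i: "integrable (measure_pmf p) (\<lambda>z. one_step {..- R} {0} (\<lambda>x. ?g x / (1 - e)) (x + z))" for x
        by (rule Bochner_Integration.integrable_bound[OF ig[of x]])
           (use le e hit_nonneg[OF d2] in \<open>auto intro!: AE_I2 simp: abs_of_nonneg one_step_def\<close>)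
      show "0 \<le> ?g x / (1 - e)" for x using e hit_nonneg[OF d2] by simp
      fix x
      have "step p (one_step {..- R} {0} (\<lambda>x. ?g x / (1 - e))) x \<le> step p (\<lambda>y. 1 / (1 - e) * one_step {- R} {0} ?g y) x"
        by (rule step_mono[OF le i ig])
      also have "\<dots> = ?g x / (1 - e)" unfolding step_cmult using hit_eq[OF d2, of p x] by simp
      finally show "step p (one_step {..- R} {0} (\<lambda>x. ?g x / (1 - e))) x \<le> ?g x / (1 - e)" .
    qed
    moreover have f_pos: "?f x > 0" by (rule hit_left_halfline_pos'[OF Rp])
    moreover have "?g x \<le> ?f x" by (rule hit_mono) (use Rp in auto)
    ultimately have fg: "?f x * (1 - e) \<le> ?g x" "0 < ?f x" "?g x \<le> ?f x"
      using e by (simp_all add: pos_le_divide_eq)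
    then have g_pos: "?g x > 0" using mult_pos_pos[of "?f x" "1 - e"] e by linarith
    have q: "1 \<le> ?f x / ?g x" "?f x / ?g x \<le> 1 / (1 - e)"
      using fg g_pos e by (simp_all add: pos_le_divide_eq pos_divide_le_eq)
    have "1 / (1 - e) - 1 < \<epsilon>" using assms by (simp add: e_def divide_simps)
    then show ?thesis using q by simp
  qed
  then show ?thesis using R0(1) by blast
qed

text \<open>A zero of \<open>pot\<close> other than 0 spreads along the support, and no zero is a
  positive point. From the largest negative zero -w a jump of size at least 2 must land on 0, so it
  has size w. Then all zeros, and with them all jumps, are multiples of w >= 2, against
  irreducibility. With unit upward jumps only, w = 1 would be possible.\<close>

lemma adag_positive:
  assumes "\<exists>b\<in>set_pmf p. b \<ge> 2"
  shows "adag x > 0"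
proof (cases "x < 0")
  case False
  then show ?thesis using pot_positive[of x] by (auto simp: adag_def)
next
  case True
  have propagate: "pot (u + b) = 0" if "pot u = 0" "u \<noteq> 0" "b \<in> set_pmf p" for u b
    by (rule nonneg_eq_zero_propagates[of pot u pot])
       (use that in \<open>auto simp: step_pot pot_nonneg integrable_pot\<close>)
  have nonpos: "u \<le> 0" if "pot u = 0" for u
    using pot_positive[of u] that by force
  have "pot x \<noteq> 0"
  proof
    assume x0: "pot x = 0"
    define Q where "Q n \<longleftrightarrow> n > 0 \<and> pot (- int n) = 0" for n
    define n where "n = (LEAST n. Q n)"
    have "Q (nat (- x))" using x0 True by (simp add: Q_def)
    then have Qn: "Q n" unfolding n_def by (rule LeastI)
    have least: "n \<le> k" if "Q k" for k unfolding n_def using that by (rule Least_le)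
    define w where "w = int n"
    have w: "w > 0" "pot (- w) = 0" using Qn by (auto simp: w_def Q_def)
    have w_min: "u \<le> - w" if "pot u = 0" "u < 0" for u
      using least[of "nat (- u)"] that by (simp add: Q_def w_def)
    obtain b0 where b0: "b0 \<in> set_pmf p" "b0 \<ge> 2" using assms by blast
    have b0w: "b0 = w"
    proof -
      have "pot (- w + b0) = 0" by (rule propagate) (use w b0 in auto)
      then show ?thesis using nonpos[of "- w + b0"] w_min[of "- w + b0"] b0(2) by force
    qed
    have dvd_zero: "pot u = 0 \<Longrightarrow> w dvd u" for u
    proof (induction "nat (- u)" arbitrary: u rule: less_induct)
      case less
      show ?case
      proof (cases "u = 0")
        case False
        have u: "u < 0" using nonpos[OF less.prems] False by simp
        have "pot (u + w) = 0"
          by (rule propagate[OF less.prems]) (use u b0 b0w in auto)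
        then have "w dvd u + w" using less.hyps[of "u + w"] u w(1) by simp
        then show ?thesis by simp
      qed simp
    qed
    have dvd_supp: "w dvd b" if "b \<in> set_pmf p" for b
    proof -
      have "w dvd - w + b" by (rule dvd_zero, rule propagate) (use w that in auto)
      from dvd_add[OF this dvd_refl[of w]] show ?thesis by simp
    qed
    obtain k where "taboo p {} k (indicator {1}) 0 > 0" using irr by blast
    then have "w dvd 1"
      by (rule reach_induct[where Q="\<lambda>u. w dvd u"]) (auto intro: dvd_add dvd_supp)
    then show False using b0(2) b0w by simp
  qed
  then show ?thesis using pot_nonneg[of x] True by (simp add: adag_def)
qed

text \<open>Subadditivity gives a(R) <= a(y) + a(R - y), and the last term is small against a(y - R)
  <= a(y) + a(-R), hence against a(y) + a(R). With e = \<epsilon>/3 the inequality (1 + e)(1 - 3e)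
  <= 1 - 2e closes the estimate.\<close>

lemma pot_almost_increasing:
  assumes "\<epsilon> > 0"
  obtains R0 :: int where "R0 > 0" "\<And>R y. R \<ge> R0 \<Longrightarrow> y \<ge> R \<Longrightarrow> (1 - \<epsilon>) * pot R \<le> pot y"
proof -
  define e where "e = \<epsilon> / 3"
  have e: "e > 0" using assms by (simp add: e_def)
  obtain C where C: "C \<ge> 0" "\<And>z. z \<ge> 0 \<Longrightarrow> pot (- z) \<le> e * pot z + C"
    using pot_left_le[OF e] by blast
  obtain Z where Z: "Z > 0" "\<And>z. z \<ge> Z \<Longrightarrow> pot z > 0 \<and> pot (- z) \<le> 1 * pot z"
    using ratio_small[of 1] by auto
  obtain Z2 where Z2: "Z2 > 0" "\<And>z. z \<ge> Z2 \<Longrightarrow> pot z > C / e"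
    using pot_at_top by blast
  show ?thesis
  proof (rule that[of "max Z Z2"])
    fix R y assume R: "R \<ge> max Z Z2" and y: "y \<ge> R"
    have 1: "pot R \<le> pot y + pot (- (y - R))" using pot_subadditive[of y "R - y"] by simp
    have 2: "pot (- (y - R)) \<le> e * pot (y - R) + C" using C(2)[of "y - R"] y by simp
    have "pot (y - R) \<le> pot y + pot (- R)" using pot_subadditive[of y "- R"] by simp
    also have "\<dots> \<le> pot y + pot R" using Z(2)[of R] R by simp
    finally have "e * pot (y - R) \<le> e * (pot y + pot R)" using e by (intro mult_left_mono) auto
    with 1 2 have "pot R \<le> pot y + (e * (pot y + pot R) + C)" by linarith
    moreover have "C \<le> e * pot R" using Z2(2)[of R] R e by (simp add: field_simps)
    ultimately have "(1 - 2 * e) * pot R \<le> (1 + e) * pot y" by (simp add: algebra_simps)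
    moreover have "(1 + e) * ((1 - \<epsilon>) * pot R) \<le> (1 - 2 * e) * pot R"
    proof -
      have "(1 + e) * (1 - \<epsilon>) \<le> 1 - 2 * e" using e by (simp add: e_def algebra_simps)
      from mult_right_mono[OF this pot_nonneg[of R]] show ?thesis by (simp add: mult_ac)
    qed
    ultimately have "(1 + e) * ((1 - \<epsilon>) * pot R) \<le> (1 + e) * pot y" by linarith
    then show "(1 - \<epsilon>) * pot R \<le> pot y" using e by simp
  qed (use Z in auto)
qed

section \<open>Hitting a point or half-line on the right\<close>

definition defect :: "int \<Rightarrow> int \<Rightarrow> real" where
  "defect x R = (pot (- R) - pot (- R + x)) / adag x"

text \<open>For x different from R the relative error equals (D a(R) - a(-R)) / (a(R) + a(-R)),
  where D is the defect. At x = R the dagger in \<open>hit_point_eq\<close> contributes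
  1/\<open>sym_pot R\<close>, which is small because the potential is unbounded on the
  right.\<close>

lemma hit_point_asymp:
  assumes b: "\<exists>b\<in>set_pmf p. b \<ge> 2" and "\<epsilon> > 0"
  shows "\<exists>\<delta>>0. \<exists>R0>0. \<forall>R\<ge>R0. \<forall>x\<le>R. \<bar>defect x R\<bar> < \<delta> \<longrightarrow>
    \<bar>hit p {R} {0} x / (adag x / pot R) - 1\<bar> < \<epsilon>"
proof -
  obtain Z1 where Z1: "Z1 > 0" "\<And>z. z \<ge> Z1 \<Longrightarrow> pot z > 0 \<and> pot (- z) \<le> (\<epsilon> / 2) * pot z"
    using ratio_small[of "\<epsilon> / 2"] assms(2) by auto
  obtain Z2 where Z2: "Z2 > 0" "\<And>z. z \<ge> Z2 \<Longrightarrow> pot z > 1 / \<epsilon>"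
    using pot_at_top by blast
  have main: "\<bar>hit p {R} {0} x / (adag x / pot R) - 1\<bar> < \<epsilon>"
    if R: "R \<ge> max Z1 Z2" and x: "x \<le> R" and D: "\<bar>defect x R\<bar> < \<epsilon> / 2" for R x
  proof -
    have Rp: "R > 0" using R Z1 by simp
    have pR: "pot R > 0" using Rp by (rule pot_positive)
    have ax: "adag x > 0" using b by (rule adag_positive)
    have s: "sym_pot R > 0" using sym_pot_pos Rp by simp
    have le_s: "pot R \<le> sym_pot R" using pot_nonneg[of "- R"] by (simp add: sym_pot_def)
    have h: "hit p {R} {0} x = (adag x + pot (- R) - adag (x - R)) / sym_pot R"
      using hit_point_eq[of R x] Rp by simp
    show ?thesis
    proof (cases "x = R")
      case False
      have "hit p {R} {0} x / (adag x / pot R) - 1 = (defect x R * pot R - pot (- R)) / sym_pot R"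
      proof -
        have alg: "(A + m - N) / (P + m) / (A / P) - 1 = ((m - N) / A * P - m) / (P + m)"
          if "A > 0" "P > 0" "P + m > 0" for A m N P :: real
          using that by (simp add: divide_simps) (simp add: algebra_simps)
        have "adag (x - R) = pot (- R + x)" using False by (simp add: adag_def algebra_simps)
        then show ?thesis
          unfolding h defect_def using alg[OF ax pR, of "pot (- R)" "pot (- R + x)"] s
          by (simp add: sym_pot_def)
      qed
      also have "\<bar>\<dots>\<bar> \<le> (\<bar>defect x R\<bar> * pot R + pot (- R)) / sym_pot R"
        using s pR pot_nonneg[of "- R"] abs_triangle_ineq4[of "defect x R * pot R" "pot (- R)"]
        by (simp add: abs_mult divide_right_mono)
      also have "\<dots> < \<epsilon>"
      proof -
        have "\<bar>defect x R\<bar> * pot R < \<epsilon> / 2 * pot R" using D pR by (intro mult_strict_right_mono)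
        moreover have "pot (- R) \<le> \<epsilon> / 2 * pot R" using Z1(2)[of R] R by simp
        moreover have "\<epsilon> * pot R \<le> \<epsilon> * sym_pot R" using le_s assms(2) by (intro mult_left_mono) auto
        ultimately have "\<bar>defect x R\<bar> * pot R + pot (- R) < \<epsilon> * sym_pot R" by simp
        then show ?thesis using s by (simp add: pos_divide_less_eq)
      qed
      finally show ?thesis .
    next
      case True
      have "hit p {R} {0} x / (adag x / pot R) - 1 = - (1 / sym_pot R)"
        using True Rp pR s unfolding h by (simp add: adag_def sym_pot_def field_simps)
      then have "\<bar>hit p {R} {0} x / (adag x / pot R) - 1\<bar> = 1 / sym_pot R" using s by simp
      also have "\<dots> \<le> 1 / pot R" using le_s pR by (simp add: frac_le)
      also have "\<dots> < \<epsilon>" using Z2(2)[of R] R pR assms(2) by (simp add: field_simps)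
      finally show ?thesis .
    qed
  qed
  show ?thesis
    by (intro exI[of _ "\<epsilon> / 2"] conjI exI[of _ "max Z1 Z2"] allI impI main) (use assms Z1 in auto)
qed

text \<open>Hitting the point R bounds the half-line from below, and \<open>adag_ge_hit\<close> at
  the level (1 - e) a(R) bounds it from above; both bounds are close to
  \<open>adag x / pot R\<close>.\<close>

lemma hit_right_halfline_asymp:
  assumes b: "\<exists>b\<in>set_pmf p. b \<ge> 2" and "\<epsilon> > 0"
  shows "\<exists>\<delta>>0. \<exists>R0>0. \<forall>R\<ge>R0. \<forall>x\<le>R. \<bar>defect x R\<bar> < \<delta> \<longrightarrow>
    \<bar>hit p {R..} {0} x / hit p {R} {0} x - 1\<bar> < \<epsilon>"
proof -
  \<comment> \<open>The quotient is below 1/(1 - e)^2, which is at most 1 + 8e for e <= 1/2; e <=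
    \<epsilon>/9 brings this below 1 + \<epsilon>.\<close>
  define e where "e = min (1/2) (\<epsilon> / 9)"
  have e: "0 < e" "e \<le> 1/2" "9 * e \<le> \<epsilon>" using assms(2) by (auto simp: e_def)
  obtain \<delta> R1 where d: "\<delta> > 0" "R1 > 0" and main: "\<And>R x. R \<ge> R1 \<Longrightarrow> x \<le> R \<Longrightarrow> \<bar>defect x R\<bar> < \<delta> \<Longrightarrow>
    \<bar>hit p {R} {0} x / (adag x / pot R) - 1\<bar> < e"
    using hit_point_asymp[OF b e(1)] by blast
  obtain R2 where R2: "R2 > 0" "\<And>R y. R \<ge> R2 \<Longrightarrow> y \<ge> R \<Longrightarrow> (1 - e) * pot R \<le> pot y"
    using pot_almost_increasing[OF e(1)] by blast
  have "\<bar>hit p {R..} {0} x / hit p {R} {0} x - 1\<bar> < \<epsilon>"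
    if R: "R \<ge> max R1 R2" and x: "x \<le> R" and D: "\<bar>defect x R\<bar> < \<delta>" for R x
  proof -
    have Rp: "R > 0" using R d by simp
    have pR: "pot R > 0" using Rp by (rule pot_positive)
    have ax: "adag x > 0" using b by (rule adag_positive)
    define q where "q = adag x / pot R"
    have q: "q > 0" using ax pR by (simp add: q_def)
    let ?f = "hit p {R..} {0} x" and ?g = "hit p {R} {0} x"
    have "\<bar>?g / q - 1\<bar> < e" using main[of R x] R x D by (simp add: q_def)
    then have "1 - e < ?g / q" by linarith
    then have g: "(1 - e) * q < ?g" using q by (simp add: pos_less_divide_eq)
    have "((1 - e) * pot R) * ?f \<le> adag x"
      by (rule adag_ge_hit) (use R2(2)[of R] R Rp e pR in auto)
    then have f: "(1 - e) * ?f \<le> q" using pR by (simp add: q_def field_simps)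
    have gf: "?g \<le> ?f" by (rule hit_mono) (use Rp in auto)
    have g0: "?g > 0" using g mult_pos_pos[of "1 - e" q] q e by linarith
    have "(1 - e)\<^sup>2 * ?f \<le> (1 - e) * q"
      using mult_left_mono[OF f, of "1 - e"] e by (simp add: power2_eq_square mult_ac)
    then have "(1 - e)\<^sup>2 * ?f < ?g" using g by linarith
    then have "?f / ?g < 1 / (1 - e)\<^sup>2" using g0 e by (simp add: field_simps)
    also have "1 / (1 - e)\<^sup>2 \<le> 1 + 8 * e"
    proof -
      have "0 \<le> e * ((1 - 2 * e) * (6 - 4 * e) + e)" using e by (intro mult_nonneg_nonneg add_nonneg_nonneg) auto
      also have "e * ((1 - 2 * e) * (6 - 4 * e) + e) = (1 + 8 * e) * (1 - e)\<^sup>2 - 1"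
        by (simp add: power2_eq_square algebra_simps)
      finally show ?thesis using e by (simp add: pos_divide_le_eq)
    qed
    finally have "?f / ?g < 1 + \<epsilon>" using e by linarith
    moreover have "1 \<le> ?f / ?g" using gf g0 by simp
    ultimately show ?thesis by simp
  qed
  then show ?thesis
    by (intro exI[of _ \<delta>] conjI exI[of _ "max R1 R2"]) (use d R2 in auto)
qed

end

section \<open>Truncated moments and Fourier estimates\<close>

text \<open>Meant for antiderivatives that need not extend to 0: (0, b] is exhausted by the
  intervals [a_n, b], and the nonnegative value at a_n is dropped.\<close>

lemma nn_integral_FTC_at_zero:
  fixes G g :: "real \<Rightarrow> real"
  assumes b: "b > 0" and [measurable]: "g \<in> borel_measurable borel"
    and der: "\<And>t. 0 < t \<Longrightarrow> t \<le> b \<Longrightarrow> (G has_real_derivative g t) (at t)"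
    and g: "\<And>t. 0 < t \<Longrightarrow> t \<le> b \<Longrightarrow> 0 \<le> g t" and G: "\<And>t. 0 < t \<Longrightarrow> t \<le> b \<Longrightarrow> 0 \<le> G t"
  shows "(\<integral>\<^sup>+t. ennreal (g t) * indicator {0<..b} t \<partial>lborel) \<le> ennreal (G b)"
proof -
  define a where "a n = b / real (n + 2)" for n :: nat
  have a: "0 < a n" "a n \<le> b" for n
    using b by (auto simp: a_def divide_simps)
  have dec: "a n \<le> a m" if "m \<le> n" for m n
    using that b by (auto simp: a_def intro!: divide_left_mono)
  have part: "(\<integral>\<^sup>+t. ennreal (g t) * indicator {a n..b} t \<partial>lborel) \<le> ennreal (G b)" for n
  proof -
    have "(\<integral>\<^sup>+t. ennreal (g t) * indicator {a n..b} t \<partial>lborel) = ennreal (G b - G (a n))"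
      by (rule nn_integral_FTC_Icc)
         (use a[of n] der g in \<open>auto intro: DERIV_subset order_less_le_trans\<close>)
    also have "\<dots> \<le> ennreal (G b)" using G[of "a n"] a[of n] by (intro ennreal_leI) simp
    finally show ?thesis .
  qed
  have sup: "(SUP n. ennreal (g t) * indicator {a n..b} t) = ennreal (g t) * indicator {0<..b} t" for t
  proof (rule antisym)
    show "(SUP n. ennreal (g t) * indicator {a n..b} t) \<le> ennreal (g t) * indicator {0<..b} t"
      by (intro SUP_least mult_left_mono) (use a in \<open>auto simp: indicator_def intro: less_le_trans\<close>)
    show "ennreal (g t) * indicator {0<..b} t \<le> (SUP n. ennreal (g t) * indicator {a n..b} t)"
    proof (cases "t \<in> {0<..b}")
      case True
      obtain n :: nat where n: "b < real n * t" using reals_Archimedean3[of t] True by auto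
      have "b \<le> real (n + 2) * t" using n True by (simp add: distrib_right)
      then have "a n \<le> t" unfolding a_def by (subst pos_divide_le_eq) (auto simp: mult.commute)
      then have "ennreal (g t) * indicator {0<..b} t = ennreal (g t) * indicator {a n..b} t"
        using True by (simp add: indicator_def)
      also have "\<dots> \<le> (SUP n. ennreal (g t) * indicator {a n..b} t)" by (rule SUP_upper) simp
      finally show ?thesis .
    qed simp
  qed
  have "(\<integral>\<^sup>+t. ennreal (g t) * indicator {0<..b} t \<partial>lborel) =
      (\<integral>\<^sup>+t. (SUP n. ennreal (g t) * indicator {a n..b} t) \<partial>lborel)"
    by (simp add: sup)
  also have "\<dots> = (SUP n. \<integral>\<^sup>+t. ennreal (g t) * indicator {a n..b} t \<partial>lborel)"
    by (rule nn_integral_monotone_convergence_SUP)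
       (auto simp: incseq_def le_fun_def indicator_def dest: dec)
  also have "\<dots> \<le> ennreal (G b)" by (rule SUP_least) (rule part)
  finally show ?thesis .
qed

text \<open>Summation by parts turns the Abel mean into the average of the partial sums with weights
  (1 - q) q^n. These have total mass 1 and leave every finite block of indices as q tends to
  1.\<close>

lemma abel_limit:
  fixes b :: "nat \<Rightarrow> real"
  assumes b: "b sums S" and r: "\<And>k. 0 \<le> r k" "\<And>k. r k < 1" "r \<longlonglongrightarrow> 1"
  shows "(\<lambda>k. \<Sum>n. r k ^ n * b n) \<longlonglongrightarrow> S"
proof -
  define s where "s n = (\<Sum>i\<le>n. b i)" for n
  have s_lim: "s \<longlonglongrightarrow> S" using b by (simp add: s_def[abs_def] sums_def_le)
  then have "Bseq s" by (rule convergent_imp_Bseq[OF convergentI])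
  then obtain B0 where B0: "\<And>n. \<bar>s n\<bar> \<le> B0" unfolding Bseq_def by auto
  define B where "B = B0 + \<bar>S\<bar>"
  have B: "\<bar>s n - S\<bar> \<le> B" for n using B0[of n] unfolding B_def by linarith
  have geo: "(\<lambda>n. (1 - q) * q ^ n) sums 1" if "0 \<le> q" "q < 1" for q :: real
    using sums_mult[OF geometric_sums[of q], of "1 - q"] that by simp
  have id: "(\<lambda>n. q ^ n * b n) sums (\<Sum>n. (1 - q) * q ^ n * s n)"
    and sm: "summable (\<lambda>n. (1 - q) * q ^ n * s n)" if q: "0 \<le> q" "q < 1" for q :: real
  proof -
    have q1: "\<bar>(1 - q) * q ^ n * s n\<bar> \<le> (1 - q) * q ^ n * B0" for n
      using q B0 by (simp add: abs_mult mult_left_mono)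
    show "summable (\<lambda>n. (1 - q) * q ^ n * s n)"
      by (rule summable_comparison_test'[where g="\<lambda>n. (1 - q) * q ^ n * B0" and N=0])
         (use q1 geo[OF q] in \<open>auto simp: sums_iff intro!: summable_mult2\<close>)
    then have L: "(\<lambda>N. \<Sum>n<N. (1 - q) * q ^ n * s n) \<longlonglongrightarrow> (\<Sum>n. (1 - q) * q ^ n * s n)"
      by (rule summable_LIMSEQ)
    have eq: "(\<Sum>n\<le>N. q ^ n * b n) = (\<Sum>n<N. (1 - q) * q ^ n * s n) + q ^ N * s N" for N
      by (induction N) (simp_all add: s_def algebra_simps)
    have "(\<lambda>N. q ^ N * s N) \<longlonglongrightarrow> 0 * S"
      using q by (intro tendsto_mult s_lim LIMSEQ_power_zero) auto
    then have "(\<lambda>N. \<Sum>n\<le>N. q ^ n * b n) \<longlonglongrightarrow> (\<Sum>n. (1 - q) * q ^ n * s n) + 0"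
      unfolding eq using L by (intro tendsto_add) auto
    then show "(\<lambda>n. q ^ n * b n) sums (\<Sum>n. (1 - q) * q ^ n * s n)"
      by (simp add: sums_def_le)
  qed
  show ?thesis
  proof (rule LIMSEQ_I)
    fix e :: real assume e: "e > 0"
    obtain N where N: "\<And>n. n \<ge> N \<Longrightarrow> \<bar>s n - S\<bar> < e / 2"
      using LIMSEQ_D[OF s_lim, of "e / 2"] e by auto
    have bound: "\<bar>(\<Sum>n. q ^ n * b n) - S\<bar> \<le> (1 - q) * (real N * B) + e / 2" if q: "0 \<le> q" "q < 1" for q
    proof -
      let ?g = "\<lambda>n. (1 - q) * q ^ n * (s n - S)"
      have "(\<lambda>n. (1 - q) * q ^ n * s n - (1 - q) * q ^ n * S) sums ((\<Sum>n. q ^ n * b n) - 1 * S)"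
        using id[OF q] sm[OF q] geo[OF q]
        by (intro sums_diff sums_mult2) (auto simp: sums_iff)
      then have g: "?g sums ((\<Sum>n. q ^ n * b n) - S)" by (simp add: right_diff_distrib)
      let ?h = "\<lambda>n. (if n < N then (1 - q) * B else 0) + (1 - q) * q ^ n * (e / 2)"
      have h: "?h sums ((\<Sum>n<N. (1 - q) * B) + 1 * (e / 2))"
        by (intro sums_add sums_mult2 geo[OF q]) (use sums_If_finite_set[of "{..<N}" "\<lambda>_. (1 - q) * B"] in auto)
      have gh: "\<bar>?g n\<bar> \<le> ?h n" for n
      proof (cases "n < N")
        case True
        have "\<bar>?g n\<bar> = (1 - q) * (q ^ n * \<bar>s n - S\<bar>)" using q by (simp add: abs_mult)
        also have "\<dots> \<le> (1 - q) * (1 * B)"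
          using q B[of n] by (intro mult_left_mono mult_mono power_le_one) auto
        also have "\<dots> \<le> ?h n" using True q e by simp
        finally show ?thesis .
      next
        case False
        have "\<bar>?g n\<bar> = (1 - q) * q ^ n * \<bar>s n - S\<bar>" using q by (simp add: abs_mult)
        also have "\<dots> \<le> (1 - q) * q ^ n * (e / 2)"
          using q N[of n] False by (intro mult_left_mono) auto
        finally show ?thesis using False by simp
      qed
      have "(\<Sum>n. q ^ n * b n) - S \<le> (\<Sum>n<N. (1 - q) * B) + 1 * (e / 2)"
        by (rule sums_le[OF _ g h]) (use gh in \<open>auto simp: abs_le_iff\<close>)
      moreover have "- ((\<Sum>n. q ^ n * b n) - S) \<le> (\<Sum>n<N. (1 - q) * B) + 1 * (e / 2)"
        by (rule sums_le[OF _ sums_minus[OF g] h]) (use gh in \<open>auto simp: abs_le_iff\<close>)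
      ultimately show ?thesis by (simp add: abs_le_iff mult_ac)
    qed
    have "(\<lambda>k. (1 - r k) * (real N * B)) \<longlonglongrightarrow> (1 - 1) * (real N * B)"
      using r(3) by (intro tendsto_intros)
    then have "\<forall>\<^sub>F k in sequentially. (1 - r k) * (real N * B) < e / 2"
      using e by (intro order_tendstoD) auto
    then obtain k0 where k0: "\<And>k. k \<ge> k0 \<Longrightarrow> (1 - r k) * (real N * B) < e / 2"
      by (auto simp: eventually_sequentially)
    show "\<exists>k0. \<forall>k\<ge>k0. norm ((\<Sum>n. r k ^ n * b n) - S) < e"
    proof (intro exI[of _ k0] allI impI)
      fix k assume "k \<ge> k0"
      then show "norm ((\<Sum>n. r k ^ n * b n) - S) < e"
        using bound[OF r(1,2), of k] k0[of k] by simp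
    qed
  qed
qed

lemma one_minus_cos_le:
  fixes y :: real assumes "0 \<le> y"
  shows "1 - cos y \<le> 8 * (y\<^sup>2 / (1 + y)\<^sup>2)"
proof -
  have c1: "1 - cos y \<le> 2" using cos_ge_minus_one[of y] by linarith
  have c2: "1 - cos y \<le> y\<^sup>2 / 2" by (rule one_minus_cos_quadratic)
  have "(1 - cos y) * (1 + y)\<^sup>2 \<le> 8 * y\<^sup>2"
  proof (cases "y \<le> 1")
    case True
    have "(1 - cos y) * (1 + y)\<^sup>2 \<le> (y\<^sup>2 / 2) * 2\<^sup>2"
      using True assms c2 by (intro mult_mono power_mono) auto
    also have "\<dots> \<le> 8 * y\<^sup>2" by simp
    finally show ?thesis .
  next
    case False
    have "(1 - cos y) * (1 + y)\<^sup>2 \<le> 2 * (y + y)\<^sup>2"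
      using False assms c1 by (intro mult_mono power_mono) auto
    then show ?thesis by (simp add: power2_eq_square)
  qed
  then show ?thesis using assms by (simp add: pos_le_divide_eq)
qed

lemma sin_le_self: "0 \<le> y - sin y" if "0 \<le> y" for y :: real
  using sin_x_le_x[OF that] by simp

lemma self_minus_sin_le:
  fixes y :: real assumes "0 \<le> y"
  shows "y - sin y \<le> 8 * (y ^ 3 / (1 + y)\<^sup>2)"
proof -
  have "(y - sin y) * (1 + y)\<^sup>2 \<le> 8 * y ^ 3"
  proof (cases "y \<le> 1")
    case True
    have "\<bar>sin y - (\<Sum>m<3. sin_coeff m * y ^ m)\<bar> \<le> inverse (fact 3) * \<bar>y\<bar> ^ 3"
      by (rule Maclaurin_sin_bound)
    then have "\<bar>sin y - y\<bar> \<le> inverse (fact 3) * \<bar>y\<bar> ^ 3"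
      by (simp add: numeral_3_eq_3 sin_coeff_def)
    then have "\<bar>sin y - y\<bar> \<le> y ^ 3 / 6" using assms by (simp add: fact_numeral)
    moreover have "y - sin y \<le> \<bar>sin y - y\<bar>" using abs_ge_minus_self[of "sin y - y"] by simp
    ultimately have "y - sin y \<le> y ^ 3 / 6" by (rule order_trans[rotated])
    also have "\<dots> \<le> y ^ 3" using assms by simp
    finally have "(y - sin y) * (1 + y)\<^sup>2 \<le> y ^ 3 * 2\<^sup>2"
      using True assms by (intro mult_mono power_mono) auto
    also have "\<dots> \<le> 8 * y ^ 3" using assms by simp
    finally show ?thesis .
  next
    case False
    have "y - sin y \<le> 2 * y" using sin_ge_minus_one[of y] False by linarith
    then have "(y - sin y) * (1 + y)\<^sup>2 \<le> (2 * y) * (y + y)\<^sup>2"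
      using False assms by (intro mult_mono power_mono) auto
    then show ?thesis by (simp add: power2_eq_square power3_eq_cube)
  qed
  then show ?thesis using assms by (simp add: pos_le_divide_eq)
qed

text \<open>Neither term suffices alone: 1 - cos y vanishes at multiples of 2 pi, and y - sin y is
  only cubic near 0. The first is used up to pi, the second beyond.\<close>

lemma cos_sin_lower:
  fixes y :: real assumes "0 \<le> y"
  shows "(y\<^sup>2 / (1 + y)) / 8 \<le> (1 - cos y) + (y - sin y)"
proof (cases "y \<le> pi")
  case True
  have "(y\<^sup>2 / (1 + y)) / 8 \<le> y\<^sup>2 / 8"
    using assms divide_left_mono[of 1 "1 + y" "y\<^sup>2"] by (intro divide_right_mono) auto
  also have "\<dots> \<le> 2 * y\<^sup>2 / pi\<^sup>2"
  proof -
    have "pi\<^sup>2 \<le> 4\<^sup>2" using pi_less_4 by (intro power_mono) auto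
    then have "y\<^sup>2 * pi\<^sup>2 \<le> y\<^sup>2 * 16" by (intro mult_left_mono) auto
    then show ?thesis by (simp add: divide_simps)
  qed
  also have "\<dots> \<le> 1 - cos y" using one_minus_cos_ge_quadratic[of y] True assms by simp
  finally show ?thesis using sin_le_self[OF assms] by linarith
next
  case False
  have "y\<^sup>2 / (1 + y) \<le> y"
    using assms by (simp add: divide_le_eq power2_eq_square algebra_simps)
  then have "(y\<^sup>2 / (1 + y)) / 8 \<le> y / 8" by (rule divide_right_mono) simp
  moreover have "y - sin y \<ge> y / 2" using sin_le_one[of y] False pi_gt3 by linarith
  moreover have "0 \<le> 1 - cos y" by simp
  ultimately show ?thesis using assms by linarith
qed

text \<open>The calculus core: \<open>L\<close> is the total and \<open>N\<close> the small part, \<open>-L1\<close>, \<open>-N1\<close> are their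
  derivatives, and \<open>L - t L1\<close>, \<open>N - t N1\<close> those of \<open>t L\<close>, \<open>t N\<close>. The two weights are the sizes of
  the real and imaginary part of a Cesaro averaged kernel with \<open>1/s\<close> terms.\<close>

lemma kernel_integral_bound:
  fixes L N L1 N1 F :: "real \<Rightarrow> real"
  assumes s: "0 < s" "s \<le> \<delta>" and \<epsilon>: "0 \<le> \<epsilon>" and C: "0 \<le> C"
    and [measurable]: "L \<in> borel_measurable borel" "N \<in> borel_measurable borel"
      "L1 \<in> borel_measurable borel" "N1 \<in> borel_measurable borel"
    and dL: "\<And>t. 0 < t \<Longrightarrow> t \<le> \<delta> \<Longrightarrow> (L has_real_derivative - L1 t) (at t)"
    and dN: "\<And>t. 0 < t \<Longrightarrow> t \<le> \<delta> \<Longrightarrow> (N has_real_derivative - N1 t) (at t)"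
    and Lpos: "\<And>t. 0 < t \<Longrightarrow> t \<le> \<delta> \<Longrightarrow> 0 < L t" and Npos: "\<And>t. 0 < t \<Longrightarrow> t \<le> \<delta> \<Longrightarrow> 0 \<le> N t"
    and L1pos: "\<And>t. 0 < t \<Longrightarrow> t \<le> \<delta> \<Longrightarrow> 0 \<le> L1 t" and N1pos: "\<And>t. 0 < t \<Longrightarrow> t \<le> \<delta> \<Longrightarrow> 0 \<le> N1 t"
    and L1le: "\<And>t. 0 < t \<Longrightarrow> t \<le> \<delta> \<Longrightarrow> t * L1 t \<le> L t" and N1le: "\<And>t. 0 < t \<Longrightarrow> t \<le> \<delta> \<Longrightarrow> t * N1 t \<le> N t"
    and NL: "\<And>t. 0 < t \<Longrightarrow> t \<le> \<delta> \<Longrightarrow> N t \<le> \<epsilon> * L t"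
    and F1: "\<And>t. 0 < t \<Longrightarrow> t \<le> s \<Longrightarrow> \<bar>F t\<bar> \<le> C * ((t / s)\<^sup>2 * ((N t - t * N1 t + \<epsilon> * (L t - t * L1 t)) / (t * L t)\<^sup>2)
        + (t / s) * ((N1 t + \<epsilon> * L1 t) / (t * (L t)\<^sup>2)))"
    and F2: "\<And>t. s \<le> t \<Longrightarrow> t \<le> \<delta> \<Longrightarrow> \<bar>F t\<bar> \<le> C * ((N t - t * N1 t + \<epsilon> * (L t - t * L1 t)) / (t * L t)\<^sup>2
        + (s / t) * ((N1 t + \<epsilon> * L1 t) / (t * (L t)\<^sup>2)))"
  shows "(\<integral>\<^sup>+t. ennreal \<bar>F t\<bar> * indicator {0<..\<delta>} t \<partial>lborel) \<le> ennreal (10 * C * \<epsilon> / (s * L s))"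
proof -
  have Ls: "0 < L s" using Lpos s by simp
  have \<delta>: "0 < \<delta>" using s by simp
  have L_dec: "L s \<le> L t" if "0 < t" "t \<le> s" for t
  proof (rule DERIV_nonpos_imp_nonincreasing[OF that(2)])
    fix u assume "t \<le> u" "u \<le> s"
    then show "\<exists>y. (L has_real_derivative y) (at u) \<and> y \<le> 0"
      using dL[of u] L1pos[of u] that s by (intro exI[of _ "- L1 u"]) auto
  qed
  have f_inc: "s * L s \<le> t * L t" if "s \<le> t" "t \<le> \<delta>" for t
  proof (rule DERIV_nonneg_imp_nondecreasing[OF that(1)])
    fix u assume "s \<le> u" "u \<le> t"
    then show "\<exists>y. ((\<lambda>t. t * L t) has_real_derivative y) (at u) \<and> 0 \<le> y"
      using dL[of u] L1le[of u] that s
      by (intro exI[of _ "L u - u * L1 u"]) (auto intro!: derivative_eq_intros)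
  qed
  \<comment> \<open>The derivative contains -2 N L1/L^3, which 2 \<epsilon> L1/L^2 covers because N
    <= \<epsilon> L; hence the coefficient 3 instead of 1. The first weight is handled by
    monotonicity, since L(t) >= L(s) for t <= s.\<close>
  define G1 where "G1 t = C * ((1 / (s\<^sup>2 * (L s)\<^sup>2)) * (t * N t + \<epsilon> * (t * L t)) + (1 / s) * (3 * \<epsilon> / L t - N t / (L t)\<^sup>2))" for t
  define g1 where "g1 t = C * ((1 / (s\<^sup>2 * (L s)\<^sup>2)) * (N t - t * N1 t + \<epsilon> * (L t - t * L1 t))
      + (1 / s) * (3 * \<epsilon> * L1 t / (L t)\<^sup>2 + N1 t / (L t)\<^sup>2 - 2 * N t * L1 t / (L t) ^ 3))" for t
  have G1_der: "(G1 has_real_derivative g1 t) (at t)" if "0 < t" "t \<le> s" for t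
  proof -
    have t: "0 < t" "t \<le> \<delta>" using that s by auto
    have Lt: "L t \<noteq> 0" using Lpos[OF t] by simp
    have a1: "((\<lambda>t. t * N t + \<epsilon> * (t * L t)) has_real_derivative N t - t * N1 t + \<epsilon> * (L t - t * L1 t)) (at t)"
      by (auto intro!: derivative_eq_intros dL[OF t] dN[OF t])
    have a2: "((\<lambda>t. 3 * \<epsilon> / L t) has_real_derivative 3 * \<epsilon> * L1 t / (L t)\<^sup>2) (at t)"
      by (rule DERIV_cong[OF DERIV_divide[OF DERIV_const dL[OF t] Lt]]) (simp add: power2_eq_square)
    have a3: "((\<lambda>t. N t / (L t)\<^sup>2) has_real_derivative - (N1 t / (L t)\<^sup>2 - 2 * N t * L1 t / (L t) ^ 3)) (at t)"
      by (rule DERIV_cong[OF DERIV_divide[OF dN[OF t] DERIV_power[OF dL[OF t], of 2]]])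
         (use Lt in \<open>simp_all add: divide_simps power2_eq_square power3_eq_cube algebra_simps\<close>)
    show ?thesis
      unfolding G1_def[abs_def] g1_def
      by (rule DERIV_cong[OF DERIV_cmult[OF DERIV_add[OF DERIV_cmult[OF a1] DERIV_cmult[OF DERIV_diff[OF a2 a3]]]]]) simp
  qed
  have Fg1: "\<bar>F t\<bar> \<le> g1 t" if "0 < t" "t \<le> s" for t
  proof -
    have t: "0 < t" "t \<le> \<delta>" using that s by auto
    have Lt: "0 < L t" using Lpos[OF t] .
    let ?\<Theta> = "N t - t * N1 t + \<epsilon> * (L t - t * L1 t)"
    have \<Theta>: "0 \<le> ?\<Theta>" using N1le[OF t] L1le[OF t] \<epsilon> by simp
    have 1: "(t / s)\<^sup>2 * (?\<Theta> / (t * L t)\<^sup>2) \<le> (1 / (s\<^sup>2 * (L s)\<^sup>2)) * ?\<Theta>"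
    proof -
      have "(t / s)\<^sup>2 * (?\<Theta> / (t * L t)\<^sup>2) = ?\<Theta> / (s\<^sup>2 * (L t)\<^sup>2)"
        using t by (simp add: power_mult_distrib power_divide)
      also have "\<dots> \<le> ?\<Theta> / (s\<^sup>2 * (L s)\<^sup>2)"
        using \<Theta> Ls Lt L_dec[OF that] s by (intro divide_left_mono mult_left_mono power_mono) auto
      finally show ?thesis by simp
    qed
    have 2: "(t / s) * ((N1 t + \<epsilon> * L1 t) / (t * (L t)\<^sup>2)) \<le> (1 / s) * (3 * \<epsilon> * L1 t / (L t)\<^sup>2 + N1 t / (L t)\<^sup>2 - 2 * N t * L1 t / (L t) ^ 3)"
    proof -
      have "2 * N t * L1 t / (L t) ^ 3 \<le> 2 * (\<epsilon> * L t) * L1 t / (L t) ^ 3"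
        using NL[OF t] L1pos[OF t] Lt by (intro divide_right_mono mult_right_mono mult_left_mono) auto
      also have "\<dots> = 2 * \<epsilon> * L1 t / (L t)\<^sup>2" using Lt by (simp add: power2_eq_square power3_eq_cube)
      finally have "N1 t / (L t)\<^sup>2 + \<epsilon> * L1 t / (L t)\<^sup>2 \<le> 3 * \<epsilon> * L1 t / (L t)\<^sup>2 + N1 t / (L t)\<^sup>2 - 2 * N t * L1 t / (L t) ^ 3"
        by simp
      then have "(1 / s) * (N1 t / (L t)\<^sup>2 + \<epsilon> * L1 t / (L t)\<^sup>2) \<le> (1 / s) * (3 * \<epsilon> * L1 t / (L t)\<^sup>2 + N1 t / (L t)\<^sup>2 - 2 * N t * L1 t / (L t) ^ 3)"
        using s by (intro mult_left_mono) auto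
      moreover have "(t / s) * ((N1 t + \<epsilon> * L1 t) / (t * (L t)\<^sup>2)) = (1 / s) * (N1 t / (L t)\<^sup>2 + \<epsilon> * L1 t / (L t)\<^sup>2)"
        using t by (simp add: add_divide_distrib distrib_left mult.commute)
      ultimately show ?thesis by simp
    qed
    have "\<bar>F t\<bar> \<le> C * ((t / s)\<^sup>2 * (?\<Theta> / (t * L t)\<^sup>2) + (t / s) * ((N1 t + \<epsilon> * L1 t) / (t * (L t)\<^sup>2)))"
      by (rule F1[OF that])
    also have "\<dots> \<le> g1 t" unfolding g1_def using 1 2 C by (intro mult_left_mono add_mono)
    finally show ?thesis .
  qed
  have G1_nonneg: "0 \<le> G1 t" if "0 < t" "t \<le> s" for t
  proof -
    have t: "0 < t" "t \<le> \<delta>" using that s by auto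
    have Lt: "0 < L t" using Lpos[OF t] .
    have "N t / (L t)\<^sup>2 \<le> \<epsilon> * L t / (L t)\<^sup>2" using NL[OF t] by (intro divide_right_mono) auto
    also have "\<dots> \<le> 3 * \<epsilon> / L t" using Lt \<epsilon> by (simp add: power2_eq_square divide_simps)
    finally show ?thesis
      unfolding G1_def using C s t Npos[OF t] Lt \<epsilon> by (intro mult_nonneg_nonneg add_nonneg_nonneg) auto
  qed
  have g1_m [measurable]: "g1 \<in> borel_measurable borel" unfolding g1_def[abs_def] by measurable
  have I1: "(\<integral>\<^sup>+t. ennreal (g1 t) * indicator {0<..s} t \<partial>lborel) \<le> ennreal (G1 s)"
    by (rule nn_integral_FTC_at_zero[OF s(1) g1_m G1_der])
       (use Fg1 G1_nonneg in \<open>auto intro: order_trans[OF abs_ge_zero]\<close>)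
  have G1s: "G1 s \<le> 5 * C * \<epsilon> / (s * L s)"
  proof -
    have "(1 / (s\<^sup>2 * (L s)\<^sup>2)) * (s * N s + \<epsilon> * (s * L s)) \<le> (1 / (s\<^sup>2 * (L s)\<^sup>2)) * (s * (\<epsilon> * L s) + \<epsilon> * (s * L s))"
      using NL[of s] s Ls by (intro mult_left_mono add_right_mono) auto
    also have "\<dots> = 2 * \<epsilon> / (s * L s)" using s Ls by (simp add: power2_eq_square field_simps)
    finally have 1: "(1 / (s\<^sup>2 * (L s)\<^sup>2)) * (s * N s + \<epsilon> * (s * L s)) \<le> 2 * \<epsilon> / (s * L s)" .
    have 2: "(1 / s) * (3 * \<epsilon> / L s - N s / (L s)\<^sup>2) \<le> 3 * \<epsilon> / (s * L s)"
      using Npos[of s] s Ls by (simp add: right_diff_distrib)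
    have "G1 s \<le> C * (2 * \<epsilon> / (s * L s) + 3 * \<epsilon> / (s * L s))"
      unfolding G1_def using C 1 2 by (intro mult_left_mono add_mono)
    also have "\<dots> = 5 * C * \<epsilon> / (s * L s)" by (simp add: add_divide_distrib[symmetric] algebra_simps)
    finally show ?thesis .
  qed
  \<comment> \<open>The same device with t L(t), which increases, in place of L. The last term has a
    derivative proportional to 1/t^2 and pays for the weighted imaginary part, where t (N1 +
    \<epsilon> L1) <= 2 \<epsilon> L.\<close>
  define G2 where "G2 t = C * ((t * N t) / (t * L t)\<^sup>2 - 3 * \<epsilon> / (t * L t) - 2 * \<epsilon> * s / (s * L s) / t)" for t
  define g2 where "g2 t = C * ((N t - t * N1 t) / (t * L t)\<^sup>2 - 2 * (t * N t) * (L t - t * L1 t) / (t * L t) ^ 3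
     + 3 * \<epsilon> * (L t - t * L1 t) / (t * L t)\<^sup>2 + 2 * \<epsilon> * s / (s * L s) / t\<^sup>2)" for t
  have G2_der: "(G2 has_real_derivative g2 t) (at t)" if "s \<le> t" "t \<le> \<delta>" for t
  proof -
    have t: "0 < t" "t \<le> \<delta>" using that s by auto
    have fne: "t * L t \<noteq> 0" using t Lpos[OF t] by simp
    have df: "((\<lambda>t. t * L t) has_real_derivative L t - t * L1 t) (at t)"
      by (auto intro!: derivative_eq_intros dL[OF t])
    have dfN: "((\<lambda>t. t * N t) has_real_derivative N t - t * N1 t) (at t)"
      by (auto intro!: derivative_eq_intros dN[OF t])
    have a1: "((\<lambda>t. (t * N t) / (t * L t)\<^sup>2) has_real_derivative
       (N t - t * N1 t) / (t * L t)\<^sup>2 - 2 * (t * N t) * (L t - t * L1 t) / (t * L t) ^ 3) (at t)"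
      by (rule DERIV_cong[OF DERIV_divide[OF dfN DERIV_power[OF df, of 2]]])
         (use fne in \<open>simp_all add: divide_simps power2_eq_square power3_eq_cube algebra_simps\<close>)
    have a2: "((\<lambda>t. 3 * \<epsilon> / (t * L t)) has_real_derivative - (3 * \<epsilon> * (L t - t * L1 t) / (t * L t)\<^sup>2)) (at t)"
      by (rule DERIV_cong[OF DERIV_divide[OF DERIV_const df fne]]) (simp add: power2_eq_square)
    have a3: "((\<lambda>t. 2 * \<epsilon> * s / (s * L s) / t) has_real_derivative - (2 * \<epsilon> * s / (s * L s) / t\<^sup>2)) (at t)"
      by (rule DERIV_cong[OF DERIV_divide[OF DERIV_const DERIV_ident]]) (use t in \<open>simp_all add: power2_eq_square\<close>)
    show ?thesis
      unfolding G2_def[abs_def] g2_def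
      by (rule DERIV_cong[OF DERIV_cmult[OF DERIV_diff[OF DERIV_diff[OF a1 a2] a3]]]) simp
  qed
  have Fg2: "\<bar>F t\<bar> \<le> g2 t" if "s \<le> t" "t \<le> \<delta>" for t
  proof -
    have t: "0 < t" "t \<le> \<delta>" using that s by auto
    have Lt: "0 < L t" using Lpos[OF t] .
    have f: "0 < t * L t" using t Lt by simp
    have \<Theta>L: "0 \<le> L t - t * L1 t" using L1le[OF t] by simp
    have 1: "(N t - t * N1 t + \<epsilon> * (L t - t * L1 t)) / (t * L t)\<^sup>2 \<le> (N t - t * N1 t) / (t * L t)\<^sup>2
       - 2 * (t * N t) * (L t - t * L1 t) / (t * L t) ^ 3 + 3 * \<epsilon> * (L t - t * L1 t) / (t * L t)\<^sup>2"
    proof -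
      have "2 * (t * N t) * (L t - t * L1 t) / (t * L t) ^ 3 \<le> 2 * (t * (\<epsilon> * L t)) * (L t - t * L1 t) / (t * L t) ^ 3"
        using NL[OF t] t \<Theta>L f by (intro divide_right_mono mult_right_mono mult_left_mono) auto
      also have "\<dots> = 2 * \<epsilon> * (L t - t * L1 t) * (t * L t) / ((t * L t) * (t * L t)\<^sup>2)"
        by (simp add: power2_eq_square power3_eq_cube mult_ac)
      also have "\<dots> = 2 * \<epsilon> * (L t - t * L1 t) / (t * L t)\<^sup>2" using f by simp
      finally have le: "2 * (t * N t) * (L t - t * L1 t) / (t * L t) ^ 3 \<le> 2 * \<epsilon> * (L t - t * L1 t) / (t * L t)\<^sup>2" .
      have "2 * \<epsilon> * (L t - t * L1 t) / (t * L t)\<^sup>2 + \<epsilon> * (L t - t * L1 t) / (t * L t)\<^sup>2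
          = 3 * \<epsilon> * (L t - t * L1 t) / (t * L t)\<^sup>2"
        by (simp add: add_divide_distrib[symmetric])
      moreover have "a \<le> b \<Longrightarrow> b + e = c \<Longrightarrow> n + e \<le> n - a + c" for a b c e n :: real
        by linarith
      ultimately show ?thesis using le unfolding add_divide_distrib by blast
    qed
    have 2: "(s / t) * ((N1 t + \<epsilon> * L1 t) / (t * (L t)\<^sup>2)) \<le> 2 * \<epsilon> * s / (s * L s) / t\<^sup>2"
    proof -
      have "t * (N1 t + \<epsilon> * L1 t) \<le> 2 * \<epsilon> * L t"
        using N1le[OF t] NL[OF t] mult_left_mono[OF L1le[OF t] \<epsilon>] by (simp add: algebra_simps)
      then have "N1 t + \<epsilon> * L1 t \<le> 2 * \<epsilon> * L t / t" using t by (simp add: pos_le_divide_eq mult.commute)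
      then have "(s / t) * ((N1 t + \<epsilon> * L1 t) / (t * (L t)\<^sup>2)) \<le> (s / t) * ((2 * \<epsilon> * L t / t) / (t * (L t)\<^sup>2))"
        using s t Lt by (intro mult_left_mono divide_right_mono) auto
      also have "\<dots> = (2 * \<epsilon> * s / t\<^sup>2) / (t * L t)"
        using t Lt by (simp add: power2_eq_square mult_ac)
      also have "\<dots> \<le> (2 * \<epsilon> * s / t\<^sup>2) / (s * L s)"
        using f_inc[OF that] s Ls \<epsilon> f by (intro divide_left_mono) auto
      also have "\<dots> = 2 * \<epsilon> * s / (s * L s) / t\<^sup>2" by simp
      finally show ?thesis .
    qed
    have "\<bar>F t\<bar> \<le> C * ((N t - t * N1 t + \<epsilon> * (L t - t * L1 t)) / (t * L t)\<^sup>2 + (s / t) * ((N1 t + \<epsilon> * L1 t) / (t * (L t)\<^sup>2)))"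
      by (rule F2[OF that])
    also have "\<dots> \<le> g2 t" unfolding g2_def using 1 2 C by (intro mult_left_mono) linarith+
    finally show ?thesis .
  qed
  have g2_m [measurable]: "g2 \<in> borel_measurable borel" unfolding g2_def[abs_def] by measurable
  have I2: "(\<integral>\<^sup>+t. ennreal (g2 t) * indicator {s..\<delta>} t \<partial>lborel) = ennreal (G2 \<delta> - G2 s)"
    by (rule nn_integral_FTC_Icc)
       (use G2_der Fg2 s in \<open>auto intro: DERIV_subset order_trans[OF abs_ge_zero]\<close>)
  have G2d: "G2 \<delta> - G2 s \<le> 5 * C * \<epsilon> / (s * L s)"
  proof -
    have Ld: "0 < L \<delta>" using Lpos[of \<delta>] \<delta> by simp
    have "(\<delta> * N \<delta>) / (\<delta> * L \<delta>)\<^sup>2 \<le> (\<delta> * (\<epsilon> * L \<delta>)) / (\<delta> * L \<delta>)\<^sup>2"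
      using NL[of \<delta>] \<delta> by (intro divide_right_mono mult_left_mono) auto
    also have "\<dots> = \<epsilon> / (\<delta> * L \<delta>)" using \<delta> Ld by (simp add: power2_eq_square field_simps)
    also have "\<dots> \<le> 3 * \<epsilon> / (\<delta> * L \<delta>)" using \<delta> Ld \<epsilon> by (intro divide_right_mono) auto
    finally have 1: "(\<delta> * N \<delta>) / (\<delta> * L \<delta>)\<^sup>2 - 3 * \<epsilon> / (\<delta> * L \<delta>) \<le> 0" by simp
    have 2: "0 \<le> 2 * \<epsilon> * s / (s * L s) / \<delta>" using s Ls \<delta> \<epsilon> by simp
    have 3: "0 \<le> (s * N s) / (s * L s)\<^sup>2" using s Npos[of s] by simp
    have 4: "2 * \<epsilon> * s / (s * L s) / s = 2 * \<epsilon> / (s * L s)" using s by simp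
    have "G2 \<delta> - G2 s \<le> C * (3 * \<epsilon> / (s * L s) + 2 * \<epsilon> / (s * L s))"
      unfolding G2_def right_diff_distrib[symmetric] using 1 2 3 4 C by (intro mult_left_mono) linarith+
    also have "\<dots> = 5 * C * \<epsilon> / (s * L s)" by (simp add: add_divide_distrib[symmetric] algebra_simps)
    finally show ?thesis .
  qed
  have "(\<integral>\<^sup>+t. ennreal \<bar>F t\<bar> * indicator {0<..\<delta>} t \<partial>lborel) \<le>
    (\<integral>\<^sup>+t. ennreal (g1 t) * indicator {0<..s} t + ennreal (g2 t) * indicator {s..\<delta>} t \<partial>lborel)"
  proof (rule nn_integral_mono)
    fix t
    show "ennreal \<bar>F t\<bar> * indicator {0<..\<delta>} t \<le> ennreal (g1 t) * indicator {0<..s} t + ennreal (g2 t) * indicator {s..\<delta>} t"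
    proof (cases "0 < t \<and> t \<le> \<delta>")
      case True
      show ?thesis
      proof (cases "t \<le> s")
        case le: True
        have "ennreal \<bar>F t\<bar> \<le> ennreal (g1 t)" using Fg1[of t] True le by (intro ennreal_leI) auto
        then show ?thesis using True le by (auto simp: indicator_def intro: add_increasing2)
      next
        case False
        have "ennreal \<bar>F t\<bar> \<le> ennreal (g2 t)" using Fg2[of t] True False by (intro ennreal_leI) auto
        then show ?thesis using True False by (auto simp: indicator_def)
      qed
    qed (auto simp: indicator_def)
  qed
  also have "\<dots> = (\<integral>\<^sup>+t. ennreal (g1 t) * indicator {0<..s} t \<partial>lborel) + (\<integral>\<^sup>+t. ennreal (g2 t) * indicator {s..\<delta>} t \<partial>lborel)"
    by (rule nn_integral_add) measurable
  also have "\<dots> \<le> ennreal (5 * C * \<epsilon> / (s * L s)) + ennreal (5 * C * \<epsilon> / (s * L s))"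
    unfolding I2 using I1 G1s G2d by (intro add_mono order_trans[OF I1] ennreal_leI)
  also have "\<dots> = ennreal (10 * C * \<epsilon> / (s * L s))"
    using C \<epsilon> s Ls by (subst ennreal_plus[symmetric]) (auto simp: add_divide_distrib[symmetric])
  finally show ?thesis .
qed

lemma measurable_pmf_expectation:
  fixes F :: "int \<Rightarrow> real \<Rightarrow> real"
  assumes [measurable]: "\<And>z. F z \<in> borel_measurable borel"
  shows "(\<lambda>t. measure_pmf.expectation p (\<lambda>z. F z t)) \<in> borel_measurable borel"
proof -
  have "(\<lambda>w. F (snd w) (fst w)) \<in> borel_measurable (borel \<Otimes>\<^sub>M measure_pmf p)"
  proof (rule measurable_compose_countable'[where I=UNIV and f="\<lambda>i w. F i (fst w)" and g=snd])
    have "snd \<in> measurable (borel \<Otimes>\<^sub>M measure_pmf p) (measure_pmf p)"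
      by (rule measurable_snd)
    then show "snd \<in> measurable (borel \<Otimes>\<^sub>M measure_pmf p) (count_space UNIV)"
      by (simp cong: measurable_cong_sets)
  qed auto
  then have "(\<lambda>(t, z). F z t) \<in> borel_measurable (borel \<Otimes>\<^sub>M measure_pmf p)"
    by (simp add: case_prod_beta')
  then show ?thesis
    by (rule measure_pmf.borel_measurable_lebesgue_integral)
qed

section \<open>Cosine and sine parts of one-sided jumps\<close>

locale jump_weight =
  fixes p :: "int pmf" and w :: "int \<Rightarrow> real"
  assumes w_nonneg: "\<And>z. 0 \<le> w z" and w_int: "integrable (measure_pmf p) w"
begin

text \<open>\<open>Lam t\<close> is a smooth substitute for \<open>m (1 / t)\<close>, comparable to it and with derivative \<open>- Lam1 t\<close>.\<close>

definition Lam :: "real \<Rightarrow> real" where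
  "Lam t = measure_pmf.expectation p (\<lambda>z. (w z)\<^sup>2 / (1 + t * w z))"

definition Lam1 :: "real \<Rightarrow> real" where
  "Lam1 t = measure_pmf.expectation p (\<lambda>z. (w z) ^ 3 / (1 + t * w z)\<^sup>2)"

definition cosp :: "real \<Rightarrow> real" where
  "cosp t = measure_pmf.expectation p (\<lambda>z. 1 - cos (t * w z))"

definition sinp :: "real \<Rightarrow> real" where
  "sinp t = measure_pmf.expectation p (\<lambda>z. t * w z - sin (t * w z))"

lemma den_pos: "0 < t \<Longrightarrow> 0 < 1 + t * w z"
  using w_nonneg[of z] by (simp add: add_pos_nonneg)

lemma integrable_of_le:
  assumes "\<And>z. \<bar>f z\<bar> \<le> K * w z"
  shows "integrable (measure_pmf p) f"
  by (rule Bochner_Integration.integrable_bound[of _ "\<lambda>z. K * w z"])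
     (use assms w_int in \<open>auto intro!: AE_I2 intro: order_trans[OF _ abs_ge_self]\<close>)

lemma ratio_le: "0 < t \<Longrightarrow> w z / (1 + t * w z) \<le> 1 / t"
  using den_pos[of t z] by (simp add: divide_simps mult.commute)

lemma integrable_Lam: assumes "0 < t" shows "integrable (measure_pmf p) (\<lambda>z. (w z)\<^sup>2 / (1 + t * w z))"
proof (rule integrable_of_le[of _ "1 / t"])
  fix z
  have "(w z)\<^sup>2 / (1 + t * w z) = w z / (1 + t * w z) * w z" by (simp add: power2_eq_square)
  also have "\<dots> \<le> 1 / t * w z" by (intro mult_right_mono ratio_le assms w_nonneg)
  finally show "\<bar>(w z)\<^sup>2 / (1 + t * w z)\<bar> \<le> 1 / t * w z"
    using den_pos[OF assms, of z] by (simp add: abs_of_nonneg)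
qed

lemma integrable_Lam1: assumes "0 < t" shows "integrable (measure_pmf p) (\<lambda>z. (w z) ^ 3 / (1 + t * w z)\<^sup>2)"
proof (rule integrable_of_le[of _ "(1 / t)\<^sup>2"])
  fix z
  have "(w z) ^ 3 / (1 + t * w z)\<^sup>2 = (w z / (1 + t * w z))\<^sup>2 * w z"
    by (simp add: power2_eq_square power3_eq_cube)
  also have "\<dots> \<le> (1 / t)\<^sup>2 * w z"
    using den_pos[OF assms, of z] w_nonneg[of z] by (intro mult_right_mono power_mono ratio_le assms) auto
  finally show "\<bar>(w z) ^ 3 / (1 + t * w z)\<^sup>2\<bar> \<le> (1 / t)\<^sup>2 * w z"
    using w_nonneg[of z] by (simp add: abs_of_nonneg)
qed

lemma Lam_nonneg: "0 < t \<Longrightarrow> 0 \<le> Lam t"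
  unfolding Lam_def using den_pos by (intro integral_nonneg_AE) (auto simp: less_imp_le)

lemma Lam1_nonneg: "0 \<le> Lam1 t"
  unfolding Lam1_def using w_nonneg by (intro integral_nonneg_AE) auto

lemma measurable_Lam [measurable]: "Lam \<in> borel_measurable borel"
  unfolding Lam_def[abs_def] by (rule measurable_pmf_expectation) measurable

lemma measurable_Lam1 [measurable]: "Lam1 \<in> borel_measurable borel"
  unfolding Lam1_def[abs_def] by (rule measurable_pmf_expectation) measurable

text \<open>This is the derivative of t \<open>Lam t\<close>. In this form it is visibly nonnegative
  and comparable to the bound for 1 - cos, whereas \<open>Lam1\<close> matches the bound for y - sin
  y.\<close>

lemma Theta_eq:
  assumes "0 < t"
  shows "Lam t - t * Lam1 t = measure_pmf.expectation p (\<lambda>z. (w z)\<^sup>2 / (1 + t * w z)\<^sup>2)"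
    and "integrable (measure_pmf p) (\<lambda>z. (w z)\<^sup>2 / (1 + t * w z)\<^sup>2)"
proof -
  have eq: "(w z)\<^sup>2 / (1 + t * w z) - t * ((w z) ^ 3 / (1 + t * w z)\<^sup>2) = (w z)\<^sup>2 / (1 + t * w z)\<^sup>2" for z
  proof -
    have d: "1 + t * w z \<noteq> 0" using den_pos[OF assms, of z] by simp
    have "(w z)\<^sup>2 / (1 + t * w z) = (w z)\<^sup>2 * (1 + t * w z) / (1 + t * w z)\<^sup>2"
      using d by (simp add: power2_eq_square)
    then show ?thesis by (simp add: diff_divide_distrib[symmetric] power2_eq_square power3_eq_cube algebra_simps)
  qed
  show "integrable (measure_pmf p) (\<lambda>z. (w z)\<^sup>2 / (1 + t * w z)\<^sup>2)"
    unfolding eq[symmetric] by (intro Bochner_Integration.integrable_diff integrable_mult_right integrable_Lam integrable_Lam1 assms)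
  show "Lam t - t * Lam1 t = measure_pmf.expectation p (\<lambda>z. (w z)\<^sup>2 / (1 + t * w z)\<^sup>2)"
    unfolding eq[symmetric] Lam_def Lam1_def
    by (subst Bochner_Integration.integral_diff)
       (auto intro!: integrable_mult_right integrable_Lam integrable_Lam1 assms simp del: times_divide_eq_right)
qed

lemma t_Lam1_le: assumes "0 < t" shows "t * Lam1 t \<le> Lam t"
proof -
  have "0 \<le> Lam t - t * Lam1 t"
    unfolding Theta_eq(1)[OF assms] by (intro integral_nonneg_AE) auto
  then show ?thesis by simp
qed

lemma Lam_antimono: assumes "0 < s" "s \<le> t" shows "Lam t \<le> Lam s"
  unfolding Lam_def
proof (rule integral_mono)
  fix z
  show "(w z)\<^sup>2 / (1 + t * w z) \<le> (w z)\<^sup>2 / (1 + s * w z)"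
    using assms den_pos[of s z] den_pos[of t z] w_nonneg[of z]
    by (intro divide_left_mono add_left_mono mult_right_mono mult_pos_pos) auto
qed (use assms integrable_Lam in auto)

lemma Lam_diff:
  assumes "0 < s" "0 < t"
  shows "Lam s - Lam t = - (s - t) * measure_pmf.expectation p (\<lambda>z. (w z) ^ 3 / ((1 + s * w z) * (1 + t * w z)))"
proof -
  have eq: "(w z)\<^sup>2 / (1 + s * w z) - (w z)\<^sup>2 / (1 + t * w z) =
      - (s - t) * ((w z) ^ 3 / ((1 + s * w z) * (1 + t * w z)))" for z
    using den_pos[of s z] den_pos[of t z] assms
    by (simp add: divide_simps) (simp add: power2_eq_square power3_eq_cube algebra_simps)
  have "Lam s - Lam t = measure_pmf.expectation p (\<lambda>z. (w z)\<^sup>2 / (1 + s * w z) - (w z)\<^sup>2 / (1 + t * w z))"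
    unfolding Lam_def by (rule Bochner_Integration.integral_diff[symmetric]) (use assms integrable_Lam in auto)
  also have "\<dots> = - (s - t) * measure_pmf.expectation p (\<lambda>z. (w z) ^ 3 / ((1 + s * w z) * (1 + t * w z)))"
    unfolding eq by (rule integral_mult_right_zero)
  finally show ?thesis .
qed

lemma Lam_deriv:
  assumes t: "0 < t"
  shows "(Lam has_real_derivative - Lam1 t) (at t)"
  unfolding DERIV_def tendsto_at_iff_sequentially
proof (intro allI impI)
  fix h :: "nat \<Rightarrow> real"
  assume h: "\<forall>i. h i \<in> UNIV - {0}" "h \<longlonglongrightarrow> 0"
  \<comment> \<open>Cutting the increments at -t/2 keeps t + k at least t/2, so one integrable
    majorant serves all indices; the cut is eventually inactive.\<close>
  define k where "k i = max (h i) (- t / 2)" for i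
  have k_lim: "k \<longlonglongrightarrow> 0"
    using tendsto_max[OF h(2) tendsto_const[of "- t / 2"]] t unfolding k_def by (simp add: max_def)
  have tk: "t + k i \<ge> t / 2" for i by (simp add: k_def)
  let ?q = "\<lambda>i z. (w z) ^ 3 / ((1 + (t + k i) * w z) * (1 + t * w z))"
  have "(\<lambda>i. measure_pmf.expectation p (?q i)) \<longlonglongrightarrow> measure_pmf.expectation p (\<lambda>z. (w z) ^ 3 / (1 + t * w z)\<^sup>2)"
  proof (rule integral_dominated_convergence[where w="\<lambda>z. 2 / t * (1 / t) * w z"])
    show "integrable (measure_pmf p) (\<lambda>z. 2 / t * (1 / t) * w z)" using w_int by simp
    show "AE z in measure_pmf p. (\<lambda>i. ?q i z) \<longlonglongrightarrow> (w z) ^ 3 / (1 + t * w z)\<^sup>2"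
    proof (rule AE_I2)
      fix z
      have "(\<lambda>i. ?q i z) \<longlonglongrightarrow> (w z) ^ 3 / ((1 + (t + 0) * w z) * (1 + t * w z))"
        using den_pos[OF t, of z] by (intro tendsto_intros k_lim) auto
      then show "(\<lambda>i. ?q i z) \<longlonglongrightarrow> (w z) ^ 3 / (1 + t * w z)\<^sup>2" by (simp add: power2_eq_square)
    qed
    show "AE z in measure_pmf p. norm (?q i z) \<le> 2 / t * (1 / t) * w z" for i
    proof (rule AE_I2)
      fix z
      have tk0: "0 < t + k i" using tk[of i] t by simp
      have "w z / (1 + (t + k i) * w z) \<le> 1 / (t + k i)" by (rule ratio_le[OF tk0])
      also have "\<dots> \<le> 2 / t" using tk[of i] t tk0 by (simp add: divide_simps)
      finally have a: "w z / (1 + (t + k i) * w z) \<le> 2 / t" .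
      have "?q i z = w z / (1 + (t + k i) * w z) * (w z / (1 + t * w z)) * w z"
        by (simp add: power3_eq_cube)
      also have "\<dots> \<le> 2 / t * (1 / t) * w z"
        using a den_pos[OF t, of z] den_pos[OF tk0, of z] w_nonneg[of z] t
        by (intro mult_right_mono mult_mono ratio_le) auto
      finally show "norm (?q i z) \<le> 2 / t * (1 / t) * w z"
        using den_pos[OF t, of z] den_pos[OF tk0, of z] w_nonneg[of z] by (simp add: abs_of_nonneg)
    qed
  qed auto
  then have lim: "(\<lambda>i. - measure_pmf.expectation p (?q i)) \<longlonglongrightarrow> - Lam1 t"
    unfolding Lam1_def by (rule tendsto_minus)
  have "\<forall>\<^sub>F i in sequentially. h i > - t / 2"
    using h(2) t by (intro order_tendstoD) auto
  then have "\<forall>\<^sub>F i in sequentially. - measure_pmf.expectation p (?q i) = ((\<lambda>h. (Lam (t + h) - Lam t) / h) \<circ> h) i"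
  proof eventually_elim
    case (elim i)
    then have ki: "k i = h i" by (simp add: k_def)
    have "0 < t + h i" using tk[of i] t ki by simp
    then show ?case using Lam_diff[of "t + h i" t] t h(1) by (simp add: ki)
  qed
  with lim show "((\<lambda>h. (Lam (t + h) - Lam t) / h) \<circ> h) \<longlonglongrightarrow> - Lam1 t"
    by (rule Lim_transform_eventually)
qed

lemma integrable_cosp: "integrable (measure_pmf p) (\<lambda>z. 1 - cos (t * w z))"
proof (rule integrable_bounded_pmf[where K=2])
  show "\<bar>1 - cos (t * w x)\<bar> \<le> 2" for x
    using cos_ge_minus_one[of "t * w x"] cos_le_one[of "t * w x"] by linarith
qed

lemma integrable_sinp: "integrable (measure_pmf p) (\<lambda>z. t * w z - sin (t * w z))"
  by (intro Bochner_Integration.integrable_diff integrable_mult_right w_int integrable_bounded_pmf[where K=1]) auto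

lemma cosp_nonneg: "0 \<le> cosp t"
  unfolding cosp_def by (intro integral_nonneg_AE) auto

lemma sinp_nonneg: "0 < t \<Longrightarrow> 0 \<le> sinp t"
  unfolding sinp_def using w_nonneg sin_le_self by (intro integral_nonneg_AE) auto

lemma cosp_le: assumes "0 < t" shows "cosp t \<le> 8 * t\<^sup>2 * (Lam t - t * Lam1 t)"
proof -
  have "cosp t \<le> measure_pmf.expectation p (\<lambda>z. 8 * t\<^sup>2 * ((w z)\<^sup>2 / (1 + t * w z)\<^sup>2))"
    unfolding cosp_def
  proof (rule integral_mono[OF integrable_cosp])
    show "1 - cos (t * w z) \<le> 8 * t\<^sup>2 * ((w z)\<^sup>2 / (1 + t * w z)\<^sup>2)" for z
      using one_minus_cos_le[of "t * w z"] assms w_nonneg[of z] by (simp add: power_mult_distrib)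
  qed (intro integrable_mult_right Theta_eq(2) assms)
  then show ?thesis unfolding integral_mult_right_zero Theta_eq(1)[OF assms] .
qed

lemma sinp_le: assumes "0 < t" shows "sinp t \<le> 8 * t ^ 3 * Lam1 t"
proof -
  have "sinp t \<le> measure_pmf.expectation p (\<lambda>z. 8 * t ^ 3 * ((w z) ^ 3 / (1 + t * w z)\<^sup>2))"
    unfolding sinp_def
  proof (rule integral_mono[OF integrable_sinp])
    show "t * w z - sin (t * w z) \<le> 8 * t ^ 3 * ((w z) ^ 3 / (1 + t * w z)\<^sup>2)" for z
      using self_minus_sin_le[of "t * w z"] assms w_nonneg[of z] by (simp add: power_mult_distrib)
  qed (intro integrable_mult_right integrable_Lam1 assms)
  then show ?thesis unfolding integral_mult_right_zero Lam1_def .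
qed

lemma cosp_sinp_ge: assumes "0 < t" shows "t\<^sup>2 * Lam t / 8 \<le> cosp t + sinp t"
proof -
  have "measure_pmf.expectation p (\<lambda>z. t\<^sup>2 / 8 * ((w z)\<^sup>2 / (1 + t * w z))) \<le>
      measure_pmf.expectation p (\<lambda>z. (1 - cos (t * w z)) + (t * w z - sin (t * w z)))"
  proof (rule integral_mono)
    show "t\<^sup>2 / 8 * ((w z)\<^sup>2 / (1 + t * w z)) \<le> (1 - cos (t * w z)) + (t * w z - sin (t * w z))" for z
      using cos_sin_lower[of "t * w z"] assms w_nonneg[of z] by (simp add: power_mult_distrib mult_ac)
  qed (intro integrable_mult_right integrable_Lam assms Bochner_Integration.integrable_add integrable_cosp integrable_sinp)+
  also have "\<dots> = cosp t + sinp t"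
    unfolding cosp_def sinp_def by (rule Bochner_Integration.integral_add[OF integrable_cosp integrable_sinp])
  finally show ?thesis unfolding integral_mult_right_zero Lam_def by simp
qed

end

definition posw :: "int \<Rightarrow> real" where "posw z = max 0 (real_of_int z)"
definition negw :: "int \<Rightarrow> real" where "negw z = max 0 (- real_of_int z)"

context zwalk
begin

sublocale P: jump_weight p posw
  by unfold_locales (use int_p in \<open>auto simp: posw_def[abs_def] intro!: integrable_max\<close>)

sublocale N: jump_weight p negw
  by unfold_locales (use int_p in \<open>auto simp: negw_def[abs_def] intro!: integrable_max\<close>)

text \<open>Mean zero allows t z to be added to the sine term without changing its mean. For t > 0
  each half-line then contributes a nonnegative \<open>sinp\<close>, and the two enter the imaginary
  part with opposite signs.\<close>

lemma one_minus_phi: "1 - phi p t = Complex (P.cosp t + N.cosp t) (P.sinp t - N.sinp t)"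
proof (rule complex_eqI)
  have c: "1 - cos (t * real_of_int z) = (1 - cos (t * posw z)) + (1 - cos (t * negw z))" for z
    by (auto simp: posw_def negw_def max_def)
  have s: "t * real_of_int z - sin (t * real_of_int z) = (t * posw z - sin (t * posw z)) - (t * negw z - sin (t * negw z))" for z
    by (auto simp: posw_def negw_def max_def)
  have "Re (1 - phi p t) = reA t" by (simp add: reA_def)
  also have "\<dots> = P.cosp t + N.cosp t"
    unfolding reA_eq c P.cosp_def N.cosp_def
    by (rule Bochner_Integration.integral_add[OF P.integrable_cosp N.integrable_cosp])
  finally show "Re (1 - phi p t) = Re (Complex (P.cosp t + N.cosp t) (P.sinp t - N.sinp t))" by simp
  have "Im (1 - phi p t) = - measure_pmf.expectation p (\<lambda>z. sin (t * real_of_int z))"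
    by (simp add: Im_phi)
  also have "\<dots> = measure_pmf.expectation p (\<lambda>z. t * real_of_int z - sin (t * real_of_int z))"
    by (subst Bochner_Integration.integral_diff)
       (auto intro!: integrable_mult_right int_p integrable_bounded_pmf[where K=1] simp: mean_p)
  also have "\<dots> = P.sinp t - N.sinp t"
    unfolding s P.sinp_def N.sinp_def
    by (rule Bochner_Integration.integral_diff[OF P.integrable_sinp N.integrable_sinp])
  finally show "Im (1 - phi p t) = Im (Complex (P.cosp t + N.cosp t) (P.sinp t - N.sinp t))" by simp
qed

definition Ltot :: "real \<Rightarrow> real" where "Ltot t = P.Lam t + N.Lam t"
definition Ltot1 :: "real \<Rightarrow> real" where "Ltot1 t = P.Lam1 t + N.Lam1 t"

lemma Ltot_deriv: "0 < t \<Longrightarrow> (Ltot has_real_derivative - Ltot1 t) (at t)"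
  unfolding Ltot_def[abs_def] Ltot1_def
  by (auto intro!: derivative_eq_intros P.Lam_deriv N.Lam_deriv)

lemma measurable_Ltot [measurable]: "Ltot \<in> borel_measurable borel" "Ltot1 \<in> borel_measurable borel"
  unfolding Ltot_def[abs_def] Ltot1_def[abs_def] by measurable

lemma Ltot1_nonneg: "0 \<le> Ltot1 t"
  using P.Lam1_nonneg[of t] N.Lam1_nonneg[of t] by (simp add: Ltot1_def)

lemma Ltot_antimono: "0 < s \<Longrightarrow> s \<le> t \<Longrightarrow> Ltot t \<le> Ltot s"
  using P.Lam_antimono N.Lam_antimono by (simp add: Ltot_def add_mono)

lemma Ltot_pos: assumes "0 < t" shows "0 < Ltot t"
proof -
  have "0 \<le> Ltot t" using P.Lam_nonneg N.Lam_nonneg assms by (simp add: Ltot_def)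
  moreover have "Ltot t \<noteq> 0"
  proof
    assume 0: "Ltot t = 0"
    then have "N.Lam t = 0" using P.Lam_nonneg[OF assms] N.Lam_nonneg[OF assms] by (simp add: Ltot_def)
    then have "AE z in measure_pmf p. (negw z)\<^sup>2 / (1 + t * negw z) = 0"
      unfolding N.Lam_def using N.den_pos[OF assms]
      by (subst (asm) integral_nonneg_eq_0_iff_AE[OF N.integrable_Lam[OF assms]]) (auto simp: less_imp_le)
    then have z: "negw z = 0" if "z \<in> set_pmf p" for z
      using that N.den_pos[OF assms, of z] by (auto simp: AE_measure_pmf_iff)
    obtain c where "c \<in> set_pmf p" "c < 0" using exists_negative_step by blast
    then show False using z[of c] by (simp add: negw_def)
  qed
  ultimately show ?thesis by simp
qed

text \<open>For t <= 1/n the denominators are at most 2 on jumps up to n, so half of the truncated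
  second moment is a lower bound; 3K leaves room for the strict inequality.\<close>

lemma Ltot_at_zero:
  assumes "K > 0"
  obtains \<delta> where "\<delta> > 0" "\<And>t. 0 < t \<Longrightarrow> t \<le> \<delta> \<Longrightarrow> Ltot t > K"
proof -
  obtain n where n: "n > 0" "measure_pmf.expectation p (\<lambda>z. (real_of_int z)\<^sup>2 * indicator {- int n..int n} z) \<ge> 3 * K"
    by (rule truncated_second_moment)
  show ?thesis
  proof (rule that[of "1 / real n"])
    fix t :: real assume t: "0 < t" "t \<le> 1 / real n"
    have "1 / 2 * (3 * K) \<le> 1 / 2 * measure_pmf.expectation p (\<lambda>z. (real_of_int z)\<^sup>2 * indicator {- int n..int n} z)"
      using n by simp
    also have "\<dots> = measure_pmf.expectation p (\<lambda>z. 1 / 2 * ((real_of_int z)\<^sup>2 * indicator {- int n..int n} z))" by simp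
    also have "\<dots> \<le> measure_pmf.expectation p (\<lambda>z. (posw z)\<^sup>2 / (1 + t * posw z) + (negw z)\<^sup>2 / (1 + t * negw z))"
    proof (rule integral_mono)
      have pt: "1 / 2 * ((real_of_int z)\<^sup>2 * indicator {- int n..int n} z) \<le> (posw z)\<^sup>2 / (1 + t * posw z) + (negw z)\<^sup>2 / (1 + t * negw z)" for z
      proof -
        have sum: "(posw z)\<^sup>2 / (1 + t * posw z) + (negw z)\<^sup>2 / (1 + t * negw z) = (real_of_int z)\<^sup>2 / (1 + t * \<bar>real_of_int z\<bar>)"
          by (auto simp: posw_def negw_def max_def)
        show ?thesis
        proof (cases "z \<in> {- int n..int n}")
          case True
          then have "\<bar>real_of_int z\<bar> \<le> real n" by auto
          then have "t * \<bar>real_of_int z\<bar> \<le> 1 / real n * real n" using t by (intro mult_mono) auto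
          then have "1 + t * \<bar>real_of_int z\<bar> \<le> 2" using n by simp
          then have "(real_of_int z)\<^sup>2 / 2 \<le> (real_of_int z)\<^sup>2 / (1 + t * \<bar>real_of_int z\<bar>)"
            using t by (intro divide_left_mono mult_pos_pos) (auto intro: add_pos_nonneg)
          then show ?thesis unfolding sum using True by simp
        next
          case False
          then show ?thesis unfolding sum using t by simp
        qed
      qed
      show "1 / 2 * ((real_of_int z)\<^sup>2 * indicator {- int n..int n} z) \<le> (posw z)\<^sup>2 / (1 + t * posw z) + (negw z)\<^sup>2 / (1 + t * negw z)" for z
        by (rule pt)
      show i: "integrable (measure_pmf p) (\<lambda>z. (posw z)\<^sup>2 / (1 + t * posw z) + (negw z)\<^sup>2 / (1 + t * negw z))"
        by (intro Bochner_Integration.integrable_add P.integrable_Lam N.integrable_Lam t)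
      show "integrable (measure_pmf p) (\<lambda>z. 1 / 2 * ((real_of_int z)\<^sup>2 * indicator {- int n..int n} z))"
      proof (rule Bochner_Integration.integrable_bound[OF i])
        have "\<bar>1 / 2 * ((real_of_int z)\<^sup>2 * indicator {- int n..int n} z)\<bar> \<le>
            \<bar>(posw z)\<^sup>2 / (1 + t * posw z) + (negw z)\<^sup>2 / (1 + t * negw z)\<bar>" for z
          by (rule order_trans[OF _ order_trans[OF pt abs_ge_self]]) (simp add: indicator_def)
        then show "AE z in measure_pmf p. norm (1 / 2 * ((real_of_int z)\<^sup>2 * indicator {- int n..int n} z)) \<le>
            norm ((posw z)\<^sup>2 / (1 + t * posw z) + (negw z)\<^sup>2 / (1 + t * negw z))"
          unfolding real_norm_def by (intro AE_I2)
      qed simp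
    qed
    also have "\<dots> = Ltot t"
      unfolding Ltot_def P.Lam_def N.Lam_def
      by (rule Bochner_Integration.integral_add[OF P.integrable_Lam[OF t(1)] N.integrable_Lam[OF t(1)]])
    finally show "Ltot t > K" using assms by simp
  qed (use n in simp)
qed

end

text \<open>The crude bound |A - B|/Q^2 would mix real and imaginary parts, whose weights must stay
  apart. The difference is -(A - B) W with W = 1/(AB), and the imaginary part of AB is a1 b2 + a2
  b1. So every term of the first bound keeps a factor from the real parts and every term of the
  second one from the imaginary parts.\<close>

lemma resolvent_difference_bounds:
  fixes a1 a2 b1 b2 Q :: real
  assumes Q: "Q > 0" "Q \<le> norm (Complex a1 a2)" "Q \<le> norm (Complex b1 b2)" and pos: "0 \<le> a1" "0 \<le> b1"
  shows "\<bar>Re (1 / Complex a1 a2 - 1 / Complex b1 b2)\<bar> \<le> \<bar>a1 - b1\<bar> / Q\<^sup>2 + \<bar>a2 - b2\<bar> * (a1 + b1) / Q ^ 3"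
    and "\<bar>Im (1 / Complex a1 a2 - 1 / Complex b1 b2)\<bar> \<le> \<bar>a2 - b2\<bar> / Q\<^sup>2 + \<bar>a1 - b1\<bar> * (\<bar>a2\<bar> + \<bar>b2\<bar>) / Q ^ 3"
proof -
  define A where "A = Complex a1 a2"
  define B where "B = Complex b1 b2"
  define \<alpha> where "\<alpha> = norm A"
  define \<beta> where "\<beta> = norm B"
  have \<alpha>\<beta>: "Q \<le> \<alpha>" "Q \<le> \<beta>" "0 < \<alpha>" "0 < \<beta>" using Q by (auto simp: A_def B_def \<alpha>_def \<beta>_def)
  have ne: "A \<noteq> 0" "B \<noteq> 0" using \<alpha>\<beta> by (auto simp: \<alpha>_def \<beta>_def)
  have comp: "\<bar>a1\<bar> \<le> \<alpha>" "\<bar>a2\<bar> \<le> \<alpha>" "\<bar>b1\<bar> \<le> \<beta>" "\<bar>b2\<bar> \<le> \<beta>"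
    using abs_Re_le_cmod[of A] abs_Im_le_cmod[of A] abs_Re_le_cmod[of B] abs_Im_le_cmod[of B]
    by (simp_all add: A_def B_def \<alpha>_def \<beta>_def)
  define W where "W = 1 / (A * B)"
  have diff: "1 / A - 1 / B = - ((A - B) * W)"
    using ne by (simp add: W_def field_simps)
  have nW: "norm W = 1 / (\<alpha> * \<beta>)" by (simp add: W_def norm_divide norm_mult \<alpha>_def \<beta>_def)
  have "\<alpha> * \<beta> \<ge> Q\<^sup>2" unfolding power2_eq_square using \<alpha>\<beta> Q by (intro mult_mono) auto
  then have nW_le: "norm W \<le> 1 / Q\<^sup>2" unfolding nW using Q(1) \<alpha>\<beta> by (intro divide_left_mono mult_pos_pos) auto
  have ReW: "\<bar>Re W\<bar> \<le> 1 / Q\<^sup>2" using abs_Re_le_cmod[of W] nW_le by linarith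
  have "(norm (A * B))\<^sup>2 = (\<alpha> * \<beta>)\<^sup>2" by (simp add: norm_mult \<alpha>_def \<beta>_def)
  moreover have "Im (1 / w) = - Im w / (norm w)\<^sup>2" for w
    by (simp add: Im_divide cmod_power2)
  moreover have "Im (A * B) = a1 * b2 + a2 * b1" by (simp add: A_def B_def)
  ultimately have ImW: "\<bar>Im W\<bar> = \<bar>a1 * b2 + a2 * b1\<bar> / (\<alpha> * \<beta>)\<^sup>2"
    unfolding W_def by (simp only: abs_divide abs_minus_cancel abs_power2)
  have tri: "\<bar>a1 * b2 + a2 * b1\<bar> \<le> a1 * \<bar>b2\<bar> + \<bar>a2\<bar> * b1"
    using abs_triangle_ineq[of "a1 * b2" "a2 * b1"] pos by (simp add: abs_mult)
  have q3: "\<alpha>\<^sup>2 * \<beta> \<ge> Q ^ 3" "\<alpha> * \<beta>\<^sup>2 \<ge> Q ^ 3"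
  proof -
    have "Q\<^sup>2 * Q \<le> \<alpha>\<^sup>2 * \<beta>" "Q * Q\<^sup>2 \<le> \<alpha> * \<beta>\<^sup>2" using \<alpha>\<beta> Q by (auto intro!: mult_mono power_mono)
    then show "\<alpha>\<^sup>2 * \<beta> \<ge> Q ^ 3" "\<alpha> * \<beta>\<^sup>2 \<ge> Q ^ 3" by (simp_all add: power2_eq_square power3_eq_cube)
  qed
  have Im1: "\<bar>Im W\<bar> \<le> (a1 + b1) / Q ^ 3"
  proof -
    have "\<bar>Im W\<bar> \<le> (a1 * \<beta> + \<alpha> * b1) / (\<alpha> * \<beta>)\<^sup>2"
      unfolding ImW using tri comp pos
      by (intro divide_right_mono order_trans[OF tri] add_mono mult_left_mono mult_right_mono) auto
    also have "\<dots> = a1 / (\<alpha>\<^sup>2 * \<beta>) + b1 / (\<alpha> * \<beta>\<^sup>2)"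
      using \<alpha>\<beta> by (simp add: add_divide_distrib power2_eq_square mult_ac)
    also have "\<dots> \<le> a1 / Q ^ 3 + b1 / Q ^ 3"
      using q3 Q pos by (intro add_mono divide_left_mono) (auto intro!: mult_pos_pos \<alpha>\<beta>)
    finally show ?thesis by (simp add: add_divide_distrib)
  qed
  have Im2: "\<bar>Im W\<bar> \<le> (\<bar>a2\<bar> + \<bar>b2\<bar>) / Q ^ 3"
  proof -
    have "\<bar>Im W\<bar> \<le> (\<alpha> * \<bar>b2\<bar> + \<bar>a2\<bar> * \<beta>) / (\<alpha> * \<beta>)\<^sup>2"
      unfolding ImW using tri comp pos
      by (intro divide_right_mono order_trans[OF tri] add_mono mult_left_mono mult_right_mono) auto
    also have "\<dots> = \<bar>b2\<bar> / (\<alpha> * \<beta>\<^sup>2) + \<bar>a2\<bar> / (\<alpha>\<^sup>2 * \<beta>)"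
      using \<alpha>\<beta> by (simp add: add_divide_distrib power2_eq_square mult_ac)
    also have "\<dots> \<le> \<bar>b2\<bar> / Q ^ 3 + \<bar>a2\<bar> / Q ^ 3"
      using q3 Q by (intro add_mono divide_left_mono) (auto intro!: mult_pos_pos \<alpha>\<beta>)
    finally show ?thesis by (simp add: add_divide_distrib)
  qed
  have Re_eq: "Re (1 / A - 1 / B) = - ((a1 - b1) * Re W - (a2 - b2) * Im W)"
    and Im_eq: "Im (1 / A - 1 / B) = - ((a1 - b1) * Im W + (a2 - b2) * Re W)"
    unfolding diff by (simp_all add: A_def B_def)
  have "\<bar>Re (1 / A - 1 / B)\<bar> \<le> \<bar>a1 - b1\<bar> * \<bar>Re W\<bar> + \<bar>a2 - b2\<bar> * \<bar>Im W\<bar>"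
    unfolding Re_eq abs_minus_cancel abs_mult[symmetric] by (rule abs_triangle_ineq4)
  also have "\<dots> \<le> \<bar>a1 - b1\<bar> * (1 / Q\<^sup>2) + \<bar>a2 - b2\<bar> * ((a1 + b1) / Q ^ 3)"
    by (intro add_mono mult_left_mono ReW Im1) auto
  finally show "\<bar>Re (1 / Complex a1 a2 - 1 / Complex b1 b2)\<bar> \<le> \<bar>a1 - b1\<bar> / Q\<^sup>2 + \<bar>a2 - b2\<bar> * (a1 + b1) / Q ^ 3"
    by (simp add: A_def B_def)
  have "\<bar>Im (1 / A - 1 / B)\<bar> \<le> \<bar>a1 - b1\<bar> * \<bar>Im W\<bar> + \<bar>a2 - b2\<bar> * \<bar>Re W\<bar>"
    unfolding Im_eq abs_minus_cancel abs_mult[symmetric] by (rule abs_triangle_ineq)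
  also have "\<dots> \<le> \<bar>a1 - b1\<bar> * ((\<bar>a2\<bar> + \<bar>b2\<bar>) / Q ^ 3) + \<bar>a2 - b2\<bar> * (1 / Q\<^sup>2)"
    by (intro add_mono mult_left_mono ReW Im2) auto
  finally show "\<bar>Im (1 / Complex a1 a2 - 1 / Complex b1 b2)\<bar> \<le> \<bar>a2 - b2\<bar> / Q\<^sup>2 + \<bar>a1 - b1\<bar> * (\<bar>a2\<bar> + \<bar>b2\<bar>) / Q ^ 3"
    by (simp add: A_def B_def)
qed

text \<open>Real minus imaginary part is at most twice the modulus, and it contains
  \<open>cn\<close> and \<open>sn\<close> with the same sign. Only \<open>sp\<close> can cancel
  them, and the factor 200 prevents it: b/8 - 8a >= (a + b)/16 once a + b >= 200a.\<close>

lemma complex_lower_bound: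
  fixes t :: real
  assumes "t\<^sup>2 * Lm / 8 \<le> cn + sn" "0 \<le> cp" "sp \<le> 8 * t\<^sup>2 * N" "200 * N \<le> N + Lm" "0 \<le> N"
  shows "t\<^sup>2 * (N + Lm) / 32 \<le> norm (Complex (cp + cn) (sp - sn))"
proof -
  let ?w = "Complex (cp + cn) (sp - sn)"
  define a where "a = t\<^sup>2 * N"
  define b where "b = t\<^sup>2 * Lm"
  have ab: "t\<^sup>2 * (N + Lm) = a + b" by (simp add: a_def b_def distrib_left)
  have "t\<^sup>2 * (200 * N) \<le> t\<^sup>2 * (N + Lm)" using assms(4) by (intro mult_left_mono) auto
  then have "200 * a \<le> a + b" by (simp add: ab a_def)
  moreover have "0 \<le> a" using assms(5) by (simp add: a_def)
  ultimately have "(a + b) / 16 \<le> b / 8 - 8 * a" by simp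
  then have "t\<^sup>2 * (N + Lm) / 16 \<le> t\<^sup>2 * Lm / 8 - 8 * t\<^sup>2 * N"
    unfolding ab by (simp add: a_def b_def)
  also have "\<dots> \<le> Re ?w - Im ?w" using assms by simp
  also have "\<dots> \<le> 2 * norm ?w"
    using abs_Re_le_cmod[of ?w] abs_Im_le_cmod[of ?w] by linarith
  finally show ?thesis by simp
qed

section \<open>Fourier representation of the potential when negative jumps dominate\<close>

locale zwalk_neg = zwalk +
  assumes right_small: "\<And>\<epsilon>. 0 < \<epsilon> \<Longrightarrow> \<exists>\<delta>>0. \<forall>t. 0 < t \<longrightarrow> t \<le> \<delta> \<longrightarrow> P.Lam t \<le> \<epsilon> * Ltot t"
begin

text \<open>The sine parts of positive and negative jumps could cancel in the imaginary part; the
  dominance of the negative jumps excludes this near 0.\<close>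

lemma one_minus_phi_lower:
  obtains \<delta> where "0 < \<delta>" "\<delta> \<le> pi"
    "\<And>t. 0 < t \<Longrightarrow> t \<le> \<delta> \<Longrightarrow> t\<^sup>2 * Ltot t / 32 \<le> norm (1 - phi p t)"
proof -
  obtain \<delta> where \<delta>: "\<delta> > 0" "\<And>t. 0 < t \<Longrightarrow> t \<le> \<delta> \<Longrightarrow> P.Lam t \<le> 1 / 200 * Ltot t"
    using right_small[of "1 / 200"] by auto
  show ?thesis
  proof (rule that[of "min \<delta> pi"])
    fix t assume t: "0 < t" "t \<le> min \<delta> pi"
    have "P.sinp t \<le> 8 * t ^ 3 * P.Lam1 t" by (rule P.sinp_le[OF t(1)])
    also have "\<dots> = 8 * t\<^sup>2 * (t * P.Lam1 t)" by (simp add: power2_eq_square power3_eq_cube)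
    also have "\<dots> \<le> 8 * t\<^sup>2 * P.Lam t" by (intro mult_left_mono P.t_Lam1_le t) auto
    finally have sp: "P.sinp t \<le> 8 * t\<^sup>2 * P.Lam t" .
    have "t\<^sup>2 * (P.Lam t + N.Lam t) / 32 \<le> norm (Complex (P.cosp t + N.cosp t) (P.sinp t - N.sinp t))"
      by (rule complex_lower_bound)
         (use N.cosp_sinp_ge[OF t(1)] P.cosp_nonneg sp \<delta>(2)[of t] t P.Lam_nonneg[OF t(1)] in \<open>auto simp: Ltot_def\<close>)
    then show "t\<^sup>2 * Ltot t / 32 \<le> norm (1 - phi p t)"
      by (simp add: Ltot_def one_minus_phi)
  qed (use \<delta> in auto)
qed

text \<open>The Abel means of the defining series are Fourier integrals over 1 - r phi, and r tends
  to 1 under the majorant \<open>W\<close>. Its singular term is a multiple of Ltot1/Ltot^2, the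
  derivative of 1/Ltot, and is therefore integrable at 0.\<close>

lemma pot_fourier:
  shows "set_integrable lborel {0..pi} (\<lambda>t. Re ((1 - cis (real_of_int x * t)) / (1 - phi p t)))"
    and "pot x = (LBINT t:{0..pi}. Re ((1 - cis (real_of_int x * t)) / (1 - phi p t))) / pi"
proof -
  let ?x = "real_of_int x"
  obtain \<delta> where \<delta>: "0 < \<delta>" "\<delta> \<le> pi"
    "\<And>t. 0 < t \<Longrightarrow> t \<le> \<delta> \<Longrightarrow> t\<^sup>2 * Ltot t / 32 \<le> norm (1 - phi p t)"
    using one_minus_phi_lower by blast
  obtain c where c: "c > 0" "\<And>t. \<delta> \<le> t \<Longrightarrow> t \<le> pi \<Longrightarrow> reA t \<ge> c"
    using reA_bounded_below[OF \<delta>(1,2)] by blast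
  \<comment> \<open>The 32 stems from the lower bound for 1 - phi; 16384 = 2 * 8 * 32^2 combines the
    sine bound with the squared denominator; 6/c covers [\<delta>, pi].\<close>
  define W where "W t = indicator {0..pi} t * (32 * ?x\<^sup>2 / Ltot \<delta> + 6 / c) +
     16384 * \<bar>?x\<bar> * (Ltot1 t / (Ltot t)\<^sup>2 * indicator {0<..\<delta>} t)" for t
  have Ld: "0 < Ltot \<delta>" using \<delta> by (simp add: Ltot_pos)
  have W_int: "integrable lborel W"
  proof -
    have "integrable lborel (\<lambda>t. Ltot1 t / (Ltot t)\<^sup>2 * indicator {0<..\<delta>} t)"
    proof (rule integrableI_nonneg)
      have "(\<integral>\<^sup>+t. ennreal (Ltot1 t / (Ltot t)\<^sup>2 * indicator {0<..\<delta>} t) \<partial>lborel) =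
          (\<integral>\<^sup>+t. ennreal (Ltot1 t / (Ltot t)\<^sup>2) * indicator {0<..\<delta>} t \<partial>lborel)"
        by (intro nn_integral_cong) (auto simp: indicator_def)
      also have "\<dots> \<le> ennreal (1 / Ltot \<delta>)"
      proof (rule nn_integral_FTC_at_zero[OF \<delta>(1)])
        fix t assume t: "0 < t" "t \<le> \<delta>"
        have Lt: "0 < Ltot t" using Ltot_pos[OF t(1)] .
        show "((\<lambda>t. 1 / Ltot t) has_real_derivative Ltot1 t / (Ltot t)\<^sup>2) (at t)"
          by (rule DERIV_cong[OF DERIV_divide[OF DERIV_const Ltot_deriv[OF t(1)]]])
             (use Lt in \<open>auto simp: power2_eq_square\<close>)
        show "0 \<le> Ltot1 t / (Ltot t)\<^sup>2" "0 \<le> 1 / Ltot t" using Lt Ltot1_nonneg[of t] by auto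
      qed measurable
      finally show "(\<integral>\<^sup>+t. ennreal (Ltot1 t / (Ltot t)\<^sup>2 * indicator {0<..\<delta>} t) \<partial>lborel) < \<infinity>"
        by (simp add: le_less_trans)
    qed (use Ltot1_nonneg in auto)
    then show ?thesis
      unfolding W_def[abs_def]
      by (intro Bochner_Integration.integrable_add integrable_mult_right integrable_mult_left integrable_real_indicator) auto
  qed
  define w where "w r t = 1 - complex_of_real r * phi p t" for r t
  have bound: "\<bar>indicator {0..pi} t * Re ((1 - cis (?x * t)) / w r t)\<bar> \<le> W t" if r: "1 / 2 \<le> r" "r \<le> 1" for r t
  proof (cases "0 < t \<and> t \<le> pi")
    case False
    then have "indicator {0..pi} t * Re ((1 - cis (?x * t)) / w r t) = 0"
      by (auto simp: indicator_def)
    moreover have "0 \<le> W t" using Ld c Ltot1_nonneg by (auto simp: W_def)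
    ultimately show ?thesis by (simp only: abs_zero)
  next
    case True
    let ?A = "1 - phi p t"
    \<comment> \<open>Since 1 - r phi = (1 - r) + r (1 - phi), its real part is at least, and its
      imaginary part exactly, r times that of 1 - phi. With r >= 1/2 the bounds at r = 1 carry over
      with a factor 2.\<close>
    have Re_w: "Re (w r t) \<ge> r * Re ?A" using r by (simp add: w_def algebra_simps)
    have Im_w: "Im (w r t) = r * Im ?A" by (simp add: w_def)
    have ReA: "Re ?A = reA t" by (simp add: reA_def)
    have reA: "0 < reA t" using reA_pos True by simp
    have rA: "0 \<le> r * Re ?A" unfolding ReA using r reA by simp
    have "(r * norm ?A)\<^sup>2 = (r * Re ?A)\<^sup>2 + (r * Im ?A)\<^sup>2"
      by (simp add: power_mult_distrib cmod_power2 distrib_left)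
    also have "\<dots> \<le> (Re (w r t))\<^sup>2 + (Im (w r t))\<^sup>2"
      unfolding Im_w by (intro add_mono power_mono[OF Re_w rA] order_refl)
    also have "\<dots> = (norm (w r t))\<^sup>2" by (simp add: cmod_power2)
    finally have "r * norm ?A \<le> norm (w r t)" by (rule power2_le_imp_le) simp
    moreover have "1 / 2 * norm ?A \<le> r * norm ?A" using r by (intro mult_right_mono) auto
    ultimately have nw: "norm ?A / 2 \<le> norm (w r t)" "r * norm ?A \<le> norm (w r t)" by simp_all
    have nA: "0 < norm ?A" using complex_Re_le_cmod[of ?A] reA ReA by linarith
    have nw0: "0 < norm (w r t)" using nw nA by linarith
    have R1: "\<bar>Re (1 / w r t)\<bar> \<le> 2 / norm ?A"
    proof -
      have "\<bar>Re (1 / w r t)\<bar> \<le> 1 / norm (w r t)"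
        using abs_Re_le_cmod[of "1 / w r t"] by (simp add: norm_divide)
      also have "\<dots> \<le> 1 / (norm ?A / 2)" using nw nA nw0 by (intro divide_left_mono) auto
      finally show ?thesis by simp
    qed
    have I1: "\<bar>Im (1 / w r t)\<bar> \<le> 2 * \<bar>Im ?A\<bar> / (norm ?A)\<^sup>2"
    proof -
      have "Im (1 / u) = - Im u / (norm u)\<^sup>2" for u
        by (simp add: Im_divide cmod_power2)
      moreover have "\<bar>r\<bar> = r" using r by simp
      ultimately have "\<bar>Im (1 / w r t)\<bar> = r * \<bar>Im ?A\<bar> / (norm (w r t))\<^sup>2"
        by (simp only: abs_divide abs_minus_cancel abs_power2 abs_mult Im_w)
      also have "\<dots> \<le> r * \<bar>Im ?A\<bar> / (r * norm ?A)\<^sup>2"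
        using nw r nA nw0 by (intro divide_left_mono power_mono) auto
      also have "\<dots> = (1 / r) * (\<bar>Im ?A\<bar> / (norm ?A)\<^sup>2)"
        using r by (simp add: power2_eq_square)
      also have "\<dots> \<le> 2 * (\<bar>Im ?A\<bar> / (norm ?A)\<^sup>2)"
        using r by (intro mult_right_mono) (auto simp: divide_simps)
      finally show ?thesis by simp
    qed
    have div: "(1 - cis (?x * t)) / w r t = (1 - cis (?x * t)) * (1 / w r t)" by simp
    have "Re ((1 - cis y) * u) = (1 - cos y) * Re u + sin y * Im u" for y u by simp
    then have "Re ((1 - cis (?x * t)) / w r t) = (1 - cos (?x * t)) * Re (1 / w r t) + sin (?x * t) * Im (1 / w r t)"
      by (simp only: div)
    then have "\<bar>Re ((1 - cis (?x * t)) / w r t)\<bar> \<le> \<bar>(1 - cos (?x * t)) * Re (1 / w r t)\<bar> + \<bar>sin (?x * t) * Im (1 / w r t)\<bar>"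
      using abs_triangle_ineq by metis
    also have "\<dots> \<le> (1 - cos (?x * t)) * (2 / norm ?A) + \<bar>sin (?x * t)\<bar> * (2 * \<bar>Im ?A\<bar> / (norm ?A)\<^sup>2)"
      unfolding abs_mult using R1 I1 by (intro add_mono mult_mono) auto
    also have "\<dots> \<le> W t"
    proof (cases "t \<le> \<delta>")
      case tle: True
      have t: "0 < t" using True by simp
      have Lt: "0 < Ltot t" by (rule Ltot_pos[OF t])
      have lowA: "t\<^sup>2 * Ltot t / 32 \<le> norm ?A" by (rule \<delta>(3)[OF t tle])
      have low0: "0 < t\<^sup>2 * Ltot t / 32" using t Lt by simp
      have c2: "1 - cos (?x * t) \<le> (?x * t)\<^sup>2 / 2" by (rule one_minus_cos_quadratic)
      have "(1 - cos (?x * t)) * (2 / norm ?A) \<le> (?x * t)\<^sup>2 / 2 * (2 / (t\<^sup>2 * Ltot t / 32))"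
        using c2 lowA low0 nA by (intro mult_mono divide_left_mono mult_pos_pos) auto
      also have "\<dots> = 32 * ?x\<^sup>2 / Ltot t" using t by (simp add: power_mult_distrib)
      also have "\<dots> \<le> 32 * ?x\<^sup>2 / Ltot \<delta>"
        using Ltot_antimono[OF t tle] Ld Lt by (intro divide_left_mono) auto
      also have "\<dots> \<le> 32 * ?x\<^sup>2 / Ltot \<delta> + 6 / c" using c by simp
      finally have 1: "(1 - cos (?x * t)) * (2 / norm ?A) \<le> 32 * ?x\<^sup>2 / Ltot \<delta> + 6 / c" .
      have ImA: "\<bar>Im ?A\<bar> \<le> 8 * t ^ 3 * Ltot1 t"
        using P.sinp_le[OF t] N.sinp_le[OF t] P.sinp_nonneg[OF t] N.sinp_nonneg[OF t]
        unfolding one_minus_phi Ltot1_def by (simp add: abs_le_iff distrib_left)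
      have "\<bar>sin (?x * t)\<bar> \<le> \<bar>?x\<bar> * t" using abs_sin_x_le_abs_x[of "?x * t"] t by (simp add: abs_mult)
      then have "\<bar>sin (?x * t)\<bar> * (2 * \<bar>Im ?A\<bar> / (norm ?A)\<^sup>2) \<le>
          (\<bar>?x\<bar> * t) * (2 * (8 * t ^ 3 * Ltot1 t) / (t\<^sup>2 * Ltot t / 32)\<^sup>2)"
        using ImA lowA low0 t nA Ltot1_nonneg[of t] by (intro mult_mono frac_le power_mono) auto
      also have "\<dots> = 16384 * \<bar>?x\<bar> * (Ltot1 t / (Ltot t)\<^sup>2)"
        using t Lt by (simp add: power2_eq_square power3_eq_cube)
      finally have 2: "\<bar>sin (?x * t)\<bar> * (2 * \<bar>Im ?A\<bar> / (norm ?A)\<^sup>2) \<le> 16384 * \<bar>?x\<bar> * (Ltot1 t / (Ltot t)\<^sup>2)" .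
      show ?thesis using add_mono[OF 1 2] True tle by (simp add: W_def)
    next
      case False
      have lowA: "c \<le> norm ?A" using c(2)[of t] False True complex_Re_le_cmod[of ?A] ReA by linarith
      have "1 - cos (?x * t) \<le> 2" using cos_ge_minus_one[of "?x * t"] by linarith
      then have 1: "(1 - cos (?x * t)) * (2 / norm ?A) \<le> 2 * (2 / c)"
        using lowA c nA by (intro mult_mono divide_left_mono) auto
      have "2 * \<bar>Im ?A\<bar> / (norm ?A)\<^sup>2 \<le> 2 * norm ?A / (norm ?A)\<^sup>2"
        using abs_Im_le_cmod[of ?A] by (intro divide_right_mono mult_left_mono) auto
      also have "\<dots> = 2 / norm ?A" using nA by (simp add: power2_eq_square)
      also have "\<dots> \<le> 2 / c" using lowA c nA by (intro divide_left_mono) auto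
      finally have "\<bar>sin (?x * t)\<bar> * (2 * \<bar>Im ?A\<bar> / (norm ?A)\<^sup>2) \<le> 1 * (2 / c)"
        by (intro mult_mono) auto
      with 1 have "(1 - cos (?x * t)) * (2 / norm ?A) + \<bar>sin (?x * t)\<bar> * (2 * \<bar>Im ?A\<bar> / (norm ?A)\<^sup>2) \<le> 6 / c"
        by simp
      then show ?thesis using True False Ld by (simp add: W_def add_increasing)
    qed
    finally show ?thesis using True by simp
  qed
  have meas: "(\<lambda>t. indicator {0..pi} t * Re ((1 - cis (?x * t)) / w r t)) \<in> borel_measurable lborel" for r
    unfolding w_def cis_conv_exp by measurable
  show int: "set_integrable lborel {0..pi} (\<lambda>t. Re ((1 - cis (?x * t)) / (1 - phi p t)))"
    unfolding set_integrable_def real_scaleR_def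
  proof (rule Bochner_Integration.integrable_bound[OF W_int])
    show "(\<lambda>t. indicat_real {0..pi} t * Re ((1 - cis (?x * t)) / (1 - phi p t))) \<in> borel_measurable lborel"
      using meas[of 1] by (simp add: w_def)
    show "AE t in lborel. norm (indicat_real {0..pi} t * Re ((1 - cis (?x * t)) / (1 - phi p t))) \<le> norm (W t)"
      using bound[of 1] by (intro AE_I2) (auto simp: w_def simp del: Re_divide intro: order_trans[OF _ abs_ge_self])
  qed
  define r where "r k = 1 - 1 / real (k + 2)" for k :: nat
  have r: "0 \<le> r k" "r k < 1" "1 / 2 \<le> r k" for k by (auto simp: r_def divide_simps)
  have r_lim: "r \<longlonglongrightarrow> 1"
  proof -
    have "(\<lambda>k. 1 / real (k + 2)) \<longlonglongrightarrow> 0"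
      using LIMSEQ_ignore_initial_segment[OF lim_1_over_n, of 2] by simp
    from tendsto_diff[OF tendsto_const this, of 1] show ?thesis by (simp add: r_def[abs_def])
  qed
  have L1: "(\<lambda>k. \<Sum>n. r k ^ n * (pn p n 0 - pn p n x)) \<longlonglongrightarrow> pot x"
    by (rule abel_limit[OF pot_sums r(1,2) r_lim])
  have "(\<Sum>n. r k ^ n * (pn p n 0 - pn p n x)) = (LBINT t:{0..pi}. Re ((1 - cis (?x * t)) / w (r k) t)) / pi" for k
  proof -
    have i: "set_integrable lborel {0..pi} (\<lambda>t. Re (cis (real_of_int y * t) / w (r k) t))" for y
    proof -
      have "continuous_on {0..pi} (\<lambda>t. Re (cis (real_of_int y * t) * (1 / w (r k) t)))"
        unfolding w_def by (intro continuous_on_Re continuous_on_mult continuous_on_resolvent r continuous_intros)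
      then show ?thesis by (intro borel_integrable_atLeastAtMost') simp
    qed
    have "(\<Sum>n. r k ^ n * (pn p n 0 - pn p n x)) = (\<Sum>n. r k ^ n * pn p n 0) - (\<Sum>n. r k ^ n * pn p n x)"
      unfolding right_diff_distrib by (rule suminf_diff[symmetric]) (intro summable_power_pn r)+
    also have "\<dots> = ((LBINT t:{0..pi}. Re (cis (real_of_int 0 * t) / w (r k) t)) - (LBINT t:{0..pi}. Re (cis (?x * t) / w (r k) t))) / pi"
      unfolding resolvent_fourier[OF r(1,2)] w_def by (simp add: diff_divide_distrib)
    also have "(LBINT t:{0..pi}. Re (cis (real_of_int 0 * t) / w (r k) t)) - (LBINT t:{0..pi}. Re (cis (?x * t) / w (r k) t))
       = (LBINT t:{0..pi}. Re (cis (real_of_int 0 * t) / w (r k) t) - Re (cis (?x * t) / w (r k) t))"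
      by (rule set_integral_diff(2)[OF i i, symmetric])
    also have "(\<lambda>t. Re (cis (real_of_int 0 * t) / w (r k) t) - Re (cis (?x * t) / w (r k) t)) = (\<lambda>t. Re ((1 - cis (?x * t)) / w (r k) t))"
      by (simp add: fun_eq_iff diff_divide_distrib del: Re_divide)
    finally show ?thesis .
  qed
  with L1 have L2: "(\<lambda>k. (LBINT t:{0..pi}. Re ((1 - cis (?x * t)) / w (r k) t)) / pi) \<longlonglongrightarrow> pot x" by simp
  have "(\<lambda>k. LBINT t:{0..pi}. Re ((1 - cis (?x * t)) / w (r k) t)) \<longlonglongrightarrow> (LBINT t:{0..pi}. Re ((1 - cis (?x * t)) / (1 - phi p t)))"
    unfolding set_lebesgue_integral_def real_scaleR_def
  proof (rule integral_dominated_convergence[OF _ _ W_int])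
    show "AE t in lborel. (\<lambda>k. indicat_real {0..pi} t * Re ((1 - cis (?x * t)) / w (r k) t)) \<longlonglongrightarrow>
        indicat_real {0..pi} t * Re ((1 - cis (?x * t)) / (1 - phi p t))"
    proof (rule AE_I2)
      fix t
      show "(\<lambda>k. indicat_real {0..pi} t * Re ((1 - cis (?x * t)) / w (r k) t)) \<longlonglongrightarrow>
        indicat_real {0..pi} t * Re ((1 - cis (?x * t)) / (1 - phi p t))"
      proof (cases "0 < t \<and> t \<le> pi")
        case True
        then have "1 - complex_of_real 1 * phi p t \<noteq> 0" using reA_pos[of t] by (auto simp: reA_def)
        then have "(\<lambda>k. indicat_real {0..pi} t * Re ((1 - cis (?x * t)) / (1 - complex_of_real (r k) * phi p t))) \<longlonglongrightarrow>
          indicat_real {0..pi} t * Re ((1 - cis (?x * t)) / (1 - complex_of_real 1 * phi p t))"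
          by (intro tendsto_mult tendsto_const tendsto_Re tendsto_divide tendsto_diff tendsto_of_real r_lim)
        then show ?thesis by (simp add: w_def)
      next
        case False
        then have "t = 0 \<or> t \<notin> {0..pi}" by auto
        then show ?thesis by auto
      qed
    qed
    show "AE t in lborel. norm (indicat_real {0..pi} t * Re ((1 - cis (?x * t)) / w (r k) t)) \<le> W t" for k
      using bound[of "r k"] r[of k] by (intro AE_I2) (auto simp del: Re_divide)
    show "(\<lambda>t. indicat_real {0..pi} t * Re ((1 - cis (?x * t)) / (1 - phi p t))) \<in> borel_measurable lborel"
      using meas[of 1] by (simp add: w_def)
  qed (rule meas)
  from tendsto_divide[OF this tendsto_const pi_neq_zero]
  show "pot x = (LBINT t:{0..pi}. Re ((1 - cis (?x * t)) / (1 - phi p t))) / pi"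
    by (rule LIMSEQ_unique[OF L2])
qed

end

section \<open>The upward skip-free comparison walk\<close>

lemma reach_step:
  assumes "b \<in> set_pmf q" "taboo q {} n (indicator {y}) (x + b) > 0"
  shows "taboo q {} (Suc n) (indicator {y}) x > 0"
proof -
  have "0 < pmf q b * taboo q {} n (indicator {y}) (x + b)"
    using assms by (simp add: pmf_positive)
  also have "\<dots> \<le> taboo q {} (Suc n) (indicator {y}) x"
    unfolding taboo_empty_Suc
    by (rule step_ge_atom)
       (auto intro!: taboo_nonneg integrable_bounded_pmf[where K=1] abs_taboo_le simp: indicator_def)
  finally show ?thesis .
qed

text \<open>The walk jumps down by \<open>c\<close> until it is at or below \<open>y\<close>, then
  climbs by unit steps.\<close>

lemma reach_all:
  assumes up: "1 \<in> set_pmf q" and down: "c \<in> set_pmf q" "c < 0"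
  shows "\<exists>n. taboo q {} n (indicator {y}) x > 0"
proof -
  have up_reach: "\<exists>n. taboo q {} n (indicator {y}) (y - int k) > 0" for k
  proof (induction k)
    case 0
    have "taboo q {} 0 (indicator {y}) (y - int 0) > 0" by simp
    then show ?case by blast
  next
    case (Suc k)
    then obtain n where "taboo q {} n (indicator {y}) (y - int k) > 0" by blast
    then have "taboo q {} n (indicator {y}) (y - int (Suc k) + 1) > 0" by simp
    from reach_step[OF up this] show ?case by blast
  qed
  show ?thesis
  proof (induction "nat (x - y)" arbitrary: x rule: less_induct)
    case less
    show ?case
    proof (cases "x \<le> y")
      case True
      then show ?thesis using up_reach[of "nat (y - x)"] by simp
    next
      case False
      then have "nat (x + c - y) < nat (x - y)" using down by simp
      then obtain n where "taboo q {} n (indicator {y}) (x + c) > 0" using less by blast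
      from reach_step[OF down(1) this] show ?thesis by blast
    qed
  qed
qed

context zwalk_neg
begin

definition c0 :: real where "c0 = measure_pmf.expectation p negw"

definition \<theta> :: real where "\<theta> = measure_pmf.prob p {..<0} + c0"

lemma c0_pos: "0 < c0"
proof -
  obtain c where c: "c \<in> set_pmf p" "c < 0" using exists_negative_step by blast
  have "0 < pmf p c * negw (0 + c)" using c by (simp add: pmf_positive negw_def mult_pos_neg)
  also have "\<dots> \<le> step p negw 0"
    by (rule step_ge_atom) (auto intro: N.w_nonneg simp: N.w_int)
  finally show ?thesis by (simp add: c0_def step_def)
qed

lemma \<theta>_pos: "0 < \<theta>"
  using c0_pos by (simp add: \<theta>_def add_nonneg_pos)

text \<open>The comparison walk keeps the negative jumps of \<open>p\<close> and replaces the positive ones by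
  jumps of size \<open>1\<close> with the same mean; \<open>\<theta>\<close> normalizes the total mass.\<close>

definition cmp_fun :: "int \<Rightarrow> real" where
  "cmp_fun k = (pmf p k * indicator {..<0} k + c0 * indicator {1} k) / \<theta>"

definition cmp :: "int pmf" where "cmp = embed_pmf cmp_fun"

lemma pmf_cmp: "pmf cmp k = cmp_fun k"
  unfolding cmp_def
proof (rule pmf_embed_pmf)
  show "0 \<le> cmp_fun k" for k using c0_pos \<theta>_pos by (simp add: cmp_fun_def)
  have "(\<integral>\<^sup>+k. ennreal (cmp_fun k) \<partial>count_space UNIV) =
    (\<integral>\<^sup>+k. ennreal (1 / \<theta>) * (ennreal (pmf p k) * indicator {..<0} k + ennreal c0 * indicator {1} k) \<partial>count_space UNIV)"
    using c0_pos \<theta>_pos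
    by (intro nn_integral_cong) (auto simp: cmp_fun_def indicator_def ennreal_mult'[symmetric])
  also have "\<dots> = ennreal (1 / \<theta>) * ((\<integral>\<^sup>+k. ennreal (pmf p k) * indicator {..<0} k \<partial>count_space UNIV) +
      (\<integral>\<^sup>+k. ennreal c0 * indicator {1} k \<partial>count_space UNIV))"
    by (subst nn_integral_cmult) (auto simp: nn_integral_add)
  also have "(\<integral>\<^sup>+k. ennreal (pmf p k) * indicator {..<0} k \<partial>count_space UNIV) = ennreal (measure_pmf.prob p {..<0})"
    by (subst nn_integral_measure_pmf[symmetric]) (simp add: measure_pmf.emeasure_eq_measure)
  also have "(\<integral>\<^sup>+k. ennreal c0 * indicator {1::int} k \<partial>count_space UNIV) = ennreal c0"
    by (simp add: nn_integral_cmult_indicator)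
  also have "ennreal (1 / \<theta>) * (ennreal (measure_pmf.prob p {..<0}) + ennreal c0) = 1"
    using c0_pos \<theta>_pos
    by (simp add: ennreal_plus[symmetric] ennreal_mult'[symmetric] \<theta>_def[symmetric] del: ennreal_plus)
  finally show "(\<integral>\<^sup>+k. ennreal (cmp_fun k) \<partial>count_space UNIV) = 1" .
qed

lemma cmp_expectation:
  fixes h :: "int \<Rightarrow> real"
  assumes "integrable (measure_pmf p) (\<lambda>z. h z * indicator {..<0} z)"
  shows "integrable (measure_pmf cmp) h"
    and "measure_pmf.expectation cmp h =
      (measure_pmf.expectation p (\<lambda>z. h z * indicator {..<0} z) + c0 * h 1) / \<theta>"
proof -
  have i1: "integrable (count_space UNIV) (\<lambda>z. pmf p z * (h z * indicator {..<0} z))"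
    using assms unfolding measure_pmf_eq_density[of p] by (subst (asm) integrable_density) auto
  have i2: "integrable (count_space UNIV) (\<lambda>z. (c0 * h 1) * indicator {1::int} z)"
    by (intro integrable_mult_right integrable_real_indicator) auto
  have eq: "pmf cmp z * h z = (pmf p z * (h z * indicator {..<0} z) + (c0 * h 1) * indicator {1} z) / \<theta>" for z
    by (auto simp: pmf_cmp cmp_fun_def indicator_def)
  have i3: "integrable (count_space UNIV) (\<lambda>z. pmf cmp z * h z)"
    unfolding eq by (intro integrable_divide_zero Bochner_Integration.integrable_add i1 i2)
  then show "integrable (measure_pmf cmp) h"
    unfolding measure_pmf_eq_density[of cmp] by (subst integrable_density) auto
  have "measure_pmf.expectation cmp h = (\<integral>z. pmf cmp z * h z \<partial>count_space UNIV)"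
    unfolding measure_pmf_eq_density[of cmp] by (subst integral_density) auto
  also have "\<dots> = ((\<integral>z. pmf p z * (h z * indicator {..<0} z) \<partial>count_space UNIV) + c0 * h 1) / \<theta>"
    unfolding eq integral_divide_zero Bochner_Integration.integral_add[OF i1 i2] by simp
  also have "(\<integral>z. pmf p z * (h z * indicator {..<0} z) \<partial>count_space UNIV) =
      measure_pmf.expectation p (\<lambda>z. h z * indicator {..<0} z)"
    unfolding measure_pmf_eq_density[of p] by (subst integral_density) auto
  finally show "measure_pmf.expectation cmp h =
      (measure_pmf.expectation p (\<lambda>z. h z * indicator {..<0} z) + c0 * h 1) / \<theta>" .
qed

lemma set_cmp: "1 \<in> set_pmf cmp" "c \<in> set_pmf p \<Longrightarrow> c < 0 \<Longrightarrow> c \<in> set_pmf cmp" "z \<in> set_pmf cmp \<Longrightarrow> z \<le> 1"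
  using c0_pos \<theta>_pos pmf_positive[of c p]
  by (auto simp: set_pmf_iff pmf_cmp cmp_fun_def indicator_def of_bool_def split: if_splits)

lemma negw_expectation_cmp:
  assumes "H 0 = 0" "integrable (measure_pmf p) (\<lambda>z. H (negw z))"
  shows "integrable (measure_pmf cmp) (\<lambda>z. H (negw z))"
    and "measure_pmf.expectation cmp (\<lambda>z. H (negw z)) = measure_pmf.expectation p (\<lambda>z. H (negw z)) / \<theta>"
proof -
  have eq: "H (negw z) * indicator {..<0} z = H (negw z)" for z
    using assms(1) by (auto simp: negw_def indicator_def max_def)
  have i: "integrable (measure_pmf p) (\<lambda>z. H (negw z) * indicator {..<0} z)"
    unfolding eq by (rule assms(2))
  show "integrable (measure_pmf cmp) (\<lambda>z. H (negw z))" by (rule cmp_expectation(1)[OF i])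
  show "measure_pmf.expectation cmp (\<lambda>z. H (negw z)) = measure_pmf.expectation p (\<lambda>z. H (negw z)) / \<theta>"
    unfolding cmp_expectation(2)[OF i] eq using assms(1) by (simp add: negw_def)
qed

lemma posw_expectation_cmp:
  assumes "H 0 = 0"
  shows "measure_pmf.expectation cmp (\<lambda>z. H (posw z)) = c0 * H 1 / \<theta>"
proof -
  have eq: "H (posw z) * indicator {..<0} z = 0" for z
    using assms by (auto simp: posw_def indicator_def max_def)
  have i: "integrable (measure_pmf p) (\<lambda>z. H (posw z) * indicator {..<0} z)"
    unfolding eq by simp
  show ?thesis unfolding cmp_expectation(2)[OF i] eq by (simp add: posw_def)
qed

text \<open>Otherwise \<open>N.Lam\<close> would stay bounded near 0 and, the positive part being at
  most half of the total, so would \<open>Ltot\<close>, against infinite variance.\<close>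

lemma negw_second_moment: "(\<integral>\<^sup>+z. ennreal ((negw z)\<^sup>2) \<partial>measure_pmf p) = \<infinity>"
proof (rule ccontr)
  assume "\<not> ?thesis"
  then have fin: "(\<integral>\<^sup>+z. ennreal ((negw z)\<^sup>2) \<partial>measure_pmf p) < \<infinity>" by (simp add: less_top)
  have int: "integrable (measure_pmf p) (\<lambda>z. (negw z)\<^sup>2)"
    by (rule integrableI_nonneg) (use fin in auto)
  define B where "B = measure_pmf.expectation p (\<lambda>z. (negw z)\<^sup>2)"
  have B: "0 \<le> B" unfolding B_def by (intro integral_nonneg_AE) auto
  have le: "N.Lam t \<le> B" if "0 < t" for t
    unfolding N.Lam_def B_def
  proof (rule integral_mono[OF N.integrable_Lam[OF that] int])
    fix z
    show "(negw z)\<^sup>2 / (1 + t * negw z) \<le> (negw z)\<^sup>2"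
      using divide_left_mono[of 1 "1 + t * negw z" "(negw z)\<^sup>2"] N.w_nonneg[of z] that
      by (simp add: add_pos_nonneg)
  qed
  obtain d1 where d1: "d1 > 0" "\<And>t. 0 < t \<Longrightarrow> t \<le> d1 \<Longrightarrow> P.Lam t \<le> 1 / 2 * Ltot t"
    using right_small[of "1 / 2"] by auto
  obtain d2 where d2: "d2 > 0" "\<And>t. 0 < t \<Longrightarrow> t \<le> d2 \<Longrightarrow> Ltot t > 2 * B + 1"
    using Ltot_at_zero[of "2 * B + 1"] B by auto
  define t where "t = min d1 d2"
  have t: "0 < t" using d1 d2 by (simp add: t_def)
  have "Ltot t \<le> 2 * N.Lam t" using d1(2)[of t] t by (simp add: t_def Ltot_def)
  then show False using d2(2)[of t] le[OF t] t by (simp add: t_def)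
qed

lemma zwalk_cmp: "zwalk cmp"
proof
  obtain c where c: "c \<in> set_pmf p" "c < 0" using exists_negative_step by blast
  show "\<exists>n. taboo cmp {} n (indicator {y}) x > 0" for x y
    by (rule reach_all[OF set_cmp(1) set_cmp(2)[OF c] c(2)])
  have eq: "real_of_int z * indicator {..<0} z = - negw z" for z
    by (auto simp: negw_def indicator_def max_def)
  have i: "integrable (measure_pmf p) (\<lambda>z. real_of_int z * indicator {..<0} z)"
    unfolding eq using N.w_int by simp
  show "integrable (measure_pmf cmp) real_of_int" by (rule cmp_expectation(1)[OF i])
  show "measure_pmf.expectation cmp real_of_int = 0"
    unfolding cmp_expectation(2)[OF i] eq by (simp add: c0_def)
  have "\<infinity> = ennreal (1 / \<theta>) * (\<integral>\<^sup>+z. ennreal ((negw z)\<^sup>2) \<partial>measure_pmf p)"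
    using \<theta>_pos by (simp add: negw_second_moment ennreal_mult_top)
  also have "\<dots> = (\<integral>\<^sup>+z. ennreal (1 / \<theta>) * (ennreal (pmf p z) * ennreal ((negw z)\<^sup>2)) \<partial>count_space UNIV)"
    by (simp add: nn_integral_measure_pmf nn_integral_cmult)
  also have "\<dots> \<le> (\<integral>\<^sup>+z. ennreal (pmf cmp z) * ennreal ((real_of_int z)\<^sup>2) \<partial>count_space UNIV)"
  proof (rule nn_integral_mono)
    fix z
    have "1 / \<theta> * (pmf p z * (negw z)\<^sup>2) \<le> pmf cmp z * (real_of_int z)\<^sup>2"
      using c0_pos \<theta>_pos by (auto simp: pmf_cmp cmp_fun_def negw_def indicator_def max_def)
    then show "ennreal (1 / \<theta>) * (ennreal (pmf p z) * ennreal ((negw z)\<^sup>2)) \<le> ennreal (pmf cmp z) * ennreal ((real_of_int z)\<^sup>2)"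
      using \<theta>_pos by (simp add: ennreal_mult[symmetric] ennreal_leI del: times_divide_eq_left)
  qed
  also have "\<dots> = (\<integral>\<^sup>+z. ennreal ((real_of_int z)\<^sup>2) \<partial>measure_pmf cmp)"
    by (rule nn_integral_measure_pmf[symmetric])
  finally show "(\<integral>\<^sup>+z. ennreal ((real_of_int z)\<^sup>2) \<partial>measure_pmf cmp) = \<infinity>" by (simp add: top.extremum_unique)
qed

text \<open>A single upward jump size keeps its positive \<open>Lam\<close> bounded while the total
  tends to infinity. So the comparison walk satisfies the same hypothesis, and its potential has the
  same Fourier formula.\<close>

lemma zwalk_neg_cmp: "zwalk_neg cmp"
proof -
  interpret C: zwalk cmp by (rule zwalk_cmp)
  show ?thesis
  proof
    fix \<epsilon> :: real assume \<epsilon>: "0 < \<epsilon>"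
    obtain \<delta> where \<delta>: "\<delta> > 0" "\<And>t. 0 < t \<Longrightarrow> t \<le> \<delta> \<Longrightarrow> C.Ltot t > c0 / \<theta> / \<epsilon>"
      using C.Ltot_at_zero[of "c0 / \<theta> / \<epsilon>"] c0_pos \<theta>_pos \<epsilon> by auto
    have "C.P.Lam t \<le> \<epsilon> * C.Ltot t" if t: "0 < t" "t \<le> \<delta>" for t
    proof -
      have "C.P.Lam t = c0 * (1\<^sup>2 / (1 + t * 1)) / \<theta>"
        unfolding C.P.Lam_def by (rule posw_expectation_cmp[of "\<lambda>w. w\<^sup>2 / (1 + t * w)"]) simp
      also have "\<dots> \<le> c0 / \<theta>"
        using t c0_pos \<theta>_pos by (simp add: divide_right_mono divide_le_eq)
      also have "\<dots> = \<epsilon> * (c0 / \<theta> / \<epsilon>)" using \<epsilon> by simp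
      also have "\<dots> \<le> \<epsilon> * C.Ltot t" using \<delta>(2)[OF t] \<epsilon> by (intro mult_left_mono) auto
      finally show ?thesis .
    qed
    then show "\<exists>\<delta>>0. \<forall>t. 0 < t \<longrightarrow> t \<le> \<delta> \<longrightarrow> C.P.Lam t \<le> \<epsilon> * C.Ltot t" using \<delta>(1) by blast
  qed
qed

abbreviation pot' :: "int \<Rightarrow> real" where "pot' \<equiv> zwalk.pot cmp"

text \<open>The comparison walk is upward skip-free, so it cannot pass from \<open>-w\<close> to \<open>R\<close> without visiting
  \<open>0\<close>; the hitting formula then makes \<open>a'\<close> additive on the negative axis, and sublinearity kills it.\<close>

lemma pot'_nonpos: assumes "x \<le> 0" shows "pot' x = 0"
proof -
  interpret C: zwalk cmp by (rule zwalk_cmp)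
  have no_hit: "hit cmp {R} {0} x = 0" if "R > 0" "x < 0" for R x
  proof -
    have disj: "{R} \<inter> {0} = {}" using that by auto
    have "x < 0 \<Longrightarrow> hitN cmp {R} {0} N x = 0" for N x
    proof (induction N arbitrary: x)
      case (Suc N)
      have "AE z in measure_pmf cmp. one_step {R} {0} (hitN cmp {R} {0} N) (x + z) = 0"
      proof (subst AE_measure_pmf_iff, intro ballI)
        fix z assume "z \<in> set_pmf cmp"
        then have "x + z \<le> 0" using set_cmp(3)[of z] Suc.prems by simp
        then show "one_step {R} {0} (hitN cmp {R} {0} N) (x + z) = 0"
          using Suc.IH[of "x + z"] that(1) by (auto simp: one_step_def)
      qed
      then have "step cmp (one_step {R} {0} (hitN cmp {R} {0} N)) x = 0"
        unfolding step_def by (simp add: integral_eq_zero_AE)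
      then show ?case using hitN_Suc[OF disj] by simp
    qed (simp add: hitN_def)
    then show ?thesis
      using LIMSEQ_unique[OF hitN_tendsto[OF disj, of cmp x], of 0] that by simp
  qed
  have add: "pot' (- w - R) = pot' (- w) + pot' (- R)" if "w > 0" "R > 0" for w R
    using C.hit_formula[of R "- w"] no_hit[of R "- w"] that by (simp add: C.adag_def)
  have lin: "pot' (- int (Suc n)) = real (Suc n) * pot' (- 1)" for n
  proof (induction n)
    case (Suc n)
    then show ?case using add[of "int (Suc n)" 1] by (simp add: algebra_simps)
  qed simp
  have zero: "pot' (- 1) = 0"
  proof (rule ccontr)
    assume "pot' (- 1) \<noteq> 0"
    then have pos: "pot' (- 1) > 0" using C.pot_nonneg[of "- 1"] by simp
    then obtain D where D: "\<And>x. \<bar>pot' x\<bar> \<le> pot' (- 1) / 2 * \<bar>real_of_int x\<bar> + D"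
      using C.sublinear_pot unfolding sublinear_def by (meson half_gt_zero)
    obtain n :: nat where n: "real n * (pot' (- 1) / 2) > D"
      using reals_Archimedean3[of "pot' (- 1) / 2"] pos by (metis half_gt_zero)
    have "pot' (- int (Suc n)) \<le> pot' (- 1) / 2 * \<bar>real_of_int (- int (Suc n))\<bar> + D"
      by (rule order_trans[OF abs_ge_self D])
    then have "real (Suc n) * pot' (- 1) \<le> pot' (- 1) / 2 * real (Suc n) + D"
      unfolding lin by (simp add: add.commute)
    then show False using n pos by (simp add: field_simps)
  qed
  show ?thesis
  proof (cases "x = 0")
    case False
    then have "x = - int (Suc (nat (- x - 1)))" using assms by simp
    then have "pot' x = pot' (- int (Suc (nat (- x - 1))))" by (rule arg_cong)
    also have "\<dots> = 0" unfolding lin zero by simp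
    finally show ?thesis .
  qed simp
qed

lemma pot'_nonneg: "0 \<le> pot' x"
  using zwalk.pot_nonneg[OF zwalk_cmp] .

lemma pot'_subadditive: "pot' (x + y) \<le> pot' x + pot' y"
  using zwalk.pot_subadditive[OF zwalk_cmp] .

lemma pot'_mono: "k \<le> m \<Longrightarrow> pot' k \<le> pot' m"
  using pot'_subadditive[of m "k - m"] pot'_nonpos[of "k - m"] by simp

text \<open>The Poisson equation is summed over the triangle 0 <= x <= m < n, which collects the
  total source n. On the other side a jump z contributes \<open>T z\<close>: its part linear in z
  has mean zero, and the rest is at most pot'(n) times \<open>V (negw z)\<close>, whose mean is
  bounded through \<open>N.Lam\<close> at 1/(n + 1).\<close>

lemma pot'_lower: "real n * \<theta> \<le> pot' (int n) * (2 * N.Lam (1 / (real n + 1)))"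
proof -
  interpret C: zwalk cmp by (rule zwalk_cmp)
  let ?a = "\<lambda>k. pot' k"
  let ?A = "pot' (int n)"
  define S where "S = (\<Sum>m<n. ?a (int m + 1))"
  define T where "T z = (\<Sum>m<n. \<Sum>x\<le>m. ?a (int x + z) - ?a (int x))" for z
  \<comment> \<open>For a jump -v there are v shifted sums, each below S by at most the smaller of v
    and n + 1 copies of \<open>?A\<close>; this produces v times min(v, n + 1).\<close>
  define V where "V v = v * min v (real n + 1)" for v :: real
  have A0: "0 \<le> ?A" by (rule pot'_nonneg)
  have tele: "(\<Sum>x\<le>m. ?a (int x + 1) - ?a (int x)) = ?a (int m + 1)" for m
    by (induction m) (simp_all add: pot'_nonpos algebra_simps)
  have down: "(\<Sum>x\<le>m. ?a (int x - int v) - ?a (int x)) = - (\<Sum>i<v. ?a (int m - int i))" for m v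
  proof (induction v)
    case (Suc v)
    have "(\<Sum>x\<le>m. ?a (int x - int (Suc v)) - ?a (int x - int v)) = - ?a (int m - int v)"
      by (induction m) (simp_all add: pot'_nonpos algebra_simps)
    then have "(\<Sum>x\<le>m. ?a (int x - int (Suc v))) = (\<Sum>x\<le>m. ?a (int x - int v)) - ?a (int m - int v)"
      by (simp add: sum_subtractf)
    then show ?case using Suc by (simp add: sum_subtractf)
  qed simp
  have S_le: "S \<le> real n * ?A"
  proof -
    have "S \<le> (\<Sum>m<n. ?A)" unfolding S_def by (intro sum_mono pot'_mono) auto
    then show ?thesis by simp
  qed
  have shift: "S - (\<Sum>m<n. ?a (int m - int i)) \<le> (real i + 1) * ?A" for i
  proof (induction i)
    case 0
    have "S - (\<Sum>m<n. ?a (int m)) = ?a (int n) - ?a 0"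
      unfolding S_def sum_subtractf[symmetric]
      using sum_lessThan_telescope[of "\<lambda>m. ?a (int m)" n] by (simp add: add.commute)
    then show ?case by (simp add: pot'_nonpos)
  next
    case (Suc i)
    have "(\<Sum>m<n. ?a (int m - int i)) - (\<Sum>m<n. ?a (int m - int (Suc i))) = ?a (int n - int (Suc i)) - ?a (int 0 - int (Suc i))"
      unfolding sum_subtractf[symmetric]
      using sum_lessThan_telescope[of "\<lambda>m. ?a (int m - int (Suc i))" n] by simp
    also have "\<dots> \<le> ?A" using pot'_mono[of "int n - int (Suc i)" "int n"] pot'_nonneg[of "int 0 - int (Suc i)"] by simp
    finally show ?case using Suc by (simp add: algebra_simps)
  qed
  have T_le: "T z \<le> real_of_int z * S + ?A * V (negw z)" if z: "z \<le> 1" for z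
  proof -
    have "z = 1 \<or> z = - int (nat (- z))" using z by linarith
    then consider "z = 1" | v where "z = - int v" by blast
    then show ?thesis
    proof cases
      case 1
      then show ?thesis by (simp add: T_def tele S_def negw_def V_def)
    next
      case (2 v)
      have "T z = - (\<Sum>m<n. \<Sum>i<v. ?a (int m - int i))"
        using down by (simp add: T_def 2 sum_negf)
      also have "(\<Sum>m<n. \<Sum>i<v. ?a (int m - int i)) = (\<Sum>i<v. \<Sum>m<n. ?a (int m - int i))"
        by (rule sum.swap)
      finally have "T z + real v * S = (\<Sum>i<v. S - (\<Sum>m<n. ?a (int m - int i)))"
        by (simp add: sum_subtractf)
      also have "\<dots> \<le> (\<Sum>i<v. min (real v) (real n + 1) * ?A)"
      proof (rule sum_mono)
        fix i assume "i \<in> {..<v}"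
        then have "real i + 1 \<le> real v" by simp
        then have "(real i + 1) * ?A \<le> real v * ?A" using A0 by (rule mult_right_mono)
        with shift[of i] have 1: "S - (\<Sum>m<n. ?a (int m - int i)) \<le> real v * ?A" by linarith
        have "0 \<le> (\<Sum>m<n. ?a (int m - int i))" by (intro sum_nonneg pot'_nonneg)
        with S_le A0 have 2: "S - (\<Sum>m<n. ?a (int m - int i)) \<le> (real n + 1) * ?A" by (simp add: distrib_right)
        show "S - (\<Sum>m<n. ?a (int m - int i)) \<le> min (real v) (real n + 1) * ?A"
          using 1 2 by (simp add: min_def)
      qed
      also have "\<dots> = ?A * V (real v)" by (simp add: V_def)
      also have "real v = negw z" using 2 by (simp add: negw_def)
      finally show ?thesis using 2 by (simp add: negw_def)
    qed
  qed
  have V_le: "V v \<le> 2 * (v\<^sup>2 / (1 + 1 / (real n + 1) * v))" if "0 \<le> v" for v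
  proof -
    have d: "0 < 1 + 1 / (real n + 1) * v" using that by (intro add_pos_nonneg) auto
    have "V v * (1 + 1 / (real n + 1) * v) \<le> 2 * v\<^sup>2"
    proof (cases "v \<le> real n + 1")
      case True
      then have "V v * (1 + 1 / (real n + 1) * v) = v\<^sup>2 * (1 + v / (real n + 1))"
        by (simp add: V_def power2_eq_square)
      also have "\<dots> \<le> v\<^sup>2 * 2" using True by (intro mult_left_mono) (auto simp: divide_le_eq)
      finally show ?thesis by simp
    next
      case False
      then have "V v * (1 + 1 / (real n + 1) * v) = v * (real n + 1) + v\<^sup>2"
        by (simp add: V_def field_simps power2_eq_square)
      also have "v * (real n + 1) \<le> v * v" using False that by (intro mult_left_mono) auto
      finally show ?thesis by (simp add: power2_eq_square)
    qed
    then show ?thesis using d by (simp add: pos_le_divide_eq)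
  qed
  have s0: "0 < 1 / (real n + 1)" by simp
  have V_int: "integrable (measure_pmf p) (\<lambda>z. V (negw z))"
    by (rule N.integrable_of_le[of _ "real n + 1"])
       (auto simp: V_def abs_mult N.w_nonneg min_def intro!: mult_left_mono simp: mult.commute)
  have V0: "V 0 = 0" by (simp add: V_def)
  have EV: "measure_pmf.expectation cmp (\<lambda>z. V (negw z)) \<le> 2 * N.Lam (1 / (real n + 1)) / \<theta>"
  proof -
    have "measure_pmf.expectation p (\<lambda>z. V (negw z)) \<le> measure_pmf.expectation p (\<lambda>z. 2 * ((negw z)\<^sup>2 / (1 + 1 / (real n + 1) * negw z)))"
      by (rule integral_mono[OF V_int integrable_mult_right[OF N.integrable_Lam[OF s0]]]) (rule V_le[OF N.w_nonneg])
    also have "\<dots> = 2 * N.Lam (1 / (real n + 1))" unfolding N.Lam_def by (rule integral_mult_right_zero)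
    finally show ?thesis
      unfolding negw_expectation_cmp(2)[OF V0 V_int] using \<theta>_pos by (intro divide_right_mono) auto
  qed
  have Tx_int: "integrable (measure_pmf cmp) (\<lambda>z. ?a (int x + z) - ?a (int x))" for x
    by (intro Bochner_Integration.integrable_diff C.integrable_pot) simp
  have T_int: "integrable (measure_pmf cmp) T"
    unfolding T_def[abs_def] by (intro Bochner_Integration.integrable_sum Tx_int)
  have one: "measure_pmf.expectation cmp (\<lambda>z. ?a (int x + z) - ?a (int x)) = indicator {0} (int x)" for x
    using C.step_pot[of "int x"] by (simp add: step_def C.integrable_pot)
  have "measure_pmf.expectation cmp T = (\<Sum>m<n. \<Sum>x\<le>m. indicator {0} (int x))"
  proof -
    have "measure_pmf.expectation cmp T = (\<Sum>m<n. \<Sum>x\<le>m. measure_pmf.expectation cmp (\<lambda>z. ?a (int x + z) - ?a (int x)))"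
      unfolding T_def[abs_def]
      by (subst Bochner_Integration.integral_sum)
         (auto intro!: Bochner_Integration.integrable_sum Tx_int sum.cong Bochner_Integration.integral_sum)
    then show ?thesis by (simp only: one)
  qed
  also have "\<dots> = (\<Sum>m<n. 1)"
  proof (rule sum.cong[OF refl])
    fix m
    have "(\<Sum>x\<le>m. indicator {0} (int x)) = (\<Sum>x\<in>{..m}. if x = 0 then 1 else (0::real))"
      by (intro sum.cong) (auto simp: indicator_def)
    then show "(\<Sum>x\<le>m. indicator {0} (int x)) = (1::real)" by (simp add: sum.delta)
  qed
  finally have "real n = measure_pmf.expectation cmp T" by simp
  also have "\<dots> \<le> measure_pmf.expectation cmp (\<lambda>z. real_of_int z * S + ?A * V (negw z))"
    by (rule integral_mono_AE[OF T_int])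
       (auto intro!: Bochner_Integration.integrable_add integrable_mult_left integrable_mult_right C.int_p
          negw_expectation_cmp(1)[OF V0 V_int] T_le set_cmp(3) simp: AE_measure_pmf_iff)
  also have "\<dots> = ?A * measure_pmf.expectation cmp (\<lambda>z. V (negw z))"
    by (subst Bochner_Integration.integral_add)
       (auto intro!: integrable_mult_left integrable_mult_right C.int_p negw_expectation_cmp(1)[OF V0 V_int] simp: C.mean_p)
  also have "\<dots> \<le> ?A * (2 * N.Lam (1 / (real n + 1)) / \<theta>)" by (intro mult_left_mono EV A0)
  finally show ?thesis using \<theta>_pos by (simp add: pos_le_divide_eq)
qed

text \<open>Multiplication by \<theta> undoes the normalization, so the negative jumps contribute
  the same \<open>N.cosp\<close> and \<open>N.sinp\<close> as in \<open>one_minus_phi\<close> and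
  cancel in the difference of the two.\<close>

lemma one_minus_phi_cmp:
  "\<theta> * (1 - phi cmp t) = Complex (c0 * (1 - cos t) + N.cosp t) (c0 * (t - sin t) - N.sinp t)"
proof -
  interpret C: zwalk cmp by (rule zwalk_cmp)
  have "C.N.cosp t = N.cosp t / \<theta>"
    unfolding C.N.cosp_def N.cosp_def
    by (rule negw_expectation_cmp(2)[of "\<lambda>w. 1 - cos (t * w)"]) (auto intro: N.integrable_cosp)
  moreover have "C.N.sinp t = N.sinp t / \<theta>"
    unfolding C.N.sinp_def N.sinp_def
    by (rule negw_expectation_cmp(2)[of "\<lambda>w. t * w - sin (t * w)"]) (auto intro: N.integrable_sinp)
  moreover have "C.P.cosp t = c0 * (1 - cos (t * 1)) / \<theta>"
    unfolding C.P.cosp_def by (rule posw_expectation_cmp[of "\<lambda>w. 1 - cos (t * w)"]) simp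
  moreover have "C.P.sinp t = c0 * (t * 1 - sin (t * 1)) / \<theta>"
    unfolding C.P.sinp_def by (rule posw_expectation_cmp[of "\<lambda>w. t * w - sin (t * w)"]) simp
  ultimately show ?thesis
    using \<theta>_pos unfolding C.one_minus_phi by (auto simp: complex_eq_iff add_divide_distrib[symmetric] diff_divide_distrib[symmetric])
qed

end

section \<open>Cesaro means of the potential\<close>

lemma sum_reverse_Suc: "(\<Sum>j<R. g (R - j)) = (\<Sum>j<R. g (Suc j))" for g :: "nat \<Rightarrow> real"
proof -
  have "(\<Sum>j<R. g (R - j)) = (\<Sum>j<R. g (Suc (R - Suc j)))"
    by (intro sum.cong) (auto simp: Suc_diff_Suc)
  also have "\<dots> = (\<Sum>j<R. g (Suc j))" by (rule sum.nat_diff_reindex)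
  finally show ?thesis .
qed

definition cesaro_kernel :: "nat \<Rightarrow> real \<Rightarrow> complex" where
  "cesaro_kernel R \<tau> = (\<Sum>j<R. 1 - cis (real j * \<tau>)) / of_nat R"

text \<open>The gain lies in the imaginary part: the sines add up to a geometric sum of size 1/t, so
  their average decays like 1/(R t). The real part is only bounded for large R t.\<close>

lemma cesaro_kernel_bounds:
  assumes R: "R > 0" and \<tau>: "\<bar>\<tau>\<bar> = t" "0 < t" "t \<le> pi"
  shows "\<bar>Re (cesaro_kernel R \<tau>)\<bar> \<le> (real R * t)\<^sup>2" "\<bar>Re (cesaro_kernel R \<tau>)\<bar> \<le> 2"
    "\<bar>Im (cesaro_kernel R \<tau>)\<bar> \<le> real R * t" "\<bar>Im (cesaro_kernel R \<tau>)\<bar> \<le> 4 / (real R * t)"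
    "norm (cesaro_kernel R \<tau>) \<le> 2"
proof -
  have Re_eq: "Re (cesaro_kernel R \<tau>) = (\<Sum>j<R. 1 - cos (real j * \<tau>)) / real R"
    by (simp add: cesaro_kernel_def)
  have Im_eq: "Im (cesaro_kernel R \<tau>) = - (\<Sum>j<R. sin (real j * \<tau>)) / real R"
    by (simp add: cesaro_kernel_def sum_negf)
  have Re0: "0 \<le> (\<Sum>j<R. 1 - cos (real j * \<tau>)) / real R" by (intro divide_nonneg_nonneg sum_nonneg) auto
  have "(\<Sum>j<R. 1 - cos (real j * \<tau>)) \<le> (\<Sum>j<R. (real R * t)\<^sup>2)"
  proof (rule sum_mono)
    fix j assume j: "j \<in> {..<R}"
    have "1 - cos (real j * \<tau>) \<le> (real j * \<tau>)\<^sup>2 / 2" by (rule one_minus_cos_quadratic)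
    also have "\<dots> \<le> (real j * \<tau>)\<^sup>2" by simp
    also have "\<dots> = (real j * t)\<^sup>2" using \<tau>(1) by (metis abs_mult abs_of_nat power2_abs)
    also have "\<dots> \<le> (real R * t)\<^sup>2" using j \<tau> by (intro power_mono mult_right_mono) auto
    finally show "1 - cos (real j * \<tau>) \<le> (real R * t)\<^sup>2" .
  qed
  then have "(\<Sum>j<R. 1 - cos (real j * \<tau>)) / real R \<le> (real R * t)\<^sup>2" using R by (simp add: divide_le_eq mult.commute)
  then show "\<bar>Re (cesaro_kernel R \<tau>)\<bar> \<le> (real R * t)\<^sup>2" using Re0 by (simp add: Re_eq)
  have "norm (\<Sum>j<R. 1 - cis (real j * \<tau>)) \<le> (\<Sum>j<R. 2)"
  proof (rule order_trans[OF norm_sum sum_mono])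
    fix j
    have "norm (1 - cis (real j * \<tau>)) \<le> norm (1::complex) + norm (cis (real j * \<tau>))" by (rule norm_triangle_ineq4)
    then show "norm (1 - cis (real j * \<tau>)) \<le> 2" by simp
  qed
  then show n2: "norm (cesaro_kernel R \<tau>) \<le> 2"
    using R by (simp add: cesaro_kernel_def norm_divide divide_le_eq)
  then show "\<bar>Re (cesaro_kernel R \<tau>)\<bar> \<le> 2" using abs_Re_le_cmod order_trans by blast
  have "\<bar>\<Sum>j<R. sin (real j * \<tau>)\<bar> \<le> (\<Sum>j<R. real R * t)"
  proof (rule order_trans[OF sum_abs sum_mono])
    fix j assume j: "j \<in> {..<R}"
    have "\<bar>sin (real j * \<tau>)\<bar> \<le> \<bar>real j * \<tau>\<bar>" by (rule abs_sin_x_le_abs_x)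
    also have "\<dots> \<le> real R * t" unfolding abs_mult using j \<tau> by (intro mult_mono) auto
    finally show "\<bar>sin (real j * \<tau>)\<bar> \<le> real R * t" .
  qed
  then show "\<bar>Im (cesaro_kernel R \<tau>)\<bar> \<le> real R * t"
    using R by (simp add: Im_eq divide_le_eq mult.commute)
  have n1: "2 * t / pi \<le> norm (1 - cis \<tau>)"
  proof (rule power2_le_imp_le)
    have "(2 * t / pi)\<^sup>2 = 2 * (2 * t\<^sup>2 / pi\<^sup>2)" by (simp add: power_mult_distrib power_divide)
    also have "\<dots> \<le> 2 * (1 - cos t)" using \<tau> one_minus_cos_ge_quadratic[of t] by simp
    also have "cos t = cos \<tau>" using \<tau>(1) by (metis cos_abs_real)
    also have "2 * (1 - cos \<tau>) = (norm (1 - cis \<tau>))\<^sup>2"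
    proof -
      have "(norm (1 - cis \<tau>))\<^sup>2 = 1 - 2 * cos \<tau> + ((cos \<tau>)\<^sup>2 + (sin \<tau>)\<^sup>2)"
        by (simp add: cmod_power2 power2_diff)
      then show ?thesis by simp
    qed
    finally show "(2 * t / pi)\<^sup>2 \<le> (norm (1 - cis \<tau>))\<^sup>2" .
  qed simp
  have n0: "0 < 2 * t / pi" using \<tau> by simp
  then have ne: "cis \<tau> \<noteq> 1" using n1 by auto
  have "(\<Sum>j<R. cis (real j * \<tau>)) = (\<Sum>j<R. cis \<tau> ^ j)"
    by (rule sum.cong[OF refl]) (simp add: Complex.DeMoivre)
  also have "\<dots> = (1 - cis \<tau> ^ R) / (1 - cis \<tau>)" using sum_gp_strict[of "cis \<tau>" R] ne by simp
  finally have "norm (\<Sum>j<R. cis (real j * \<tau>)) = norm (1 - cis \<tau> ^ R) / norm (1 - cis \<tau>)" by (simp add: norm_divide)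
  also have "\<dots> \<le> 2 / (2 * t / pi)"
  proof (rule frac_le[OF _ _ n0 n1])
    have "norm (1 - cis \<tau> ^ R) \<le> norm (1::complex) + norm (cis \<tau> ^ R)" by (rule norm_triangle_ineq4)
    then show "norm (1 - cis \<tau> ^ R) \<le> 2" by (simp add: norm_power)
  qed simp
  also have "\<dots> = pi / t" using \<tau> by simp
  also have "\<dots> \<le> 4 / t" using pi_less_4 \<tau> by (intro divide_right_mono) auto
  finally have "\<bar>Im (\<Sum>j<R. cis (real j * \<tau>))\<bar> \<le> 4 / t"
    using abs_Im_le_cmod order_trans by blast
  then have "\<bar>\<Sum>j<R. sin (real j * \<tau>)\<bar> / real R \<le> 4 / t / real R" by (intro divide_right_mono) auto
  then show "\<bar>Im (cesaro_kernel R \<tau>)\<bar> \<le> 4 / (real R * t)"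
    by (simp add: Im_eq mult.commute)
qed

context zwalk_neg
begin

text \<open>The positive jumps of both walks together: c0/(1 + t) is what a unit jump of mass c0
  contributes to \<open>Lam\<close>. One pair of functions thus controls the given walk and the
  scaled comparison walk.\<close>

definition Ncmp :: "real \<Rightarrow> real" where "Ncmp t = P.Lam t + c0 / (1 + t)"
definition Ncmp1 :: "real \<Rightarrow> real" where "Ncmp1 t = P.Lam1 t + c0 / (1 + t)\<^sup>2"
definition Lcmp :: "real \<Rightarrow> real" where "Lcmp t = N.Lam t + Ncmp t"
definition Lcmp1 :: "real \<Rightarrow> real" where "Lcmp1 t = N.Lam1 t + Ncmp1 t"

lemma Ncmp_deriv: assumes "0 < t" shows "(Ncmp has_real_derivative - Ncmp1 t) (at t)"
proof -
  have "((\<lambda>t. c0 / (1 + t)) has_real_derivative - (c0 / (1 + t)\<^sup>2)) (at t)"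
    using assms by (auto intro!: derivative_eq_intros simp: power2_eq_square)
  from DERIV_add[OF P.Lam_deriv[OF assms] this] show ?thesis
    by (simp add: Ncmp_def[abs_def] Ncmp1_def)
qed

lemma Lcmp_deriv: assumes "0 < t" shows "(Lcmp has_real_derivative - Lcmp1 t) (at t)"
  using DERIV_add[OF N.Lam_deriv[OF assms] Ncmp_deriv[OF assms]] by (simp add: Lcmp_def[abs_def] Lcmp1_def)

lemma measurable_Lcmp [measurable]: "Ncmp \<in> borel_measurable borel" "Ncmp1 \<in> borel_measurable borel"
  "Lcmp \<in> borel_measurable borel" "Lcmp1 \<in> borel_measurable borel"
  unfolding Lcmp_def[abs_def] Lcmp1_def[abs_def] Ncmp_def[abs_def] Ncmp1_def[abs_def] by measurable

lemma Ncmp_nonneg: "0 < t \<Longrightarrow> 0 \<le> Ncmp t" "0 < t \<Longrightarrow> 0 \<le> Ncmp1 t"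
  using P.Lam_nonneg[of t] P.Lam1_nonneg[of t] c0_pos by (auto simp: Ncmp_def Ncmp1_def)

lemma Lcmp_pos: "0 < t \<Longrightarrow> 0 < Lcmp t" "0 < t \<Longrightarrow> 0 \<le> Lcmp1 t"
  using P.Lam_nonneg[of t] N.Lam_nonneg[of t] N.Lam1_nonneg[of t] Ncmp_nonneg[of t] c0_pos
  by (auto simp: Lcmp_def Lcmp1_def Ncmp_def intro!: add_nonneg_pos)

lemma c0_part: "0 < t \<Longrightarrow> c0 / (1 + t) - t * (c0 / (1 + t)\<^sup>2) = c0 / (1 + t)\<^sup>2"
  by (simp add: divide_simps power2_eq_square) (simp add: algebra_simps)

lemma Theta_Ncmp: "0 < t \<Longrightarrow> Ncmp t - t * Ncmp1 t = (P.Lam t - t * P.Lam1 t) + c0 / (1 + t)\<^sup>2"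
  using c0_part[of t] by (simp add: Ncmp_def Ncmp1_def distrib_left)

lemma Theta_Lcmp: "Lcmp t - t * Lcmp1 t = (N.Lam t - t * N.Lam1 t) + (Ncmp t - t * Ncmp1 t)"
  by (simp add: Lcmp_def Lcmp1_def distrib_left)

lemma t_Ncmp1_le: "0 < t \<Longrightarrow> t * Ncmp1 t \<le> Ncmp t"
  using Theta_Ncmp[of t] P.t_Lam1_le[of t] divide_nonneg_nonneg[OF less_imp_le[OF c0_pos] zero_le_power2[of "1 + t"]] by linarith

lemma t_Lcmp1_le: "0 < t \<Longrightarrow> t * Lcmp1 t \<le> Lcmp t"
  using Theta_Lcmp[of t] t_Ncmp1_le[of t] N.t_Lam1_le[of t] by simp

lemma Ncmp_small:
  assumes \<epsilon>: "0 < \<epsilon>"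
  obtains \<delta> where "0 < \<delta>" "\<delta> \<le> pi" "\<And>t. 0 < t \<Longrightarrow> t \<le> \<delta> \<Longrightarrow> Ncmp t \<le> \<epsilon> * Lcmp t"
proof -
  obtain d1 where d1: "d1 > 0" "\<And>t. 0 < t \<Longrightarrow> t \<le> d1 \<Longrightarrow> P.Lam t \<le> \<epsilon> / 2 * Ltot t"
    using right_small[of "\<epsilon> / 2"] \<epsilon> by auto
  obtain d2 where d2: "d2 > 0" "\<And>t. 0 < t \<Longrightarrow> t \<le> d2 \<Longrightarrow> Ltot t > 2 * c0 / \<epsilon>"
    using Ltot_at_zero[of "2 * c0 / \<epsilon>"] c0_pos \<epsilon> by auto
  show ?thesis
  proof (rule that[of "min pi (min d1 d2)"])
    fix t assume t: "0 < t" "t \<le> min pi (min d1 d2)"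
    have "c0 / (1 + t) \<le> c0" using c0_pos t by (simp add: divide_le_eq)
    also have "c0 = \<epsilon> / 2 * (2 * c0 / \<epsilon>)" using \<epsilon> by simp
    also have "\<dots> \<le> \<epsilon> / 2 * Ltot t" using d2(2)[of t] t \<epsilon> by (intro mult_left_mono) auto
    finally have "Ncmp t \<le> \<epsilon> / 2 * Ltot t + \<epsilon> / 2 * Ltot t"
      unfolding Ncmp_def using d1(2)[of t] t by (intro add_mono) auto
    then have "Ncmp t \<le> \<epsilon> * Ltot t" by simp
    also have "\<dots> \<le> \<epsilon> * Lcmp t" using c0_pos t \<epsilon> by (intro mult_left_mono) (auto simp: Lcmp_def Ltot_def Ncmp_def)
    finally show "Ncmp t \<le> \<epsilon> * Lcmp t" .
  qed (use d1 d2 in auto)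
qed

text \<open>The density that replaces 1/(1 - phi) in the Fourier formula when a is replaced by a -
  a'/\<theta>.\<close>

definition Psi :: "real \<Rightarrow> complex" where
  "Psi t = 1 / (1 - phi p t) - 1 / (\<theta> * (1 - phi cmp t))"

text \<open>Both denominators have modulus at least Q and differ only by positive-jump terms: a
  Theta of \<open>Ncmp\<close> bounds the real difference and \<open>Ncmp1\<close> the imaginary
  one. The cross terms gain \<epsilon> from the smallness of \<open>Ncmp\<close> against
  \<open>Lcmp\<close>.\<close>

lemma Psi_bounds:
  assumes t: "0 < t" and \<epsilon>: "0 < \<epsilon>" "\<epsilon> \<le> 1 / 200" and small: "Ncmp t \<le> \<epsilon> * Lcmp t"
  shows "\<bar>Re (Psi t)\<bar> \<le> 4194304 * ((Ncmp t - t * Ncmp1 t + \<epsilon> * (Lcmp t - t * Lcmp1 t)) / (t * Lcmp t)\<^sup>2)"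
    and "\<bar>Im (Psi t)\<bar> \<le> 4194304 * ((Ncmp1 t + \<epsilon> * Lcmp1 t) / (t * (Lcmp t)\<^sup>2))"
proof -
  define a1 where "a1 = P.cosp t + N.cosp t"
  define a2 where "a2 = P.sinp t - N.sinp t"
  define b1 where "b1 = c0 * (1 - cos t) + N.cosp t"
  define b2 where "b2 = c0 * (t - sin t) - N.sinp t"
  define Q where "Q = t\<^sup>2 * (Ncmp t + N.Lam t) / 32"
  define TN where "TN = Ncmp t - t * Ncmp1 t"
  define TL where "TL = Lcmp t - t * Lcmp1 t"
  have L: "0 < Lcmp t" using Lcmp_pos t by simp
  have Q_eq: "Q = t\<^sup>2 * Lcmp t / 32" by (simp add: Q_def Lcmp_def)
  have Q: "Q > 0" using t L by (simp add: Q_eq)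
  have TN: "0 \<le> TN" "TN \<le> Ncmp t" using t_Ncmp1_le[OF t] Ncmp_nonneg[OF t] t by (auto simp: TN_def)
  have TL: "0 \<le> TL" using t_Lcmp1_le[OF t] by (simp add: TL_def)
  have TP: "0 \<le> P.Lam t - t * P.Lam1 t" using P.t_Lam1_le[OF t] by simp
  have cc: "0 \<le> c0 / (1 + t)\<^sup>2" using c0_pos by simp
  have cP: "0 \<le> P.cosp t" "P.cosp t \<le> 8 * t\<^sup>2 * (P.Lam t - t * P.Lam1 t)" using P.cosp_nonneg P.cosp_le[OF t] by auto
  have cN: "0 \<le> N.cosp t" "N.cosp t \<le> 8 * t\<^sup>2 * (N.Lam t - t * N.Lam1 t)" using N.cosp_nonneg N.cosp_le[OF t] by auto
  have sP: "0 \<le> P.sinp t" "P.sinp t \<le> 8 * t ^ 3 * P.Lam1 t" using P.sinp_nonneg[OF t] P.sinp_le[OF t] by auto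
  have sN: "0 \<le> N.sinp t" "N.sinp t \<le> 8 * t ^ 3 * N.Lam1 t" using N.sinp_nonneg[OF t] N.sinp_le[OF t] by auto
  have c1: "0 \<le> c0 * (1 - cos t)" "c0 * (1 - cos t) \<le> 8 * t\<^sup>2 * (c0 / (1 + t)\<^sup>2)"
    using c0_pos mult_left_mono[OF one_minus_cos_le[of t], of c0] t by (auto simp: mult_ac)
  have s1: "0 \<le> c0 * (t - sin t)" "c0 * (t - sin t) \<le> 8 * t ^ 3 * (c0 / (1 + t)\<^sup>2)"
    using c0_pos mult_left_mono[OF self_minus_sin_le[of t], of c0] sin_le_self[of t] t by (auto simp: mult_ac)
  have t3: "8 * t ^ 3 * x = 8 * t\<^sup>2 * (t * x)" for x by (simp add: power2_eq_square power3_eq_cube)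
  have PN: "8 * t ^ 3 * P.Lam1 t \<le> 8 * t ^ 3 * Ncmp1 t" "8 * t ^ 3 * (c0 / (1 + t)\<^sup>2) \<le> 8 * t ^ 3 * Ncmp1 t"
    using t cc P.Lam1_nonneg[of t] unfolding Ncmp1_def by (intro mult_left_mono; simp)+
  have N1N: "8 * t ^ 3 * Ncmp1 t \<le> 8 * t\<^sup>2 * Ncmp t" unfolding t3 using t_Ncmp1_le[OF t] by (intro mult_left_mono) auto
  have "8 * t\<^sup>2 * Ncmp t \<le> 8 * t\<^sup>2 * (\<epsilon> * Lcmp t)" using small by (intro mult_left_mono) auto
  note N\<epsilon> = this
  have "200 * Ncmp t \<le> 200 * (\<epsilon> * Lcmp t)" using small by simp
  also have "\<dots> \<le> 1 * Lcmp t" using \<epsilon> L by (simp add: mult_right_mono)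
  finally have N200: "200 * Ncmp t \<le> Ncmp t + N.Lam t" by (simp add: Lcmp_def)
  have lowA: "Q \<le> norm (Complex a1 a2)"
    unfolding Q_def a1_def a2_def
    by (rule complex_lower_bound[OF N.cosp_sinp_ge[OF t] cP(1) _ N200]) (use sP PN N1N Ncmp_nonneg[OF t] in linarith)+
  have lowB: "Q \<le> norm (Complex b1 b2)"
    unfolding Q_def b1_def b2_def
    by (rule complex_lower_bound[OF N.cosp_sinp_ge[OF t] c1(1) _ N200]) (use s1 PN N1N Ncmp_nonneg[OF t] in linarith)+
  have Psi_eq: "Psi t = 1 / Complex a1 a2 - 1 / Complex b1 b2"
    unfolding Psi_def one_minus_phi one_minus_phi_cmp a1_def a2_def b1_def b2_def ..
  have TN_eq: "8 * t\<^sup>2 * TN = 8 * t\<^sup>2 * (P.Lam t - t * P.Lam1 t) + 8 * t\<^sup>2 * (c0 / (1 + t)\<^sup>2)"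
    unfolding TN_def Theta_Ncmp[OF t] by (simp only: distrib_left)
  have TL_eq: "8 * t\<^sup>2 * TL = 8 * t\<^sup>2 * (N.Lam t - t * N.Lam1 t) + 8 * t\<^sup>2 * TN"
    unfolding TL_def TN_def Theta_Lcmp by (simp only: distrib_left)
  have TP8: "0 \<le> 8 * t\<^sup>2 * (P.Lam t - t * P.Lam1 t)" "0 \<le> 8 * t\<^sup>2 * (c0 / (1 + t)\<^sup>2)"
    by (intro mult_nonneg_nonneg TP cc; simp)+
  have L1_eq: "8 * t ^ 3 * Lcmp1 t = 8 * t ^ 3 * N.Lam1 t + 8 * t ^ 3 * Ncmp1 t" by (simp add: Lcmp1_def distrib_left)
  have d1: "\<bar>a1 - b1\<bar> \<le> 8 * t\<^sup>2 * TN"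
    using cP c1 TP8 unfolding TN_eq a1_def b1_def by (simp add: abs_le_iff)
  have d2: "\<bar>a2 - b2\<bar> \<le> 8 * t ^ 3 * Ncmp1 t"
    using sP s1 PN unfolding a2_def b2_def by (simp add: abs_le_iff)
  have ab1: "0 \<le> a1" "0 \<le> b1" "a1 + b1 \<le> 2 * (8 * t\<^sup>2 * TL)"
    using cP cN c1 TP8 unfolding TL_eq TN_eq a1_def b1_def by simp_all
  have ab2: "\<bar>a2\<bar> + \<bar>b2\<bar> \<le> 2 * (8 * t ^ 3 * Lcmp1 t)"
  proof -
    have N1: "0 \<le> 8 * t ^ 3 * N.Lam1 t" "0 \<le> 8 * t ^ 3 * Ncmp1 t" using N.Lam1_nonneg[of t] Ncmp_nonneg(2)[OF t] t by auto
    have "\<bar>a2\<bar> \<le> 8 * t ^ 3 * Lcmp1 t" "\<bar>b2\<bar> \<le> 8 * t ^ 3 * Lcmp1 t"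
      using sP sN s1 PN N1 unfolding L1_eq a2_def b2_def by (simp_all add: abs_le_iff)
    then show ?thesis by simp
  qed
  have tTN: "8 * t\<^sup>2 * TN \<le> 8 * t\<^sup>2 * (\<epsilon> * Lcmp t)" using TN(2) N\<epsilon> order_trans mult_left_mono[of TN "Ncmp t" "8 * t\<^sup>2"] by force
  \<comment> \<open>The 1/32 in Q brings 1024 and 32768. With 8 and 2 * 8 from the cosine and sine
    bounds these give 8192 = 8 * 1024 and 4194304 = 8 * 16 * 32768.\<close>
  have Q2: "Q\<^sup>2 = t\<^sup>2 * (t * Lcmp t)\<^sup>2 / 1024" and Q3: "Q ^ 3 = t ^ 3 * (t * Lcmp t) ^ 3 / 32768"
    by (simp_all add: Q_eq power2_eq_square power3_eq_cube)
  have "\<bar>Re (Psi t)\<bar> \<le> \<bar>a1 - b1\<bar> / Q\<^sup>2 + \<bar>a2 - b2\<bar> * (a1 + b1) / Q ^ 3"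
    unfolding Psi_eq by (rule resolvent_difference_bounds(1)[OF Q lowA lowB ab1(1,2)])
  also have "\<dots> \<le> (8 * t\<^sup>2 * TN) / Q\<^sup>2 + (8 * t\<^sup>2 * (\<epsilon> * Lcmp t)) * (2 * (8 * t\<^sup>2 * TL)) / Q ^ 3"
    using d1 d2 ab1 N1N N\<epsilon> Q L \<epsilon> by (intro add_mono divide_right_mono mult_mono) auto
  also have "\<dots> = 8192 * (TN / (t * Lcmp t)\<^sup>2) + 4194304 * (\<epsilon> * TL / (t * Lcmp t)\<^sup>2)"
    unfolding Q2 Q3 using t L by (simp add: power2_eq_square power3_eq_cube)
  also have "\<dots> \<le> 4194304 * (TN / (t * Lcmp t)\<^sup>2) + 4194304 * (\<epsilon> * TL / (t * Lcmp t)\<^sup>2)"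
    using TN by (intro add_right_mono mult_right_mono) auto
  also have "\<dots> = 4194304 * ((TN + \<epsilon> * TL) / (t * Lcmp t)\<^sup>2)" by (simp only: add_divide_distrib distrib_left)
  finally show "\<bar>Re (Psi t)\<bar> \<le> 4194304 * ((Ncmp t - t * Ncmp1 t + \<epsilon> * (Lcmp t - t * Lcmp1 t)) / (t * Lcmp t)\<^sup>2)"
    by (simp only: TN_def TL_def)
  have "\<bar>Im (Psi t)\<bar> \<le> \<bar>a2 - b2\<bar> / Q\<^sup>2 + \<bar>a1 - b1\<bar> * (\<bar>a2\<bar> + \<bar>b2\<bar>) / Q ^ 3"
    unfolding Psi_eq by (rule resolvent_difference_bounds(2)[OF Q lowA lowB ab1(1,2)])
  also have "\<dots> \<le> (8 * t ^ 3 * Ncmp1 t) / Q\<^sup>2 + (8 * t\<^sup>2 * (\<epsilon> * Lcmp t)) * (2 * (8 * t ^ 3 * Lcmp1 t)) / Q ^ 3"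
    using d1 d2 ab2 tTN Q L \<epsilon> by (intro add_mono divide_right_mono mult_mono) auto
  also have "\<dots> = 8192 * (Ncmp1 t / (t * (Lcmp t)\<^sup>2)) + 4194304 * (\<epsilon> * Lcmp1 t / (t * (Lcmp t)\<^sup>2))"
    unfolding Q2 Q3 using t L by (simp add: power2_eq_square power3_eq_cube mult_ac)
  also have "\<dots> \<le> 4194304 * (Ncmp1 t / (t * (Lcmp t)\<^sup>2)) + 4194304 * (\<epsilon> * Lcmp1 t / (t * (Lcmp t)\<^sup>2))"
    using Ncmp_nonneg(2)[OF t] t by (intro add_right_mono mult_right_mono) auto
  also have "\<dots> = 4194304 * ((Ncmp1 t + \<epsilon> * Lcmp1 t) / (t * (Lcmp t)\<^sup>2))" by (simp only: add_divide_distrib distrib_left)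
  finally show "\<bar>Im (Psi t)\<bar> \<le> 4194304 * ((Ncmp1 t + \<epsilon> * Lcmp1 t) / (t * (Lcmp t)\<^sup>2))" .
qed

text \<open>The sign \<sigma> selects the half-line; the averages over j and over -j differ only in
  the sign of the frequency in the kernel.\<close>

lemma cesaro_difference_fourier:
  assumes R: "R > 0" and \<sigma>: "\<sigma> \<in> {1, - 1 :: int}"
  shows "set_integrable lborel {0..pi} (\<lambda>t. Re (cesaro_kernel R (real_of_int \<sigma> * t) * Psi t))"
    and "(\<Sum>j<R. pot (\<sigma> * int j) - pot' (\<sigma> * int j) / \<theta>) / real R =
      (LBINT t:{0..pi}. Re (cesaro_kernel R (real_of_int \<sigma> * t) * Psi t)) / pi"
proof -
  interpret C: zwalk_neg cmp by (rule zwalk_neg_cmp)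
  define f where "f j t = Re ((1 - cis (real_of_int (\<sigma> * int j) * t)) / (1 - phi p t))" for j t
  define g where "g j t = Re ((1 - cis (real_of_int (\<sigma> * int j) * t)) / (1 - phi cmp t)) / \<theta>" for j t
  have fi: "set_integrable lborel {0..pi} (f j)" and f_eq: "pot (\<sigma> * int j) = (LBINT t:{0..pi}. f j t) / pi" for j
    unfolding f_def by (rule pot_fourier)+
  have gi: "set_integrable lborel {0..pi} (g j)" for j
    unfolding g_def using C.pot_fourier(1)[of "\<sigma> * int j"] by (intro set_integrable_divide) auto
  have g_eq: "pot' (\<sigma> * int j) / \<theta> = (LBINT t:{0..pi}. g j t) / pi" for j
    unfolding g_def using C.pot_fourier(2)[of "\<sigma> * int j"] by simp
  have eq: "(\<Sum>j<R. f j t - g j t) / real R = Re (cesaro_kernel R (real_of_int \<sigma> * t) * Psi t)" for t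
  proof -
    have "f j t - g j t = Re ((1 - cis (real j * (real_of_int \<sigma> * t))) * Psi t)" for j
    proof -
      have "g j t = Re ((1 - cis (real_of_int (\<sigma> * int j) * t)) / (1 - phi cmp t) / of_real \<theta>)"
        unfolding g_def by (simp only: Re_divide_of_real)
      moreover have "w / a - w / b / of_real \<theta> = w * (1 / a - 1 / (of_real \<theta> * b))" for w a b :: complex
        by (simp add: right_diff_distrib mult.commute)
      ultimately have "f j t - g j t = Re ((1 - cis (real_of_int (\<sigma> * int j) * t)) * Psi t)"
        by (simp only: f_def Psi_def minus_complex.sel(1)[symmetric])
      then show ?thesis by (simp add: mult_ac)
    qed
    then have "(\<Sum>j<R. f j t - g j t) / real R = Re (\<Sum>j<R. (1 - cis (real j * (real_of_int \<sigma> * t))) * Psi t) / real R"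
      by (simp only: Re_sum)
    also have "\<dots> = Re ((\<Sum>j<R. (1 - cis (real j * (real_of_int \<sigma> * t))) * Psi t) / of_real (real R))"
      by (simp only: Re_divide_of_real)
    also have "(\<Sum>j<R. (1 - cis (real j * (real_of_int \<sigma> * t))) * Psi t) / of_real (real R) = cesaro_kernel R (real_of_int \<sigma> * t) * Psi t"
      by (simp add: cesaro_kernel_def sum_distrib_right)
    finally show ?thesis .
  qed
  have fgi: "set_integrable lborel {0..pi} (\<lambda>t. f j t - g j t)" for j by (intro set_integral_diff fi gi)
  have "set_integrable lborel {0..pi} (\<lambda>t. (\<Sum>j<R. f j t - g j t) / real R)"
  proof -
    have "(\<lambda>t. indicator {0..pi} t *\<^sub>R ((\<Sum>j<R. f j t - g j t) / real R)) =
        (\<lambda>t. (\<Sum>j<R. indicator {0..pi} t *\<^sub>R (f j t - g j t)) / real R)"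
      by (simp add: fun_eq_iff sum_distrib_left)
    then show ?thesis
      using fgi unfolding set_integrable_def
      by (simp only:) (intro integrable_divide_zero Bochner_Integration.integrable_sum)
  qed
  then show "set_integrable lborel {0..pi} (\<lambda>t. Re (cesaro_kernel R (real_of_int \<sigma> * t) * Psi t))"
    by (simp only: eq)
  have "(LBINT t:{0..pi}. (\<Sum>j<R. f j t - g j t) / real R) = (\<Sum>j<R. LBINT t:{0..pi}. f j t - g j t) / real R"
    by (simp only: set_integral_divide_zero set_integral_finite_sum[OF fgi])
  also have "(\<Sum>j<R. LBINT t:{0..pi}. f j t - g j t) = pi * (\<Sum>j<R. pot (\<sigma> * int j) - pot' (\<sigma> * int j) / \<theta>)"
    by (simp add: set_integral_diff(2)[OF fi gi] f_eq g_eq sum_distrib_left right_diff_distrib)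
  finally show "(\<Sum>j<R. pot (\<sigma> * int j) - pot' (\<sigma> * int j) / \<theta>) / real R =
      (LBINT t:{0..pi}. Re (cesaro_kernel R (real_of_int \<sigma> * t) * Psi t)) / pi"
    by (simp only: eq) simp
qed

text \<open>On (0, \<delta>] the kernel integral bound applies with s = 1/R; on [\<delta>, pi] both
  denominators stay away from 0 and yield M. The constant is 10 * 4 * 4194304, with the 4 from the
  decay of the Cesaro kernel.\<close>

lemma cesaro_difference_bound:
  assumes \<epsilon>: "0 < \<epsilon>" "\<epsilon> \<le> 1 / 200"
  shows "\<exists>M\<ge>0. \<exists>R1>0. \<forall>R\<ge>R1. \<forall>\<sigma>\<in>{1, - 1 :: int}.
      \<bar>(\<Sum>j<R. pot (\<sigma> * int j) - pot' (\<sigma> * int j) / \<theta>) / real R\<bar> \<le> 167772160 * \<epsilon> * (real R / Lcmp (1 / real R)) + M"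
proof -
  interpret C: zwalk_neg cmp by (rule zwalk_neg_cmp)
  obtain \<delta> where \<delta>: "0 < \<delta>" "\<delta> \<le> pi" "\<And>t. 0 < t \<Longrightarrow> t \<le> \<delta> \<Longrightarrow> Ncmp t \<le> \<epsilon> * Lcmp t"
    using Ncmp_small[OF \<epsilon>(1)] by blast
  obtain c1 where c1: "c1 > 0" "\<And>t. \<delta> \<le> t \<Longrightarrow> t \<le> pi \<Longrightarrow> reA t \<ge> c1"
    using reA_bounded_below[OF \<delta>(1,2)] by blast
  obtain c2 where c2: "c2 > 0" "\<And>t. \<delta> \<le> t \<Longrightarrow> t \<le> pi \<Longrightarrow> C.reA t \<ge> c2"
    using C.reA_bounded_below[OF \<delta>(1,2)] by blast
  define M where "M = 2 * (1 / c1 + 1 / (\<theta> * c2))"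
  have M: "0 \<le> M" using c1 c2 \<theta>_pos by (simp add: M_def)
  obtain R1 :: nat where R1: "0 < R1" "1 / real R1 \<le> \<delta>"
  proof -
    obtain n :: nat where "1 < real n * \<delta>" using reals_Archimedean3[OF \<delta>(1)] by blast
    then have "1 \<le> \<delta> * real (Suc n)" using \<delta>(1) by (simp add: distrib_left mult.commute)
    then have "1 / real (Suc n) \<le> \<delta>" by (subst pos_divide_le_eq) auto
    then show ?thesis using that[of "Suc n"] by blast
  qed
  have bound: "\<bar>(\<Sum>j<R. pot (\<sigma> * int j) - pot' (\<sigma> * int j) / \<theta>) / real R\<bar> \<le> 167772160 * \<epsilon> * (real R / Lcmp (1 / real R)) + M"
    if R: "R \<ge> R1" and \<sigma>: "\<sigma> \<in> {1, - 1 :: int}" for R \<sigma>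
  proof -
    have Rp: "R > 0" using R R1 by simp
    define s where "s = 1 / real R"
    have s: "0 < s" "s \<le> \<delta>"
    proof -
      have "1 / real R \<le> 1 / real R1" using R R1 by (intro divide_left_mono) auto
      then show "s \<le> \<delta>" using R1 by (simp add: s_def)
    qed (use Rp in \<open>simp add: s_def\<close>)
    define K where "K t = cesaro_kernel R (real_of_int \<sigma> * t)" for t
    define F where "F t = Re (K t * Psi t)" for t
    have K_bounds: "\<bar>Re (K t)\<bar> \<le> (t / s)\<^sup>2" "\<bar>Re (K t)\<bar> \<le> 2" "\<bar>Im (K t)\<bar> \<le> t / s" "\<bar>Im (K t)\<bar> \<le> 4 * (s / t)" "norm (K t) \<le> 2"
      if t: "0 < t" "t \<le> pi" for t
      using cesaro_kernel_bounds[OF Rp, of "real_of_int \<sigma> * t" t] t \<sigma>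
      by (auto simp: K_def s_def abs_mult mult.commute)
    have F_le: "\<bar>F t\<bar> \<le> \<bar>Re (K t)\<bar> * \<bar>Re (Psi t)\<bar> + \<bar>Im (K t)\<bar> * \<bar>Im (Psi t)\<bar>" for t
    proof -
      have "F t = Re (K t) * Re (Psi t) - Im (K t) * Im (Psi t)" by (simp add: F_def)
      then show ?thesis
        using abs_triangle_ineq4[of "Re (K t) * Re (Psi t)" "Im (K t) * Im (Psi t)"] by (simp add: abs_mult)
    qed
    let ?X = "\<lambda>t. (Ncmp t - t * Ncmp1 t + \<epsilon> * (Lcmp t - t * Lcmp1 t)) / (t * Lcmp t)\<^sup>2"
    let ?Y = "\<lambda>t. (Ncmp1 t + \<epsilon> * Lcmp1 t) / (t * (Lcmp t)\<^sup>2)"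
    have XY: "0 \<le> ?X t" "0 \<le> ?Y t" if "0 < t" for t
      using t_Ncmp1_le[OF that] t_Lcmp1_le[OF that] Ncmp_nonneg(2)[OF that] Lcmp_pos(2)[OF that] \<epsilon> that by simp_all
    have near: "(\<integral>\<^sup>+t. ennreal \<bar>F t\<bar> * indicator {0<..\<delta>} t \<partial>lborel) \<le> ennreal (10 * 16777216 * \<epsilon> / (s * Lcmp s))"
    proof (rule kernel_integral_bound[OF s, where L=Lcmp and N=Ncmp and ?L1.0=Lcmp1 and ?N1.0=Ncmp1])
      fix t assume t: "0 < t" "t \<le> s"
      then have t': "t \<le> \<delta>" "t \<le> pi" using s \<delta> by auto
      have "\<bar>F t\<bar> \<le> (t / s)\<^sup>2 * (4194304 * ?X t) + (t / s) * (4194304 * ?Y t)"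
        using K_bounds[OF t(1) t'(2)] Psi_bounds[OF t(1) \<epsilon> \<delta>(3)[OF t(1) t'(1)]] t s XY[OF t(1)]
        by (intro order_trans[OF F_le] add_mono mult_mono) auto
      also have "\<dots> = 4194304 * ((t / s)\<^sup>2 * ?X t + (t / s) * ?Y t)" by (simp only: distrib_left mult_ac)
      also have "\<dots> \<le> 16777216 * ((t / s)\<^sup>2 * ?X t + (t / s) * ?Y t)"
        using XY[OF t(1)] t s by (intro mult_right_mono add_nonneg_nonneg mult_nonneg_nonneg) auto
      finally show "\<bar>F t\<bar> \<le> 16777216 * ((t / s)\<^sup>2 * ?X t + (t / s) * ?Y t)" .
    next
      fix t assume t: "s \<le> t" "t \<le> \<delta>"
      then have t0: "0 < t" "t \<le> pi" using s \<delta> by auto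
      have "\<bar>F t\<bar> \<le> 2 * (4194304 * ?X t) + (4 * (s / t)) * (4194304 * ?Y t)"
        using K_bounds[OF t0] Psi_bounds[OF t0(1) \<epsilon> \<delta>(3)[OF t0(1) t(2)]] t s XY[OF t0(1)] t0
        by (intro order_trans[OF F_le] add_mono mult_mono) auto
      also have "\<dots> \<le> 16777216 * ?X t + 16777216 * ((s / t) * ?Y t)"
      proof -
        have "2 * (4194304 * x) + (4 * r) * (4194304 * y) \<le> 16777216 * x + 16777216 * (r * y)" if "0 \<le> x" for x r y :: real
          using that by simp
        then show ?thesis using XY(1)[OF t0(1)] by blast
      qed
      also have "\<dots> = 16777216 * (?X t + (s / t) * ?Y t)" by (simp only: distrib_left)
      finally show "\<bar>F t\<bar> \<le> 16777216 * (?X t + (s / t) * ?Y t)" .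
    qed (use \<epsilon> \<delta> Lcmp_deriv Ncmp_deriv Lcmp_pos Ncmp_nonneg t_Lcmp1_le t_Ncmp1_le in auto)
    have far: "\<bar>F t\<bar> \<le> M" if t: "\<delta> \<le> t" "t \<le> pi" for t
    proof -
      have t0: "0 < t" using t \<delta> by simp
      have nA: "c1 \<le> norm (1 - phi p t)" using c1(2)[OF t] complex_Re_le_cmod[of "1 - phi p t"] by (simp add: reA_def)
      have nB: "c2 \<le> norm (1 - phi cmp t)" using c2(2)[OF t] complex_Re_le_cmod[of "1 - phi cmp t"] by (simp add: C.reA_def)
      have "norm (Psi t) \<le> norm (1 / (1 - phi p t)) + norm (1 / (\<theta> * (1 - phi cmp t)))"
        unfolding Psi_def by (rule norm_triangle_ineq4)
      also have "\<dots> \<le> 1 / c1 + 1 / (\<theta> * c2)"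
        using nA nB c1(1) c2(1) \<theta>_pos by (intro add_mono) (auto simp: norm_divide norm_mult intro!: divide_left_mono mult_left_mono mult_pos_pos)
      finally have "norm (K t * Psi t) \<le> 2 * (1 / c1 + 1 / (\<theta> * c2))"
        unfolding norm_mult using K_bounds(5)[OF t0 t(2)] by (intro mult_mono) auto
      then show ?thesis using abs_Re_le_cmod[of "K t * Psi t"] by (simp add: F_def M_def)
    qed
    \<comment> \<open>The point 0 belongs to [0, pi] but not to (0, \<delta>]; the kernel vanishes
      there.\<close>
    have F0: "F 0 = 0" by (simp add: F_def K_def cesaro_kernel_def)
    have F_int: "integrable lborel (\<lambda>t. indicator {0..pi} t *\<^sub>R F t)"
      using cesaro_difference_fourier(1)[OF Rp \<sigma>] by (simp add: F_def K_def set_integrable_def)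
    have b0: "0 \<le> 10 * 16777216 * \<epsilon> / (s * Lcmp s)" using \<epsilon> s Lcmp_pos(1)[OF s(1)] by simp
    have "ennreal \<bar>LBINT t:{0..pi}. F t\<bar> \<le> (\<integral>\<^sup>+t. ennreal \<bar>indicator {0..pi} t *\<^sub>R F t\<bar> \<partial>lborel)"
      unfolding set_lebesgue_integral_def using integral_norm_bound_ennreal[OF F_int] by simp
    also have "\<dots> \<le> (\<integral>\<^sup>+t. ennreal \<bar>F t\<bar> * indicator {0<..\<delta>} t + ennreal M * indicator {\<delta>..pi} t \<partial>lborel)"
    proof (rule nn_integral_mono)
      fix t
      show "ennreal \<bar>indicator {0..pi} t *\<^sub>R F t\<bar> \<le> ennreal \<bar>F t\<bar> * indicator {0<..\<delta>} t + ennreal M * indicator {\<delta>..pi} t"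
      proof (cases "t \<in> {\<delta>..pi}")
        case True
        have "ennreal \<bar>F t\<bar> \<le> ennreal M" using far[of t] True by (intro ennreal_leI) auto
        then show ?thesis using True \<delta> by (auto simp: indicator_def intro: add_increasing)
      next
        case False
        then show ?thesis using F0 by (cases "t = 0") (auto simp: indicator_def)
      qed
    qed
    also have "\<dots> = (\<integral>\<^sup>+t. ennreal \<bar>F t\<bar> * indicator {0<..\<delta>} t \<partial>lborel) + (\<integral>\<^sup>+t. ennreal M * indicator {\<delta>..pi} t \<partial>lborel)"
    proof (rule nn_integral_add)
      have "(\<lambda>t. ennreal \<bar>indicator {0..pi} t *\<^sub>R F t\<bar> * indicator {0<..\<delta>} t) \<in> borel_measurable lborel"
        using borel_measurable_integrable[OF F_int] by measurable
      also have "(\<lambda>t. ennreal \<bar>indicator {0..pi} t *\<^sub>R F t\<bar> * indicator {0<..\<delta>} t) = (\<lambda>t. ennreal \<bar>F t\<bar> * indicator {0<..\<delta>} t)"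
        using \<delta> by (auto simp: indicator_def fun_eq_iff)
      finally show "(\<lambda>t. ennreal \<bar>F t\<bar> * indicator {0<..\<delta>} t) \<in> borel_measurable lborel" .
    qed simp
    also have "(\<integral>\<^sup>+t. ennreal M * indicator {\<delta>..pi} t \<partial>lborel) = ennreal (M * (pi - \<delta>))"
      using \<delta> M by (simp add: nn_integral_cmult_indicator ennreal_mult)
    also have "(\<integral>\<^sup>+t. ennreal \<bar>F t\<bar> * indicator {0<..\<delta>} t \<partial>lborel) + ennreal (M * (pi - \<delta>))
        \<le> ennreal (10 * 16777216 * \<epsilon> / (s * Lcmp s)) + ennreal (M * pi)"
      using M \<delta> by (intro add_mono near ennreal_leI mult_left_mono) auto
    also have "\<dots> = ennreal (10 * 16777216 * \<epsilon> / (s * Lcmp s) + M * pi)"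
      using b0 M by (subst ennreal_plus) auto
    finally have "\<bar>LBINT t:{0..pi}. F t\<bar> \<le> 10 * 16777216 * \<epsilon> / (s * Lcmp s) + M * pi"
      using b0 M by (subst (asm) ennreal_le_iff) auto
    then have "\<bar>LBINT t:{0..pi}. F t\<bar> / pi \<le> (10 * 16777216 * \<epsilon> / (s * Lcmp s) + M * pi) / pi"
      by (intro divide_right_mono) auto
    also have "\<dots> = 10 * 16777216 * \<epsilon> / (s * Lcmp s) / pi + M" by (simp add: add_divide_distrib)
    also have "\<dots> \<le> 10 * 16777216 * \<epsilon> / (s * Lcmp s) + M"
      using divide_left_mono[of 1 pi "10 * 16777216 * \<epsilon> / (s * Lcmp s)"] b0 pi_gt3 by simp
    also have "10 * 16777216 * \<epsilon> / (s * Lcmp s) = 167772160 * \<epsilon> * (real R / Lcmp (1 / real R))"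
      by (simp add: s_def)
    finally show ?thesis
      unfolding cesaro_difference_fourier(2)[OF Rp \<sigma>] by (simp add: F_def K_def)
  qed
  show ?thesis using M R1(1) bound by blast
qed

text \<open>\<open>pot'_lower\<close> at R - 1, which evaluates \<open>N.Lam\<close> at 1/R, bounds
  R/Lcmp(1/R) by 4 pot'(R)/\<theta>: one factor 2 is in that lemma, the other is R <= 2(R - 1).
  Hence 671088640 = 4 * 167772160. The constant M is absorbed because pot'(R) tends to
  infinity.\<close>

lemma cesaro_difference_small:
  assumes \<eta>: "0 < \<eta>"
  shows "\<exists>R1\<ge>2. \<forall>R\<ge>R1. pot' (int R) > 0 \<and> (\<forall>\<sigma>\<in>{1, - 1 :: int}.
      \<bar>(\<Sum>j<R. pot (\<sigma> * int j) - pot' (\<sigma> * int j) / \<theta>) / real R\<bar> \<le> \<eta> * (pot' (int R) / \<theta>))"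
proof -
  interpret C: zwalk cmp by (rule zwalk_cmp)
  define \<epsilon> where "\<epsilon> = min (1 / 200) (\<eta> / 2 / 671088640)"
  have \<epsilon>: "0 < \<epsilon>" "\<epsilon> \<le> 1 / 200" "671088640 * \<epsilon> \<le> \<eta> / 2" using \<eta> by (auto simp: \<epsilon>_def)
  obtain M R1 where MR: "0 \<le> M" "0 < R1" and bound:
    "\<And>R \<sigma>. R \<ge> R1 \<Longrightarrow> \<sigma> \<in> {1, - 1 :: int} \<Longrightarrow>
      \<bar>(\<Sum>j<R. pot (\<sigma> * int j) - pot' (\<sigma> * int j) / \<theta>) / real R\<bar> \<le> 167772160 * \<epsilon> * (real R / Lcmp (1 / real R)) + M"
    using cesaro_difference_bound[OF \<epsilon>(1,2)] by blast
  obtain R2 where R2: "\<And>y. \<bar>y\<bar> \<ge> R2 \<Longrightarrow> C.sym_pot y > 2 * M * \<theta> / \<eta>" using C.sym_pot_at_infinity by blast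
  have big: "pot' (int R) > 2 * M * \<theta> / \<eta>" if "R \<ge> nat R2" for R
    using R2[of "int R"] that pot'_nonpos[of "- int R"] by (simp add: C.sym_pot_def)
  show ?thesis
  proof (intro exI[of _ "max 2 (max R1 (nat R2))"] conjI allI impI ballI)
    fix R :: nat and \<sigma> :: int
    assume R: "R \<ge> max 2 (max R1 (nat R2))" and \<sigma>: "\<sigma> \<in> {1, - 1}"
    let ?q = "pot' (int R) / \<theta>"
    define L where "L = Lcmp (1 / real R)"
    have L: "0 < L" using Lcmp_pos(1)[of "1 / real R"] R by (simp add: L_def)
    have "real (R - 1) * \<theta> \<le> pot' (int (R - 1)) * (2 * N.Lam (1 / (real (R - 1) + 1)))" by (rule pot'_lower)
    also have "real (R - 1) + 1 = real R" using R by simp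
    also have "pot' (int (R - 1)) * (2 * N.Lam (1 / real R)) \<le> pot' (int R) * (2 * L)"
      using pot'_nonneg R N.Lam_nonneg[of "1 / real R"] Ncmp_nonneg(1)[of "1 / real R"]
      by (intro mult_mono pot'_mono) (auto simp: L_def Lcmp_def)
    finally have "real (R - 1) * \<theta> \<le> pot' (int R) * (2 * L)" .
    moreover have "real R / 2 \<le> real (R - 1)" using R by simp
    ultimately have "real R / 2 * \<theta> \<le> pot' (int R) * (2 * L)"
      using \<theta>_pos mult_right_mono[of "real R / 2" "real (R - 1)" \<theta>] by linarith
    then have RL: "real R / L \<le> 4 * ?q" using L \<theta>_pos by (simp add: field_simps)
    have "\<bar>(\<Sum>j<R. pot (\<sigma> * int j) - pot' (\<sigma> * int j) / \<theta>) / real R\<bar> \<le> 167772160 * \<epsilon> * (real R / L) + M"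
      unfolding L_def by (rule bound) (use R \<sigma> in auto)
    also have "167772160 * \<epsilon> * (real R / L) \<le> 167772160 * \<epsilon> * (4 * ?q)" using RL \<epsilon> by (intro mult_left_mono) auto
    also have "\<dots> = 671088640 * \<epsilon> * ?q" by simp
    also have "\<dots> \<le> \<eta> / 2 * ?q" using \<epsilon>(3) pot'_nonneg[of "int R"] \<theta>_pos by (intro mult_right_mono) auto
    also have "M \<le> \<eta> / 2 * ?q" using big[of R] R \<eta> \<theta>_pos by (simp add: field_simps)
    also have "\<eta> / 2 * ?q + \<eta> / 2 * ?q = \<eta> * ?q" by (simp add: field_simps)
    finally show "\<bar>(\<Sum>j<R. pot (\<sigma> * int j) - pot' (\<sigma> * int j) / \<theta>) / real R\<bar> \<le> \<eta> * ?q" by simp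
  next
    fix R :: nat assume R: "R \<ge> max 2 (max R1 (nat R2))"
    have "0 \<le> 2 * M * \<theta> / \<eta>" using MR \<theta>_pos \<eta> by simp
    then show "pot' (int R) > 0" using big[of R] R by simp
  qed simp
qed

text \<open>Subadditivity ties values to means: a(-R) <= a(-(R - j)) + a(-j) bounds a(-R) by the
  left mean, and a(j) <= a(R) + a(j - R) bounds a(R) from below by the right mean, which follows
  that of a'/\<theta>.\<close>

lemma potential_ratio_small:
  assumes \<epsilon>: "0 < \<epsilon>"
  obtains Z :: int where "\<And>z. z \<ge> Z \<Longrightarrow> 0 < pot z \<and> pot (- z) \<le> \<epsilon> * pot z"
proof -
  \<comment> \<open>The left value will be at most 4 \<eta> q and the right one at least (1/4 - 6
    \<eta>) q, which is at least q/8, so the ratio is at most 32 \<eta>.\<close>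
  define \<eta> where "\<eta> = min (1 / 100) (\<epsilon> / 32)"
  have \<eta>: "0 < \<eta>" "\<eta> \<le> 1 / 100" "32 * \<eta> \<le> \<epsilon>" using \<epsilon> by (auto simp: \<eta>_def)
  obtain R1 :: nat where R1: "2 \<le> R1" and small:
    "\<And>R \<sigma>. R \<ge> R1 \<Longrightarrow> \<sigma> \<in> {1, - 1 :: int} \<Longrightarrow>
      \<bar>(\<Sum>j<R. pot (\<sigma> * int j) - pot' (\<sigma> * int j) / \<theta>) / real R\<bar> \<le> \<eta> * (pot' (int R) / \<theta>)"
    and pos: "\<And>R. R \<ge> R1 \<Longrightarrow> pot' (int R) > 0"
    using cesaro_difference_small[OF \<eta>(1)] by blast
  show ?thesis
  proof (rule that[of "int R1"])
    fix z assume z: "z \<ge> int R1"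
    define R where "R = nat z"
    have R: "R \<ge> R1" "z = int R" "2 \<le> R" using z R1 by (auto simp: R_def)
    have Rr: "2 \<le> real R" using R by simp
    define q where "q = pot' (int R) / \<theta>"
    have q: "0 < q" using pos[OF R(1)] \<theta>_pos by (simp add: q_def)
    define Am where "Am = (\<Sum>j<R. pot (- int j))"
    define Ap where "Ap = (\<Sum>j<R. pot (int j))"
    have Am: "Am \<le> \<eta> * q * real R"
    proof -
      have "\<bar>Am / real R\<bar> \<le> \<eta> * q"
        using small[OF R(1), of "- 1"] by (simp add: pot'_nonpos Am_def q_def)
      then have "Am / real R \<le> \<eta> * q" by linarith
      then show ?thesis using Rr by (simp add: divide_le_eq)
    qed
    \<comment> \<open>Subadditivity alone suggests q/2, but the reflected sum contains the extra end
      term a'(R); R >= 2 absorbs it at the cost of the factor 1/4.\<close>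
    have Wsum: "(\<Sum>j<R. pot' (int j) / \<theta>) \<ge> real R / 4 * q"
    proof -
      have "(\<Sum>j<R. pot' (int R)) \<le> (\<Sum>j<R. pot' (int j) + pot' (int (R - j)))"
      proof (rule sum_mono)
        fix j assume "j \<in> {..<R}"
        then show "pot' (int R) \<le> pot' (int j) + pot' (int (R - j))"
          using pot'_subadditive[of "int j" "int (R - j)"] by (simp add: of_nat_diff)
      qed
      also have "\<dots> = (\<Sum>j<R. pot' (int j)) + (\<Sum>j<R. pot' (int (R - j)))" by (rule sum.distrib)
      also have "(\<Sum>j<R. pot' (int (R - j))) = (\<Sum>j<R. pot' (int (Suc j)))"
        by (rule sum_reverse_Suc)
      also have "\<dots> = (\<Sum>j<R. pot' (int j)) + pot' (int R) - pot' 0"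
        using sum_lessThan_telescope[of "\<lambda>j. pot' (int j)" R] by (simp add: sum_subtractf)
      finally have "real R * pot' (int R) \<le> 2 * (\<Sum>j<R. pot' (int j)) + pot' (int R)" by (simp add: pot'_nonpos)
      moreover have "2 * pot' (int R) \<le> real R * pot' (int R)" using Rr pos[OF R(1)] by (intro mult_right_mono) auto
      ultimately have "real R * pot' (int R) / 4 \<le> (\<Sum>j<R. pot' (int j))" by linarith
      then have "real R * pot' (int R) / 4 / \<theta> \<le> (\<Sum>j<R. pot' (int j)) / \<theta>" using \<theta>_pos by (intro divide_right_mono) auto
      then show ?thesis by (simp add: q_def sum_divide_distrib)
    qed
    have Ap: "(1 / 4 - \<eta>) * q * real R \<le> Ap"
    proof -
      have "\<bar>(Ap - (\<Sum>j<R. pot' (int j) / \<theta>)) / real R\<bar> \<le> \<eta> * q"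
        using small[OF R(1), of 1] by (simp add: Ap_def q_def sum_subtractf)
      then have "- (\<eta> * q) \<le> (Ap - (\<Sum>j<R. pot' (int j) / \<theta>)) / real R" by linarith
      then have "- (\<eta> * q) * real R \<le> Ap - (\<Sum>j<R. pot' (int j) / \<theta>)" using Rr by (simp add: pos_le_divide_eq)
      then show ?thesis using Wsum by (simp add: algebra_simps)
    qed
    have left: "pot (- int R) \<le> 4 * \<eta> * q"
    proof -
      have "(\<Sum>j\<in>{1..<R}. pot (- int R)) \<le> (\<Sum>j\<in>{1..<R}. pot (- int (R - j)) + pot (- int j))"
      proof (rule sum_mono)
        fix j assume "j \<in> {1..<R}"
        then show "pot (- int R) \<le> pot (- int (R - j)) + pot (- int j)"
          using pot_subadditive[of "- int (R - j)" "- int j"] by (simp add: of_nat_diff)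
      qed
      also have "\<dots> = (\<Sum>j\<in>{1..<R}. pot (- int (R - j))) + (\<Sum>j\<in>{1..<R}. pot (- int j))" by (rule sum.distrib)
      also have "(\<Sum>j\<in>{1..<R}. pot (- int (R - j))) = (\<Sum>j\<in>{1..<R}. pot (- int j))"
        by (rule sum.reindex_bij_witness[of _ "\<lambda>j. R - j" "\<lambda>j. R - j"]) auto
      also have "(\<Sum>j\<in>{1..<R}. pot (- int j)) \<le> Am"
        unfolding Am_def by (rule sum_mono2) (auto simp: pot_nonneg)
      finally have "(real R - 1) * pot (- int R) \<le> 2 * Am" using R by (simp add: of_nat_diff)
      moreover have "real R / 2 * pot (- int R) \<le> (real R - 1) * pot (- int R)"
        using Rr pot_nonneg by (intro mult_right_mono) auto
      ultimately have "real R * pot (- int R) \<le> real R * (4 * \<eta> * q)" using Am by (simp add: algebra_simps)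
      then show ?thesis using Rr by simp
    qed
    have right: "q / 8 \<le> pot (int R)"
    proof -
      have "Ap \<le> (\<Sum>j<R. pot (int R) + pot (- int (R - j)))"
        unfolding Ap_def
      proof (rule sum_mono)
        fix j assume "j \<in> {..<R}"
        then show "pot (int j) \<le> pot (int R) + pot (- int (R - j))"
          using pot_subadditive[of "int R" "- int (R - j)"] by (simp add: of_nat_diff)
      qed
      also have "\<dots> = real R * pot (int R) + (\<Sum>j<R. pot (- int (R - j)))" by (simp add: sum.distrib)
      also have "(\<Sum>j<R. pot (- int (R - j))) = (\<Sum>j<R. pot (- int (Suc j)))"
        by (rule sum_reverse_Suc)
      also have "\<dots> = Am + pot (- int R) - pot 0"
        using sum_lessThan_telescope[of "\<lambda>j. pot (- int j)" R] by (simp add: sum_subtractf Am_def)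
      finally have "Ap \<le> real R * pot (int R) + Am + pot (- int R)" by simp
      also have "pot (- int R) \<le> real R * (4 * \<eta> * q)"
      proof -
        have "1 * (4 * \<eta> * q) \<le> real R * (4 * \<eta> * q)" using Rr q \<eta> by (intro mult_right_mono) auto
        then show ?thesis using left by linarith
      qed
      finally have "(1 / 4 - \<eta>) * q * real R \<le> real R * pot (int R) + \<eta> * q * real R + real R * (4 * \<eta> * q)"
        using Ap Am by linarith
      then have "real R * ((1 / 4 - 6 * \<eta>) * q) \<le> real R * pot (int R)" by (simp add: algebra_simps)
      then have "(1 / 4 - 6 * \<eta>) * q \<le> pot (int R)" using Rr by simp
      moreover have "1 / 8 * q \<le> (1 / 4 - 6 * \<eta>) * q" using \<eta> q by (intro mult_right_mono) auto
      ultimately show ?thesis by simp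
    qed
    have "4 * \<eta> * q = 32 * \<eta> * (q / 8)" by simp
    also have "\<dots> \<le> \<epsilon> * pot (int R)" using right \<eta> q by (intro mult_mono) auto
    finally show "0 < pot z \<and> pot (- z) \<le> \<epsilon> * pot z" using left right q R(2) by simp
  qed
qed

text \<open>Makes the hitting estimates, proved from the ratio limit alone, available under
  dominance of the negative jumps.\<close>

sublocale zwalk_left
proof
  obtain Z where "\<And>z. z \<ge> Z \<Longrightarrow> 0 < pot z \<and> pot (- z) \<le> 1 * pot z"
    using potential_ratio_small[of 1] by auto
  then show "\<forall>\<^sub>F z in at_top. pot z \<noteq> 0"
    unfolding eventually_at_top_linorder by (metis less_irrefl)
  show "((\<lambda>z. pot (- z) / pot z) \<longlongrightarrow> 0) at_top"
  proof (rule tendstoI)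
    fix e :: real assume e: "e > 0"
    then obtain Z where Z: "\<And>z. z \<ge> Z \<Longrightarrow> 0 < pot z \<and> pot (- z) \<le> e / 2 * pot z"
      using potential_ratio_small[of "e / 2"] by auto
    have "dist (pot (- z) / pot z) 0 < e" if "z \<ge> Z" for z
    proof -
      have "pot (- z) / pot z \<le> e / 2" using Z[OF that] by (simp add: divide_le_eq)
      moreover have "0 \<le> pot (- z) / pot z" by (intro divide_nonneg_nonneg pot_nonneg)
      ultimately have "\<bar>pot (- z) / pot z\<bar> < e" using e by (simp only: abs_of_nonneg)
      then show ?thesis by (simp only: dist_real_def diff_zero)
    qed
    then show "\<forall>\<^sub>F z in at_top. dist (pot (- z) / pot z) 0 < e"
      unfolding eventually_at_top_linorder by blast
  qed
qed

end

section \<open>Iterated tail integrals\<close>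

lemma pmf_nn_integral_swap:
  fixes F :: "int \<Rightarrow> real \<Rightarrow> ennreal"
  assumes [measurable]: "\<And>z. F z \<in> borel_measurable borel"
  shows "(\<integral>\<^sup>+t. (\<integral>\<^sup>+z. F z t \<partial>measure_pmf p) \<partial>lborel) = (\<integral>\<^sup>+z. (\<integral>\<^sup>+t. F z t \<partial>lborel) \<partial>measure_pmf p)"
proof -
  interpret pair_sigma_finite "measure_pmf p" "lborel :: real measure" ..
  have "(\<lambda>w. F (fst w) (snd w)) \<in> borel_measurable (measure_pmf p \<Otimes>\<^sub>M lborel)"
  proof (rule measurable_compose_countable'[where I=UNIV and f="\<lambda>i w. F i (snd w)" and g=fst])
    show "(\<lambda>w. F i (snd w)) \<in> borel_measurable (measure_pmf p \<Otimes>\<^sub>M lborel)" for i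
      by (rule measurable_compose[OF measurable_snd]) simp
    have "fst \<in> measurable (measure_pmf p \<Otimes>\<^sub>M (lborel :: real measure)) (measure_pmf p)"
      by (rule measurable_fst)
    then show "fst \<in> measurable (measure_pmf p \<Otimes>\<^sub>M (lborel :: real measure)) (count_space UNIV)"
      by (simp cong: measurable_cong_sets)
  qed simp
  from Fubini[OF this] show ?thesis by simp
qed

context jump_weight
begin

text \<open>Closed form of the twice integrated tail: the integral of max(0, w - s) over s in
  [0, x], averaged over the jump.\<close>

definition tail2 :: "real \<Rightarrow> real" where
  "tail2 x = measure_pmf.expectation p (\<lambda>z. w z * min (w z) x - (min (w z) x)\<^sup>2 / 2)"

lemma tail_integral:
  assumes "0 \<le> x"
  shows "(LBINT y:{x..}. measure_pmf.prob p {z. y < w z}) = measure_pmf.expectation p (\<lambda>z. max 0 (w z - x))"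
proof -
  have prob_eq: "ennreal (measure_pmf.prob p {z. y < w z}) = (\<integral>\<^sup>+z. indicator {..<w z} y \<partial>measure_pmf p)" for y
  proof -
    have "(\<integral>\<^sup>+z. indicator {..<w z} y \<partial>measure_pmf p) = (\<integral>\<^sup>+z. indicator {z. y < w z} z \<partial>measure_pmf p)"
      by (intro nn_integral_cong) (simp add: indicator_def)
    then show ?thesis by (simp add: measure_pmf.emeasure_eq_measure)
  qed
  have prob_exp: "measure_pmf.prob p {z. y < w z} = measure_pmf.expectation p (\<lambda>z. indicator {..<w z} y)" for y
  proof -
    have "measure_pmf.expectation p (\<lambda>z. indicator {..<w z} y) = measure_pmf.expectation p (indicator {z. y < w z})"
      by (intro Bochner_Integration.integral_cong) (auto simp: indicator_def)
    also have "\<dots> = measure_pmf.prob p {z. y < w z}" by simp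
    finally show ?thesis ..
  qed
  have meas: "(\<lambda>y. measure_pmf.prob p {z. y < w z}) \<in> borel_measurable borel"
    unfolding prob_exp by (rule measurable_pmf_expectation) measurable
  have int: "integrable (measure_pmf p) (\<lambda>z. max 0 (w z - x))"
    by (rule integrable_of_le[of _ 1]) (use w_nonneg assms in \<open>auto simp: max_def\<close>)
  have "(\<integral>\<^sup>+y. ennreal (indicator {x..} y *\<^sub>R measure_pmf.prob p {z. y < w z}) \<partial>lborel) =
      (\<integral>\<^sup>+y. (\<integral>\<^sup>+z. indicator {x..<w z} y \<partial>measure_pmf p) \<partial>lborel)"
  proof (rule nn_integral_cong)
    fix y
    show "ennreal (indicator {x..} y *\<^sub>R measure_pmf.prob p {z. y < w z}) = (\<integral>\<^sup>+z. indicator {x..<w z} y \<partial>measure_pmf p)"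
    proof (cases "x \<le> y")
      case True
      then have "(\<integral>\<^sup>+z. indicator {x..<w z} y \<partial>measure_pmf p) = (\<integral>\<^sup>+z. indicator {..<w z} y \<partial>measure_pmf p)"
        by (intro nn_integral_cong) (auto simp: indicator_def)
      then show ?thesis using True by (simp add: prob_eq)
    qed simp
  qed
  also have "\<dots> = (\<integral>\<^sup>+z. (\<integral>\<^sup>+y. indicator {x..<w z} y \<partial>lborel) \<partial>measure_pmf p)"
    by (rule pmf_nn_integral_swap) measurable
  also have "\<dots> = (\<integral>\<^sup>+z. ennreal (max 0 (w z - x)) \<partial>measure_pmf p)"
    by (intro nn_integral_cong) (auto simp: max_def)
  also have "\<dots> = ennreal (measure_pmf.expectation p (\<lambda>z. max 0 (w z - x)))"
    by (rule nn_integral_eq_integral[OF int]) auto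
  finally have "(\<integral>\<^sup>+y. ennreal (indicator {x..} y *\<^sub>R measure_pmf.prob p {z. y < w z}) \<partial>lborel) =
      ennreal (measure_pmf.expectation p (\<lambda>z. max 0 (w z - x)))" .
  then show ?thesis
    unfolding set_lebesgue_integral_def using meas
    by (subst integral_eq_nn_integral) (auto intro!: integral_nonneg_AE)
qed

lemma tail_double_integral:
  assumes "0 \<le> x"
  shows "(LBINT s:{0..x}. measure_pmf.expectation p (\<lambda>z. max 0 (w z - s))) = tail2 x"
proof -
  have int: "integrable (measure_pmf p) (\<lambda>z. max 0 (w z - s))" if "0 \<le> s" for s
    by (rule integrable_of_le[of _ 1]) (use w_nonneg that in \<open>auto simp: max_def\<close>)
  have meas: "(\<lambda>s. measure_pmf.expectation p (\<lambda>z. max 0 (w z - s))) \<in> borel_measurable borel"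
    by (rule measurable_pmf_expectation) measurable
  define h where "h v = v * min v x - (min v x)\<^sup>2 / 2" for v :: real
  have h_nonneg: "0 \<le> h v" and h_le: "h v \<le> x * v" if "0 \<le> v" for v
  proof -
    have m: "0 \<le> min v x" "min v x \<le> v" "min v x \<le> x" using that assms by auto
    have "(min v x)\<^sup>2 \<le> v * min v x" using m by (simp add: power2_eq_square mult_right_mono)
    then show "0 \<le> h v" using mult_nonneg_nonneg[OF that m(1)] by (simp add: h_def)
    have "v * min v x \<le> v * x" using m that by (intro mult_left_mono) auto
    moreover have "0 \<le> (min v x)\<^sup>2" by (rule zero_le_power2)
    ultimately show "h v \<le> x * v" unfolding h_def mult.commute[of x v] by linarith
  qed
  have h_int: "integrable (measure_pmf p) (\<lambda>z. h (w z))"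
    by (rule integrable_of_le[of _ x]) (use h_nonneg h_le w_nonneg in \<open>auto simp: abs_of_nonneg\<close>)
  have inner: "(\<integral>\<^sup>+s. ennreal (indicator {0..x} s * max 0 (v - s)) \<partial>lborel) = ennreal (h v)" if v: "0 \<le> v" for v
  proof -
    have "(\<integral>\<^sup>+s. ennreal (indicator {0..x} s * max 0 (v - s)) \<partial>lborel) =
        (\<integral>\<^sup>+s. ennreal (v - s) * indicator {0..min v x} s \<partial>lborel)"
      by (intro nn_integral_cong) (auto simp: indicator_def max_def)
    also have "\<dots> = ennreal ((v * min v x - (min v x)\<^sup>2 / 2) - (v * 0 - 0\<^sup>2 / 2))"
      by (rule nn_integral_FTC_Icc) (use v assms in \<open>auto intro!: derivative_eq_intros\<close>)
    finally show ?thesis by (simp add: h_def)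
  qed
  have "(\<integral>\<^sup>+s. ennreal (indicator {0..x} s *\<^sub>R measure_pmf.expectation p (\<lambda>z. max 0 (w z - s))) \<partial>lborel) =
      (\<integral>\<^sup>+s. (\<integral>\<^sup>+z. ennreal (indicator {0..x} s * max 0 (w z - s)) \<partial>measure_pmf p) \<partial>lborel)"
  proof (rule nn_integral_cong)
    fix s
    show "ennreal (indicator {0..x} s *\<^sub>R measure_pmf.expectation p (\<lambda>z. max 0 (w z - s))) =
        (\<integral>\<^sup>+z. ennreal (indicator {0..x} s * max 0 (w z - s)) \<partial>measure_pmf p)"
      using nn_integral_eq_integral[OF int[of s]] by (cases "s \<in> {0..x}") auto
  qed
  also have "\<dots> = (\<integral>\<^sup>+z. (\<integral>\<^sup>+s. ennreal (indicator {0..x} s * max 0 (w z - s)) \<partial>lborel) \<partial>measure_pmf p)"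
    by (rule pmf_nn_integral_swap) measurable
  also have "\<dots> = (\<integral>\<^sup>+z. ennreal (h (w z)) \<partial>measure_pmf p)"
    by (intro nn_integral_cong inner w_nonneg)
  also have "\<dots> = ennreal (measure_pmf.expectation p (\<lambda>z. h (w z)))"
    by (rule nn_integral_eq_integral[OF h_int]) (use h_nonneg w_nonneg in auto)
  finally have "(\<integral>\<^sup>+s. ennreal (indicator {0..x} s *\<^sub>R measure_pmf.expectation p (\<lambda>z. max 0 (w z - s))) \<partial>lborel) =
      ennreal (measure_pmf.expectation p (\<lambda>z. h (w z)))" .
  moreover have "0 \<le> measure_pmf.expectation p (\<lambda>z. h (w z))"
    by (intro integral_nonneg_AE) (use h_nonneg w_nonneg in auto)
  ultimately have "(LBINT s:{0..x}. measure_pmf.expectation p (\<lambda>z. max 0 (w z - s))) = measure_pmf.expectation p (\<lambda>z. h (w z))"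
    unfolding set_lebesgue_integral_def using meas
    by (subst integral_eq_nn_integral) (auto intro!: AE_I2 mult_nonneg_nonneg integral_nonneg_AE)
  then show ?thesis by (simp only: tail2_def h_def)
qed

text \<open>The comparison is pointwise in v = \<open>w z\<close>: both integrands are of order v^2
  for v <= x and of order v x beyond, within factors of 2.\<close>

lemma Lam_tail2:
  assumes x: "0 < x"
  shows "Lam (1 / x) \<le> 2 * tail2 x" "tail2 x \<le> 2 * Lam (1 / x)"
proof -
  define h where "h v = v * min v x - (min v x)\<^sup>2 / 2" for v :: real
  define T where "T v = v\<^sup>2 / (1 + 1 / x * v)" for v :: real
  have T_eq: "T v = x * v\<^sup>2 / (x + v)" if "0 \<le> v" for v using x that by (simp add: T_def field_simps)
  have hT: "T v \<le> 2 * h v" "h v \<le> 2 * T v" if v: "0 \<le> v" for v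
  proof -
    have d: "0 < x + v" using x v by simp
    have "T v \<le> 2 * h v \<and> h v \<le> 2 * T v"
    proof (cases "v \<le> x")
      case True
      then have h: "h v = v\<^sup>2 / 2" by (simp add: h_def power2_eq_square)
      have "x * v\<^sup>2 \<le> v\<^sup>2 * (x + v)" 
        unfolding mult.commute[of "v\<^sup>2"] using v by (intro mult_right_mono) auto
      then have 1: "T v \<le> v\<^sup>2" unfolding T_eq[OF v] using d by (simp add: pos_divide_le_eq)
      have "v\<^sup>2 * (x + v) \<le> v\<^sup>2 * (2 * x)" using True by (intro mult_left_mono) auto
      then have "v\<^sup>2 / 2 \<le> T v" unfolding T_eq[OF v] using d by (simp add: pos_le_divide_eq mult_ac)
      moreover have "0 \<le> v\<^sup>2" by simp
      ultimately show ?thesis using 1 h by linarith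
    next
      case False
      then have h: "h v = v * x - x\<^sup>2 / 2" by (simp add: h_def)
      have vx: "x * x \<le> v * x" using False x by (intro mult_right_mono) auto
      have xv: "0 \<le> v * x" using v x by simp
      have "x * v\<^sup>2 \<le> (v * x) * (x + v)" using v x by (simp add: power2_eq_square algebra_simps)
      then have "T v \<le> v * x" unfolding T_eq[OF v] using d by (simp add: pos_divide_le_eq)
      moreover have "v * x \<le> 2 * h v" using vx by (simp add: h power2_eq_square)
      moreover have "(v * x) * (x + v) \<le> (v * x) * (2 * v)" using False xv by (intro mult_left_mono) auto
      then have "v * x \<le> 2 * T v" unfolding T_eq[OF v] using d by (simp add: pos_le_divide_eq power2_eq_square mult_ac)
      moreover have "h v \<le> v * x" by (simp add: h)
      ultimately show ?thesis by linarith
    qed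
    then show "T v \<le> 2 * h v" "h v \<le> 2 * T v" by auto
  qed
  have Ti: "integrable (measure_pmf p) (\<lambda>z. T (w z))"
    unfolding T_def using integrable_Lam[of "1 / x"] x by simp
  have T0: "0 \<le> T v" if "0 \<le> v" for v using x that by (simp add: T_def)
  have hi: "integrable (measure_pmf p) (\<lambda>z. h (w z))"
  proof (rule Bochner_Integration.integrable_bound[OF integrable_mult_right[OF Ti, of 2]])
    show "AE z in measure_pmf p. norm (h (w z)) \<le> norm (2 * T (w z))"
    proof (rule AE_I2)
      fix z
      show "norm (h (w z)) \<le> norm (2 * T (w z))"
        using hT[OF w_nonneg, of z] T0[OF w_nonneg, of z] by simp
    qed
  qed simp
  have "Lam (1 / x) = measure_pmf.expectation p (\<lambda>z. T (w z))" by (simp add: Lam_def T_def)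
  moreover have "tail2 x = measure_pmf.expectation p (\<lambda>z. h (w z))" by (simp add: tail2_def h_def)
  moreover have "measure_pmf.expectation p (\<lambda>z. T (w z)) \<le> measure_pmf.expectation p (\<lambda>z. 2 * h (w z))"
    by (intro integral_mono Ti integrable_mult_right hi hT w_nonneg)
  moreover have "measure_pmf.expectation p (\<lambda>z. h (w z)) \<le> measure_pmf.expectation p (\<lambda>z. 2 * T (w z))"
    by (intro integral_mono Ti integrable_mult_right hi hT w_nonneg)
  ultimately show "Lam (1 / x) \<le> 2 * tail2 x" "tail2 x \<le> 2 * Lam (1 / x)" by simp_all
qed

end

section \<open>Transfer to the probability space and conclusion\<close>

lemma pn_translate: "taboo p {} n (indicator {y}) x = pn p n (x - y)"
proof (induction n arbitrary: x)
  case 0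
  then show ?case by (simp add: pn_0 indicator_def)
next
  case (Suc n)
  then show ?case by (simp add: taboo_empty_Suc pn_Suc step_def algebra_simps)
qed

locale zwalk_space = iid_steps M X p + zwalk p
  for M :: "'a measure" and X :: "nat \<Rightarrow> 'a \<Rightarrow> int" and p :: "int pmf"
begin

lemma potential_eq: "potential M X x = pot x"
  by (simp add: potential_def pot_def prob_walk_eq pn_translate)

lemma potential_dag_eq: "potential_dag M X x = adag x"
  by (simp add: potential_dag_def adag_def potential_eq)

lemma prob_X0: "\<P>(\<omega> in M. X 0 \<omega> \<in> A) = measure_pmf.prob p A"
proof -
  have "measure_pmf.prob p A = measure (distr M (count_space UNIV) (X 0)) A" by (simp add: law)
  also have "\<dots> = prob (X 0 -` A \<inter> space M)" by (rule measure_distr) auto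
  also have "X 0 -` A \<inter> space M = {\<omega> \<in> space M. X 0 \<omega> \<in> A}" by auto
  finally show ?thesis by simp
qed

lemma m_plus_eq: "0 \<le> x \<Longrightarrow> m_plus M (X 0) x = P.tail2 x"
proof -
  assume x: "0 \<le> x"
  have eta: "eta_plus M (X 0) s = measure_pmf.expectation p (\<lambda>z. max 0 (posw z - s))" if s: "0 \<le> s" for s
  proof -
    have "mu_plus M (X 0) y = measure_pmf.prob p {z. y < posw z}" if "s \<le> y" for y
      using prob_X0[of "{z. y < real_of_int z}"] s that
      by (simp add: mu_plus_def posw_def less_max_iff_disj)
    then have "eta_plus M (X 0) s = (LBINT y:{s..}. measure_pmf.prob p {z. y < posw z})"
      unfolding eta_plus_def by (intro set_lebesgue_integral_cong) auto
    then show ?thesis using P.tail_integral[OF s] by simp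
  qed
  have "m_plus M (X 0) x = (LBINT s:{0..x}. measure_pmf.expectation p (\<lambda>z. max 0 (posw z - s)))"
    unfolding m_plus_def by (intro set_lebesgue_integral_cong) (auto simp: eta)
  then show ?thesis using P.tail_double_integral[OF x] by simp
qed

lemma m_minus_eq: "0 \<le> x \<Longrightarrow> m_minus M (X 0) x = N.tail2 x"
proof -
  assume x: "0 \<le> x"
  have eta: "eta_minus M (X 0) s = measure_pmf.expectation p (\<lambda>z. max 0 (negw z - s))" if s: "0 \<le> s" for s
  proof -
    have "mu_minus M (X 0) y = measure_pmf.prob p {z. y < negw z}" if "s \<le> y" for y
    proof -
      have "{z. real_of_int z < - y} = {z. y < negw z}"
        using s that by (auto simp: negw_def less_max_iff_disj)
      moreover have "mu_minus M (X 0) y = measure_pmf.prob p {z. real_of_int z < - y}"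
        unfolding mu_minus_def prob_X0[symmetric] mem_Collect_eq ..
      ultimately show ?thesis by (simp only:)
    qed
    then have "eta_minus M (X 0) s = (LBINT y:{s..}. measure_pmf.prob p {z. y < negw z})"
      unfolding eta_minus_def by (intro set_lebesgue_integral_cong) auto
    then show ?thesis using N.tail_integral[OF s] by simp
  qed
  have "m_minus M (X 0) x = (LBINT s:{0..x}. measure_pmf.expectation p (\<lambda>z. max 0 (negw z - s)))"
    unfolding m_minus_def by (intro set_lebesgue_integral_cong) (auto simp: eta)
  then show ?thesis using N.tail_double_integral[OF x] by simp
qed

text \<open>With x = 1/t the two comparisons of \<open>Lam\<close> with \<open>tail2\<close> cost a
  factor 4 in all, hence \<epsilon>/4. Positivity of the total permits clearing the
  denominator.\<close>

lemma zwalk_neg_of_tails: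
  assumes lim: "((\<lambda>x. m_plus M (X 0) x / m_total M (X 0) x) \<longlongrightarrow> 0) at_top"
  shows "zwalk_neg p"
proof
  fix \<epsilon> :: real assume \<epsilon>: "0 < \<epsilon>"
  then have "\<forall>\<^sub>F x in at_top. m_plus M (X 0) x / m_total M (X 0) x < \<epsilon> / 4"
    by (intro order_tendstoD(2)[OF lim]) simp
  then obtain x0 where x0: "\<And>x. x \<ge> x0 \<Longrightarrow> m_plus M (X 0) x / m_total M (X 0) x < \<epsilon> / 4"
    by (auto simp: eventually_at_top_linorder)
  define \<delta> where "\<delta> = 1 / max 1 x0"
  have "P.Lam t \<le> \<epsilon> * Ltot t" if t: "0 < t" "t \<le> \<delta>" for t
  proof -
    define x where "x = 1 / t"
    have x: "0 < x" "t = 1 / x" using t by (auto simp: x_def)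
    have "1 / \<delta> \<le> x" unfolding x_def using t by (intro divide_left_mono) (auto simp: \<delta>_def)
    then have "x0 \<le> x" by (simp add: \<delta>_def)
    then have "m_plus M (X 0) x / m_total M (X 0) x < \<epsilon> / 4" using x0[of x] by simp
    moreover have tot: "m_total M (X 0) x = P.tail2 x + N.tail2 x"
      using x m_plus_eq[of x] m_minus_eq[of x] by (simp add: m_total_def)
    moreover have "0 < Ltot (1 / x)" using x by (intro Ltot_pos) simp
    then have "0 < m_total M (X 0) x"
      using P.Lam_tail2(1)[OF x(1)] N.Lam_tail2(1)[OF x(1)] unfolding tot Ltot_def by linarith
    ultimately have "P.tail2 x \<le> \<epsilon> / 4 * (P.tail2 x + N.tail2 x)"
      using m_plus_eq[of x] x by (simp add: pos_divide_less_eq less_imp_le)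
    also have "\<dots> \<le> \<epsilon> / 4 * (2 * P.Lam t + 2 * N.Lam t)"
      using P.Lam_tail2(2)[OF x(1)] N.Lam_tail2(2)[OF x(1)] \<epsilon> x(2) by (intro mult_left_mono add_mono) auto
    finally have "2 * P.tail2 x \<le> \<epsilon> * Ltot t" by (simp add: Ltot_def algebra_simps)
    then show ?thesis using P.Lam_tail2(1)[OF x(1)] x(2) by simp
  qed
  moreover have "0 < \<delta>" by (simp add: \<delta>_def)
  ultimately show "\<exists>\<delta>>0. \<forall>t. 0 < t \<longrightarrow> t \<le> \<delta> \<longrightarrow> P.Lam t \<le> \<epsilon> * Ltot t" by blast
qed

end

lemma zwalk_space_of_iid:
  fixes M :: "'a measure" and X :: "nat \<Rightarrow> 'a \<Rightarrow> int"
  assumes "prob_space M" "iid M X" "irreducible_walk M X"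
    and int: "integrable M (\<lambda>\<omega>. real_of_int (X 0 \<omega>))"
    and mean: "(\<integral>\<omega>. real_of_int (X 0 \<omega>) \<partial>M) = 0"
    and var: "(\<integral>\<^sup>+\<omega>. ennreal ((real_of_int (X 0 \<omega>))\<^sup>2) \<partial>M) = \<infinity>"
  obtains p where "zwalk_space M X p"
proof -
  obtain p where p: "iid_steps M X p" using iid_imp_iid_steps assms(1,2) by blast
  interpret iid_steps M X p by (rule p)
  have "zwalk p"
  proof
    fix x y
    obtain n where "\<P>(\<omega> in M. walk X x n \<omega> = y) > 0"
      using assms(3) unfolding irreducible_walk_def by blast
    then show "\<exists>n. taboo p {} n (indicator {y}) x > 0" unfolding prob_walk_eq by blast
  next
    show "integrable (measure_pmf p) real_of_int"
      using int unfolding law[of 0, symmetric] by (subst integrable_distr_eq) auto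
    show "measure_pmf.expectation p real_of_int = 0"
      using mean unfolding law[of 0, symmetric] by (subst integral_distr) auto
    show "(\<integral>\<^sup>+z. ennreal ((real_of_int z)\<^sup>2) \<partial>measure_pmf p) = \<infinity>"
      using var unfolding law[of 0, symmetric] by (subst nn_integral_distr) auto
  qed
  then show ?thesis using p that by (simp add: zwalk_space_def)
qed

theorem proposition52:
  fixes M :: "'a measure" and X :: "nat \<Rightarrow> 'a \<Rightarrow> int"
  assumes "prob_space M"
    and "iid M X"
    and "irreducible_walk M X"
    and "integrable M (\<lambda>\<omega>. real_of_int (X 0 \<omega>))"
    and "(\<integral>\<omega>. real_of_int (X 0 \<omega>) \<partial>M) = 0"
    and "(\<integral>\<^sup>+\<omega>. ennreal ((real_of_int (X 0 \<omega>))\<^sup>2) \<partial>M) = \<infinity>"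
    and "\<P>(\<omega> in M. X 0 \<omega> \<ge> 2) > 0"
  shows
    "(quotient_tendsto (\<lambda>z. potential M X (- z)) (\<lambda>z. potential M X z) 0 at_top \<longrightarrow>
        asymp_uniformly
          (\<lambda>x R. prob_hit_before M X x {..- R} {0})
          (\<lambda>x R. prob_hit_before M X x {- R} {0}))
     \<and>
     (((\<lambda>x. m_plus M (X 0) x / m_total M (X 0) x) \<longlongrightarrow> 0) at_top \<longrightarrow>
        quotient_tendsto (\<lambda>z. potential M X (- z)) (\<lambda>z. potential M X z) 0 at_top
        \<and> asymp_subject_to
            (\<lambda>x R. prob_hit_before M X x {R..} {0})
            (\<lambda>x R. prob_hit_before M X x {R} {0})
            (\<lambda>x R. (potential M X (- R) - potential M X (- R + x)) / potential_dag M X x)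
        \<and> asymp_subject_to
            (\<lambda>x R. prob_hit_before M X x {R} {0})
            (\<lambda>x R. potential_dag M X x / potential M X R)
            (\<lambda>x R. (potential M X (- R) - potential M X (- R + x)) / potential_dag M X x))"
proof -
  obtain p where "zwalk_space M X p"
    using zwalk_space_of_iid assms(1-6) by blast
  then interpret zwalk_space M X p .
  have hit_eq': "prob_hit_before M X x A {0} = hit p A {0} x" if "0 \<notin> A" for x A
    using that by (intro prob_hit_before_eq(2)) auto
  \<comment> \<open>The assumption P[X >= 2] > 0 as a point of the support, the form in which
    positivity of \<open>adag\<close> uses it.\<close>
  have b2: "\<exists>b\<in>set_pmf p. b \<ge> 2"
  proof -
    have "measure_pmf.prob p {2..} > 0" using assms(7) prob_X0[of "{2..}"] by simp
    then show ?thesis by (auto simp: measure_pmf_zero_iff zero_less_measure_iff)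
  qed
  have part1: "asymp_uniformly (\<lambda>x R. prob_hit_before M X x {..- R} {0}) (\<lambda>x R. prob_hit_before M X x {- R} {0})"
    if "quotient_tendsto (\<lambda>z. potential M X (- z)) (\<lambda>z. potential M X z) 0 at_top"
  proof -
    interpret L: zwalk_left p
      by unfold_locales (use that in \<open>auto simp: quotient_tendsto_def potential_eq\<close>)
    show ?thesis
      unfolding asymp_uniformly_def
    proof (intro allI impI)
      fix \<epsilon> :: real assume "\<epsilon> > 0"
      from L.hit_halfline_asymp_point[OF this] obtain R0 where R0: "R0 > 0"
        "\<forall>R\<ge>R0. \<forall>x. \<bar>hit p {..- R} {0} x / hit p {- R} {0} x - 1\<bar> < \<epsilon>" by blast
      then show "\<exists>R0>0. \<forall>R\<ge>R0. \<forall>x. \<bar>prob_hit_before M X x {..- R} {0} / prob_hit_before M X x {- R} {0} - 1\<bar> < \<epsilon>"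
        by (intro exI[of _ R0]) (auto simp: hit_eq')
    qed
  qed
  have part2: "quotient_tendsto (\<lambda>z. potential M X (- z)) (\<lambda>z. potential M X z) 0 at_top
        \<and> asymp_subject_to
            (\<lambda>x R. prob_hit_before M X x {R..} {0})
            (\<lambda>x R. prob_hit_before M X x {R} {0})
            (\<lambda>x R. (potential M X (- R) - potential M X (- R + x)) / potential_dag M X x)
        \<and> asymp_subject_to
            (\<lambda>x R. prob_hit_before M X x {R} {0})
            (\<lambda>x R. potential_dag M X x / potential M X R)
            (\<lambda>x R. (potential M X (- R) - potential M X (- R + x)) / potential_dag M X x)"
    if "((\<lambda>x. m_plus M (X 0) x / m_total M (X 0) x) \<longlongrightarrow> 0) at_top"
  proof -
    interpret L: zwalk_neg p by (rule zwalk_neg_of_tails[OF that])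
    have D: "(potential M X (- R) - potential M X (- R + x)) / potential_dag M X x = L.defect x R" for x R
      by (simp add: L.defect_def potential_eq potential_dag_eq)
    show ?thesis
      unfolding D
    proof (intro conjI)
      show "quotient_tendsto (\<lambda>z. potential M X (- z)) (\<lambda>z. potential M X z) 0 at_top"
        using L.ev_nonzero L.ratio_limit by (simp add: quotient_tendsto_def potential_eq)
      show "asymp_subject_to (\<lambda>x R. prob_hit_before M X x {R..} {0}) (\<lambda>x R. prob_hit_before M X x {R} {0}) L.defect"
        unfolding asymp_subject_to_def
      proof (intro allI impI)
        fix \<epsilon> :: real assume "\<epsilon> > 0"
        from L.hit_right_halfline_asymp[OF b2 this] obtain \<delta> R0 where "\<delta> > 0" "R0 > 0"
          "\<forall>R\<ge>R0. \<forall>x\<le>R. \<bar>L.defect x R\<bar> < \<delta> \<longrightarrow> \<bar>hit p {R..} {0} x / hit p {R} {0} x - 1\<bar> < \<epsilon>" by blast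
        then show "\<exists>\<delta>>0. \<exists>R0>0. \<forall>R\<ge>R0. \<forall>x\<le>R. \<bar>L.defect x R\<bar> < \<delta> \<longrightarrow>
            \<bar>prob_hit_before M X x {R..} {0} / prob_hit_before M X x {R} {0} - 1\<bar> < \<epsilon>"
          by (intro exI[of _ \<delta>] conjI exI[of _ R0]) (auto simp: hit_eq')
      qed
      show "asymp_subject_to (\<lambda>x R. prob_hit_before M X x {R} {0}) (\<lambda>x R. potential_dag M X x / potential M X R) L.defect"
        unfolding asymp_subject_to_def
      proof (intro allI impI)
        fix \<epsilon> :: real assume "\<epsilon> > 0"
        from L.hit_point_asymp[OF b2 this] obtain \<delta> R0 where "\<delta> > 0" "R0 > 0"
          "\<forall>R\<ge>R0. \<forall>x\<le>R. \<bar>L.defect x R\<bar> < \<delta> \<longrightarrow> \<bar>hit p {R} {0} x / (adag x / pot R) - 1\<bar> < \<epsilon>" by blast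
        then show "\<exists>\<delta>>0. \<exists>R0>0. \<forall>R\<ge>R0. \<forall>x\<le>R. \<bar>L.defect x R\<bar> < \<delta> \<longrightarrow>
            \<bar>prob_hit_before M X x {R} {0} / (potential_dag M X x / potential M X R) - 1\<bar> < \<epsilon>"
          by (intro exI[of _ \<delta>] conjI exI[of _ R0]) (auto simp: hit_eq' potential_eq potential_dag_eq)
      qed
    qed
  qed
  show ?thesis using part1 part2 by blast
qed

end
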